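(* Let $m\geq 3$ and let $\Omega\subset\mathbb{R}^m$ be a smooth bounded domain. For each $q\in\left]0,\frac{m+2}{m-2}\right[$ and each $f\in\mathcal{A}_q$ there exists a divergent sequence $\{a_n\}$ in $]0,+\infty[$ with the following property: for every $n\in\mathbb{N}$ and for every continuous and non-decreasing function $k:[0,+\infty[\to[0,+\infty[$ such that $\lim_{t\to+\infty}\frac{K(t)}{t^{\frac{q+1}{2}}}=+\infty$ and $\operatorname{int}(k^{-1}(0))=\emptyset$, where $K(t)=\int_0^t k(s)\,ds$, there exists $b>0$ such that the problem $$\begin{cases}-\left(a_n+b\,k\left(\int_\Omega|\nabla u(x)|^2dx\right)\right)\Delta u=f(u) & \text{in }\Omega\\ u_{|\partial\Omega}=0\end{cases}$$ has at least three weak solutions, two of which are global minima in $H^1_0(\Omega)$ of the energy functional $$u\mapsto \frac{a_n}{2}\int_\Omega|\nabla u(x)|^2dx+\frac{b}{2}K\left(\int_\Omega|\nabla u(x)|^2dx\right)-\int_\Omega F(u(x))\,dx,$$ where $F(\xi)=\int_0^\xi f(t)\,dt$.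
   Context: For $q\in\left]0,\frac{m+2}{m-2}\right]$, $\mathcal{A}_q$ denotes the class of all continuous functions $f:\mathbb{R}\to\mathbb{R}$ such that $$\limsup_{|\xi|\to+\infty}\frac{|f(\xi)|}{|\xi|^q}<+\infty$$ and $$-\infty<\liminf_{|\xi|\to+\infty}\frac{F(\xi)}{\xi^2}\leq\limsup_{|\xi|\to+\infty}\frac{F(\xi)}{\xi^2}=+\infty,$$ where $F(\xi)=\int_0^\xi f(t)\,dt$. Given a continuous function $h:[0,+\infty[\to\mathbb{R}$, a weak solution of the problem $-h\left(\int_\Omega|\nabla u(x)|^2dx\right)\Delta u=f(u)$ in $\Omega$, $u_{|\partial\Omega}=0$, is any $u\in H^1_0(\Omega)$ such that $$h\left(\int_\Omega|\nabla u(x)|^2dx\right)\int_\Omega\nabla u(x)\nabla v(x)\,dx=\int_\Omega f(u(x))v(x)\,dx$$ for all $v\in H^1_0(\Omega)$. (In the theorem, $h(t)=a_n+b\,k(t)$.) $]a,b[$ denotes an open interval. A divergent sequence in $]0,+\infty[$ is one tending to $+\infty$. The interior $\operatorname{int}(k^{-1}(0))$ is that of the set $\{t\in[0,+\infty[\,: k(t)=0\}$. A "global minimum" of a functional is a point at which it attains its infimum; the solutions and global minima counted are distinct. *)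

theory Defs
  imports "HOL-Analysis.Analysis"
begin

text \<open>Functions of class \<open>C\<^sup>n\<close>; the recursion is meant for open sets \<open>S\<close>, where
  the two-sided derivative \<open>at x\<close> agrees with the one relative to \<open>S\<close>.\<close>

primrec C_on :: "nat \<Rightarrow> 'a::euclidean_space set \<Rightarrow> ('a \<Rightarrow> 'b::real_normed_vector) \<Rightarrow> bool" where
  "C_on 0 S f \<longleftrightarrow> continuous_on S f"
| "C_on (Suc n) S f \<longleftrightarrow>
     f differentiable_on S \<and> (\<forall>i\<in>Basis. C_on n S (\<lambda>x. frechet_derivative f (at x) i))"

definition smooth_on :: "'a::euclidean_space set \<Rightarrow> ('a \<Rightarrow> 'b::real_normed_vector) \<Rightarrow> bool" where
  "smooth_on S f \<longleftrightarrow> (\<forall>n. C_on n S f)"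

text \<open>Boundary of class \<open>C\<^sup>\<infinity>\<close>: every boundary point has a neighbourhood \<open>U\<close> and a
  smooth diffeomorphism of \<open>U\<close> onto an open set \<open>V\<close> that straightens the boundary and maps
  the part of \<open>\<Omega>\<close> in \<open>U\<close> onto the part of \<open>V\<close> in a coordinate half-space.\<close>

definition smooth_boundary :: "'a::euclidean_space set \<Rightarrow> bool" where
  "smooth_boundary \<Omega> \<longleftrightarrow>
     (\<forall>x\<in>frontier \<Omega>. \<exists>U V \<Phi> \<Psi>. \<exists>e\<in>Basis.
        open U \<and> x \<in> U \<and> open V \<and> homeomorphism U V \<Phi> \<Psi> \<and>
        smooth_on U (\<Phi> :: 'a \<Rightarrow> 'a) \<and> smooth_on V \<Psi> \<and>
        \<Phi> ` (U \<inter> \<Omega>) = {y\<in>V. y \<bullet> e > 0} \<and>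
        \<Phi> ` (U \<inter> frontier \<Omega>) = {y\<in>V. y \<bullet> e = 0})"

definition smooth_bounded_domain :: "'a::euclidean_space set \<Rightarrow> bool" where
  "smooth_bounded_domain \<Omega> \<longleftrightarrow>
     open \<Omega> \<and> connected \<Omega> \<and> \<Omega> \<noteq> {} \<and> bounded \<Omega> \<and> smooth_boundary \<Omega>"

text \<open>Sobolev spaces are sets of representatives: their elements are total functions of which
  only the values on \<open>\<Omega>\<close>, up to null sets, matter.\<close>

definition test_functions :: "'a::euclidean_space set \<Rightarrow> ('a \<Rightarrow> real) set" where
  "test_functions \<Omega> =
     {\<phi>. smooth_on UNIV \<phi> \<and> compact (closure {x. \<phi> x \<noteq> 0}) \<and> closure {x. \<phi> x \<noteq> 0} \<subseteq> \<Omega>}"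

definition L2 :: "'a::euclidean_space set \<Rightarrow> ('a \<Rightarrow> 'b::euclidean_space) set" where
  "L2 \<Omega> = {u \<in> borel_measurable (lebesgue_on \<Omega>). integrable (lebesgue_on \<Omega>) (\<lambda>x. (norm (u x))\<^sup>2)}"

definition is_weak_gradient ::
    "'a::euclidean_space set \<Rightarrow> ('a \<Rightarrow> real) \<Rightarrow> ('a \<Rightarrow> 'a) \<Rightarrow> bool" where
  "is_weak_gradient \<Omega> u g \<longleftrightarrow>
     (\<forall>\<phi>\<in>test_functions \<Omega>. \<forall>i\<in>Basis.
        (\<integral>x. u x * frechet_derivative \<phi> (at x) i \<partial>lebesgue_on \<Omega>) =
        - (\<integral>x. (g x \<bullet> i) * \<phi> x \<partial>lebesgue_on \<Omega>))"

definition H1 :: "'a::euclidean_space set \<Rightarrow> ('a \<Rightarrow> real) set" where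
  "H1 \<Omega> = {u \<in> L2 \<Omega>. \<exists>g\<in>L2 \<Omega>. is_weak_gradient \<Omega> u g}"

text \<open>The weak gradient of a function in \<open>H1 \<Omega>\<close> is unique almost everywhere on \<open>\<Omega>\<close>, so the
  choice does not affect the integrals below.\<close>

definition weak_gradient :: "'a::euclidean_space set \<Rightarrow> ('a \<Rightarrow> real) \<Rightarrow> 'a \<Rightarrow> 'a" where
  "weak_gradient \<Omega> u = (SOME g. g \<in> L2 \<Omega> \<and> is_weak_gradient \<Omega> u g)"

definition dirichlet_integral :: "'a::euclidean_space set \<Rightarrow> ('a \<Rightarrow> real) \<Rightarrow> real" where
  "dirichlet_integral \<Omega> u = (\<integral>x. (norm (weak_gradient \<Omega> u x))\<^sup>2 \<partial>lebesgue_on \<Omega>)"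

definition H1_norm :: "'a::euclidean_space set \<Rightarrow> ('a \<Rightarrow> real) \<Rightarrow> real" where
  "H1_norm \<Omega> u = sqrt ((\<integral>x. (u x)\<^sup>2 \<partial>lebesgue_on \<Omega>) + dirichlet_integral \<Omega> u)"

definition H10 :: "'a::euclidean_space set \<Rightarrow> ('a \<Rightarrow> real) set" where
  "H10 \<Omega> = {u \<in> H1 \<Omega>. \<exists>\<phi> :: nat \<Rightarrow> 'a \<Rightarrow> real. (\<forall>n. \<phi> n \<in> test_functions \<Omega>) \<and>
     (\<lambda>n. H1_norm \<Omega> (\<lambda>x. \<phi> n x - u x)) \<longlonglongrightarrow> 0}"

text \<open>Equality as elements of the function space.\<close>

definition ae_equal :: "'a::euclidean_space set \<Rightarrow> ('a \<Rightarrow> real) \<Rightarrow> ('a \<Rightarrow> real) \<Rightarrow> bool" where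
  "ae_equal \<Omega> u v \<longleftrightarrow> (AE x in lebesgue_on \<Omega>. u x = v x)"

text \<open>The interval integral is oriented: it changes sign for negative \<open>\<xi>\<close>.\<close>

definition primitive :: "(real \<Rightarrow> real) \<Rightarrow> real \<Rightarrow> real" where
  "primitive f \<xi> = (LBINT t=0..ereal \<xi>. f t)"

text \<open>On the real line, \<open>at_infinity\<close> is the filter of \<open>\<bar>\<xi>\<bar> \<rightarrow> \<infinity>\<close>.\<close>

definition class_A :: "real \<Rightarrow> (real \<Rightarrow> real) set" where
  "class_A q = {f. continuous_on UNIV f \<and>
     Limsup at_infinity (\<lambda>\<xi>. ereal (\<bar>f \<xi>\<bar> / \<bar>\<xi>\<bar> powr q)) < \<infinity> \<and>
     - \<infinity> < Liminf at_infinity (\<lambda>\<xi>. ereal (primitive f \<xi> / \<xi>\<^sup>2)) \<and>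
     Limsup at_infinity (\<lambda>\<xi>. ereal (primitive f \<xi> / \<xi>\<^sup>2)) = \<infinity>}"

text \<open>Weak solutions of \<open>- h (\<integral> |\<nabla>u|\<^sup>2) \<Delta>u = f(u)\<close> in \<open>\<Omega>\<close>, \<open>u = 0\<close> on the boundary. Integrability
  of \<open>f(u) v\<close> is demanded explicitly because the integral of a non-integrable function is 0.\<close>

definition weak_solution ::
    "'a::euclidean_space set \<Rightarrow> (real \<Rightarrow> real) \<Rightarrow> (real \<Rightarrow> real) \<Rightarrow> ('a \<Rightarrow> real) \<Rightarrow> bool" where
  "weak_solution \<Omega> h f u \<longleftrightarrow> u \<in> H10 \<Omega> \<and>
     (\<forall>v\<in>H10 \<Omega>. integrable (lebesgue_on \<Omega>) (\<lambda>x. f (u x) * v x) \<and>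
        h (dirichlet_integral \<Omega> u) *
          (\<integral>x. weak_gradient \<Omega> u x \<bullet> weak_gradient \<Omega> v x \<partial>lebesgue_on \<Omega>) =
        (\<integral>x. f (u x) * v x \<partial>lebesgue_on \<Omega>))"

definition energy ::
    "'a::euclidean_space set \<Rightarrow> real \<Rightarrow> real \<Rightarrow> (real \<Rightarrow> real) \<Rightarrow> (real \<Rightarrow> real) \<Rightarrow> ('a \<Rightarrow> real) \<Rightarrow> real"
  where
  "energy \<Omega> a b k f u =
     a / 2 * dirichlet_integral \<Omega> u + b / 2 * primitive k (dirichlet_integral \<Omega> u)
       - (\<integral>x. primitive f (u x) \<partial>lebesgue_on \<Omega>)"

definition global_min_on :: "'b set \<Rightarrow> ('b \<Rightarrow> real) \<Rightarrow> 'b \<Rightarrow> bool" where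
  "global_min_on X J u \<longleftrightarrow> u \<in> X \<and> (\<forall>v\<in>X. J u \<le> J v)"

end

theory Submission
  imports Defs "HOL-Library.Function_Algebras" "HOL-Complex_Analysis.Great_Picard" "HOL-Computational_Algebra.Polynomial"
begin

text \<open>Write \<open>D(u)\<close> for the Dirichlet integral and \<open>J(u)\<close> for the integral of \<open>F(u)\<close>. By subcriticality
  \<open>|J(u)| \<le> C (1 + D(u)\<^sup>(\<^sup>q\<^sup>+\<^sup>1\<^sup>)\<^sup>/\<^sup>2)\<close>, so for \<open>a > 4C\<close> and every \<open>b > 0\<close> the energy is bounded below on
  the sphere \<open>D = 1\<close> by some \<open>\<alpha> > 0\<close>, whereas it vanishes at \<open>0\<close>: no global minimiser lies on the
  sphere. The class of nonlinearities makes \<open>a D / 2 - J\<close> unbounded below, so for small \<open>b\<close> the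
  minimisers have \<open>D > 1\<close>; for large \<open>b\<close> the growth of \<open>K\<close> forces \<open>D < 1\<close>. Minimisers depend compactly
  on \<open>b\<close>, hence at the threshold value of \<open>b\<close> there is one of each kind. They are separated by the
  sphere, and the mountain pass theorem yields a third critical point at a level of at least \<open>\<alpha>\<close>.

  The Sobolev inequality and Rellich compactness are needed only below the critical exponent, where
  they follow from elementary estimates of dyadic averages of test functions. Since elements of \<open>H10\<close>
  are representatives, the Dirichlet form is only a semi-inner product there.\<close>

text \<open>The sequence has to be fixed before \<open>k\<close> is known. The bound on the sphere
  therefore drops the nonnegative term with \<open>K\<close> and reads
  \<open>\<alpha> = a / 2 - 2 * C\<close>, where \<open>C\<close> comes from the growth of
  \<open>J\<close> alone; this is the origin of \<open>4 * C\<close>. Emptiness of the interior of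
  the zero set of \<open>k\<close> enters as \<open>0 < K 1\<close>, which makes the term with
  \<open>b\<close> felt everywhere outside the unit ball. The growth of \<open>K\<close> makes the
  energy coercive uniformly for \<open>b\<close> away from zero, so that minimisers can be followed
  while \<open>b\<close> varies. That \<open>q > 1\<close> is not assumed but forced by the
  superquadratic growth of the primitive.

  As \<open>f\<close> is merely continuous, no explicit modulus of continuity is available for the
  derivative of \<open>J\<close>; the uniform continuity on which the mountain pass argument rests
  is obtained from compactness, by contradiction. The three solutions have to differ as classes
  modulo null sets: the two minimisers are told apart by their Dirichlet integrals, the third
  solution by its energy.\<close>

instantiation "fun" :: (type, real_vector) real_vector
begin

definition "r *\<^sub>R f = (\<lambda>x. r *\<^sub>R f x)"

instance
  by standard (simp_all add: scaleR_fun_def fun_eq_iff scaleR_add_right scaleR_add_left)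

end

lemma scaleR_fun_apply [simp]: "(r *\<^sub>R f) x = r *\<^sub>R f x"
  by (simp add: scaleR_fun_def)

section \<open>Complete semi-inner product spaces\<close>

text \<open>The form may vanish on nonzero vectors, because functions that agree almost everywhere
  are still different elements of the carrier. Limits, minimisers and representing vectors are
  therefore determined only up to seminorm zero, and completeness promises some limit, not a unique
  one.\<close>

locale semi_hilbert =
  fixes X :: "'v::real_vector set" and ip :: "'v \<Rightarrow> 'v \<Rightarrow> real"
  assumes subspace_X: "subspace X"
    and ip_add_left: "\<And>x y z. x \<in> X \<Longrightarrow> y \<in> X \<Longrightarrow> z \<in> X \<Longrightarrow> ip (x + y) z = ip x z + ip y z"
    and ip_scale_left: "\<And>c x y. x \<in> X \<Longrightarrow> y \<in> X \<Longrightarrow> ip (c *\<^sub>R x) y = c * ip x y"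
    and ip_commute: "\<And>x y. x \<in> X \<Longrightarrow> y \<in> X \<Longrightarrow> ip x y = ip y x"
    and ip_nonneg: "\<And>x. x \<in> X \<Longrightarrow> 0 \<le> ip x x"
    and ip_complete: "\<And>x. (\<And>n::nat. x n \<in> X) \<Longrightarrow>
       (\<And>e. e > 0 \<Longrightarrow> \<exists>N. \<forall>m\<ge>N. \<forall>n\<ge>N. ip (x m - x n) (x m - x n) < e) \<Longrightarrow>
       \<exists>l\<in>X. (\<lambda>n. ip (x n - l) (x n - l)) \<longlonglongrightarrow> 0"
begin

definition nm :: "'v \<Rightarrow> real" where "nm x = sqrt (ip x x)"

lemma X_closed [simp, intro]:
  "0 \<in> X" "x \<in> X \<Longrightarrow> y \<in> X \<Longrightarrow> x + y \<in> X" "x \<in> X \<Longrightarrow> y \<in> X \<Longrightarrow> x - y \<in> X"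
  "x \<in> X \<Longrightarrow> c *\<^sub>R x \<in> X" "x \<in> X \<Longrightarrow> - x \<in> X"
  using subspace_X by (auto intro: subspace_0 subspace_add subspace_diff subspace_scale subspace_neg)

lemma ip_add_right: "x \<in> X \<Longrightarrow> y \<in> X \<Longrightarrow> z \<in> X \<Longrightarrow> ip z (x + y) = ip z x + ip z y"
  using ip_add_left[of x y z] ip_commute by simp

lemma ip_scale_right: "x \<in> X \<Longrightarrow> y \<in> X \<Longrightarrow> ip y (c *\<^sub>R x) = c * ip y x"
  using ip_scale_left[of x y c] ip_commute by simp

lemma ip_minus_left: "x \<in> X \<Longrightarrow> y \<in> X \<Longrightarrow> ip (- x) y = - ip x y"
  using ip_scale_left[of x y "-1"] by simp

lemma ip_minus_right: "x \<in> X \<Longrightarrow> y \<in> X \<Longrightarrow> ip y (- x) = - ip y x"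
  using ip_scale_right[of x y "-1"] by simp

lemma ip_diff_left: "x \<in> X \<Longrightarrow> y \<in> X \<Longrightarrow> z \<in> X \<Longrightarrow> ip (x - y) z = ip x z - ip y z"
  using ip_add_left[of x "- y" z] by (simp add: ip_minus_left)

lemma ip_diff_right: "x \<in> X \<Longrightarrow> y \<in> X \<Longrightarrow> z \<in> X \<Longrightarrow> ip z (x - y) = ip z x - ip z y"
  using ip_add_right[of x "- y" z] by (simp add: ip_minus_right)

lemmas ip_simps = ip_add_left ip_add_right ip_scale_left ip_scale_right ip_minus_left
  ip_minus_right ip_diff_left ip_diff_right

lemma ip_zero [simp]: "x \<in> X \<Longrightarrow> ip 0 x = 0" "x \<in> X \<Longrightarrow> ip x 0 = 0"
  using ip_scale_left[of 0 x 0] ip_scale_right[of 0 x 0] by simp_all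

lemma nm_nonneg [simp]: "x \<in> X \<Longrightarrow> 0 \<le> nm x"
  by (simp add: nm_def ip_nonneg)

lemma nm_sq: "x \<in> X \<Longrightarrow> (nm x)\<^sup>2 = ip x x"
  by (simp add: nm_def ip_nonneg)

lemma nm_zero [simp]: "nm 0 = 0"
  by (simp add: nm_def)

lemma cauchy_schwarz: assumes "x \<in> X" "y \<in> X" shows "\<bar>ip x y\<bar> \<le> nm x * nm y"
proof -
  have q: "0 \<le> t\<^sup>2 * ip x x + 2 * t * ip x y + ip y y" for t
    using ip_nonneg[of "t *\<^sub>R x + y"] assms ip_commute[of y x]
    by (simp add: ip_simps power2_eq_square algebra_simps)
  have "(ip x y)\<^sup>2 \<le> ip x x * ip y y"
  proof (cases "ip x x = 0")
    case True
    have "ip x y = 0"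
    proof (rule ccontr)
      assume ne: "ip x y \<noteq> 0"
      \<comment> \<open>For \<open>ip x x = 0\<close> the polynomial in \<open>q\<close> is affine
        in \<open>t\<close>; this choice of \<open>t\<close> gives it the negative value
        \<open>- ip y y - 2\<close>.\<close>
      have "- (ip y y + 1) / ip x y * ip x y = - (ip y y + 1)" using ne by simp
      then have "0 \<le> - 2 * (ip y y + 1) + ip y y"
        using q[of "- (ip y y + 1) / ip x y"] unfolding True mult.assoc by simp
      then show False using ip_nonneg[OF assms(2)] by argo
    qed
    then show ?thesis using True by simp
  next
    case False
    then have p: "ip x x > 0" using ip_nonneg[OF assms(1)] by linarith
    have "0 \<le> (- ip x y / ip x x)\<^sup>2 * ip x x + 2 * (- ip x y / ip x x) * ip x y + ip y y"
      by (rule q)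
    also have "\<dots> = ip y y - (ip x y)\<^sup>2 / ip x x"
      using p by (simp add: power2_eq_square field_simps)
    finally show ?thesis using p by (simp add: field_simps)
  qed
  then have "\<bar>ip x y\<bar> \<le> sqrt (ip x x * ip y y)" by (simp add: real_le_rsqrt)
  then show ?thesis by (simp add: nm_def real_sqrt_mult)
qed

lemma nm_triangle: assumes "x \<in> X" "y \<in> X" shows "nm (x + y) \<le> nm x + nm y"
proof -
  have "(nm (x + y))\<^sup>2 = (nm x)\<^sup>2 + 2 * ip x y + (nm y)\<^sup>2"
    using assms ip_commute[of y x] by (simp add: nm_sq ip_simps)
  also have "\<dots> \<le> (nm x + nm y)\<^sup>2"
    using cauchy_schwarz[OF assms] by (simp add: power2_sum)
  finally show ?thesis by (rule power2_le_imp_le) (use assms in simp)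
qed

lemma nm_scale: "x \<in> X \<Longrightarrow> nm (c *\<^sub>R x) = \<bar>c\<bar> * nm x"
  by (simp add: nm_def ip_simps real_sqrt_mult[symmetric] flip: mult.assoc)
     (simp add: real_sqrt_mult)

lemma nm_minus: "x \<in> X \<Longrightarrow> nm (- x) = nm x"
  using nm_scale[of x "-1"] by simp

lemma nm_minus_commute: "x \<in> X \<Longrightarrow> y \<in> X \<Longrightarrow> nm (x - y) = nm (y - x)"
  using nm_minus[of "x - y"] by simp

lemma nm_diff_triangle: assumes "x \<in> X" "y \<in> X" "z \<in> X"
  shows "nm (x - z) \<le> nm (x - y) + nm (y - z)"
  using nm_triangle[of "x - y" "y - z"] assms by simp

lemma nm_diff_ineq: assumes "x \<in> X" "y \<in> X" shows "\<bar>nm x - nm y\<bar> \<le> nm (x - y)"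
  using nm_diff_triangle[of x y 0] nm_diff_triangle[of y x 0] nm_minus_commute[of x y] assms
  by simp

lemma parallelogram: assumes "x \<in> X" "y \<in> X"
  shows "ip (x - y) (x - y) = 2 * ip x x + 2 * ip y y - 4 * ip ((1/2) *\<^sub>R (x + y)) ((1/2) *\<^sub>R (x + y))"
  using assms by (simp add: ip_simps algebra_simps)

text \<open>Packages what the parallelogram law yields in \<open>riesz\<close> and
  \<open>mazur\<close>: for \<open>m \<le> n\<close> a bound by a null sequence in the smaller
  index. Symmetry of the seminorm covers the other order.\<close>

lemma cauchy_near_minimizers:
  assumes x: "\<And>n::nat. x n \<in> X" and e: "e \<longlonglongrightarrow> (0::real)"
    and le: "\<And>m n. m \<le> n \<Longrightarrow> ip (x m - x n) (x m - x n) \<le> e m"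
  obtains l where "l \<in> X" "(\<lambda>n. ip (x n - l) (x n - l)) \<longlonglongrightarrow> 0"
proof -
  have "\<exists>N. \<forall>m\<ge>N. \<forall>n\<ge>N. ip (x m - x n) (x m - x n) < d" if "d > 0" for d
  proof -
    obtain N where N: "\<And>n. n \<ge> N \<Longrightarrow> \<bar>e n\<bar> < d"
      using LIMSEQ_D[OF e, of d] \<open>d > 0\<close> by auto
    have "ip (x m - x n) (x m - x n) < d" if "m \<ge> N" "n \<ge> N" for m n
    proof (cases "m \<le> n")
      case True then show ?thesis using le[OF True] N[of m] that by linarith
    next
      case False
      have "ip (x m - x n) (x m - x n) = ip (x n - x m) (x n - x m)"
        using nm_minus_commute[of "x m" "x n"] x nm_sq[of "x m - x n"] nm_sq[of "x n - x m"] by simp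
      then show ?thesis using False le[of n m] N[of n] that by linarith
    qed
    then show ?thesis by blast
  qed
  from ip_complete[OF x this] show ?thesis using that by blast
qed

lemma nm_tendsto:
  assumes "\<And>n::nat. x n \<in> X" "l \<in> X" "(\<lambda>n. ip (x n - l) (x n - l)) \<longlonglongrightarrow> 0"
  shows "(\<lambda>n. nm (x n)) \<longlonglongrightarrow> nm l"
proof -
  have "(\<lambda>n. nm (x n - l)) \<longlonglongrightarrow> 0"
    using tendsto_real_sqrt[OF assms(3)] by (simp add: nm_def)
  then have "(\<lambda>n. nm (x n) - nm l) \<longlonglongrightarrow> 0"
    by (rule Lim_null_comparison[rotated]) (use assms nm_diff_ineq in auto)
  then show ?thesis by (simp add: LIM_zero_iff)
qed

lemma nm_tendsto_0: "(\<lambda>n. ip (x n - l) (x n - l)) \<longlonglongrightarrow> 0 \<Longrightarrow> (\<lambda>n::nat. nm (x n - l)) \<longlonglongrightarrow> 0"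
  using tendsto_real_sqrt by (fastforce simp: nm_def)

lemma ip_tendsto:
  assumes x: "\<And>n::nat. x n \<in> X" "l \<in> X" "y \<in> X" and lim: "(\<lambda>n. ip (x n - l) (x n - l)) \<longlonglongrightarrow> 0"
  shows "(\<lambda>n. ip (x n) y) \<longlonglongrightarrow> ip l y"
proof -
  have z: "(\<lambda>n. nm (x n - l) * nm y) \<longlonglongrightarrow> 0"
    by (rule tendsto_mult_left_zero[OF nm_tendsto_0[OF lim]])
  have "(\<lambda>n. ip (x n) y - ip l y) \<longlonglongrightarrow> 0"
  proof (rule Lim_null_comparison[OF always_eventually z], rule allI)
    fix n
    have "ip (x n) y - ip l y = ip (x n - l) y" using x by (simp add: ip_diff_left)
    then show "norm (ip (x n) y - ip l y) \<le> nm (x n - l) * nm y" using cauchy_schwarz[of "x n - l" y] x by simp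
  qed
  then show ?thesis by (simp add: LIM_zero_iff)
qed

lemma ip_tendsto_trans:
  assumes "\<And>n::nat. x n \<in> X" "\<And>n. y n \<in> X" "l \<in> X"
    "(\<lambda>n. ip (x n - y n) (x n - y n)) \<longlonglongrightarrow> 0" "(\<lambda>n. ip (y n - l) (y n - l)) \<longlonglongrightarrow> 0"
  shows "(\<lambda>n. ip (x n - l) (x n - l)) \<longlonglongrightarrow> 0"
proof -
  have "(\<lambda>n. 2 * ip (x n - y n) (x n - y n) + 2 * ip (y n - l) (y n - l)) \<longlonglongrightarrow> 2 * 0 + 2 * 0"
    by (intro tendsto_intros assms)
  then have z: "(\<lambda>n. 2 * ip (x n - y n) (x n - y n) + 2 * ip (y n - l) (y n - l)) \<longlonglongrightarrow> 0" by simp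
  show ?thesis
  proof (rule Lim_null_comparison[OF always_eventually z], rule allI)
    fix n
    have "(nm (x n - l))\<^sup>2 \<le> (nm (x n - y n) + nm (y n - l))\<^sup>2"
      using nm_diff_triangle[of "x n" "y n" l] assms(1-3) by (intro power_mono) auto
    also have "\<dots> \<le> 2 * (nm (x n - y n))\<^sup>2 + 2 * (nm (y n - l))\<^sup>2"
      using sum_squares_bound[of "nm (x n - y n)" "nm (y n - l)"] by (simp add: power2_sum)
    finally show "norm (ip (x n - l) (x n - l)) \<le> 2 * ip (x n - y n) (x n - y n) + 2 * ip (y n - l) (y n - l)"
      using assms(1-3) by (simp add: nm_sq ip_nonneg)
  qed
qed

text \<open>The representing vector minimises \<open>ip w w - 2 * \<phi> w\<close>. Boundedness of
  \<open>\<phi>\<close> allows the square to be completed, which bounds the functional below; the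
  parallelogram law makes minimising sequences Cauchy; the first variation at the limit is the
  asserted identity.\<close>

lemma riesz:
  assumes add: "\<And>x y. x \<in> X \<Longrightarrow> y \<in> X \<Longrightarrow> \<phi> (x + y) = \<phi> x + \<phi> y"
    and scale: "\<And>c x. x \<in> X \<Longrightarrow> \<phi> (c *\<^sub>R x) = c * (\<phi> x :: real)"
    and bdd: "\<And>x. x \<in> X \<Longrightarrow> \<bar>\<phi> x\<bar> \<le> M * nm x"
  obtains g where "g \<in> X" "\<And>v. v \<in> X \<Longrightarrow> ip g v = \<phi> v"
proof -
  define E where "E w = ip w w - 2 * \<phi> w" for w
  have low: "E w \<ge> - M\<^sup>2" if "w \<in> X" for w
  proof -
    have "0 \<le> (nm w - M)\<^sup>2" by simp
    then show ?thesis using bdd[OF that] nm_sq[OF that]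
      unfolding E_def power2_diff by (simp add: algebra_simps)
  qed
  define I where "I = Inf (E ` X)"
  have bb: "bdd_below (E ` X)" using low by (auto intro!: bdd_belowI)
  have I: "I \<le> E w" if "w \<in> X" for w unfolding I_def using bb that by (auto intro: cInf_lower)
  have "\<exists>w\<in>X. E w < I + 1 / Suc n" for n :: nat
    using cInf_lessD[of "E ` X" "I + 1 / Suc n"] unfolding I_def by fastforce
  then obtain w where w: "\<And>n. w n \<in> X" and wE: "\<And>n. E (w n) < I + 1 / Suc n" by metis
  have "ip (w m - w n) (w m - w n) \<le> 4 / Suc m" if "m \<le> n" for m n
  proof -
    have "E ((1/2) *\<^sub>R (w m + w n)) \<ge> I" by (intro I) (use w in auto)
    then have "4 * ip ((1/2) *\<^sub>R (w m + w n)) ((1/2) *\<^sub>R (w m + w n)) \<ge> 4 * I + 4 * (\<phi> (w m) + \<phi> (w n))"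
      unfolding E_def using w by (simp add: add scale field_simps)
    then have "ip (w m - w n) (w m - w n) \<le> 2 * E (w m) + 2 * E (w n) - 4 * I"
      unfolding parallelogram[OF w[of m] w[of n]] E_def by (simp add: algebra_simps)
    also have "\<dots> \<le> 2 * (I + 1 / Suc m) + 2 * (I + 1 / Suc n) - 4 * I"
      using wE[of m] wE[of n] by (intro diff_right_mono add_mono mult_left_mono) auto
    also have "\<dots> = 2 / Suc m + 2 / Suc n" by (simp add: algebra_simps)
    also have "\<dots> \<le> 2 / Suc m + 2 / Suc m"
      using that by (intro add_left_mono divide_left_mono) auto
    finally show ?thesis by simp
  qed
  moreover have "(\<lambda>m. 4 / Suc m) \<longlonglongrightarrow> (0::real)"
    using tendsto_mult[OF tendsto_const[of 4] LIMSEQ_inverse_real_of_nat] by (simp add: field_simps)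
  ultimately obtain g where g: "g \<in> X" and lim: "(\<lambda>n. ip (w n - g) (w n - g)) \<longlonglongrightarrow> 0"
    using cauchy_near_minimizers[of w "\<lambda>m. 4 / Suc m"] w by blast
  have nl: "(\<lambda>n. nm (w n)) \<longlonglongrightarrow> nm g" by (rule nm_tendsto[OF w g lim])
  have "(\<lambda>n. nm (w n - g)) \<longlonglongrightarrow> 0"
    using tendsto_real_sqrt[OF lim] by (simp add: nm_def)
  then have "(\<lambda>n. M * nm (w n - g)) \<longlonglongrightarrow> 0" by (rule tendsto_mult_right_zero)
  then have "(\<lambda>n. \<phi> (w n) - \<phi> g) \<longlonglongrightarrow> 0"
  proof (rule Lim_null_comparison[rotated], intro always_eventually allI)
    fix n
    have "\<phi> (w n) - \<phi> g = \<phi> (w n - g)"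
      using add[of "w n - g" g] w g by simp
    then show "norm (\<phi> (w n) - \<phi> g) \<le> M * nm (w n - g)" using bdd[of "w n - g"] w g by simp
  qed
  then have pl: "(\<lambda>n. \<phi> (w n)) \<longlonglongrightarrow> \<phi> g" by (simp add: LIM_zero_iff)
  have "(\<lambda>n. E (w n)) \<longlonglongrightarrow> E g"
    unfolding E_def using nm_sq w g by (simp flip: nm_sq) (intro tendsto_intros nl pl)
  moreover have "(\<lambda>n. I + 1 / Suc n) \<longlonglongrightarrow> I + 0"
    by (intro tendsto_intros) (use LIMSEQ_inverse_real_of_nat in \<open>simp add: field_simps\<close>)
  ultimately have Eg: "E g \<le> I"
    using LIMSEQ_le wE by (metis (no_types, lifting) add.right_neutral less_imp_le)
  have "ip g v = \<phi> v" if v: "v \<in> X" for v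
  proof -
    have q: "0 \<le> 2 * t * (ip g v - \<phi> v) + t\<^sup>2 * ip v v" for t
    proof -
      have "E g \<le> E (g + t *\<^sub>R v)" using Eg I[of "g + t *\<^sub>R v"] g v by auto
      then show ?thesis unfolding E_def using g v ip_commute[of v g]
        by (simp add: ip_simps add scale power2_eq_square algebra_simps)
    qed
    define A where "A = ip g v - \<phi> v"
    have "A * A \<le> 0"
    proof -
      \<comment> \<open>The value \<open>t = - A / B\<close> minimises the upper bound
        \<open>2 * t * A + t\<^sup>2 * B\<close>. Adding 1 keeps the divisor positive when
        \<open>v\<close> has seminorm zero.\<close>
      define B where "B = ip v v + 1"
      have B: "B > 0" "ip v v \<le> B" using ip_nonneg[OF v] unfolding B_def by auto
      have "0 \<le> 2 * (- A / B) * A + (- A / B)\<^sup>2 * ip v v" using q[of "- A / B"] unfolding A_def[symmetric] .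
      also have "\<dots> \<le> 2 * (- A / B) * A + (- A / B)\<^sup>2 * B" using B by (intro add_left_mono mult_left_mono) auto
      also have "\<dots> = - (A * A) / B" using B by (simp add: power2_eq_square field_simps)
      finally show ?thesis using B by (simp add: field_simps)
    qed
    then have "A = 0" by (auto simp: mult_le_0_iff)
    then show ?thesis unfolding A_def by simp
  qed
  with g show ?thesis using that by blast
qed

text \<open>Substitute for weak compactness: near-minimal norm elements of the convex hulls of the tails
  form a Cauchy sequence by the parallelogram law.\<close>

lemma mazur:
  assumes x: "\<And>n::nat. x n \<in> X" and lim: "(\<lambda>n. ip (x n) (x n)) \<longlonglongrightarrow> d"
  obtains w l where "\<And>n. w n \<in> convex hull (x ` {n..})" "l \<in> X"
    "(\<lambda>n. ip (w n - l) (w n - l)) \<longlonglongrightarrow> 0" "ip l l \<le> d"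
proof -
  define C where "C n = convex hull (x ` {n..})" for n
  define N where "N w = ip w w" for w
  have CX: "C n \<subseteq> X" for n unfolding C_def
    by (intro hull_minimal subspace_imp_convex[OF subspace_X]) (use x in auto)
  have Cmono: "C n \<subseteq> C m" if "m \<le> n" for m n
    unfolding C_def by (intro hull_mono image_mono) (use that in auto)
  define \<alpha> where "\<alpha> n = Inf (N ` C n)" for n
  have ne: "N ` C n \<noteq> {}" for n
    unfolding C_def using hull_subset[of "x ` {n..}" convex] by auto
  have bb: "bdd_below (N ` C n)" for n
    using CX[of n] by (intro bdd_belowI[of _ 0]) (auto simp: N_def ip_nonneg)
  have \<alpha>: "\<alpha> n \<le> N w" if "w \<in> C n" for w n
    unfolding \<alpha>_def using that bb by (auto intro: cInf_lower)
  have xC: "x k \<in> C n" if "n \<le> k" for n k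
    unfolding C_def using that hull_subset[of "x ` {n..}" convex] by auto
  have \<alpha>d: "\<alpha> n \<le> d" for n
    by (rule tendsto_lowerbound[OF lim])
       (use \<alpha> xC in \<open>auto simp: N_def eventually_sequentially intro!: exI[of _ n]\<close>)
  have \<alpha>mono: "\<alpha> m \<le> \<alpha> n" if "m \<le> n" for m n
    unfolding \<alpha>_def by (rule cInf_superset_mono[OF ne bb]) (use Cmono[OF that] in auto)
  have "incseq \<alpha>" using \<alpha>mono by (simp add: incseq_def)
  then obtain A where A: "\<alpha> \<longlonglongrightarrow> A" "\<And>n. \<alpha> n \<le> A"
    using incseq_convergent[of \<alpha> d] \<alpha>d by auto
  have Ad: "A \<le> d" by (rule LIMSEQ_le_const2[OF A(1)]) (use \<alpha>d in auto)
  have "\<exists>w\<in>C n. N w < \<alpha> n + 1 / Suc n" for n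
    using cInf_lessD[OF ne, of n "\<alpha> n + 1 / Suc n"] unfolding \<alpha>_def by fastforce
  then obtain w where w: "\<And>n. w n \<in> C n" and wN: "\<And>n. N (w n) < \<alpha> n + 1 / Suc n" by metis
  have wX: "w n \<in> X" for n using w CX by auto
  \<comment> \<open>The infima \<open>\<alpha>\<close> increase to \<open>A\<close> because the
    hulls shrink. Both \<open>w m\<close> and \<open>w n\<close> are measured against
    \<open>A\<close>, their midpoint only against \<open>\<alpha> m\<close>; the gap between the two
    produces the first term.\<close>
  define e where "e m = 4 * (A - \<alpha> m) + 4 / Suc m" for m
  have z: "(\<lambda>m. 1 / Suc m) \<longlonglongrightarrow> (0::real)"
    using LIMSEQ_inverse_real_of_nat by (simp add: field_simps)
  have "(\<lambda>m. 4 * (A - \<alpha> m) + 4 * (1 / Suc m)) \<longlonglongrightarrow> 4 * (A - A) + 4 * 0"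
    by (intro tendsto_intros A z)
  then have "e \<longlonglongrightarrow> 0" unfolding e_def by simp
  moreover have "ip (w m - w n) (w m - w n) \<le> e m" if "m \<le> n" for m n
  proof -
    \<comment> \<open>Since \<open>C n \<subseteq> C m\<close>, the midpoint stays in the larger
      hull, whose infimum is \<open>\<alpha> m\<close>.\<close>
    have "(1/2) *\<^sub>R w m + (1/2) *\<^sub>R w n \<in> C m"
      using w[of m] w[of n] Cmono[OF that] unfolding C_def
      by (intro convexD[OF convex_convex_hull]) auto
    then have "\<alpha> m \<le> N ((1/2) *\<^sub>R (w m + w n))" using \<alpha> by (simp add: scaleR_add_right)
    then have "ip (w m - w n) (w m - w n) \<le> 2 * N (w m) + 2 * N (w n) - 4 * \<alpha> m"
      using parallelogram[OF wX[of m] wX[of n]] unfolding N_def by linarith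
    also have "\<dots> \<le> 2 * (\<alpha> m + 1 / Suc m) + 2 * (\<alpha> n + 1 / Suc n) - 4 * \<alpha> m"
      using wN[of m] wN[of n] by (intro diff_right_mono add_mono mult_left_mono) auto
    also have "\<dots> \<le> 2 * (A + 1 / Suc m) + 2 * (A + 1 / Suc m) - 4 * \<alpha> m"
      using A(2)[of m] A(2)[of n] that by (intro diff_right_mono add_mono mult_left_mono) (auto simp: field_simps)
    finally show ?thesis unfolding e_def by (simp add: algebra_simps)
  qed
  ultimately obtain l where l: "l \<in> X" "(\<lambda>n. ip (w n - l) (w n - l)) \<longlonglongrightarrow> 0"
    using cauchy_near_minimizers[of w e] wX by blast
  have "(\<lambda>n. (nm (w n))\<^sup>2) \<longlonglongrightarrow> (nm l)\<^sup>2" by (intro tendsto_intros nm_tendsto wX l)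
  then have t: "(\<lambda>n. N (w n)) \<longlonglongrightarrow> ip l l" unfolding N_def using wX l by (simp add: nm_sq)
  have "(\<lambda>n. A + 1 / Suc n) \<longlonglongrightarrow> A + 0" by (intro tendsto_intros z)
  then have "ip l l \<le> A + 0"
  proof (rule LIMSEQ_le[OF t], intro exI[of _ 0] allI impI)
    fix n show "N (w n) \<le> A + 1 / Suc n"
      using add_right_mono[OF A(2)[of n], of "1 / Suc n"] wN[of n] by (rule order_trans[OF less_imp_le, rotated])
  qed
  with Ad l w show ?thesis using that[of w l] unfolding C_def by simp
qed

subsection \<open>The mountain pass theorem\<close>

text \<open>Continuity for the seminorm, spelled out with epsilon and delta since \<open>X\<close>
  is a set with a seminorm and not a type carrying the topology. The same applies to the paths
  defined next.\<close>

definition continuous_X :: "('v \<Rightarrow> real) \<Rightarrow> bool" where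
  "continuous_X \<Psi> \<longleftrightarrow> (\<forall>u\<in>X. \<forall>e>0. \<exists>d>0. \<forall>v\<in>X. nm (v - u) < d \<longrightarrow> \<bar>\<Psi> v - \<Psi> u\<bar> < e)"

definition path_X :: "(real \<Rightarrow> 'v) \<Rightarrow> bool" where
  "path_X \<gamma> \<longleftrightarrow> (\<forall>t\<in>{0..1}. \<gamma> t \<in> X \<and> ((\<lambda>s. nm (\<gamma> s - \<gamma> t)) \<longlongrightarrow> 0) (at t within {0..1}))"

lemma path_X_small:
  assumes "path_X \<gamma>" "t \<in> {0..1}" "d > 0"
  shows "\<forall>\<^sub>F s in at t within {0..1}. s \<in> {0..1} \<and> nm (\<gamma> s - \<gamma> t) < d"
proof -
  have "((\<lambda>s. nm (\<gamma> s - \<gamma> t)) \<longlongrightarrow> 0) (at t within {0..1})" using assms by (auto simp: path_X_def)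
  from order_tendstoD(2)[OF this \<open>d > 0\<close>]
  show ?thesis by (auto simp: eventually_at_filter elim: eventually_mono)
qed

lemma continuous_X_path:
  assumes "continuous_X \<Psi>" "path_X \<gamma>"
  shows "continuous_on {0..1} (\<lambda>t. \<Psi> (\<gamma> t))"
  unfolding continuous_on_def
proof (intro ballI tendstoI)
  fix t e :: real assume t: "t \<in> {0..1}" and e: "e > 0"
  have "\<gamma> t \<in> X" using assms t by (auto simp: path_X_def)
  then obtain d where d: "d > 0" "\<And>v. v \<in> X \<Longrightarrow> nm (v - \<gamma> t) < d \<Longrightarrow> \<bar>\<Psi> v - \<Psi> (\<gamma> t)\<bar> < e"
    using assms(1) e unfolding continuous_X_def by blast
  show "\<forall>\<^sub>F s in at t within {0..1}. dist (\<Psi> (\<gamma> s)) (\<Psi> (\<gamma> t)) < e"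
    using path_X_small[OF assms(2) t d(1)]
    by eventually_elim (use d assms(2) in \<open>auto simp: dist_real_def path_X_def\<close>)
qed

lemma path_X_map:
  assumes T: "\<And>u. u \<in> X \<Longrightarrow> T u \<in> X"
    and cont: "\<And>u e. u \<in> X \<Longrightarrow> e > 0 \<Longrightarrow> \<exists>d>0. \<forall>v\<in>X. nm (v - u) < d \<longrightarrow> nm (T v - T u) < e"
    and "path_X \<gamma>"
  shows "path_X (\<lambda>t. T (\<gamma> t))"
  unfolding path_X_def
proof (intro ballI conjI tendstoI)
  fix t e :: real assume t: "t \<in> {0..1}" and e: "e > 0"
  have gt: "\<gamma> t \<in> X" using assms t by (auto simp: path_X_def)
  obtain d where d: "d > 0" "\<And>v. v \<in> X \<Longrightarrow> nm (v - \<gamma> t) < d \<Longrightarrow> nm (T v - T (\<gamma> t)) < e"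
    using cont[OF gt e] by blast
  show "\<forall>\<^sub>F s in at t within {0..1}. dist (nm (T (\<gamma> s) - T (\<gamma> t))) 0 < e"
    using path_X_small[OF assms(3) t d(1)]
    by eventually_elim (use d assms gt in \<open>auto simp: path_X_def\<close>)
next
  fix t :: real assume t: "t \<in> {0..1}"
  then show "T (\<gamma> t) \<in> X" using assms by (auto simp: path_X_def)
qed

lemma continuous_X_nm: "continuous_X nm"
  unfolding continuous_X_def using nm_diff_ineq by (meson le_less_trans)

lemma path_X_segment: assumes "u \<in> X" "v \<in> X" shows "path_X (\<lambda>t. u + t *\<^sub>R (v - u))"
  unfolding path_X_def
proof (intro ballI conjI)
  fix t :: real
  have eq: "nm ((u + s *\<^sub>R (v - u)) - (u + t *\<^sub>R (v - u))) = \<bar>s - t\<bar> * nm (v - u)" for s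
    using nm_scale[of "v - u" "s - t"] assms by (simp add: scaleR_left_diff_distrib)
  have "((\<lambda>s. \<bar>s - t\<bar> * nm (v - u)) \<longlongrightarrow> \<bar>t - t\<bar> * nm (v - u)) (at t within {0..1})"
    by (intro tendsto_intros)
  then show "((\<lambda>s. nm ((u + s *\<^sub>R (v - u)) - (u + t *\<^sub>R (v - u)))) \<longlongrightarrow> 0) (at t within {0..1})"
    unfolding eq by simp
qed (use assms in auto)

text \<open>Since the gradient is uniformly continuous on bounded sets, a single explicit gradient step
  lowers the functional by a fixed amount near a non-critical level; no gradient flow is needed.\<close>

theorem mountain_pass:
  fixes \<Phi> :: "'v \<Rightarrow> real" and g :: "'v \<Rightarrow> 'v"
  assumes u0: "u0 \<in> X" and u1: "u1 \<in> X"
    and gX: "\<And>u. u \<in> X \<Longrightarrow> g u \<in> X"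
    and deriv: "\<And>u w s. u \<in> X \<Longrightarrow> w \<in> X \<Longrightarrow>
        ((\<lambda>s. \<Phi> (u + s *\<^sub>R w)) has_real_derivative ip (g (u + s *\<^sub>R w)) w) (at s)"
    and bdd: "\<And>R. \<exists>M. \<forall>u\<in>X. nm u \<le> R \<longrightarrow> nm (g u) \<le> M"
    and unif: "\<And>R e. e > 0 \<Longrightarrow> \<exists>d>0. \<forall>u\<in>X. \<forall>v\<in>X. nm u \<le> R \<longrightarrow> nm v \<le> R \<longrightarrow> nm (u - v) < d \<longrightarrow> nm (g u - g v) < e"
    and coercive: "\<And>M. \<exists>R. \<forall>u\<in>X. \<Phi> u \<le> M \<longrightarrow> nm u \<le> R"
    and palais_smale: "\<And>x c. (\<And>n::nat. x n \<in> X) \<Longrightarrow> (\<lambda>n. nm (g (x n))) \<longlonglongrightarrow> 0 \<Longrightarrow>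
        (\<lambda>n. \<Phi> (x n)) \<longlonglongrightarrow> c \<Longrightarrow> \<exists>u\<in>X. \<Phi> u = c \<and> nm (g u) = 0"
    and sep: "nm u0 \<le> r" "r \<le> nm u1" "\<And>u. u \<in> X \<Longrightarrow> nm u = r \<Longrightarrow> \<alpha> \<le> \<Phi> u"
    and low: "\<Phi> u0 < \<alpha>" "\<Phi> u1 < \<alpha>"
  shows "\<exists>u\<in>X. \<alpha> \<le> \<Phi> u \<and> nm (g u) = 0"
proof -
  have mvt: "\<exists>\<theta>\<in>{0<..<1}. \<Phi> (u + w) - \<Phi> u = ip (g (u + \<theta> *\<^sub>R w)) w" if "u \<in> X" "w \<in> X" for u w
    using MVT2[of 0 1 "\<lambda>s. \<Phi> (u + s *\<^sub>R w)" "\<lambda>s. ip (g (u + s *\<^sub>R w)) w"] deriv[OF that] by auto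
  have near: "nm (u + \<theta> *\<^sub>R w) \<le> nm u + nm w" if "u \<in> X" "w \<in> X" "\<theta> \<in> {0<..<1}" for u w \<theta>
  proof -
    have "nm (u + \<theta> *\<^sub>R w) \<le> nm u + \<theta> * nm w" using nm_triangle[of u "\<theta> *\<^sub>R w"] that by (simp add: nm_scale)
    also have "\<dots> \<le> nm u + 1 * nm w" using that by (intro add_left_mono mult_right_mono) auto
    finally show ?thesis by simp
  qed
  have c\<Phi>: "continuous_X \<Phi>"
    unfolding continuous_X_def
  proof (intro ballI allI impI)
    fix u and e :: real assume u: "u \<in> X" and e: "e > 0"
    obtain M' where M': "\<And>v. v \<in> X \<Longrightarrow> nm v \<le> nm u + 1 \<Longrightarrow> nm (g v) \<le> M'" using bdd by blast
    define M where "M = \<bar>M'\<bar> + 1"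
    have M: "M > 0" "\<And>v. v \<in> X \<Longrightarrow> nm v \<le> nm u + 1 \<Longrightarrow> nm (g v) \<le> M"
      using M' unfolding M_def by force+
    have "\<bar>\<Phi> v - \<Phi> u\<bar> < e" if v: "v \<in> X" and d: "nm (v - u) < min 1 (e / M)" for v
    proof -
      obtain \<theta> where \<theta>: "\<theta> \<in> {0<..<1}" "\<Phi> v - \<Phi> u = ip (g (u + \<theta> *\<^sub>R (v - u))) (v - u)"
        using mvt[of u "v - u"] u v by auto
      have "nm (u + \<theta> *\<^sub>R (v - u)) \<le> nm u + 1" using near[of u "v - u" \<theta>] u v \<theta> d by simp
      then have "nm (g (u + \<theta> *\<^sub>R (v - u))) * nm (v - u) \<le> M * nm (v - u)"
        using M u v by (intro mult_right_mono) auto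
      also have "\<dots> < e" using d M by (simp add: field_simps)
      finally show ?thesis using cauchy_schwarz[of "g (u + \<theta> *\<^sub>R (v - u))" "v - u"] \<theta> u v gX by simp
    qed
    then show "\<exists>d>0. \<forall>v\<in>X. nm (v - u) < d \<longrightarrow> \<bar>\<Phi> v - \<Phi> u\<bar> < e"
      using M e by (intro exI[of _ "min 1 (e / M)"]) auto
  qed
  have cg: "\<exists>d>0. \<forall>v\<in>X. nm (v - u) < d \<longrightarrow> nm (g v - g u) < e" if u: "u \<in> X" and e: "e > 0" for u e
  proof -
    obtain d where d: "d > 0" "\<And>v. v \<in> X \<Longrightarrow> nm v \<le> nm u + 1 \<Longrightarrow> nm (v - u) < d \<Longrightarrow> nm (g v - g u) < e"
      using unif[OF e, of "nm u + 1"] u by force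
    have "nm v \<le> nm u + 1" if "v \<in> X" "nm (v - u) < 1" for v
      using nm_triangle[of u "v - u"] u that by simp
    then show ?thesis using d by (intro exI[of _ "min 1 d"]) auto
  qed
  define \<Gamma> where "\<Gamma> = {\<gamma>. path_X \<gamma> \<and> \<gamma> 0 = u0 \<and> \<gamma> 1 = u1}"
  define S :: "(real \<Rightarrow> 'v) \<Rightarrow> real" where "S \<gamma> = Sup ((\<lambda>t. \<Phi> (\<gamma> t)) ` {0..1})" for \<gamma>
  have Sup_att: "\<exists>t\<in>{0..1}. S \<gamma> = \<Phi> (\<gamma> t) \<and> (\<forall>s\<in>{0..1}. \<Phi> (\<gamma> s) \<le> S \<gamma>)" if "\<gamma> \<in> \<Gamma>" for \<gamma>
  proof -
    have "continuous_on {0..1} (\<lambda>t. \<Phi> (\<gamma> t))" using that c\<Phi> by (auto simp: \<Gamma>_def intro: continuous_X_path)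
    from continuous_attains_sup[OF _ _ this] obtain t :: real
      where t: "t \<in> {0..1}" "\<forall>s\<in>{0..1}. \<Phi> (\<gamma> s) \<le> \<Phi> (\<gamma> t)" by auto
    have "S \<gamma> = \<Phi> (\<gamma> t)" unfolding S_def by (rule cSup_eq_maximum) (use t in auto)
    with t show ?thesis by auto
  qed
  \<comment> \<open>The seminorm is continuous along a path and passes from at most \<open>r\<close>
    to at least \<open>r\<close>, so the path meets the sphere on which \<open>\<Phi>\<close> is at
    least \<open>\<alpha>\<close>.\<close>
  have S\<alpha>: "\<alpha> \<le> S \<gamma>" if g: "\<gamma> \<in> \<Gamma>" for \<gamma>
  proof -
    have "continuous_on {0..1} (\<lambda>t. nm (\<gamma> t))"
      using g by (auto simp: \<Gamma>_def intro: continuous_X_path continuous_X_nm)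
    from IVT'[OF _ _ _ this, of r] obtain t where "t \<in> {0..1}" "nm (\<gamma> t) = r"
      using g sep by (auto simp: \<Gamma>_def)
    moreover from this have "\<gamma> t \<in> X" using g by (auto simp: \<Gamma>_def path_X_def)
    ultimately show ?thesis using sep(3)[of "\<gamma> t"] Sup_att[OF g] by (metis order_trans)
  qed
  have seg: "(\<lambda>t. u0 + t *\<^sub>R (u1 - u0)) \<in> \<Gamma>"
    unfolding \<Gamma>_def using path_X_segment[OF u0 u1] by simp
  define c where "c = Inf (S ` \<Gamma>)"
  have bb: "bdd_below (S ` \<Gamma>)" using S\<alpha> by (auto intro!: bdd_belowI)
  have c\<alpha>: "\<alpha> \<le> c" unfolding c_def using S\<alpha> seg by (intro cInf_greatest) auto
  have cS: "c \<le> S \<gamma>" if "\<gamma> \<in> \<Gamma>" for \<gamma> unfolding c_def using bb that by (auto intro: cInf_lower)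
  show ?thesis
  proof (rule ccontr)
    assume contra: "\<not> ?thesis"
    \<comment> \<open>If the minimax level \<open>c\<close> carried no critical point, the
      Palais-Smale condition would keep the gradient away from zero on a whole band of levels around
      \<open>c\<close>. One number \<open>\<epsilon>\<close> serves both as width of the band and as
      lower bound.\<close>
    have "\<exists>\<epsilon>>0. \<forall>u\<in>X. \<bar>\<Phi> u - c\<bar> \<le> \<epsilon> \<longrightarrow> nm (g u) \<ge> \<epsilon>"
    proof (rule ccontr)
      assume neg: "\<not> ?thesis"
      have "\<exists>u\<in>X. \<bar>\<Phi> u - c\<bar> \<le> 1 / Suc n \<and> nm (g u) < 1 / Suc n" for n :: nat
      proof (rule ccontr)
        assume "\<not> ?thesis"
        then have "\<forall>u\<in>X. \<bar>\<Phi> u - c\<bar> \<le> 1 / Suc n \<longrightarrow> 1 / Suc n \<le> nm (g u)" by force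
        moreover have "(1::real) / Suc n > 0" by simp
        ultimately show False using neg by metis
      qed
      then obtain x where x: "\<And>n::nat. x n \<in> X" "\<And>n. \<bar>\<Phi> (x n) - c\<bar> \<le> 1 / Suc n"
        "\<And>n. nm (g (x n)) < 1 / Suc n" by metis
      have z: "(\<lambda>m. 1 / Suc m) \<longlonglongrightarrow> (0::real)"
        using LIMSEQ_inverse_real_of_nat by (simp add: field_simps)
      have "(\<lambda>n. nm (g (x n))) \<longlonglongrightarrow> 0"
        by (rule Lim_null_comparison[OF _ z]) (use x gX in \<open>auto intro!: always_eventually less_imp_le simp del: of_nat_Suc\<close>)
      moreover have "(\<lambda>n. \<Phi> (x n) - c) \<longlonglongrightarrow> 0"
        by (rule Lim_null_comparison[OF _ z]) (use x in auto)
      then have "(\<lambda>n. \<Phi> (x n)) \<longlonglongrightarrow> c" by (simp add: LIM_zero_iff)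
      ultimately obtain u where "u \<in> X" "\<Phi> u = c" "nm (g u) = 0"
        using palais_smale[of x c] x(1) by blast
      then show False using contra c\<alpha> by auto
    qed
    then obtain \<epsilon> where \<epsilon>: "\<epsilon> > 0" "\<And>u. u \<in> X \<Longrightarrow> \<bar>\<Phi> u - c\<bar> \<le> \<epsilon> \<Longrightarrow> nm (g u) \<ge> \<epsilon>" by blast
    define \<beta> where "\<beta> = max (\<Phi> u0) (\<Phi> u1)"
    \<comment> \<open>The deformation is to act only above \<open>c - \<eta>\<close>: inside the
      band where the gradient is bounded below, and nowhere near the end points, whose values are at
      most \<open>\<beta> < c\<close>.\<close>
    define \<eta> where "\<eta> = min \<epsilon> (c - \<beta>)"
    have \<eta>: "\<eta> > 0" "\<eta> \<le> \<epsilon>" "\<Phi> u0 \<le> c - \<eta>" "\<Phi> u1 \<le> c - \<eta>"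
      using \<epsilon> low c\<alpha> unfolding \<eta>_def \<beta>_def by auto
    obtain R where R: "\<And>u. u \<in> X \<Longrightarrow> \<Phi> u \<le> c + \<eta> \<Longrightarrow> nm u \<le> R" using coercive by blast
    obtain M' where M': "\<And>u. u \<in> X \<Longrightarrow> nm u \<le> R \<Longrightarrow> nm (g u) \<le> M'" using bdd by blast
    define M where "M = \<bar>M'\<bar> + 1"
    have M: "M > 0" "\<And>u. u \<in> X \<Longrightarrow> nm u \<le> R \<Longrightarrow> nm (g u) \<le> M"
      using M' unfolding M_def by force+
    obtain \<tau> where \<tau>: "\<tau> > 0" "\<And>u v. u \<in> X \<Longrightarrow> v \<in> X \<Longrightarrow> nm u \<le> R + 1 \<Longrightarrow> nm v \<le> R + 1 \<Longrightarrow>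
        nm (u - v) < \<tau> \<Longrightarrow> nm (g u - g v) < \<epsilon> / 2"
      using unif[of "\<epsilon> / 2" "R + 1"] \<epsilon> by auto
    \<comment> \<open>A step then has length at most \<open>t * M\<close>. Being below
      \<open>\<tau>\<close>, it changes the gradient by less than \<open>\<epsilon> / 2\<close>;
      being at most 1, it stays in the ball of radius \<open>R + 1\<close> on which
      \<open>\<tau>\<close> was chosen.\<close>
    define t where "t = min (\<tau> / 2) 1 / M"
    have t: "t > 0" "t * M < \<tau>" "t * M \<le> 1" using \<tau> M unfolding t_def by auto
    \<comment> \<open>A continuous cutoff in the level: 0 up to \<open>c - \<eta>\<close>, so that
      the end points of paths stay fixed, and 1 from \<open>c - \<eta> / 2\<close> on.\<close>
    define \<rho> where "\<rho> u = max 0 (min 1 ((\<Phi> u - (c - \<eta>)) / (\<eta> / 2)))" for u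
    have \<rho>: "0 \<le> \<rho> u" "\<rho> u \<le> 1" for u unfolding \<rho>_def by auto
    define T where "T u = u - (t * \<rho> u) *\<^sub>R g u" for u
    have TX: "T u \<in> X" if "u \<in> X" for u using that gX unfolding T_def by auto
    have dec: "\<Phi> (T u) \<le> \<Phi> u - t * \<rho> u * \<epsilon>\<^sup>2 / 2" if u: "u \<in> X" and le: "\<Phi> u \<le> c + \<eta>" for u
    proof (cases "\<rho> u = 0")
      case True then show ?thesis unfolding T_def by simp
    next
      case False
      then have "\<rho> u > 0" using \<rho>[of u] by simp
      then have "\<Phi> u > c - \<eta>" using \<eta> unfolding \<rho>_def by (auto simp: max_def field_simps split: if_splits)
      then have G: "\<epsilon> \<le> nm (g u)" using \<epsilon>(2)[OF u] le \<eta> by simp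
      have nu: "nm u \<le> R" "nm (g u) \<le> M" using R M u le by auto
      define w where "w = (- (t * \<rho> u)) *\<^sub>R g u"
      have wX: "w \<in> X" and Tw: "T u = u + w" using u gX unfolding w_def T_def by auto
      have nw: "nm w = t * \<rho> u * nm (g u)" unfolding w_def using nm_scale[OF gX[OF u], of "- (t * \<rho> u)"] \<rho>[of u] t by (simp add: abs_mult)
      have "t * \<rho> u * nm (g u) \<le> t * 1 * M" using \<rho>[of u] t nu gX[OF u] by (intro mult_mono) auto
      then have nwt: "nm w \<le> t * M" unfolding nw by simp
      obtain \<theta> where \<theta>: "\<theta> \<in> {0<..<1}" "\<Phi> (u + w) - \<Phi> u = ip (g (u + \<theta> *\<^sub>R w)) w"
        using mvt[OF u wX] by blast
      define z where "z = u + \<theta> *\<^sub>R w"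
      have zX: "z \<in> X" unfolding z_def using u wX by auto
      have z1: "nm z \<le> R + 1" using near[OF u wX \<theta>(1)] nu nwt t unfolding z_def by simp
      have "nm (z - u) = \<theta> * nm w" unfolding z_def using wX \<theta> by (simp add: nm_scale)
      also have "\<dots> \<le> 1 * nm w" using \<theta> wX by (intro mult_right_mono) auto
      finally have "nm (z - u) < \<tau>" using nwt t by simp
      then have gz: "nm (g z - g u) \<le> \<epsilon> / 2" using \<tau>(2)[OF zX u z1] nu by simp
      have "\<Phi> (T u) - \<Phi> u = ip (g u) w + ip (g z - g u) w"
        using \<theta>(2) zX u wX gX unfolding Tw z_def[symmetric] by (simp add: ip_simps)
      also have "ip (g u) w = - (t * \<rho> u * (nm (g u))\<^sup>2)"
        unfolding w_def using gX[OF u] by (simp add: ip_simps nm_sq)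
      also have "ip (g z - g u) w \<le> nm (g z - g u) * nm w"
        using cauchy_schwarz[of "g z - g u" w] gX zX u wX by simp
      \<comment> \<open>Since \<open>\<epsilon> / 2\<close> is at most half the gradient at
        \<open>u\<close>, the variation of the gradient along the step destroys at most half of the
        first-order decrease.\<close>
      also have "\<dots> \<le> nm (g u) / 2 * nm w" using gz G wX by (intro mult_right_mono) auto
      also have "- (t * \<rho> u * (nm (g u))\<^sup>2) + nm (g u) / 2 * nm w = - (t * \<rho> u * (nm (g u))\<^sup>2 / 2)"
        unfolding nw by (simp add: power2_eq_square algebra_simps)
      also have "\<dots> \<le> - (t * \<rho> u * \<epsilon>\<^sup>2 / 2)"
        using t \<rho>[of u] G \<epsilon> by (auto intro!: mult_left_mono power_mono)
      finally show ?thesis by simp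
    qed
    have \<rho>cont: "continuous_X \<rho>"
      unfolding continuous_X_def
    proof (intro ballI allI impI)
      fix u and e :: real assume u: "u \<in> X" and e: "e > 0"
      obtain d where d: "d > 0" "\<And>v. v \<in> X \<Longrightarrow> nm (v - u) < d \<Longrightarrow> \<bar>\<Phi> v - \<Phi> u\<bar> < e * (\<eta> / 2)"
        using c\<Phi>[unfolded continuous_X_def, rule_format, OF u mult_pos_pos[OF e half_gt_zero[OF \<eta>(1)]]]
        by blast
      have "\<bar>\<rho> v - \<rho> u\<bar> \<le> \<bar>\<Phi> v - \<Phi> u\<bar> / (\<eta> / 2)" for v
      proof -
        have "\<bar>max 0 (min 1 a) - max 0 (min 1 b)\<bar> \<le> \<bar>a - b\<bar>" for a b :: real by (simp add: max_def min_def)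
        from this[of "(\<Phi> v - (c - \<eta>)) / (\<eta> / 2)" "(\<Phi> u - (c - \<eta>)) / (\<eta> / 2)"]
        moreover have "(\<Phi> v - (c - \<eta>)) / (\<eta> / 2) - (\<Phi> u - (c - \<eta>)) / (\<eta> / 2) = (\<Phi> v - \<Phi> u) / (\<eta> / 2)"
          by (simp only: diff_divide_distrib[symmetric]) simp
        ultimately show ?thesis unfolding \<rho>_def using \<eta>(1) by (simp only: abs_divide) simp
      qed
      moreover have "\<bar>\<Phi> v - \<Phi> u\<bar> / (\<eta> / 2) < e" if "v \<in> X" "nm (v - u) < d" for v
        using d(2)[OF that] \<eta>(1) by (simp only: pos_divide_less_eq half_gt_zero)
      ultimately show "\<exists>d>0. \<forall>v\<in>X. nm (v - u) < d \<longrightarrow> \<bar>\<rho> v - \<rho> u\<bar> < e"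
        using d(1) by (intro exI[of _ d]) (auto intro: le_less_trans)
    qed
    have Tcont: "\<exists>d>0. \<forall>v\<in>X. nm (v - u) < d \<longrightarrow> nm (T v - T u) < e" if u: "u \<in> X" and e: "e > 0" for u e
    proof -
      define N where "N = nm (g u) + 1"
      have N: "N > 0" using nm_nonneg[OF gX[OF u]] unfolding N_def by linarith
      have e3: "e / (3 * t) > 0" "e / (3 * t * N) > 0" using e t N by auto
      obtain d1 where d1: "d1 > 0" "\<And>v. v \<in> X \<Longrightarrow> nm (v - u) < d1 \<Longrightarrow> nm (g v - g u) < e / (3 * t)"
        using cg[OF u e3(1)] by blast
      obtain d2 where d2: "d2 > 0" "\<And>v. v \<in> X \<Longrightarrow> nm (v - u) < d2 \<Longrightarrow> \<bar>\<rho> v - \<rho> u\<bar> < e / (3 * t * N)"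
        using \<rho>cont u e3(2) unfolding continuous_X_def by blast
      have "nm (T v - T u) < e" if v: "v \<in> X" and d: "nm (v - u) < min (e / 3) (min d1 d2)" for v
      proof -
        have eq: "T v - T u = (v - u) + ((- (t * \<rho> v)) *\<^sub>R (g v - g u) + (- (t * (\<rho> v - \<rho> u))) *\<^sub>R g u)"
          unfolding T_def by (simp add: algebra_simps)
        have "nm (T v - T u) \<le> nm (v - u) + (nm ((- (t * \<rho> v)) *\<^sub>R (g v - g u)) + nm ((- (t * (\<rho> v - \<rho> u))) *\<^sub>R g u))"
          unfolding eq using u v gX by (intro nm_triangle[THEN order_trans] add_left_mono nm_triangle) auto
        also have "\<dots> = nm (v - u) + (t * \<rho> v * nm (g v - g u) + t * \<bar>\<rho> v - \<rho> u\<bar> * nm (g u))"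
          using u v gX t \<rho>[of v] by (simp only: nm_scale X_closed abs_minus_cancel abs_mult)
        also have "\<dots> < e / 3 + (e / 3 + e / 3)"
        proof (intro add_strict_mono)
          show "nm (v - u) < e / 3" using d by simp
          have "t * \<rho> v * nm (g v - g u) \<le> t * 1 * nm (g v - g u)"
            using t \<rho>[of v] gX u v by (intro mult_right_mono mult_left_mono) auto
          also have "\<dots> < t * (e / (3 * t))"
            unfolding mult_1_right using d1(2)[OF v] d t by (intro mult_strict_left_mono) auto
          finally show "t * \<rho> v * nm (g v - g u) < e / 3" using t by simp
          have "t * \<bar>\<rho> v - \<rho> u\<bar> * nm (g u) \<le> t * \<bar>\<rho> v - \<rho> u\<bar> * N"
            using t unfolding N_def by (intro mult_left_mono) auto
          also have "\<dots> < t * (e / (3 * t * N)) * N"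
            using d2(2)[OF v] d t N by (intro mult_strict_right_mono mult_strict_left_mono) auto
          finally show "t * \<bar>\<rho> v - \<rho> u\<bar> * nm (g u) < e / 3" using t N by simp
        qed
        finally show ?thesis by simp
      qed
      then show ?thesis using d1(1) d2(1) e by (intro exI[of _ "min (e / 3) (min d1 d2)"]) auto
    qed
    \<comment> \<open>Half of the decrease guaranteed where the cutoff is 1, so that an almost
      optimal path is pushed strictly below \<open>c\<close>; the bound by \<open>\<eta>\<close>
      keeps the path in the region where \<open>dec\<close> applies.\<close>
    define \<kappa> where "\<kappa> = min \<eta> (t * \<epsilon>\<^sup>2 / 4)"
    have \<kappa>: "\<kappa> > 0" using \<eta> t \<epsilon> unfolding \<kappa>_def by auto
    obtain \<gamma> where \<gamma>: "\<gamma> \<in> \<Gamma>" "S \<gamma> < c + \<kappa>"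
      using cInf_lessD[of "S ` \<Gamma>" "c + \<kappa>"] seg \<kappa> unfolding c_def[symmetric] by auto
    have "\<rho> u0 = 0" "\<rho> u1 = 0"
      using divide_nonpos_pos[of "\<Phi> u0 - (c - \<eta>)" "\<eta> / 2"] divide_nonpos_pos[of "\<Phi> u1 - (c - \<eta>)" "\<eta> / 2"] \<eta>
      unfolding \<rho>_def by linarith+
    then have "(\<lambda>s. T (\<gamma> s)) \<in> \<Gamma>"
      using \<gamma>(1) path_X_map[OF TX Tcont, of \<gamma>] by (auto simp: \<Gamma>_def T_def)
    from Sup_att[OF this] cS[OF this] obtain s where s: "s \<in> {0..1}" "c \<le> \<Phi> (T (\<gamma> s))" by auto
    have gs: "\<gamma> s \<in> X" using \<gamma>(1) s by (auto simp: \<Gamma>_def path_X_def)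
    have "\<Phi> (\<gamma> s) \<le> S \<gamma>" using Sup_att[OF \<gamma>(1)] s by blast
    then have le: "\<Phi> (\<gamma> s) < c + \<eta>" "\<Phi> (\<gamma> s) < c + t * \<epsilon>\<^sup>2 / 4" using \<gamma>(2) unfolding \<kappa>_def by auto
    have d: "\<Phi> (T (\<gamma> s)) \<le> \<Phi> (\<gamma> s) - t * \<rho> (\<gamma> s) * \<epsilon>\<^sup>2 / 2" using dec[OF gs] le by simp
    have p: "0 < t * \<epsilon>\<^sup>2" using t \<epsilon> by simp
    \<comment> \<open>At the maximum of the deformed path the old point was either near the level,
      where the full step more than consumes the surplus over \<open>c\<close>, or below
      \<open>c - \<eta> / 2\<close>, from where a step cannot climb back to
      \<open>c\<close>.\<close>
    show False
    proof (cases "\<Phi> (\<gamma> s) \<ge> c - \<eta> / 2")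
      case True
      then have "\<rho> (\<gamma> s) = 1" unfolding \<rho>_def using \<eta>(1) by (auto simp: max_def min_def field_simps)
      then show False using d s(2) le(2) p by simp
    next
      case False
      have "0 \<le> t * \<rho> (\<gamma> s) * \<epsilon>\<^sup>2 / 2" using t \<rho>[of "\<gamma> s"] by simp
      then show False using d s(2) False \<eta>(1) by linarith
    qed
  qed
qed

end

section \<open>Smooth functions\<close>

text \<open>All derivatives are supplied at once as a sequence \<open>H\<close>. For functions of
  one variable this is easier to exhibit than an instance of the recursion behind
  \<open>C_on\<close>, and it is all that \<open>C_on_compose\<close> requires of the outer
  function.\<close>

definition smooth_real :: "(real \<Rightarrow> real) \<Rightarrow> bool" where
  "smooth_real h \<longleftrightarrow> (\<exists>H. H 0 = h \<and> (\<forall>n x. (H n has_real_derivative H (Suc n) x) (at x)))"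

lemma smooth_realE:
  assumes "smooth_real h"
  obtains h' where "\<And>x. (h has_real_derivative h' x) (at x)" "smooth_real h'"
proof -
  obtain H where H: "H 0 = h" "\<And>n x. (H n has_real_derivative H (Suc n) x) (at x)"
    using assms unfolding smooth_real_def by auto
  have "smooth_real (H 1)" unfolding smooth_real_def
    by (rule exI[of _ "\<lambda>n. H (Suc n)"]) (use H in auto)
  then show ?thesis using that[of "H 1"] H(2)[of 0] H(1) by simp
qed

lemma smooth_real_affine:
  assumes "smooth_real h" shows "smooth_real (\<lambda>x. a * h (b * x + c))"
proof -
  obtain H where H: "H 0 = h" "\<And>n x. (H n has_real_derivative H (Suc n) x) (at x)"
    using assms unfolding smooth_real_def by auto
  define G where "G n x = a * b ^ n * H n (b * x + c)" for n :: nat and x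
  have "(G n has_real_derivative G (Suc n) x) (at x)" for n x
  proof -
    have "((\<lambda>x. H n (b * x + c)) has_real_derivative H (Suc n) (b * x + c) * b) (at x)"
      by (rule DERIV_chain2[OF H(2)]) (auto intro!: derivative_eq_intros)
    from DERIV_cmult[OF this, of "a * b ^ n"] show ?thesis unfolding G_def by (simp add: ac_simps)
  qed
  moreover have "G 0 = (\<lambda>x. a * h (b * x + c))" unfolding G_def H(1) by simp
  ultimately show ?thesis unfolding smooth_real_def by (intro exI[of _ G]) simp
qed

lemma smooth_real_add_const:
  assumes "smooth_real h" shows "smooth_real (\<lambda>x. h x + c)"
proof -
  obtain H where H: "H 0 = h" "\<And>n x. (H n has_real_derivative H (Suc n) x) (at x)"
    using assms unfolding smooth_real_def by auto
  have "((if n = 0 then (\<lambda>x. h x + c) else H n) has_real_derivative H (Suc n) x) (at x)" for n x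
    using H(2)[of n x] by (cases n) (auto intro!: derivative_eq_intros simp: H(1))
  then show ?thesis unfolding smooth_real_def
    by (intro exI[of _ "\<lambda>n. if n = 0 then (\<lambda>x. h x + c) else H n"]) auto
qed

lemma poly_times_exp_tendsto_0: "((\<lambda>s. poly p s * exp (- s)) \<longlongrightarrow> (0::real)) at_top"
proof -
  have "((\<lambda>s. \<Sum>i\<le>degree p. coeff p i * (s ^ i / exp s)) \<longlongrightarrow> (\<Sum>i\<le>degree p. coeff p i * 0)) at_top"
    by (intro tendsto_intros tendsto_power_div_exp_0)
  then show ?thesis
    by (simp add: poly_altdef sum_distrib_right exp_minus divide_inverse mult.assoc)
qed

definition exp_cutoff :: "real \<Rightarrow> real" where
  "exp_cutoff t = (if t > 0 then exp (- (1 / t)) else 0)"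

lemma exp_cutoff_props [simp]:
  "0 \<le> exp_cutoff t" "exp_cutoff t \<le> 1" "exp_cutoff t > 0 \<longleftrightarrow> t > 0" "exp_cutoff t = 0 \<longleftrightarrow> t \<le> 0"
  by (auto simp: exp_cutoff_def)

text \<open>On the positive half-line the \<open>n\<close>-th derivative is
  \<open>poly (P n) s * exp (- s)\<close> with \<open>s = 1 / t\<close>. Differentiation in
  \<open>t\<close> is \<open>- s\<^sup>2\<close> times differentiation in \<open>s\<close>, which
  explains the recursion for \<open>P\<close>. At zero the exponential beats every
  polynomial.\<close>

lemma smooth_real_exp_cutoff: "smooth_real exp_cutoff"
proof -
  define P :: "nat \<Rightarrow> real poly" where "P = rec_nat 1 (\<lambda>_ p. [:0,0,1:] * (p - pderiv p))"
  have P: "P 0 = 1" "P (Suc n) = [:0,0,1:] * (P n - pderiv (P n))" for n by (simp_all add: P_def)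
  define H where "H n t = (if t > 0 then poly (P n) (1 / t) * exp (- (1 / t)) else 0)" for n t
  have "(H n has_real_derivative H (Suc n) x) (at x)" for n x
  proof -
    consider "x > 0" | "x < 0" | "x = 0" by linarith
    then show ?thesis
    proof cases
      case 1
      have "((\<lambda>t. poly (P n) (1 / t)) has_real_derivative (poly (pderiv (P n)) (1 / x) * (- 1 / (x * x)))) (at x)"
        by (rule DERIV_chain2[OF poly_DERIV]) (use 1 in \<open>auto intro!: derivative_eq_intros\<close>)
      then have "((\<lambda>t. poly (P n) (1 / t) * exp (- (1 / t))) has_real_derivative H (Suc n) x) (at x)"
        using 1 by (auto intro!: derivative_eq_intros simp: H_def P(2) field_simps)
      moreover have "\<forall>\<^sub>F t in nhds x. poly (P n) (1 / t) * exp (- (1 / t)) = H n t"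
        using eventually_nhds_in_open[of "{0<..}" x] 1 by (auto elim!: eventually_mono simp: H_def)
      ultimately show ?thesis by (subst DERIV_cong_ev[OF refl _ refl, symmetric]) auto
    next
      case 2
      have "((\<lambda>t. 0) has_real_derivative H (Suc n) x) (at x)" using 2 by (simp add: H_def)
      moreover have "\<forall>\<^sub>F t in nhds x. 0 = H n t"
        using eventually_nhds_in_open[of "{..<0}" x] 2 by (auto elim!: eventually_mono simp: H_def)
      ultimately show ?thesis by (subst DERIV_cong_ev[OF refl _ refl, symmetric]) auto
    next
      case 3
      have "((\<lambda>t. (H n t - H n 0) / (t - 0)) \<longlongrightarrow> 0) (at 0)"
      proof (rule filterlim_split_at)
        have "\<forall>\<^sub>F t in at_left 0. 0 = (H n t - H n 0) / (t - 0)"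
          by (auto simp: H_def eventually_at_filter)
        then show "((\<lambda>t. (H n t - H n 0) / (t - 0)) \<longlongrightarrow> 0) (at_left 0)"
          by (rule Lim_transform_eventually[OF tendsto_const])
        \<comment> \<open>The quotient by \<open>t\<close> contributes one more factor
          \<open>s = 1 / t\<close>, hence the polynomial \<open>[:0,1:] * P n\<close>.\<close>
        have "((\<lambda>s. poly ([:0,1:] * P n) s * exp (- s)) \<longlongrightarrow> 0) at_top"
          by (rule poly_times_exp_tendsto_0)
        from filterlim_compose[OF this filterlim_inverse_at_top_right]
        have "((\<lambda>t. poly ([:0,1:] * P n) (inverse t) * exp (- inverse t)) \<longlongrightarrow> 0) (at_right 0)" .
        moreover have "\<forall>\<^sub>F t in at_right 0. poly ([:0,1:] * P n) (inverse t) * exp (- inverse t) = (H n t - H n 0) / (t - 0)"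
          by (auto simp: H_def eventually_at_filter field_simps)
        ultimately show "((\<lambda>t. (H n t - H n 0) / (t - 0)) \<longlongrightarrow> 0) (at_right 0)"
          by (rule Lim_transform_eventually)
      qed
      then show ?thesis using 3 by (simp add: has_field_derivative_iff H_def)
    qed
  qed
  moreover have "H 0 = exp_cutoff" by (auto simp: H_def P exp_cutoff_def)
  ultimately show ?thesis unfolding smooth_real_def by (intro exI[of _ H]) simp
qed

text \<open>The factor \<open>exp 1\<close> normalises the value at 0 to 0, as
  \<open>exp_cutoff 1 = exp (- 1)\<close>. Only arguments \<open>t \<ge> 0\<close> are meant; for
  negative ones the values are negative.\<close>

definition plateau :: "real \<Rightarrow> real" where
  "plateau t = 1 - exp 1 * exp_cutoff (1 - t)"

lemma plateau_props: "plateau 0 = 0" "t \<ge> 1 \<Longrightarrow> plateau t = 1" "0 \<le> t \<Longrightarrow> 0 \<le> plateau t" "plateau t \<le> 1"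
proof -
  show "plateau 0 = 0" by (simp add: plateau_def exp_cutoff_def flip: exp_add)
  show "t \<ge> 1 \<Longrightarrow> plateau t = 1" by (simp add: plateau_def)
  show "plateau t \<le> 1" by (simp add: plateau_def)
  show "0 \<le> plateau t" if "0 \<le> t"
  proof (cases "t < 1")
    case True
    have "1 - 1 / (1 - t) \<le> 0" using True that by (simp add: field_simps)
    then have "exp (1 - 1 / (1 - t)) \<le> 1" by (simp only: exp_le_one_iff)
    then show ?thesis using True by (simp add: plateau_def exp_cutoff_def flip: exp_add)
  next
    case False
    then have "exp_cutoff (1 - t) = 0" by (simp only: exp_cutoff_props(4))
    then have "plateau t = 1" unfolding plateau_def by (simp only: mult_zero_right diff_zero)
    then show ?thesis by simp
  qed
qed

lemma smooth_real_plateau: "smooth_real plateau"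
  using smooth_real_add_const[OF smooth_real_affine[OF smooth_real_exp_cutoff, of "- exp 1" "-1" 1], of 1]
  by (simp add: plateau_def[abs_def] algebra_simps)

subsection \<open>Closure properties\<close>

lemma C_on_Suc_imp: "C_on (Suc n) S f \<Longrightarrow> C_on n S f"
  by (induction n arbitrary: f) (auto simp: differentiable_imp_continuous_on)

lemma C_on_const: "C_on n UNIV (\<lambda>x. c)"
  by (induction n arbitrary: c) (auto simp: frechet_derivative_const)

text \<open>By uniqueness of derivatives, any derivative at hand may stand in for the one picked by
  \<open>frechet_derivative\<close>. The inductions for sums, products and compositions go through
  this rule.\<close>

lemma C_on_UNIV_Suc:
  assumes "\<And>x. (f has_derivative f' x) (at x)" and "\<And>i. i \<in> Basis \<Longrightarrow> C_on n UNIV (\<lambda>x. f' x i)"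
  shows "C_on (Suc n) UNIV f"
proof -
  have "frechet_derivative f (at x) = f' x" for x using frechet_derivative_at[OF assms(1)] by simp
  then show ?thesis using assms by (auto simp: differentiable_on_def differentiable_def)
qed

lemma C_on_SucD:
  assumes "C_on (Suc n) UNIV f"
  shows "(f has_derivative frechet_derivative f (at x)) (at x)"
    and "i \<in> Basis \<Longrightarrow> C_on n UNIV (\<lambda>x. frechet_derivative f (at x) i)"
  using assms by (auto simp: differentiable_on_def frechet_derivative_works[symmetric])

lemma C_on_linear: "bounded_linear f \<Longrightarrow> C_on n UNIV f"
  by (cases n) (auto simp: linear_continuous_on simp del: C_on.simps(2)
    intro!: C_on_UNIV_Suc[where f' = "\<lambda>x. f"] C_on_const bounded_linear_imp_has_derivative)

lemma C_on_add:
  "C_on n UNIV f \<Longrightarrow> C_on n UNIV g \<Longrightarrow> C_on n UNIV (\<lambda>x. f x + g x)"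
proof (induction n arbitrary: f g)
  case 0 then show ?case by (auto intro: continuous_intros)
next
  case (Suc n)
  show ?case
    by (rule C_on_UNIV_Suc[OF has_derivative_add[OF C_on_SucD(1)[OF Suc.prems(1)] C_on_SucD(1)[OF Suc.prems(2)]]])
       (use Suc.IH C_on_SucD(2)[OF Suc.prems(1)] C_on_SucD(2)[OF Suc.prems(2)] in blast)
qed

lemma C_on_mult:
  fixes f g :: "'a::euclidean_space \<Rightarrow> real"
  shows "C_on n UNIV f \<Longrightarrow> C_on n UNIV g \<Longrightarrow> C_on n UNIV (\<lambda>x. f x * g x)"
proof (induction n arbitrary: f g)
  case 0 then show ?case by (auto intro: continuous_intros)
next
  case (Suc n)
  show ?case
    by (rule C_on_UNIV_Suc[OF has_derivative_mult[OF C_on_SucD(1)[OF Suc.prems(1)] C_on_SucD(1)[OF Suc.prems(2)]]])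
       (intro C_on_add Suc.IH C_on_SucD(2)[OF Suc.prems(1)] C_on_SucD(2)[OF Suc.prems(2)] C_on_Suc_imp[OF Suc.prems(1)] C_on_Suc_imp[OF Suc.prems(2)])
qed

lemma C_on_compose:
  fixes f :: "'a::euclidean_space \<Rightarrow> real"
  shows "smooth_real h \<Longrightarrow> C_on n UNIV f \<Longrightarrow> C_on n UNIV (\<lambda>x. h (f x))"
proof (induction n arbitrary: h f)
  case 0
  obtain h' where "\<And>x. (h has_real_derivative h' x) (at x)" "smooth_real h'"
    using smooth_realE[OF 0(1)] by blast
  then have "continuous_on UNIV h"
    by (auto intro!: DERIV_isCont simp: continuous_on_eq_continuous_at)
  then show ?case using 0 by (auto intro: continuous_on_compose2)
next
  case (Suc n)
  obtain h' where h': "\<And>x. (h has_real_derivative h' x) (at x)" "smooth_real h'"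
    using smooth_realE[OF Suc.prems(1)] by blast
  have d: "((\<lambda>x. h (f x)) has_derivative (\<lambda>y. h' (f x) * frechet_derivative f (at x) y)) (at x)" for x
    using has_derivative_compose[OF C_on_SucD(1)[OF Suc.prems(2)] h'(1)[unfolded has_field_derivative_def]] .
  show ?case
    by (rule C_on_UNIV_Suc[OF d])
       (rule C_on_mult[OF Suc.IH[OF h'(2) C_on_Suc_imp[OF Suc.prems(2)]] C_on_SucD(2)[OF Suc.prems(2)]])
qed

lemma C_on_prod:
  fixes f :: "'i \<Rightarrow> 'a::euclidean_space \<Rightarrow> real"
  assumes "finite I" "\<And>i. i \<in> I \<Longrightarrow> C_on n UNIV (f i)"
  shows "C_on n UNIV (\<lambda>x. \<Prod>i\<in>I. f i x)"
  using assms by (induction I rule: finite_induct) (auto intro: C_on_const C_on_mult)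

lemma smooth_on_compose: "smooth_real h \<Longrightarrow> smooth_on UNIV f \<Longrightarrow> smooth_on UNIV (\<lambda>x. h (f x))"
  for f :: "'a::euclidean_space \<Rightarrow> real"
  by (simp add: smooth_on_def C_on_compose)

subsection \<open>Test functions approximating the indicator of a box\<close>

definition box_bump :: "'a::euclidean_space \<Rightarrow> 'a \<Rightarrow> 'a \<Rightarrow> real" where
  "box_bump a b x = (\<Prod>i\<in>Basis. exp_cutoff (x \<bullet> i - a \<bullet> i) * exp_cutoff (b \<bullet> i - x \<bullet> i))"

lemma box_bump_nonneg: "0 \<le> box_bump a b x"
  by (simp add: box_bump_def prod_nonneg)

lemma box_bump_pos: "0 < box_bump a b x \<longleftrightarrow> x \<in> box a b"
proof -
  have "box_bump a b x \<noteq> 0 \<longleftrightarrow> x \<in> box a b"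
    by (auto simp: box_bump_def mem_box not_le)
  then show ?thesis using box_bump_nonneg[of a b x] by linarith
qed

lemma smooth_box_bump: "smooth_on UNIV (box_bump a b)"
  unfolding smooth_on_def
proof
  fix n
  have *: "C_on n UNIV (\<lambda>x. exp_cutoff (s * (x \<bullet> i) + c))" for s c :: real and i :: 'a
    by (rule C_on_compose[OF _ C_on_linear])
       (use smooth_real_affine[OF smooth_real_exp_cutoff, of 1 s c] in \<open>auto intro: bounded_linear_inner_left\<close>)
  show "C_on n UNIV (box_bump a b)"
    unfolding box_bump_def[abs_def]
    using *[of 1 _ "- (a \<bullet> _)"] *[of "-1" _ "b \<bullet> _"]
    by (intro C_on_prod C_on_mult) (simp_all add: algebra_simps)
qed

text \<open>Multiplying the bump by a large \<open>j\<close> lifts it above 1 at each given point of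
  the open box, where \<open>plateau\<close> turns it into exactly 1; outside the box it stays 0.
  This gives test functions with values in the unit interval that converge pointwise to the
  indicator.\<close>

definition box_test :: "real \<Rightarrow> 'a::euclidean_space \<Rightarrow> 'a \<Rightarrow> 'a \<Rightarrow> real" where
  "box_test j a b x = plateau (j * box_bump a b x)"

lemma box_test_test_function:
  assumes "cbox a b \<subseteq> \<Omega>" shows "box_test j a b \<in> test_functions \<Omega>"
proof -
  have "smooth_on UNIV (box_test j a b)"
    unfolding box_test_def[abs_def]
    using smooth_on_compose[OF smooth_real_affine[OF smooth_real_plateau, of 1 j 0] smooth_box_bump] by simp
  moreover have "{x. box_test j a b x \<noteq> 0} \<subseteq> cbox a b"
  proof
    fix x assume "x \<in> {x. box_test j a b x \<noteq> 0}"
    then have "box_bump a b x \<noteq> 0" by (auto simp: box_test_def plateau_props)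
    then have "x \<in> box a b" using box_bump_pos[of a b x] box_bump_nonneg[of a b x] by simp
    then show "x \<in> cbox a b" using box_subset_cbox by blast
  qed
  then have "closure {x. box_test j a b x \<noteq> 0} \<subseteq> cbox a b" by (rule closure_minimal) (rule closed_cbox)
  moreover from this have "compact (closure {x. box_test j a b x \<noteq> 0})"
    using bounded_subset[OF bounded_cbox] by (auto simp: compact_eq_bounded_closed)
  ultimately show ?thesis using assms by (auto simp: test_functions_def)
qed

lemma box_test_bounds: "j \<ge> 0 \<Longrightarrow> 0 \<le> box_test j a b x" "box_test j a b x \<le> 1"
  by (auto simp: box_test_def plateau_props box_bump_nonneg)

lemma box_test_tendsto: "(\<lambda>j. box_test (real j) a b x) \<longlonglongrightarrow> indicator (box a b) x"
proof (cases "x \<in> box a b")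
  case True
  then have p: "box_bump a b x > 0" by (simp add: box_bump_pos)
  have "\<forall>\<^sub>F j in sequentially. box_test (real j) a b x = 1"
    using eventually_ge_at_top[of "nat \<lceil>1 / box_bump a b x\<rceil>"]
  proof eventually_elim
    case (elim j)
    then have "1 / box_bump a b x \<le> j" by linarith
    then show ?case using p by (simp add: box_test_def plateau_props field_simps)
  qed
  then show ?thesis using True by (simp add: tendsto_eventually)
next
  case False
  then have "box_bump a b x = 0" using box_bump_pos[of a b x] box_bump_nonneg[of a b x] by simp
  then show ?thesis using False by (simp add: box_test_def plateau_props)
qed

section \<open>Square-integrable functions\<close>

text \<open>Fatou's lemma in Bochner form. Besides the inequality it supplies integrability of the
  limit, which is the more frequent reason for using it below.\<close>

lemma fatou_bound:
  fixes f :: "nat \<Rightarrow> 'a \<Rightarrow> real"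
  assumes int: "\<And>n. integrable M (f n)" and nonneg: "\<And>n x. 0 \<le> f n x"
    and g: "g \<in> borel_measurable M" and lim: "AE x in M. (\<lambda>n. f n x) \<longlonglongrightarrow> g x"
    and le: "\<And>n. (\<integral>x. f n x \<partial>M) \<le> B"
  shows "integrable M g" "(\<integral>x. g x \<partial>M) \<le> B"
proof -
  have B: "0 \<le> B" using le[of 0] integral_nonneg_AE[of "f 0" M] nonneg by (meson AE_I2 order_trans)
  have g0: "AE x in M. 0 \<le> g x"
    using lim by eventually_elim (rule LIMSEQ_le_const, use nonneg in auto)
  have "(\<integral>\<^sup>+x. ennreal (g x) \<partial>M) = (\<integral>\<^sup>+x. liminf (\<lambda>n. ennreal (f n x)) \<partial>M)"
  proof (rule nn_integral_cong_AE)
    show "AE x in M. ennreal (g x) = liminf (\<lambda>n. ennreal (f n x))"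
      using lim
    proof eventually_elim
      case (elim x)
      then have "(\<lambda>n. ennreal (f n x)) \<longlonglongrightarrow> ennreal (g x)" by (intro tendsto_ennrealI)
      then show ?case by (simp add: lim_imp_Liminf)
    qed
  qed
  also have "\<dots> \<le> liminf (\<lambda>n. \<integral>\<^sup>+x. ennreal (f n x) \<partial>M)"
    by (rule nn_integral_liminf) (use int in auto)
  also have "(\<lambda>n. \<integral>\<^sup>+x. ennreal (f n x) \<partial>M) = (\<lambda>n. ennreal (\<integral>x. f n x \<partial>M))"
    using int nonneg by (simp add: nn_integral_eq_integral)
  also have "liminf (\<lambda>n. ennreal (\<integral>x. f n x \<partial>M)) \<le> liminf (\<lambda>n::nat. ennreal B)"
    by (intro Liminf_mono always_eventually allI ennreal_leI le)
  also have "\<dots> = ennreal B" by (rule Liminf_const) simp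
  finally have *: "(\<integral>\<^sup>+x. ennreal (g x) \<partial>M) \<le> ennreal B" .
  show i: "integrable M g"
    by (rule integrableI_nonneg[OF g g0]) (use * in \<open>simp add: le_less_trans[OF _ ennreal_less_top]\<close>)
  show "(\<integral>x. g x \<partial>M) \<le> B"
    using * nn_integral_eq_integral[OF i g0] B by simp
qed

text \<open>The Riesz-Fischer argument. Along a subsequence the squared distances fall below
  \<open>(1 / 4) ^ k\<close>. Weighted with \<open>2 ^ k\<close> they remain summable, so almost
  everywhere \<open>(d k x)\<^sup>2 \<le> C * (1 / 2) ^ k\<close> and the telescoping series
  converges absolutely. Fatou's lemma then turns the pointwise limit into a limit in the mean
  square.\<close>

lemma L2_complete:
  fixes u :: "nat \<Rightarrow> 'a \<Rightarrow> 'b::euclidean_space"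
  assumes meas[measurable]: "\<And>n. u n \<in> borel_measurable M"
    and int: "\<And>m n. integrable M (\<lambda>x. (norm (u m x - u n x))\<^sup>2)"
    and int0: "\<And>n. integrable M (\<lambda>x. (norm (u n x))\<^sup>2)"
    and cauchy: "\<And>e. e > 0 \<Longrightarrow> \<exists>N. \<forall>m\<ge>N. \<forall>n\<ge>N. (\<integral>x. (norm (u m x - u n x))\<^sup>2 \<partial>M) < e"
  obtains v where "v \<in> borel_measurable M" "integrable M (\<lambda>x. (norm (v x))\<^sup>2)"
    "\<And>n. integrable M (\<lambda>x. (norm (u n x - v x))\<^sup>2)"
    "(\<lambda>n. \<integral>x. (norm (u n x - v x))\<^sup>2 \<partial>M) \<longlonglongrightarrow> 0"
proof -
  define I where "I m n = (\<integral>x. (norm (u m x - u n x))\<^sup>2 \<partial>M)" for m n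
  have "\<exists>r. strict_mono r \<and> (\<forall>k. \<forall>m\<ge>r k. \<forall>n\<ge>r k. I m n < (1 / 4) ^ k)"
  proof -
    have "\<forall>k. \<exists>N. \<forall>m\<ge>N. \<forall>n\<ge>N. I m n < (1 / 4) ^ k"
      unfolding I_def by (intro allI cauchy) simp
    from choice[OF this] obtain N where N: "\<And>k m n. m \<ge> N k \<Longrightarrow> n \<ge> N k \<Longrightarrow> I m n < (1 / 4) ^ k" by auto
    \<comment> \<open>The sum dominates \<open>N k\<close> and is monotone; the summand
      \<open>k\<close> makes it strictly monotone.\<close>
    define r where "r k = (\<Sum>i\<le>k. N i) + k" for k
    have "strict_mono r" unfolding strict_mono_Suc_iff by (simp add: r_def)
    moreover have "N k \<le> r k" for k
      using member_le_sum[of k "{..k}" N] unfolding r_def by simp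
    ultimately show ?thesis using N by (intro exI[of _ r]) (blast intro: le_trans)
  qed
  then obtain r where r: "strict_mono r" and rI: "\<And>k m n. m \<ge> r k \<Longrightarrow> n \<ge> r k \<Longrightarrow> I m n < (1 / 4) ^ k" by blast
  define d where "d k x = norm (u (r (Suc k)) x - u (r k) x)" for k x
  have dm[measurable]: "d k \<in> borel_measurable M" for k unfolding d_def by measurable
  have "(\<integral>\<^sup>+x. (\<Sum>k. ennreal (2 ^ k * (d k x)\<^sup>2)) \<partial>M) = (\<Sum>k. \<integral>\<^sup>+x. ennreal (2 ^ k * (d k x)\<^sup>2) \<partial>M)"
    by (rule nn_integral_suminf) measurable
  also have "\<dots> \<le> (\<Sum>k. ennreal ((1 / 2) ^ k))"
  proof (intro suminf_le allI)
    fix k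
    have "(\<integral>\<^sup>+x. ennreal (2 ^ k * (d k x)\<^sup>2) \<partial>M) = ennreal (2 ^ k * I (r (Suc k)) (r k))"
      unfolding d_def I_def using int by (subst nn_integral_eq_integral) auto
    also have "\<dots> \<le> ennreal (2 ^ k * (1 / 4) ^ k)"
      using rI[of k "r (Suc k)" "r k"] strict_mono_less_eq[OF r]
      by (intro ennreal_leI mult_left_mono) (auto intro: less_imp_le)
    also have "(2::real) ^ k * (1 / 4) ^ k = (1 / 2) ^ k" by (simp flip: power_mult_distrib)
    finally show "(\<integral>\<^sup>+x. ennreal (2 ^ k * (d k x)\<^sup>2) \<partial>M) \<le> ennreal ((1 / 2) ^ k)" .
  qed auto
  also have "\<dots> = ennreal (\<Sum>k. (1 / 2) ^ k)"
    by (rule suminf_ennreal2) (auto intro: summable_geometric)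
  finally have "(\<integral>\<^sup>+x. (\<Sum>k. ennreal (2 ^ k * (d k x)\<^sup>2)) \<partial>M) \<noteq> \<infinity>"
    by (metis ennreal_less_top infinity_ennreal_def leD)
  then have fin: "AE x in M. (\<Sum>k. ennreal (2 ^ k * (d k x)\<^sup>2)) \<noteq> \<infinity>"
    by (intro nn_integral_PInf_AE) measurable
  have conv: "AE x in M. convergent (\<lambda>k. u (r k) x)"
    using fin
  proof eventually_elim
    case (elim x)
    define S where "S = (\<Sum>k. ennreal (2 ^ k * (d k x)\<^sup>2))"
    have "S \<noteq> top" using elim[folded S_def] by simp
    then obtain C where C0: "C \<ge> 0" "S = ennreal C" by (cases S) auto
    have C: "(d k x)\<^sup>2 \<le> C * (1 / 2) ^ k" for k
    proof -
      have "(\<Sum>k\<in>{k}. ennreal (2 ^ k * (d k x)\<^sup>2)) \<le> S"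
        unfolding S_def by (rule sum_le_suminf) auto
      then have "2 ^ k * (d k x)\<^sup>2 \<le> C" unfolding C0 using C0(1) by (simp del: ennreal_mult)
      then show ?thesis by (simp add: power_one_over field_simps)
    qed
    define s where "s = sqrt (1 / 2)"
    have s: "0 \<le> s" "s < 1" unfolding s_def by (auto simp: real_sqrt_divide)
    have "norm (d k x) \<le> sqrt C * s ^ k" for k
    proof -
      have "sqrt ((d k x)\<^sup>2) \<le> sqrt (C * (1 / 2) ^ k)" by (rule real_sqrt_le_mono[OF C])
      then show ?thesis unfolding s_def real_sqrt_abs by (simp only: real_sqrt_mult real_sqrt_power real_norm_def)
    qed
    moreover have "summable (\<lambda>k. sqrt C * s ^ k)"
      using s by (intro summable_mult summable_geometric) simp
    ultimately have "summable (\<lambda>k. d k x)" by (rule summable_comparison_test'[rotated])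
    then have "summable (\<lambda>k. u (r (Suc k)) x - u (r k) x)" unfolding d_def by (rule summable_norm_cancel)
    then have "convergent (\<lambda>n. \<Sum>k<n. u (r (Suc k)) x - u (r k) x)" by (simp only: summable_iff_convergent)
    then obtain L where "(\<lambda>n. u (r n) x - u (r 0) x) \<longlonglongrightarrow> L"
      unfolding convergent_def sum_lessThan_telescope[of "\<lambda>n. u (r n) x"] by blast
    from tendsto_add[OF this tendsto_const[of "u (r 0) x"]]
    have "convergent (\<lambda>k. u (r k) x)" by (auto simp: convergent_def)
    then show ?case by simp
  qed
  define v where "v x = lim (\<lambda>k. u (r k) x)" for x
  have vm[measurable]: "v \<in> borel_measurable M" unfolding v_def by measurable
  have lim: "AE x in M. (\<lambda>k. u (r k) x) \<longlonglongrightarrow> v x"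
    using conv by eventually_elim (simp add: v_def convergent_LIMSEQ_iff)
  \<comment> \<open>The subsequence is shifted by \<open>N\<close>, so that every term satisfies the
    bound that Fatou's lemma wants, not only almost all of them.\<close>
  have key: "integrable M (\<lambda>x. (norm (u n x - v x))\<^sup>2) \<and> (\<integral>x. (norm (u n x - v x))\<^sup>2 \<partial>M) \<le> e"
    if N: "\<And>m. m \<ge> N \<Longrightarrow> I n m \<le> e" for n N e
  proof -
    have rN: "r (k + N) \<ge> N" for k using seq_suble[OF r, of "k + N"] by simp
    have l: "AE x in M. (\<lambda>k. (norm (u n x - u (r (k + N)) x))\<^sup>2) \<longlonglongrightarrow> (norm (u n x - v x))\<^sup>2"
      using lim
    proof eventually_elim
      case (elim x)
      from LIMSEQ_ignore_initial_segment[OF this, of N] show ?case by (intro tendsto_intros)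
    qed
    show ?thesis
      using fatou_bound[of M "\<lambda>k x. (norm (u n x - u (r (k + N)) x))\<^sup>2" "\<lambda>x. (norm (u n x - v x))\<^sup>2" e]
        int l N[OF rN] unfolding I_def by simp
  qed
  have small: "\<exists>N. \<forall>n\<ge>N. integrable M (\<lambda>x. (norm (u n x - v x))\<^sup>2) \<and> (\<integral>x. (norm (u n x - v x))\<^sup>2 \<partial>M) \<le> e"
    if "e > 0" for e
    using cauchy[OF that] key unfolding I_def by (meson less_imp_le)
  have ndiff: "integrable M (\<lambda>x. (norm (f x - g x))\<^sup>2)"
    if "integrable M (\<lambda>x. (norm (f x))\<^sup>2)" "integrable M (\<lambda>x. (norm (g x))\<^sup>2)"
      "f \<in> borel_measurable M" "g \<in> borel_measurable M" for f g :: "'a \<Rightarrow> 'b"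
  proof (rule Bochner_Integration.integrable_bound)
    show "integrable M (\<lambda>x. 2 * (norm (f x))\<^sup>2 + 2 * (norm (g x))\<^sup>2)" using that by auto
    show "(\<lambda>x. (norm (f x - g x))\<^sup>2) \<in> borel_measurable M" using that by measurable
    show "AE x in M. norm ((norm (f x - g x))\<^sup>2) \<le> norm (2 * (norm (f x))\<^sup>2 + 2 * (norm (g x))\<^sup>2)"
    proof (rule AE_I2)
      fix x
      have "(norm (f x - g x))\<^sup>2 \<le> (norm (f x) + norm (g x))\<^sup>2"
        by (intro power_mono norm_triangle_ineq4) auto
      also have "\<dots> \<le> 2 * (norm (f x))\<^sup>2 + 2 * (norm (g x))\<^sup>2"
        using sum_squares_bound[of "norm (f x)" "norm (g x)"] by (simp add: power2_sum)
      finally show "norm ((norm (f x - g x))\<^sup>2) \<le> norm (2 * (norm (f x))\<^sup>2 + 2 * (norm (g x))\<^sup>2)" by simp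
    qed
  qed
  obtain n0 where n0: "integrable M (\<lambda>x. (norm (u n0 x - v x))\<^sup>2)" using small[of 1] by auto
  have iv: "integrable M (\<lambda>x. (norm (v x))\<^sup>2)"
    using ndiff[OF int0[of n0] n0] by simp
  show ?thesis
  proof (rule that[OF vm iv])
    show "integrable M (\<lambda>x. (norm (u n x - v x))\<^sup>2)" for n using ndiff[OF int0 iv] by simp
    show "(\<lambda>n. \<integral>x. (norm (u n x - v x))\<^sup>2 \<partial>M) \<longlonglongrightarrow> 0"
    proof (rule LIMSEQ_I)
      fix e :: real assume "e > 0"
      then obtain N where "\<forall>n\<ge>N. (\<integral>x. (norm (u n x - v x))\<^sup>2 \<partial>M) \<le> e / 2" using small[of "e / 2"] by auto
      then have "norm ((\<integral>x. (norm (u n x - v x))\<^sup>2 \<partial>M) - 0) < e" if "n \<ge> N" for n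
        using that \<open>e > 0\<close> by fastforce
      then show "\<exists>N. \<forall>n\<ge>N. norm ((\<integral>x. (norm (u n x - v x))\<^sup>2 \<partial>M) - 0) < e" by blast
    qed
  qed
qed

lemma L2_iff: "u \<in> L2 \<Omega> \<longleftrightarrow> u \<in> borel_measurable (lebesgue_on \<Omega>) \<and> integrable (lebesgue_on \<Omega>) (\<lambda>x. u x \<bullet> u x)"
  by (simp add: L2_def dot_square_norm)

lemma L2_inner_integrable:
  assumes "u \<in> L2 \<Omega>" "v \<in> L2 \<Omega>" shows "integrable (lebesgue_on \<Omega>) (\<lambda>x. u x \<bullet> v x)"
proof (rule Bochner_Integration.integrable_bound)
  show "integrable (lebesgue_on \<Omega>) (\<lambda>x. (norm (u x))\<^sup>2 + (norm (v x))\<^sup>2)"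
    using assms by (auto simp: L2_def)
  show "(\<lambda>x. u x \<bullet> v x) \<in> borel_measurable (lebesgue_on \<Omega>)" using assms by (auto simp: L2_def)
  show "AE x in lebesgue_on \<Omega>. norm (u x \<bullet> v x) \<le> norm ((norm (u x))\<^sup>2 + (norm (v x))\<^sup>2)"
  proof (rule AE_I2)
    fix x
    have "\<bar>u x \<bullet> v x\<bar> \<le> norm (u x) * norm (v x)" by (rule Cauchy_Schwarz_ineq2)
    also have "\<dots> \<le> (norm (u x))\<^sup>2 + (norm (v x))\<^sup>2"
      using sum_squares_bound[of "norm (u x)" "norm (v x)"] mult_nonneg_nonneg[OF norm_ge_zero[of "u x"] norm_ge_zero[of "v x"]] by linarith
    finally show "norm (u x \<bullet> v x) \<le> norm ((norm (u x))\<^sup>2 + (norm (v x))\<^sup>2)" by simp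
  qed
qed

lemma L2_scaleR: "u \<in> L2 \<Omega> \<Longrightarrow> c *\<^sub>R u \<in> L2 \<Omega>"
  by (auto simp: L2_iff scaleR_fun_def)

lemma L2_add: assumes "u \<in> L2 \<Omega>" "v \<in> L2 \<Omega>" shows "u + v \<in> L2 \<Omega>"
proof -
  have "integrable (lebesgue_on \<Omega>) (\<lambda>x. (u x \<bullet> u x + u x \<bullet> v x) + (v x \<bullet> u x + v x \<bullet> v x))"
    using assms by (intro Bochner_Integration.integrable_add L2_inner_integrable)
  then show ?thesis using assms by (auto simp: L2_iff plus_fun_def inner_add_left inner_add_right algebra_simps)
qed

lemma subspace_L2: "subspace (L2 \<Omega>)"
  by (rule subspaceI) (auto simp: L2_add L2_scaleR, simp add: L2_def zero_fun_def)

definition ipL :: "'a::euclidean_space set \<Rightarrow> ('a \<Rightarrow> 'b::euclidean_space) \<Rightarrow> ('a \<Rightarrow> 'b) \<Rightarrow> real" where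
  "ipL \<Omega> = (\<lambda>u v. \<integral>x. u x \<bullet> v x \<partial>lebesgue_on \<Omega>)"

interpretation L2: semi_hilbert "L2 \<Omega> :: ('a::euclidean_space \<Rightarrow> 'b::euclidean_space) set" "ipL \<Omega>" for \<Omega>
  unfolding ipL_def
proof
  show "subspace (L2 \<Omega> :: ('a \<Rightarrow> 'b) set)" by (rule subspace_L2)
next
  fix x y z :: "'a \<Rightarrow> 'b" assume "x \<in> L2 \<Omega>" "y \<in> L2 \<Omega>" "z \<in> L2 \<Omega>"
  then show "(\<integral>t. (x + y) t \<bullet> z t \<partial>lebesgue_on \<Omega>) = (\<integral>t. x t \<bullet> z t \<partial>lebesgue_on \<Omega>) + (\<integral>t. y t \<bullet> z t \<partial>lebesgue_on \<Omega>)"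
    by (simp add: inner_add_left L2_inner_integrable)
next
  fix x :: "nat \<Rightarrow> 'a \<Rightarrow> 'b"
  assume x: "\<And>n. x n \<in> L2 \<Omega>"
    and c: "\<And>e. 0 < e \<Longrightarrow> \<exists>N. \<forall>m\<ge>N. \<forall>n\<ge>N. (\<integral>t. (x m - x n) t \<bullet> (x m - x n) t \<partial>lebesgue_on \<Omega>) < e"
  have xd: "x m - x n \<in> L2 \<Omega>" for m n using subspace_diff[OF subspace_L2 x x] .
  obtain v where "v \<in> borel_measurable (lebesgue_on \<Omega>)" "integrable (lebesgue_on \<Omega>) (\<lambda>t. (norm (v t))\<^sup>2)"
    "(\<lambda>n. \<integral>t. (norm (x n t - v t))\<^sup>2 \<partial>lebesgue_on \<Omega>) \<longlonglongrightarrow> 0"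
    by (rule L2_complete[of x "lebesgue_on \<Omega>"]) (use x xd c in \<open>auto simp: L2_def dot_square_norm\<close>)
  then show "\<exists>l\<in>L2 \<Omega>. (\<lambda>n. \<integral>t. (x n - l) t \<bullet> (x n - l) t \<partial>lebesgue_on \<Omega>) \<longlonglongrightarrow> 0"
    by (intro bexI[of _ v]) (auto simp: L2_def dot_square_norm)
qed (auto simp: inner_commute)

subsection \<open>The fundamental lemma of the calculus of variations\<close>

text \<open>The positive and negative parts of \<open>W\<close> are densities of two measures that
  agree on open boxes, an intersection-stable generator of the Borel sets. The measures are equal,
  hence so are the densities almost everywhere, and both parts can agree only where they
  vanish.\<close>

lemma AE_zero_if_box_integrals_zero:
  fixes W :: "'a::euclidean_space \<Rightarrow> real"
  assumes W: "integrable lborel W" and z: "\<And>a b. (\<integral>x. W x * indicator (box a b) x \<partial>lborel) = 0"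
  shows "AE x in lborel. W x = 0"
proof -
  define P N where "P = density lborel (\<lambda>x. ennreal (max 0 (W x)))" and "N = density lborel (\<lambda>x. ennreal (max 0 (- W x)))"
  have Wm[measurable]: "W \<in> borel_measurable lborel" using W by auto
  have fin: "emeasure P (box a b) = ennreal (\<integral>x. max 0 (W x) * indicator (box a b) x \<partial>lborel)"
    "emeasure N (box a b) = ennreal (\<integral>x. max 0 (- W x) * indicator (box a b) x \<partial>lborel)"
    and ip: "integrable lborel (\<lambda>x. max 0 (W x) * indicator (box a b) x)"
     "integrable lborel (\<lambda>x. max 0 (- W x) * indicator (box a b) x)" for a b
  proof -
    have i: "integrable lborel (\<lambda>x. max 0 (s * W x) * indicator (box a b) x)" if "\<bar>s\<bar> = 1" for s :: real
    proof (rule Bochner_Integration.integrable_bound[OF W])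
      have "\<bar>max 0 (s * y)\<bar> \<le> \<bar>y\<bar>" for y
      proof -
        have "\<bar>s * y\<bar> = \<bar>y\<bar>" using that by (simp add: abs_mult)
        then show ?thesis by linarith
      qed
      then show "AE x in lborel. norm (max 0 (s * W x) * indicator (box a b) x) \<le> norm (W x)"
        by (intro AE_I2) (simp add: indicator_def)
    qed measurable
    show "integrable lborel (\<lambda>x. max 0 (W x) * indicator (box a b) x)"
     "integrable lborel (\<lambda>x. max 0 (- W x) * indicator (box a b) x)" using i[of 1] i[of "-1"] by simp_all
    then show "emeasure P (box a b) = ennreal (\<integral>x. max 0 (W x) * indicator (box a b) x \<partial>lborel)"
      "emeasure N (box a b) = ennreal (\<integral>x. max 0 (- W x) * indicator (box a b) x \<partial>lborel)"
      unfolding P_def N_def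
      by (simp_all add: emeasure_density nn_integral_eq_integral[symmetric] ennreal_mult' ennreal_indicator)
  qed
  have "P = N"
  proof (rule measure_eqI_generator_eq[of "range (\<lambda>(a,b). box a b)" UNIV])
    show "Int_stable (range (\<lambda>(a::'a,b). box a b))"
      by (auto simp: Int_stable_def box_Int_box)
    fix X assume "X \<in> range (\<lambda>(a::'a,b). box a b)"
    then obtain a b where X: "X = box a b" by auto
    have "(\<integral>x. max 0 (W x) * indicator (box a b) x \<partial>lborel) - (\<integral>x. max 0 (- W x) * indicator (box a b) x \<partial>lborel)
      = (\<integral>x. max 0 (W x) * indicator (box a b) x - max 0 (- W x) * indicator (box a b) x \<partial>lborel)"
      using ip by (simp add: Bochner_Integration.integral_diff)
    also have "(\<lambda>x. max 0 (W x) * indicator (box a b) x - max 0 (- W x) * indicator (box a b) x) = (\<lambda>x. W x * indicator (box a b) x)"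
      by (auto simp: fun_eq_iff max_def split: split_indicator)
    finally show "emeasure P X = emeasure N X" unfolding X fin z by simp
  next
    show "sets P = sigma_sets UNIV (range (\<lambda>(a,b). box a b))" "sets N = sigma_sets UNIV (range (\<lambda>(a,b). box a b))"
      unfolding P_def N_def by (simp_all add: borel_eq_box sets_measure_of_conv)
    show "range (\<lambda>n::nat. box (- (real n *\<^sub>R One)) (real n *\<^sub>R One)) \<subseteq> range (\<lambda>(a::'a,b). box a b)" by auto
    show "(\<Union>n::nat. box (- (real n *\<^sub>R One)) (real n *\<^sub>R One)) = (UNIV::'a set)" by (rule UN_box_eq_UNIV)
    show "emeasure P (box (- (real i *\<^sub>R One)) (real i *\<^sub>R One)) \<noteq> \<infinity>" for i using fin by simp
  qed auto
  then have "AE x in lborel. ennreal (max 0 (W x)) = ennreal (max 0 (- W x))"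
    unfolding P_def N_def by (subst (asm) sigma_finite_measure.density_unique_iff[OF sigma_finite_lborel]) auto
  then show ?thesis by eventually_elim (auto simp: max_def split: if_splits)
qed

text \<open>Dominated convergence along \<open>box_test\<close> gives vanishing integrals over every
  box whose closure lies in \<Omega>. Cut off to one such box, the function has zero integral over
  all boxes, so it vanishes there; countably many closed boxes exhaust \<Omega>. A Borel
  representative \<open>V\<close> is inserted because \<open>v\<close> is only Lebesgue measurable
  while boxes generate the Borel sets.\<close>

lemma fundamental_lemma:
  fixes v :: "'a::euclidean_space \<Rightarrow> real"
  assumes \<Omega>: "open \<Omega>" and v: "integrable (lebesgue_on \<Omega>) v"
    and z: "\<And>\<phi>. \<phi> \<in> test_functions \<Omega> \<Longrightarrow> (\<integral>x. v x * \<phi> x \<partial>lebesgue_on \<Omega>) = 0"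
  shows "AE x in lebesgue_on \<Omega>. v x = 0"
proof -
  have \<Omega>s: "\<Omega> \<inter> space lebesgue \<in> sets lebesgue" "\<Omega> \<in> sets lebesgue" using \<Omega> by auto
  have V: "integrable lebesgue (\<lambda>x. indicator \<Omega> x * v x)"
    using v integrable_restrict_space[OF \<Omega>s(1), of v] by simp
  obtain V where Vm: "V \<in> borel_measurable lborel" "AE x in lborel. indicator \<Omega> x * v x = V x"
    using completion_ex_borel_measurable_real[OF borel_measurable_integrable[OF V]] by blast
  have [measurable]: "V \<in> borel_measurable lborel" by fact
  have eqL: "AE x in lebesgue. indicator \<Omega> x * v x = V x" using Vm(2) by (rule AE_completion)
  have Vi: "integrable lborel V"
  proof -
    have "integrable lebesgue V \<longleftrightarrow> integrable lebesgue (\<lambda>x. indicator \<Omega> x * v x)"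
      by (rule integrable_cong_AE) (use V Vm(1) eqL in \<open>auto intro: measurable_completion\<close>)
    then have "integrable lebesgue V" using V by simp
    then show ?thesis by (simp add: integrable_completion)
  qed
  have boxz: "(\<integral>x. V x * indicator (box a b) x \<partial>lborel) = 0" if ab: "cbox a b \<subseteq> \<Omega>" for a b
  proof -
    have lim: "(\<lambda>j. \<integral>x. v x * box_test (real j) a b x \<partial>lebesgue_on \<Omega>) \<longlonglongrightarrow> (\<integral>x. v x * indicator (box a b) x \<partial>lebesgue_on \<Omega>)"
    proof (rule integral_dominated_convergence[where w = "\<lambda>x. \<bar>v x\<bar>"])
      show "(\<lambda>x. v x * indicator (box a b) x) \<in> borel_measurable (lebesgue_on \<Omega>)"
        by (rule borel_measurable_times[OF borel_measurable_integrable[OF v]])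
           (use \<Omega>s(1) ab box_subset_cbox[of a b] in \<open>auto intro!: borel_measurable_indicator simp: sets_restrict_space_iff\<close>)
      show "(\<lambda>x. v x * box_test (real j) a b x) \<in> borel_measurable (lebesgue_on \<Omega>)" for j
      proof -
        have "continuous_on UNIV (box_test (real j) a b)"
          using box_test_test_function[OF ab, of j] by (auto simp: test_functions_def smooth_on_def dest!: spec[of _ "0::nat"])
        then have "box_test (real j) a b \<in> borel_measurable (lebesgue_on \<Omega>)"
          by (rule continuous_imp_measurable_on_sets_lebesgue[OF continuous_on_subset[OF _ subset_UNIV] \<Omega>s(2)])
        then show ?thesis by (rule borel_measurable_times[OF borel_measurable_integrable[OF v]])
      qed
      show "integrable (lebesgue_on \<Omega>) (\<lambda>x. \<bar>v x\<bar>)" using v by simp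
      show "AE x in lebesgue_on \<Omega>. (\<lambda>j. v x * box_test (real j) a b x) \<longlonglongrightarrow> v x * indicator (box a b) x"
        by (intro AE_I2 tendsto_intros box_test_tendsto)
      show "AE x in lebesgue_on \<Omega>. norm (v x * box_test (real j) a b x) \<le> \<bar>v x\<bar>" for j
        using box_test_bounds[of j a b] by (intro AE_I2) (auto simp: abs_mult intro!: mult_left_le)
    qed
    have "(\<integral>x. v x * indicator (box a b) x \<partial>lebesgue_on \<Omega>) = 0"
      using LIMSEQ_unique[OF lim] z[OF box_test_test_function[OF ab]] by simp
    then have "0 = (\<integral>x. indicator \<Omega> x * (v x * indicator (box a b) x) \<partial>lebesgue)"
      using integral_restrict_space[OF \<Omega>s(1), of "\<lambda>x. v x * indicator (box a b) x"] by simp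
    also have "\<dots> = (\<integral>x. V x * indicator (box a b) x \<partial>lebesgue)"
    proof (rule integral_cong_AE)
      have "(\<lambda>x. indicator \<Omega> x * v x * indicator (box a b) x) \<in> borel_measurable lebesgue"
        by (rule borel_measurable_times[OF borel_measurable_integrable[OF V] borel_measurable_indicator]) simp
      then show "(\<lambda>x. indicator \<Omega> x * (v x * indicator (box a b) x)) \<in> borel_measurable lebesgue"
        by (simp add: mult.assoc)
      show "(\<lambda>x. V x * indicator (box a b) x) \<in> borel_measurable lebesgue" by (rule measurable_completion) measurable
      show "AE x in lebesgue. indicator \<Omega> x * (v x * indicator (box a b) x) = V x * indicator (box a b) x"
        using eqL by eventually_elim (simp flip: mult.assoc)
    qed
    also have "\<dots> = (\<integral>x. V x * indicator (box a b) x \<partial>lborel)" by (rule integral_completion) measurable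
    finally show ?thesis by simp
  qed
  have local: "AE x in lborel. x \<in> cbox p q \<longrightarrow> V x = 0" if pq: "cbox p q \<subseteq> \<Omega>" for p q
  proof -
    have "AE x in lborel. V x * indicator (box p q) x = 0"
    proof (rule AE_zero_if_box_integrals_zero)
      show "integrable lborel (\<lambda>x. V x * indicator (box p q) x)"
        using integrable_mult_indicator[of "box p q" lborel V] Vi by (simp add: mult.commute)
      fix a b :: 'a
      obtain c d where cd: "box p q \<inter> box a b = box c d" using box_Int_box[of p q a b] by blast
      show "(\<integral>x. V x * indicator (box p q) x * indicator (box a b) x \<partial>lborel) = 0"
      proof (cases "box c d = {}")
        case True
        have "(\<lambda>x. V x * indicator (box p q) x * indicator (box a b) x) = (\<lambda>x. 0)"
          using True cd by (auto simp: fun_eq_iff split: split_indicator)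
        then show ?thesis by (simp only: integral_zero)
      next
        case False
        have "closure (box c d) \<subseteq> cbox p q"
          by (rule closure_minimal[OF _ closed_cbox]) (use cd box_subset_cbox[of p q] in blast)
        then have "cbox c d \<subseteq> \<Omega>" using pq closure_box[OF False] by blast
        from boxz[OF this] show ?thesis
          by (simp add: cd[symmetric] indicator_inter_arith mult.assoc)
      qed
    qed
    moreover have "AE x in lborel. x \<notin> cbox p q - box p q"
      using negligible_frontier_interval[of p q] by (intro AE_not_in) (auto simp: negligible_iff_null_sets null_sets_def)
    ultimately show ?thesis by eventually_elim auto
  qed
  obtain D where D: "countable D" "\<And>X. X \<in> D \<Longrightarrow> X \<subseteq> \<Omega>" "\<And>X. X \<in> D \<Longrightarrow> \<exists>a b. X = cbox a b" "\<Union>D = \<Omega>"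
    using open_countable_Union_open_cbox[OF \<Omega>] by (metis PowD subsetD)
  have "AE x in lborel. \<forall>X\<in>D. x \<in> X \<longrightarrow> V x = 0"
  proof (subst AE_ball_countable[OF D(1)], intro ballI)
    fix X assume X: "X \<in> D"
    obtain a b where ab: "X = cbox a b" using D(3)[OF X] by blast
    show "AE x in lborel. x \<in> X \<longrightarrow> V x = 0" using local[of a b] D(2)[OF X] unfolding ab by blast
  qed
  then have "AE x in lebesgue. \<forall>X\<in>D. x \<in> X \<longrightarrow> V x = 0" by (rule AE_completion)
  with eqL have "AE x in lebesgue. x \<in> \<Omega> \<longrightarrow> v x = 0"
    by eventually_elim (use D(4) in \<open>auto simp: indicator_def\<close>)
  then show ?thesis by (subst AE_restrict_space_iff[OF \<Omega>s(1)])
qed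

section \<open>Estimates for test functions\<close>

definition grad :: "('a::euclidean_space \<Rightarrow> real) \<Rightarrow> 'a \<Rightarrow> 'a" where
  "grad w x = (\<Sum>i\<in>Basis. frechet_derivative w (at x) i *\<^sub>R i)"

text \<open>The estimates are proved for this class on the whole space with Borel-Lebesgue measure,
  where translations are available. Test functions belong to it, and density carries the results
  over to \<open>H10\<close>.\<close>

definition C1c :: "('a::euclidean_space \<Rightarrow> real) \<Rightarrow> bool" where
  "C1c w \<longleftrightarrow> w differentiable_on UNIV \<and> continuous_on UNIV (grad w) \<and> (\<exists>R. \<forall>x. w x \<noteq> 0 \<longrightarrow> norm x \<le> R)"

lemma has_derivative_grad:
  assumes "w differentiable at x"
  shows "(w has_derivative (\<lambda>z. grad w x \<bullet> z)) (at x)"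
proof -
  have d: "(w has_derivative frechet_derivative w (at x)) (at x)"
    using assms by (simp add: frechet_derivative_works)
  have "frechet_derivative w (at x) z = grad w x \<bullet> z" for z
  proof -
    interpret linear "frechet_derivative w (at x)" using has_derivative_linear[OF d] .
    have "frechet_derivative w (at x) z = frechet_derivative w (at x) (\<Sum>i\<in>Basis. (z \<bullet> i) *\<^sub>R i)"
      by (simp add: euclidean_representation)
    also have "\<dots> = (\<Sum>i\<in>Basis. (z \<bullet> i) * frechet_derivative w (at x) i)" by (simp add: sum scaleR)
    also have "\<dots> = grad w x \<bullet> z"
      unfolding grad_def inner_sum_left by (intro sum.cong refl) (simp add: inner_commute)
    finally show ?thesis .
  qed
  then have "frechet_derivative w (at x) = (\<lambda>z. grad w x \<bullet> z)" by auto
  with d show ?thesis by simp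
qed

lemma grad_eqI: "(w has_derivative (\<lambda>z. g \<bullet> z)) (at x) \<Longrightarrow> grad w x = g"
  unfolding grad_def by (subst frechet_derivative_at[symmetric], assumption) (simp add: euclidean_representation)

lemma C1cD:
  assumes "C1c w"
  shows "(w has_derivative (\<lambda>z. grad w x \<bullet> z)) (at x)" "continuous_on UNIV w" "continuous_on UNIV (grad w)"
proof -
  have d: "w differentiable at x" for x using assms by (auto simp: C1c_def differentiable_on_def)
  show "(w has_derivative (\<lambda>z. grad w x \<bullet> z)) (at x)" by (rule has_derivative_grad[OF d])
  show "continuous_on UNIV w" using assms by (auto simp: C1c_def differentiable_imp_continuous_on)
  show "continuous_on UNIV (grad w)" using assms by (auto simp: C1c_def)
qed

lemma C1c_support:
  assumes "C1c w"
  obtains R where "R > 0" "\<And>x. w x \<noteq> 0 \<Longrightarrow> norm x \<le> R" "\<And>x. grad w x \<noteq> 0 \<Longrightarrow> norm x \<le> R"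
proof -
  obtain R0 where R0: "\<And>x. w x \<noteq> 0 \<Longrightarrow> norm x \<le> R0" using assms by (auto simp: C1c_def)
  define R where "R = \<bar>R0\<bar> + 1"
  have "grad w x = 0" if "norm x > R" for x
  proof (rule grad_eqI)
    have "open {x::'a. norm x > R}" by (intro open_Collect_less continuous_intros)
    moreover have "((\<lambda>x. 0) has_derivative (\<lambda>z. 0 \<bullet> z)) (at x)" by simp
    moreover have "0 = w y" if "y \<in> {x. norm x > R}" for y using that R0[of y] unfolding R_def by force
    ultimately show "(w has_derivative (\<lambda>z. 0 \<bullet> z)) (at x)"
      using \<open>norm x > R\<close> has_derivative_transform_within_open[of "\<lambda>x. 0" "\<lambda>z. 0 \<bullet> z" x UNIV "{x. norm x > R}" w]
      by blast
  qed
  then show ?thesis using that[of R] R0 unfolding R_def by (force simp: not_le)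
qed

lemma integrable_continuous_bounded_support:
  fixes f :: "'a::euclidean_space \<Rightarrow> 'b::euclidean_space"
  assumes "continuous_on UNIV f" "\<And>x. f x \<noteq> 0 \<Longrightarrow> norm x \<le> R"
  shows "integrable lborel f"
proof -
  have "integrable lborel (\<lambda>x. indicator (cball 0 R) x *\<^sub>R f x)"
    by (rule borel_integrable_compact) (use assms in \<open>auto intro: continuous_on_subset\<close>)
  also have "(\<lambda>x. indicator (cball 0 R) x *\<^sub>R f x) = f"
    using assms(2) by (force simp: indicator_def dist_norm)
  finally show ?thesis .
qed

section \<open>Translations and difference quotients\<close>

lemma lborel_integral_translate:
  fixes f :: "'a::euclidean_space \<Rightarrow> real"
  assumes "f \<in> borel_measurable borel"
  shows "(\<integral>x. f (x + z) \<partial>lborel) = (\<integral>x. f x \<partial>lborel)"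
proof -
  have "(\<integral>x. f x \<partial>lborel) = (\<integral>x. f x \<partial>distr lborel borel ((+) z))" by (simp add: lborel_distr_plus)
  also have "\<dots> = (\<integral>x. f (z + x) \<partial>lborel)" by (rule integral_distr) (use assms in auto)
  finally show ?thesis by (simp add: add.commute)
qed

lemma lborel_nn_integral_translate:
  fixes f :: "'a::euclidean_space \<Rightarrow> ennreal"
  assumes "f \<in> borel_measurable borel"
  shows "(\<integral>\<^sup>+x. f (z + x) \<partial>lborel) = (\<integral>\<^sup>+x. f x \<partial>lborel)"
proof -
  have "(\<integral>\<^sup>+x. f x \<partial>lborel) = (\<integral>\<^sup>+x. f x \<partial>distr lborel borel ((+) z))" by (simp add: lborel_distr_plus)
  also have "\<dots> = (\<integral>\<^sup>+x. f (z + x) \<partial>lborel)" by (rule nn_integral_distr) (use assms in auto)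
  finally show ?thesis by simp
qed

lemma C1c_lipschitz:
  assumes w: "C1c w" obtains M where "M \<ge> 0" "\<And>x. norm (grad w x) \<le> M" "\<And>x h. \<bar>w (x + h) - w x\<bar> \<le> M * norm h"
proof -
  obtain R where R: "\<And>x. grad w x \<noteq> 0 \<Longrightarrow> norm x \<le> R" using C1c_support[OF w] by metis
  have "bounded (grad w ` cball 0 R)"
    by (intro compact_imp_bounded compact_continuous_image continuous_on_subset[OF C1cD(3)[OF w]]) auto
  then obtain M where M: "M > 0" "\<And>x. x \<in> cball 0 R \<Longrightarrow> norm (grad w x) \<le> M" by (auto simp: bounded_pos)
  have M': "norm (grad w x) \<le> M" for x
    using M R[of x] by (cases "grad w x = 0") (auto simp: dist_norm)
  have "norm (w (x + h) - w x) \<le> M * norm (x + h - x)" for x h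
  proof (rule differentiable_bound[of UNIV w "\<lambda>x z. grad w x \<bullet> z"])
    show "(w has_derivative (\<lambda>z. grad w y \<bullet> z)) (at y within UNIV)" for y using C1cD(1)[OF w] by simp
    show "onorm (\<lambda>z. grad w y \<bullet> z) \<le> M" for y
    proof (rule onorm_bound)
      show "0 \<le> M" using M by simp
      show "norm (grad w y \<bullet> z) \<le> M * norm z" for z
        using Cauchy_Schwarz_ineq2[of "grad w y" z] mult_right_mono[OF M'[of y], of "norm z"] by simp
    qed
  qed auto
  then show ?thesis using that[of M] M M' by simp
qed

lemma difference_quotient_tendsto:
  assumes w: "C1c w"
  shows "(\<lambda>n. real (Suc n) * (w (x + (1 / real (Suc n)) *\<^sub>R z) - w x)) \<longlonglongrightarrow> grad w x \<bullet> z"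
proof -
  have "((\<lambda>t. x + t *\<^sub>R z) has_derivative (\<lambda>t. t *\<^sub>R z)) (at 0)"
    by (auto intro!: derivative_eq_intros)
  from has_derivative_compose[OF this, of w "\<lambda>y. grad w x \<bullet> y"] C1cD(1)[OF w, of x]
  have "((\<lambda>t. w (x + t *\<^sub>R z)) has_real_derivative (grad w x \<bullet> z)) (at 0)"
    unfolding has_field_derivative_def by (simp add: mult.commute[of _ "grad w x \<bullet> z"] mult_commute_abs)
  then have l: "((\<lambda>t. (w (x + t *\<^sub>R z) - w x) / t) \<longlongrightarrow> grad w x \<bullet> z) (at 0)"
    by (simp add: has_field_derivative_iff)
  have f: "filterlim (\<lambda>n. 1 / real (Suc n)) (at 0) sequentially"
    unfolding filterlim_at using LIMSEQ_inverse_real_of_nat by (auto simp: field_simps)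
  from filterlim_compose[OF l f] show ?thesis by (simp add: mult.commute)
qed

text \<open>Used with the identity for \<open>G\<close> in \<open>integral_grad_zero\<close> and
  with the square in \<open>translation_estimate\<close>. The condition \<open>G 0 = 0\<close>
  confines the integrands to a fixed ball, and the Lipschitz bound for \<open>w\<close> makes them
  uniformly bounded there.\<close>

lemma difference_quotient_integral:
  fixes G :: "real \<Rightarrow> real" and w :: "'a::euclidean_space \<Rightarrow> real"
  assumes w: "C1c w" and G: "continuous_on UNIV G" "G 0 = 0"
  shows "(\<lambda>n. \<integral>x. G (real (Suc n) * (w (x + (1 / real (Suc n)) *\<^sub>R z) - w x)) \<partial>lborel) \<longlonglongrightarrow> (\<integral>x. G (grad w x \<bullet> z) \<partial>lborel)"
proof -
  obtain R where R: "R > 0" "\<And>x. w x \<noteq> 0 \<Longrightarrow> norm x \<le> R" using C1c_support[OF w] by metis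
  obtain M where M: "M \<ge> 0" "\<And>x h. \<bar>w (x + h) - w x\<bar> \<le> M * norm h" using C1c_lipschitz[OF w] by metis
  have "bounded (G ` {- (M * norm z)..M * norm z})"
    by (intro compact_imp_bounded compact_continuous_image continuous_on_subset[OF G(1)]) auto
  then obtain B where B: "B > 0" "\<And>y. \<bar>y\<bar> \<le> M * norm z \<Longrightarrow> \<bar>G y\<bar> \<le> B" unfolding bounded_pos by (force simp: abs_le_iff)
  have [measurable]: "w \<in> borel_measurable borel" "grad w \<in> borel_measurable borel" "G \<in> borel_measurable borel"
    using C1cD(2,3)[OF w] G(1) by (auto intro: borel_measurable_continuous_onI)
  show ?thesis
  proof (rule integral_dominated_convergence[where w = "\<lambda>x. B * indicator (cball 0 (R + norm z)) x"])
    show "(\<lambda>x. G (grad w x \<bullet> z)) \<in> borel_measurable lborel" by measurable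
    show "(\<lambda>x. G (real (Suc n) * (w (x + (1 / real (Suc n)) *\<^sub>R z) - w x))) \<in> borel_measurable lborel" for n by measurable
    show "integrable lborel (\<lambda>x::'a. B * indicator (cball 0 (R + norm z)) x)"
      using emeasure_lborel_cball_finite[of "0::'a" "R + norm z"] by (intro integrable_mult_right integrable_real_indicator) auto
    have "isCont G y" for y using G(1) by (simp add: continuous_on_eq_continuous_at)
    then show "AE x in lborel. (\<lambda>n. G (real (Suc n) * (w (x + (1 / real (Suc n)) *\<^sub>R z) - w x))) \<longlonglongrightarrow> G (grad w x \<bullet> z)"
      by (intro AE_I2 isCont_tendsto_compose[OF _ difference_quotient_tendsto[OF w]])
    show "AE x in lborel. norm (G (real (Suc n) * (w (x + (1 / real (Suc n)) *\<^sub>R z) - w x))) \<le> B * indicator (cball 0 (R + norm z)) x" for n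
    proof (rule AE_I2)
      fix x
      define t where "t = 1 / real (Suc n)"
      have t: "0 < t" "t \<le> 1" "real (Suc n) * t = 1" unfolding t_def by auto
      have "\<bar>real (Suc n) * (w (x + t *\<^sub>R z) - w x)\<bar> \<le> real (Suc n) * (M * norm (t *\<^sub>R z))"
        unfolding abs_mult using M(2)[of x "t *\<^sub>R z"] by simp
      also have "\<dots> = (real (Suc n) * t) * (M * norm z)" using t(1) by simp
      finally have b: "\<bar>real (Suc n) * (w (x + t *\<^sub>R z) - w x)\<bar> \<le> M * norm z" unfolding t(3) by simp
      show "norm (G (real (Suc n) * (w (x + (1 / real (Suc n)) *\<^sub>R z) - w x))) \<le> B * indicator (cball 0 (R + norm z)) x"
      proof (cases "norm x \<le> R + norm z")
        case True then show ?thesis using B(2)[OF b] unfolding t_def by (simp add: dist_norm)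
      next
        case False
        have "norm (t *\<^sub>R z) \<le> norm z" using t by (simp add: mult_left_le_one_le)
        then have "norm (x + t *\<^sub>R z) > R" using False norm_diff_ineq[of x "t *\<^sub>R z"] by linarith
        then have "w (x + t *\<^sub>R z) = 0" "w x = 0" using R(2) False norm_ge_zero[of z] by (force, smt (verit))
        then show ?thesis using G(2) B(1) unfolding t_def by simp
      qed
    qed
  qed
qed

text \<open>Translation invariance of Lebesgue measure takes the place of the divergence theorem:
  every difference quotient of \<open>w\<close> has integral zero.\<close>

lemma integral_grad_zero:
  assumes w: "C1c w" shows "(\<integral>x. grad w x \<bullet> z \<partial>lborel) = 0"
proof -
  obtain R where R: "R > 0" "\<And>x. w x \<noteq> 0 \<Longrightarrow> norm x \<le> R" using C1c_support[OF w] by metis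
  have c: "continuous_on UNIV w" using C1cD[OF w] by simp
  then have m: "w \<in> borel_measurable borel" by (rule borel_measurable_continuous_onI)
  have i: "integrable lborel w" using integrable_continuous_bounded_support[OF c R(2)] .
  have "(\<integral>x. real (Suc n) * (w (x + (1 / real (Suc n)) *\<^sub>R z) - w x) \<partial>lborel) = 0" for n
  proof -
    have "integrable lborel (\<lambda>x. w (x + (1 / real (Suc n)) *\<^sub>R z))"
    proof (rule integrable_continuous_bounded_support)
      show "continuous_on UNIV (\<lambda>x. w (x + (1 / real (Suc n)) *\<^sub>R z))"
        by (intro continuous_on_compose2[OF c] continuous_intros) auto
      show "norm x \<le> R + norm ((1 / real (Suc n)) *\<^sub>R z)" if "w (x + (1 / real (Suc n)) *\<^sub>R z) \<noteq> 0" for x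
        using R(2)[OF that] norm_diff_ineq[of x "(1 / real (Suc n)) *\<^sub>R z"] by linarith
    qed
    then show ?thesis using i by (simp add: lborel_integral_translate[OF m] Bochner_Integration.integral_diff)
  qed
  then show ?thesis using LIMSEQ_unique[OF difference_quotient_integral[OF w, of "\<lambda>y. y" z]] by auto
qed

text \<open>Split the translation into \<open>n\<close> equal steps, use convexity of the square, and let \<open>n\<close> tend to infinity.\<close>

lemma translation_estimate:
  assumes w: "C1c w"
  shows "(\<integral>x. (w (x + z) - w x)\<^sup>2 \<partial>lborel) \<le> (norm z)\<^sup>2 * (\<integral>x. (norm (grad w x))\<^sup>2 \<partial>lborel)"
proof -
  obtain R where R: "R > 0" "\<And>x. w x \<noteq> 0 \<Longrightarrow> norm x \<le> R" "\<And>x. grad w x \<noteq> 0 \<Longrightarrow> norm x \<le> R"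
    using C1c_support[OF w] by metis
  have c: "continuous_on UNIV w" "continuous_on UNIV (grad w)" using C1cD[OF w] by simp_all
  then have [measurable]: "w \<in> borel_measurable borel" by (auto intro: borel_measurable_continuous_onI)
  have int: "integrable lborel (\<lambda>x. (w (x + a) - w (x + b))\<^sup>2)" for a b
  proof (rule integrable_continuous_bounded_support)
    show "continuous_on UNIV (\<lambda>x. (w (x + a) - w (x + b))\<^sup>2)"
      by (intro continuous_intros continuous_on_compose2[OF c(1)]) auto
    show "norm x \<le> R + norm a + norm b" if "(w (x + a) - w (x + b))\<^sup>2 \<noteq> 0" for x
    proof -
      have "w (x + a) \<noteq> 0 \<or> w (x + b) \<noteq> 0" using that by auto
      then show ?thesis
        using R(2)[of "x + a"] R(2)[of "x + b"] norm_diff_ineq[of x a] norm_diff_ineq[of x b] norm_ge_zero[of a] norm_ge_zero[of b]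
        by linarith
    qed
  qed
  have le: "(\<integral>x. (w (x + z) - w x)\<^sup>2 \<partial>lborel)
      \<le> (\<integral>x. (real (Suc n) * (w (x + (1 / real (Suc n)) *\<^sub>R z) - w x))\<^sup>2 \<partial>lborel)" for n
  proof -
    define N where "N = Suc n"
    define h where "h = (1 / real N) *\<^sub>R z"
    have Nh: "real N *\<^sub>R h = z" unfolding h_def N_def by simp
    define d where "d k x = w (x + real (Suc k) *\<^sub>R h) - w (x + real k *\<^sub>R h)" for k x
    have "(w (x + z) - w x)\<^sup>2 \<le> real N * (\<Sum>k<N. (d k x)\<^sup>2)" for x
    proof -
      have "w (x + z) - w x = (\<Sum>k<N. d k x)"
        unfolding d_def using sum_lessThan_telescope[of "\<lambda>k. w (x + real k *\<^sub>R h)" N] Nh by simp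
      moreover have "(\<Sum>k<N. d k x)\<^sup>2 \<le> (\<Sum>k<N. (d k x)\<^sup>2) * real N"
        using Cauchy_Schwarz_ineq_sum[of "\<lambda>k. d k x" "\<lambda>k. 1" "{..<N}"] by simp
      ultimately show ?thesis by (simp add: mult.commute)
    qed
    then have "(\<integral>x. (w (x + z) - w x)\<^sup>2 \<partial>lborel) \<le> (\<integral>x. real N * (\<Sum>k<N. (d k x)\<^sup>2) \<partial>lborel)"
      using int[of z 0] int unfolding d_def by (intro integral_mono) auto
    also have "\<dots> = real N * (\<Sum>k<N. \<integral>x. (d k x)\<^sup>2 \<partial>lborel)"
      unfolding d_def using int by (simp add: Bochner_Integration.integral_sum)
    also have "(\<integral>x. (d k x)\<^sup>2 \<partial>lborel) = (\<integral>x. (w (x + h) - w x)\<^sup>2 \<partial>lborel)" for k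
      using lborel_integral_translate[of "\<lambda>x. (w (x + h) - w x)\<^sup>2" "real k *\<^sub>R h"]
      unfolding d_def by (simp add: scaleR_left_distrib add.assoc add.commute add.left_commute)
    \<comment> \<open>By translation invariance the \<open>N\<close> integrals coincide. Together
      with the factor \<open>N\<close> from Cauchy-Schwarz they give \<open>N\<^sup>2\<close>, which
      moves into the square and forms the difference quotient.\<close>
    then have "real N * (\<Sum>k<N. \<integral>x. (d k x)\<^sup>2 \<partial>lborel) = (\<integral>x. (real N * (w (x + h) - w x))\<^sup>2 \<partial>lborel)"
      by (simp add: power2_eq_square mult.assoc mult.left_commute)
    finally show ?thesis unfolding h_def N_def .
  qed
  have "(\<integral>x. (w (x + z) - w x)\<^sup>2 \<partial>lborel) \<le> (\<integral>x. (grad w x \<bullet> z)\<^sup>2 \<partial>lborel)"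
    by (rule LIMSEQ_le_const[OF difference_quotient_integral[OF w, of "\<lambda>y. y\<^sup>2" z]])
       (use le in \<open>auto intro: continuous_intros\<close>)
  also have "\<dots> \<le> (\<integral>x. (norm z)\<^sup>2 * (norm (grad w x))\<^sup>2 \<partial>lborel)"
  proof (rule integral_mono)
    have "grad w x \<bullet> z \<noteq> 0 \<Longrightarrow> norm x \<le> R" for x using R(3)[of x] by force
    then show "integrable lborel (\<lambda>x. (grad w x \<bullet> z)\<^sup>2)"
      by (intro integrable_continuous_bounded_support[where R = R])
         (auto intro!: continuous_intros c)
    show "integrable lborel (\<lambda>x. (norm z)\<^sup>2 * (norm (grad w x))\<^sup>2)"
      by (rule integrable_continuous_bounded_support[where R = R])
         (use R(3) in \<open>auto intro!: continuous_intros c\<close>)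
    show "(grad w x \<bullet> z)\<^sup>2 \<le> (norm z)\<^sup>2 * (norm (grad w x))\<^sup>2" for x
      using power_mono[OF Cauchy_Schwarz_ineq2[of "grad w x" z], of 2] by (simp add: power_mult_distrib mult.commute)
  qed
  finally show ?thesis by simp
qed

lemma C1c_square_integrable:
  assumes w: "C1c w"
  shows "integrable lborel (\<lambda>x. (w x)\<^sup>2)" "integrable lborel (\<lambda>x. (norm (grad w x))\<^sup>2)"
    "integrable lborel (\<lambda>x. (w (x + z) - w x)\<^sup>2)"
proof -
  obtain R where R: "R > 0" "\<And>x. w x \<noteq> 0 \<Longrightarrow> norm x \<le> R" "\<And>x. grad w x \<noteq> 0 \<Longrightarrow> norm x \<le> R"
    using C1c_support[OF w] by metis
  have c: "continuous_on UNIV w" "continuous_on UNIV (grad w)" using C1cD[OF w] by simp_all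
  show "integrable lborel (\<lambda>x. (w x)\<^sup>2)" "integrable lborel (\<lambda>x. (norm (grad w x))\<^sup>2)"
    by (rule integrable_continuous_bounded_support[where R = R]; use R in \<open>auto intro!: continuous_intros c\<close>)+
  show "integrable lborel (\<lambda>x. (w (x + z) - w x)\<^sup>2)"
  proof (rule integrable_continuous_bounded_support)
    show "continuous_on UNIV (\<lambda>x. (w (x + z) - w x)\<^sup>2)"
      by (intro continuous_intros continuous_on_compose2[OF c(1)] c) auto
    show "norm x \<le> R + norm z" if "(w (x + z) - w x)\<^sup>2 \<noteq> 0" for x
    proof -
      have "w (x + z) \<noteq> 0 \<or> w x \<noteq> 0" using that by auto
      then show ?thesis
        using R(2)[of "x + z"] R(2)[of x] norm_diff_ineq[of x z] norm_ge_zero[of z] by linarith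
    qed
  qed
qed

text \<open>A translation by a vector of length \<open>2 * R + 1\<close> moves the support off
  itself, so on the support the difference \<open>w (x + z) - w x\<close> is just
  \<open>- w x\<close>. The constant is the squared length of that vector.\<close>

lemma poincare_C1c:
  fixes w :: "'a::euclidean_space \<Rightarrow> real"
  assumes w: "C1c w" and R: "R \<ge> 0" "\<And>x. w x \<noteq> 0 \<Longrightarrow> norm x \<le> R"
  shows "(\<integral>x. (w x)\<^sup>2 \<partial>lborel) \<le> (2 * R + 1)\<^sup>2 * (\<integral>x. (norm (grad w x))\<^sup>2 \<partial>lborel)"
proof -
  obtain e :: 'a where e: "e \<in> Basis" using nonempty_Basis by blast
  define z where "z = (2 * R + 1) *\<^sub>R e"
  have nz: "norm z = 2 * R + 1" using e R unfolding z_def by simp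
  have "(w x)\<^sup>2 \<le> (w (x + z) - w x)\<^sup>2" for x
  proof (cases "w x = 0")
    case False
    then have "norm x \<le> R" using R by auto
    then have "norm (x + z) > R" using norm_diff_ineq[of z x] nz by (simp add: add.commute)
    then have "w (x + z) = 0" using R(2)[of "x + z"] by auto
    then show ?thesis by simp
  qed simp
  then have "(\<integral>x. (w x)\<^sup>2 \<partial>lborel) \<le> (\<integral>x. (w (x + z) - w x)\<^sup>2 \<partial>lborel)"
    using C1c_square_integrable[OF w] by (intro integral_mono) auto
  also have "\<dots> \<le> (2 * R + 1)\<^sup>2 * (\<integral>x. (norm (grad w x))\<^sup>2 \<partial>lborel)"
    using translation_estimate[OF w, of z] nz by simp
  finally show ?thesis .
qed

section \<open>Dyadic averages\<close>

text \<open>The half-open dyadic cube of side \<open>2 ^ (- j)\<close> that contains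
  \<open>x\<close>. Described by floors, cells of one level are the classes of an equivalence
  relation, and membership is measurable jointly in both points.\<close>

definition cell :: "nat \<Rightarrow> 'a::euclidean_space \<Rightarrow> 'a set" where
  "cell j x = {y. \<forall>i\<in>Basis. \<lfloor>2 ^ j * (y \<bullet> i)\<rfloor> = \<lfloor>2 ^ j * (x \<bullet> i)\<rfloor>}"

lemma cell_refl: "x \<in> cell j x"
  by (simp add: cell_def)

lemma cell_eq: "y \<in> cell j x \<Longrightarrow> cell j y = cell j x"
  by (auto simp: cell_def)

text \<open>The floor at level \<open>j\<close> is half the floor at level \<open>Suc j\<close>,
  rounded down; hence the cubes are nested. Because of this, \<open>dyadic_part w j\<close> is
  constant on cells of level \<open>j\<close>.\<close>

lemma cell_Suc_subset: "cell (Suc j) x \<subseteq> cell j x"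
proof -
  have "\<lfloor>2 ^ j * t\<rfloor> = \<lfloor>2 ^ Suc j * t\<rfloor> div 2" for t :: real
    using floor_divide_real_eq_div[of 2 "2 ^ Suc j * t"] by simp
  then show ?thesis by (auto simp: cell_def simp del: power_Suc)
qed

lemma cell_coord: assumes "y \<in> cell j x" "i \<in> Basis" shows "\<bar>y \<bullet> i - x \<bullet> i\<bar> \<le> 1 / 2 ^ j"
proof -
  have "\<lfloor>2 ^ j * (y \<bullet> i)\<rfloor> = \<lfloor>2 ^ j * (x \<bullet> i)\<rfloor>" using assms by (simp add: cell_def)
  then have "\<bar>2 ^ j * (y \<bullet> i) - 2 ^ j * (x \<bullet> i)\<bar> \<le> 1" by linarith
  then have "2 ^ j * \<bar>y \<bullet> i - x \<bullet> i\<bar> \<le> 1" by (simp add: abs_mult flip: right_diff_distrib)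
  then show ?thesis by (simp add: field_simps)
qed

lemma norm_le_of_coords:
  fixes z :: "'a::euclidean_space" and c :: real
  assumes "\<And>i. i \<in> Basis \<Longrightarrow> \<bar>z \<bullet> i\<bar> \<le> c"
  shows "norm z \<le> DIM('a) * c"
proof -
  have "norm z \<le> (\<Sum>i\<in>Basis. \<bar>z \<bullet> i\<bar>)" by (rule norm_le_l1)
  also have "\<dots> \<le> (\<Sum>i\<in>(Basis::'a set). c)" by (intro sum_mono assms)
  finally show ?thesis by simp
qed

lemma cell_dist: "y \<in> cell j x \<Longrightarrow> norm (y - x) \<le> DIM('a) / 2 ^ j" for x y :: "'a::euclidean_space"
  using norm_le_of_coords[of "y - x" "1 / 2 ^ j"] cell_coord[of y j x] by (simp add: inner_diff_left)

lemma box_subset_cell: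
  fixes x :: "'a::euclidean_space" and j :: nat
  defines "a \<equiv> \<Sum>i\<in>Basis. (\<lfloor>2 ^ j * (x \<bullet> i)\<rfloor> / 2 ^ j) *\<^sub>R i"
  shows "box a (a + (1 / 2 ^ j) *\<^sub>R One) \<subseteq> cell j x" "cell j x \<subseteq> cbox a (a + (1 / 2 ^ j) *\<^sub>R One)"
proof -
  have ai: "a \<bullet> i = \<lfloor>2 ^ j * (x \<bullet> i)\<rfloor> / 2 ^ j" if "i \<in> Basis" for i
    using that unfolding a_def by (simp add: inner_sum_left inner_Basis if_distrib cong: if_cong)
  have bi: "(a + (1 / 2 ^ j) *\<^sub>R One) \<bullet> i = (\<lfloor>2 ^ j * (x \<bullet> i)\<rfloor> + 1) / 2 ^ j" if "i \<in> Basis" for i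
    using that by (simp add: inner_add_left ai add_divide_distrib)
  show "box a (a + (1 / 2 ^ j) *\<^sub>R One) \<subseteq> cell j x"
    unfolding cell_def
  proof (intro subsetI CollectI ballI)
    fix y i assume y: "y \<in> box a (a + (1 / 2 ^ j) *\<^sub>R One)" and i: "i \<in> (Basis::'a set)"
    have "a \<bullet> i < y \<bullet> i" "y \<bullet> i < (a + (1 / 2 ^ j) *\<^sub>R One) \<bullet> i" using y i by (auto simp: mem_box)
    then show "\<lfloor>2 ^ j * (y \<bullet> i)\<rfloor> = \<lfloor>2 ^ j * (x \<bullet> i)\<rfloor>"
      unfolding ai[OF i] bi[OF i] by (intro floor_unique) (auto simp: field_simps)
  qed
  show "cell j x \<subseteq> cbox a (a + (1 / 2 ^ j) *\<^sub>R One)"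
    unfolding mem_box subset_iff
  proof (intro allI impI ballI)
    fix y i assume y: "y \<in> cell j x" and i: "i \<in> (Basis::'a set)"
    have "\<lfloor>2 ^ j * (y \<bullet> i)\<rfloor> = \<lfloor>2 ^ j * (x \<bullet> i)\<rfloor>" using y i by (simp add: cell_def)
    then have "\<lfloor>2 ^ j * (x \<bullet> i)\<rfloor> \<le> 2 ^ j * (y \<bullet> i)" "2 ^ j * (y \<bullet> i) \<le> \<lfloor>2 ^ j * (x \<bullet> i)\<rfloor> + 1" by linarith+
    then show "a \<bullet> i \<le> y \<bullet> i \<and> y \<bullet> i \<le> (a + (1 / 2 ^ j) *\<^sub>R One) \<bullet> i"
      unfolding ai[OF i] bi[OF i] by (auto simp: field_simps)
  qed
qed

lemma cell_measurable_pair [measurable]: "Measurable.pred (borel \<Otimes>\<^sub>M borel) (\<lambda>p. snd p \<in> cell j (fst p))"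
  unfolding cell_def mem_Collect_eq by measurable

lemma cell_borel [measurable]: "cell j x \<in> sets borel"
proof -
  have "Measurable.pred borel (\<lambda>y. y \<in> cell j x)" unfolding cell_def mem_Collect_eq by measurable
  then show ?thesis by (simp add: pred_def)
qed

lemma emeasure_cell: "emeasure lborel (cell j x) = ennreal (1 / 2 ^ (j * DIM('a)))" for x :: "'a::euclidean_space"
proof -
  define a where "a = (\<Sum>i\<in>Basis. (\<lfloor>2 ^ j * (x \<bullet> i)\<rfloor> / 2 ^ j) *\<^sub>R i)"
  define b where "b = a + (1 / 2 ^ j) *\<^sub>R One"
  have p: "(\<Prod>i\<in>Basis. (b - a) \<bullet> i) = 1 / 2 ^ (j * DIM('a))"
    unfolding b_def by (simp add: power_mult power_one_over)
  have le: "a \<bullet> i \<le> b \<bullet> i" if "i \<in> Basis" for i using that unfolding b_def by (simp add: inner_add_left)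
  have s: "box a b \<subseteq> cell j x" "cell j x \<subseteq> cbox a b" using box_subset_cell[of j x] unfolding a_def b_def by auto
  have "emeasure lborel (box a b) \<le> emeasure lborel (cell j x)" "emeasure lborel (cell j x) \<le> emeasure lborel (cbox a b)"
    by (intro emeasure_mono s; simp)+
  then show ?thesis using le p by (simp add: emeasure_lborel_box_eq emeasure_lborel_cbox_eq)
qed

lemma measure_cell: "measure lborel (cell j x) = 1 / 2 ^ (j * DIM('a))" for x :: "'a::euclidean_space"
  by (simp add: measure_def emeasure_cell)

text \<open>The prefactor is the reciprocal volume of a cell, so this is the conditional expectation
  of \<open>w\<close> on the dyadic cubes of level \<open>j\<close>.\<close>

definition avg :: "nat \<Rightarrow> ('a::euclidean_space \<Rightarrow> real) \<Rightarrow> 'a \<Rightarrow> real" where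
  "avg j w x = 2 ^ (j * DIM('a)) * (\<integral>y. indicator (cell j x) y * w y \<partial>lborel)"

lemma avg_cell: "y \<in> cell j x \<Longrightarrow> avg j w y = avg j w x"
  by (simp add: avg_def cell_eq)

lemma avg_measurable [measurable]:
  fixes w :: "'a::euclidean_space \<Rightarrow> real"
  assumes [measurable]: "w \<in> borel_measurable borel"
  shows "avg j w \<in> borel_measurable borel"
proof -
  have "(\<lambda>p. indicator {p. snd p \<in> cell j (fst p)} p * w (snd p)) \<in> borel_measurable (borel \<Otimes>\<^sub>M (borel :: 'a measure))"
    by measurable
  also have "(\<lambda>p. indicator {p. snd p \<in> cell j (fst p)} p * w (snd p)) = (\<lambda>(x, y). indicator (cell j x) y * w y)"
    by (auto simp: fun_eq_iff indicator_def)
  finally have m: "(\<lambda>(x, y). indicator (cell j x) y * w y) \<in> borel_measurable (borel \<Otimes>\<^sub>M lborel)"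
    by (simp cong: measurable_cong_sets sets_pair_measure_cong)
  show ?thesis unfolding avg_def[abs_def]
    by (intro borel_measurable_times borel_measurable_const lborel.borel_measurable_lebesgue_integral[OF m])
qed

lemma cell_integrable:
  fixes h :: "'a::euclidean_space \<Rightarrow> real"
  assumes "h \<in> borel_measurable borel" "integrable lborel (\<lambda>y. indicator (cell j x) y * (h y)\<^sup>2)"
  shows "integrable lborel (\<lambda>y. indicator (cell j x) y * h y)"
proof (rule Bochner_Integration.integrable_bound)
  have "integrable lborel (indicator (cell j x) :: 'a \<Rightarrow> real)"
    by (intro integrable_real_indicator) (auto simp: emeasure_cell)
  then show "integrable lborel (\<lambda>y. indicator (cell j x) y * (h y)\<^sup>2 + indicator (cell j x) y)"
    using assms(2) by auto
  show "(\<lambda>y. indicator (cell j x) y * h y) \<in> borel_measurable lborel" using assms(1) by measurable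
  have "\<bar>t\<bar> \<le> t\<^sup>2 + 1" for t :: real
    using sum_squares_bound[of "\<bar>t\<bar>" 1] zero_le_power2[of t] by simp
  then show "AE y in lborel. norm (indicator (cell j x) y * h y) \<le> norm (indicator (cell j x) y * (h y)\<^sup>2 + indicator (cell j x) y)"
    by (auto intro!: AE_I2 split: split_indicator)
qed

text \<open>Nonnegativity of the variance: expand the integral of \<open>(h y - c)\<^sup>2\<close>
  over the cell, where \<open>c\<close> is the mean of \<open>h\<close>.\<close>

lemma cell_jensen:
  fixes x :: "'a::euclidean_space" and h :: "'a \<Rightarrow> real"
  assumes h: "h \<in> borel_measurable borel" "integrable lborel (\<lambda>y. indicator (cell j x) y * (h y)\<^sup>2)"
  shows "(2 ^ (j * DIM('a)) * (\<integral>y. indicator (cell j x) y * h y \<partial>lborel))\<^sup>2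
    \<le> 2 ^ (j * DIM('a)) * (\<integral>y. indicator (cell j x) y * (h y)\<^sup>2 \<partial>lborel)"
proof -
  define V :: real where "V = 2 ^ (j * DIM('a))"
  define I where "I = (\<integral>y. indicator (cell j x) y * h y \<partial>lborel)"
  define c where "c = V * I"
  have V: "V > 0" by (simp add: V_def)
  have i1: "integrable lborel (\<lambda>y. indicator (cell j x) y * h y)" by (rule cell_integrable[OF h])
  have i0: "integrable lborel (indicator (cell j x) :: 'a \<Rightarrow> real)"
    by (intro integrable_real_indicator) (auto simp: emeasure_cell)
  have "0 \<le> (\<integral>y. indicator (cell j x) y * (h y - c)\<^sup>2 \<partial>lborel)" by (intro integral_nonneg_AE AE_I2) simp
  also have "(\<lambda>y. indicator (cell j x) y * (h y - c)\<^sup>2) =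
      (\<lambda>y. indicator (cell j x) y * (h y)\<^sup>2 - 2 * c * (indicator (cell j x) y * h y) + c\<^sup>2 * indicator (cell j x) y)"
    by (auto simp: fun_eq_iff power2_diff algebra_simps split: split_indicator)
  also have "(\<integral>y. indicator (cell j x) y * (h y)\<^sup>2 - 2 * c * (indicator (cell j x) y * h y) + c\<^sup>2 * indicator (cell j x) y \<partial>lborel)
     = (\<integral>y. indicator (cell j x) y * (h y)\<^sup>2 \<partial>lborel) - 2 * c * I + c\<^sup>2 * (1 / V)"
    using i1 i0 h(2) unfolding I_def by (simp add: measure_cell V_def)
  also have "\<dots> = (\<integral>y. indicator (cell j x) y * (h y)\<^sup>2 \<partial>lborel) - V * I\<^sup>2"
    unfolding c_def using V by (simp add: power2_eq_square)
  finally have "V * (V * I\<^sup>2) \<le> V * (\<integral>y. indicator (cell j x) y * (h y)\<^sup>2 \<partial>lborel)"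
    using V by (intro mult_left_mono) auto
  then show ?thesis unfolding V_def[symmetric] I_def[symmetric] by (simp add: power2_eq_square mult_ac)
qed

lemma avg_sup_bound:
  fixes w :: "'a::euclidean_space \<Rightarrow> real"
  assumes w: "w \<in> borel_measurable borel" "integrable lborel (\<lambda>x. (w x)\<^sup>2)"
  shows "(avg j w x)\<^sup>2 \<le> 2 ^ (j * DIM('a)) * (\<integral>x. (w x)\<^sup>2 \<partial>lborel)"
proof -
  have i: "integrable lborel (\<lambda>y. indicator (cell j x) y * (w y)\<^sup>2)"
    using integrable_mult_indicator[of "cell j x" lborel "\<lambda>y. (w y)\<^sup>2"] w by simp
  have "(avg j w x)\<^sup>2 \<le> 2 ^ (j * DIM('a)) * (\<integral>y. indicator (cell j x) y * (w y)\<^sup>2 \<partial>lborel)"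
    unfolding avg_def by (rule cell_jensen[OF w(1) i])
  also have "\<dots> \<le> 2 ^ (j * DIM('a)) * (\<integral>x. (w x)\<^sup>2 \<partial>lborel)"
    by (intro mult_left_mono integral_mono i w) (auto split: split_indicator)
  finally show ?thesis .
qed

text \<open>A function that is constant on a cell carries there at least its squared value times the
  volume. This controls suprema by mean squares, at the price of the reciprocal volume of a
  cell.\<close>

lemma cellwise_constant_sup_bound:
  fixes f :: "'a::euclidean_space \<Rightarrow> real"
  assumes f: "f \<in> borel_measurable borel" "integrable lborel (\<lambda>x. (f x)\<^sup>2)" and c: "\<And>y. y \<in> cell j x \<Longrightarrow> f y = f x"
  shows "(f x)\<^sup>2 \<le> 2 ^ (j * DIM('a)) * (\<integral>x. (f x)\<^sup>2 \<partial>lborel)"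
proof -
  have i0: "integrable lborel (indicator (cell j x) :: 'a \<Rightarrow> real)"
    by (intro integrable_real_indicator) (auto simp: emeasure_cell)
  have "(f x)\<^sup>2 * (1 / 2 ^ (j * DIM('a))) = (\<integral>y. (f x)\<^sup>2 * indicator (cell j x) y \<partial>lborel)"
    by (simp add: measure_cell)
  also have "\<dots> \<le> (\<integral>y. (f y)\<^sup>2 \<partial>lborel)"
    by (intro integral_mono integrable_mult_right i0 f) (use c in \<open>auto split: split_indicator\<close>)
  finally show ?thesis by (simp add: field_simps)
qed

text \<open>At \<open>x\<close> the error is the mean over the cell of \<open>w x - w y\<close>. By
  Jensen its square is at most the mean of the squares, and writing \<open>y = x + z\<close> places
  \<open>z\<close> in the cube \<open>Z\<close> around 0, which does not depend on \<open>x\<close>.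
  Exchanging the integrals leaves the translation estimate for each \<open>z\<close> in
  \<open>Z\<close>.\<close>

lemma avg_L2_error:
  fixes w :: "'a::euclidean_space \<Rightarrow> real"
  assumes w: "C1c w"
  defines "C \<equiv> 2 ^ DIM('a) * (real DIM('a))\<^sup>2"
  shows "integrable lborel (\<lambda>x. (w x - avg j w x)\<^sup>2)"
    "(\<integral>x. (w x - avg j w x)\<^sup>2 \<partial>lborel) \<le> C * (1 / 4) ^ j * (\<integral>x. (norm (grad w x))\<^sup>2 \<partial>lborel)"
proof -
  define V :: real where "V = 2 ^ (j * DIM('a))"
  define D where "D = (\<integral>x. (norm (grad w x))\<^sup>2 \<partial>lborel)"
  have D: "D \<ge> 0" unfolding D_def by simp
  have V: "V > 0" by (simp add: V_def)
  have c: "continuous_on UNIV w" using C1cD[OF w] by simp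
  then have [measurable]: "w \<in> borel_measurable borel" by (rule borel_measurable_continuous_onI)
  obtain R where R: "R > 0" "\<And>x. w x \<noteq> 0 \<Longrightarrow> norm x \<le> R" using C1c_support[OF w] by metis
  have iw: "integrable lborel w" using integrable_continuous_bounded_support[OF c R(2)] .
  have iw2: "integrable lborel (\<lambda>x. (w x)\<^sup>2)" using C1c_square_integrable[OF w] by simp
  define Z :: "'a set" where "Z = cbox (- ((1 / 2 ^ j) *\<^sub>R One)) ((1 / 2 ^ j) *\<^sub>R One)"
  have Zb: "Z \<in> sets borel" unfolding Z_def by simp
  note [measurable] = Zb
  have eZ: "emeasure lborel Z = ennreal ((2 / 2 ^ j) ^ DIM('a))"
  proof -
    have "emeasure lborel Z = ennreal (\<Prod>b\<in>Basis. ((1 / 2 ^ j) *\<^sub>R One - - ((1 / 2 ^ j) *\<^sub>R One)) \<bullet> (b::'a))"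
      unfolding Z_def by (rule emeasure_lborel_cbox) auto
    also have "(\<Prod>b\<in>Basis. ((1 / 2 ^ j) *\<^sub>R One - - ((1 / 2 ^ j) *\<^sub>R One)) \<bullet> (b::'a)) = (\<Prod>b\<in>(Basis::'a set). 2 / 2 ^ j)"
      by (rule prod.cong) (simp_all add: inner_diff_left inner_add_left)
    finally show ?thesis by simp
  qed
  have Zn: "norm z \<le> DIM('a) / 2 ^ j" if "z \<in> Z" for z
  proof -
    have "\<bar>z \<bullet> i\<bar> \<le> 1 / 2 ^ j" if i: "i \<in> Basis" for i
    proof -
      have "- (1 / 2 ^ j) \<le> z \<bullet> i" "z \<bullet> i \<le> 1 / 2 ^ j" using \<open>z \<in> Z\<close> i unfolding Z_def by (auto simp: mem_box)
      then show ?thesis by linarith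
    qed
    from norm_le_of_coords[OF this] show ?thesis by simp
  qed
  have pt: "ennreal ((w x - avg j w x)\<^sup>2) \<le> (\<integral>\<^sup>+z. ennreal (V * indicator Z z * (w (x + z) - w x)\<^sup>2) \<partial>lborel)" for x
  proof -
    have ic: "integrable lborel (\<lambda>y. indicator (cell j x) y * (w x - w y)\<^sup>2)"
    proof -
      have i0: "integrable lborel (indicator (cell j x) :: 'a \<Rightarrow> real)"
        by (intro integrable_real_indicator) (auto simp: emeasure_cell)
      have "integrable lborel (\<lambda>y. indicator (cell j x) y * (w y)\<^sup>2)" "integrable lborel (\<lambda>y. indicator (cell j x) y * w y)"
        using integrable_mult_indicator[of "cell j x" lborel "\<lambda>y. (w y)\<^sup>2"] iw2
          integrable_mult_indicator[of "cell j x" lborel w] iw by simp_all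
      then have "integrable lborel (\<lambda>y. (w x)\<^sup>2 * indicator (cell j x) y - 2 * w x * (indicator (cell j x) y * w y) + indicator (cell j x) y * (w y)\<^sup>2)"
        using i0 by (intro Bochner_Integration.integrable_add Bochner_Integration.integrable_diff integrable_mult_right)
      then show ?thesis by (simp add: power2_diff algebra_simps)
    qed
    have "w x - avg j w x = 2 ^ (j * DIM('a)) * (\<integral>y. indicator (cell j x) y * (w x - w y) \<partial>lborel)"
    proof -
      have "(\<integral>y. indicator (cell j x) y * (w x - w y) \<partial>lborel) = (\<integral>y. w x * indicator (cell j x) y - indicator (cell j x) y * w y \<partial>lborel)"
        by (simp add: algebra_simps)
      also have "\<dots> = w x * (1 / 2 ^ (j * DIM('a))) - (\<integral>y. indicator (cell j x) y * w y \<partial>lborel)"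
        using integrable_mult_indicator[of "cell j x" lborel w] iw
        by (subst Bochner_Integration.integral_diff) (auto simp: measure_cell emeasure_cell)
      finally have e: "(\<integral>y. indicator (cell j x) y * (w x - w y) \<partial>lborel) =
        w x * (1 / 2 ^ (j * DIM('a))) - (\<integral>y. indicator (cell j x) y * w y \<partial>lborel)" .
      show ?thesis unfolding avg_def e by (simp add: right_diff_distrib)
    qed
    then have "(w x - avg j w x)\<^sup>2 \<le> V * (\<integral>y. indicator (cell j x) y * (w x - w y)\<^sup>2 \<partial>lborel)"
      using cell_jensen[OF _ ic] unfolding V_def by simp
    then have "ennreal ((w x - avg j w x)\<^sup>2) \<le> ennreal (\<integral>y. V * (indicator (cell j x) y * (w x - w y)\<^sup>2) \<partial>lborel)"
      by (intro ennreal_leI) simp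
    also have "\<dots> = (\<integral>\<^sup>+y. ennreal (V * (indicator (cell j x) y * (w x - w y)\<^sup>2)) \<partial>lborel)"
      by (rule nn_integral_eq_integral[symmetric]) (use ic V in auto)
    also have "\<dots> = (\<integral>\<^sup>+z. ennreal (V * (indicator (cell j x) (x + z) * (w x - w (x + z))\<^sup>2)) \<partial>lborel)"
      by (rule lborel_nn_integral_translate[symmetric]) measurable
    also have "\<dots> \<le> (\<integral>\<^sup>+z. ennreal (V * indicator Z z * (w (x + z) - w x)\<^sup>2) \<partial>lborel)"
    proof (intro nn_integral_mono ennreal_leI)
      fix z
      have "(indicator (cell j x) (x + z) :: real) \<le> indicator Z z"
        using cell_coord[of "x + z" j x] unfolding Z_def
        by (auto simp: indicator_def mem_box inner_add_left abs_le_iff) (smt (verit))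
      then have "V * (indicator (cell j x) (x + z) * (w (x + z) - w x)\<^sup>2) \<le> V * (indicator Z z * (w (x + z) - w x)\<^sup>2)"
        using V by (intro mult_left_mono mult_right_mono) auto
      then show "V * (indicator (cell j x) (x + z) * (w x - w (x + z))\<^sup>2) \<le> V * indicator Z z * (w (x + z) - w x)\<^sup>2"
        by (simp add: power2_commute mult.assoc)
    qed
    finally show ?thesis .
  qed
  have "(\<integral>\<^sup>+x. ennreal ((w x - avg j w x)\<^sup>2) \<partial>lborel) \<le> (\<integral>\<^sup>+x. (\<integral>\<^sup>+z. ennreal (V * indicator Z z * (w (x + z) - w x)\<^sup>2) \<partial>lborel) \<partial>lborel)"
    by (intro nn_integral_mono pt)
  also have "\<dots> = (\<integral>\<^sup>+z. (\<integral>\<^sup>+x. ennreal (V * indicator Z z * (w (x + z) - w x)\<^sup>2) \<partial>lborel) \<partial>lborel)"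
  proof (rule lborel_pair.Fubini')
    show "(\<lambda>(z, x). ennreal (V * indicator Z z * (w (x + z) - w x)\<^sup>2)) \<in> borel_measurable (lborel \<Otimes>\<^sub>M lborel)"
      by measurable
  qed
  also have "\<dots> \<le> (\<integral>\<^sup>+z. ennreal (V * ((DIM('a) / 2 ^ j)\<^sup>2 * D)) * indicator Z z \<partial>lborel)"
  proof (rule nn_integral_mono)
    fix z :: 'a
    show "(\<integral>\<^sup>+x. ennreal (V * indicator Z z * (w (x + z) - w x)\<^sup>2) \<partial>lborel) \<le> ennreal (V * ((DIM('a) / 2 ^ j)\<^sup>2 * D)) * indicator Z z"
    proof (cases "z \<in> Z")
      case True
      have "(\<integral>\<^sup>+x. ennreal (V * indicator Z z * (w (x + z) - w x)\<^sup>2) \<partial>lborel) = ennreal (\<integral>x. V * (w (x + z) - w x)\<^sup>2 \<partial>lborel)"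
        using True V C1c_square_integrable(3)[OF w] by (subst nn_integral_eq_integral[symmetric]) auto
      also have "\<dots> \<le> ennreal (V * ((norm z)\<^sup>2 * D))"
        using V translation_estimate[OF w, of z] unfolding D_def by (intro ennreal_leI) simp
      also have "\<dots> \<le> ennreal (V * ((DIM('a) / 2 ^ j)\<^sup>2 * D))"
        using V D Zn[OF True] by (intro ennreal_leI mult_left_mono mult_right_mono power_mono) auto
      finally show ?thesis using True by simp
    qed simp
  qed
  also have "\<dots> = ennreal (V * ((DIM('a) / 2 ^ j)\<^sup>2 * D)) * ennreal ((2 / 2 ^ j) ^ DIM('a))"
    by (subst nn_integral_cmult_indicator) (simp_all add: eZ)
  also have "\<dots> = ennreal (V * ((DIM('a) / 2 ^ j)\<^sup>2 * D) * (2 / 2 ^ j) ^ DIM('a))"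
    using V D by (intro ennreal_mult[symmetric]) auto
  \<comment> \<open>\<open>V\<close> times the volume of \<open>Z\<close> is
    \<open>2 ^ DIM('a)\<close>, since \<open>Z\<close> has twice the side of a cell; the factor
    \<open>(1 / 4) ^ j\<close> comes from the squared length of the translations.\<close>
  also have "V * ((DIM('a) / 2 ^ j)\<^sup>2 * D) * (2 / 2 ^ j) ^ DIM('a) = C * (1 / 4) ^ j * D"
  proof -
    have "(2 / 2 ^ j) ^ DIM('a) = 2 ^ DIM('a) / V" unfolding V_def by (simp add: power_divide power_mult)
    moreover have "((2::real) ^ j)\<^sup>2 = 4 ^ j" by (simp add: power2_eq_square flip: power_mult_distrib)
    ultimately show ?thesis unfolding C_def using V by (simp add: power_divide)
  qed
  finally have le: "(\<integral>\<^sup>+x. ennreal ((w x - avg j w x)\<^sup>2) \<partial>lborel) \<le> ennreal (C * (1 / 4) ^ j * D)" .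
  show i: "integrable lborel (\<lambda>x. (w x - avg j w x)\<^sup>2)"
  proof (rule integrableI_nonneg)
    show "(\<lambda>x. (w x - avg j w x)\<^sup>2) \<in> borel_measurable lborel" by measurable
    show "(\<integral>\<^sup>+x. ennreal ((w x - avg j w x)\<^sup>2) \<partial>lborel) < \<infinity>" using le by (simp add: le_less_trans[OF _ ennreal_less_top])
  qed simp
  have "ennreal (\<integral>x. (w x - avg j w x)\<^sup>2 \<partial>lborel) \<le> ennreal (C * (1 / 4) ^ j * D)"
    using le nn_integral_eq_integral[OF i] by simp
  then show "(\<integral>x. (w x - avg j w x)\<^sup>2 \<partial>lborel) \<le> C * (1 / 4) ^ j * (\<integral>x. (norm (grad w x))\<^sup>2 \<partial>lborel)"
    unfolding D_def[symmetric] using D by (subst (asm) ennreal_le_iff) (auto simp: C_def)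
qed

lemma square_triangle_integral:
  fixes f g h :: "'a::euclidean_space \<Rightarrow> real"
  assumes "integrable lborel (\<lambda>x. (f x - g x)\<^sup>2)" "integrable lborel (\<lambda>x. (g x - h x)\<^sup>2)"
    "f \<in> borel_measurable borel" "h \<in> borel_measurable borel"
  shows "integrable lborel (\<lambda>x. (f x - h x)\<^sup>2)"
    "(\<integral>x. (f x - h x)\<^sup>2 \<partial>lborel) \<le> 2 * (\<integral>x. (f x - g x)\<^sup>2 \<partial>lborel) + 2 * (\<integral>x. (g x - h x)\<^sup>2 \<partial>lborel)"
proof -
  have p: "(f x - h x)\<^sup>2 \<le> 2 * (f x - g x)\<^sup>2 + 2 * (g x - h x)\<^sup>2" for x
    using zero_le_power2[of "(f x - g x) - (g x - h x)"] by (simp add: power2_eq_square algebra_simps)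
  show i: "integrable lborel (\<lambda>x. (f x - h x)\<^sup>2)"
    by (rule Bochner_Integration.integrable_bound[of _ "\<lambda>x. 2 * (f x - g x)\<^sup>2 + 2 * (g x - h x)\<^sup>2"])
       (use assms p in \<open>auto intro!: AE_I2\<close>)
  have "(\<integral>x. (f x - h x)\<^sup>2 \<partial>lborel) \<le> (\<integral>x. 2 * (f x - g x)\<^sup>2 + 2 * (g x - h x)\<^sup>2 \<partial>lborel)"
    by (intro integral_mono i p) (use assms in auto)
  then show "(\<integral>x. (f x - h x)\<^sup>2 \<partial>lborel) \<le> 2 * (\<integral>x. (f x - g x)\<^sup>2 \<partial>lborel) + 2 * (\<integral>x. (g x - h x)\<^sup>2 \<partial>lborel)"
    using assms by simp
qed

section \<open>The subcritical Sobolev inequality\<close>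

lemma powr_power_commute: "x \<ge> 0 \<Longrightarrow> (x powr a) ^ n = (x ^ n) powr a" for x :: real
  by (induction n) (auto simp: powr_mult)

text \<open>Jensen's inequality for the convex function \<open>x powr s\<close> with geometric
  weights \<open>\<sigma> ^ j / S\<close>. The resulting factors
  \<open>(\<sigma> powr (1 - s)) ^ j\<close> grow, but slowly when \<open>\<sigma>\<close> is close
  to 1, so a geometric decay of the terms can absorb them. Zero terms are removed because convexity
  is applied on the open half-line.\<close>

lemma sum_powr_le:
  assumes \<sigma>: "0 < \<sigma>" "\<sigma> < 1" and s: "s \<ge> 1" and a: "\<And>j. a j \<ge> (0::real)"
  shows "(\<Sum>j\<le>n. a j) powr s \<le> (1 / (1 - \<sigma>)) powr (s - 1) * (\<Sum>j\<le>(n::nat). (\<sigma> powr (1 - s)) ^ j * a j powr s)"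
proof -
  define J where "J = {j\<in>{..n}. a j > 0}"
  have J: "finite J" "J \<subseteq> {..n}" and Jp: "\<And>j. j \<in> J \<Longrightarrow> a j > 0" unfolding J_def by auto
  have z: "a j = 0" if "j \<in> {..n} - J" for j using a[of j] that unfolding J_def by force
  define S where "S = (\<Sum>j\<in>J. \<sigma> ^ j)"
  have eq: "(\<Sum>j\<le>n. a j) = (\<Sum>j\<in>J. a j)" using z J by (intro sum.mono_neutral_right) auto
  have eq2: "(\<Sum>j\<le>n. (\<sigma> powr (1 - s)) ^ j * a j powr s) = (\<Sum>j\<in>J. (\<sigma> powr (1 - s)) ^ j * a j powr s)"
    using z J by (intro sum.mono_neutral_right) auto
  show ?thesis
  proof (cases "J = {}")
    case True then show ?thesis unfolding eq eq2 using s by simp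
  next
    case False
    have S: "S > 0" unfolding S_def using \<sigma> J False by (intro sum_pos) auto
    have "S \<le> (\<Sum>j\<le>n. \<sigma> ^ j)" unfolding S_def using J \<sigma> by (intro sum_mono2) auto
    also have "\<dots> = (1 - \<sigma> ^ Suc n) / (1 - \<sigma>)" using \<sigma> by (subst sum_gp0) auto
    also have "\<dots> \<le> 1 / (1 - \<sigma>)" using \<sigma> by (intro divide_right_mono) auto
    finally have Sle: "S \<le> 1 / (1 - \<sigma>)" .
    have "(\<Sum>j\<in>J. a j) powr s = (\<Sum>j\<in>J. (\<sigma> ^ j / S) *\<^sub>R (a j * S / \<sigma> ^ j)) powr s"
      using S \<sigma> by simp
    also have "\<dots> \<le> (\<Sum>j\<in>J. (\<sigma> ^ j / S) * (a j * S / \<sigma> ^ j) powr s)"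
    proof (rule convex_on_sum[of _ "{0<..}" "\<lambda>x. x powr s"])
      show "convex_on {0<..} (\<lambda>x. x powr s)" by (rule powr_convex[OF s])
      show "(\<Sum>j\<in>J. \<sigma> ^ j / S) = 1" using S by (simp add: S_def flip: sum_divide_distrib)
    qed (use S \<sigma> Jp J False in auto)
    also have "\<dots> = (\<Sum>j\<in>J. S powr (s - 1) * ((\<sigma> powr (1 - s)) ^ j * a j powr s))"
    proof (rule sum.cong[OF refl])
      fix j
      have t: "\<sigma> ^ j > 0" using \<sigma> by simp
      have "(\<sigma> powr (1 - s)) ^ j = (\<sigma> ^ j) powr (1 - s)"
        using \<sigma> by (simp add: powr_power_commute)
      moreover have "(a j * S / \<sigma> ^ j) powr s = a j powr s * S powr s / (\<sigma> ^ j) powr s"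
        using a[of j] S t by (simp add: powr_mult powr_divide)
      ultimately show "(\<sigma> ^ j / S) * (a j * S / \<sigma> ^ j) powr s = S powr (s - 1) * ((\<sigma> powr (1 - s)) ^ j * a j powr s)"
        using S t by (simp add: powr_diff field_simps)
    qed
    also have "\<dots> = S powr (s - 1) * (\<Sum>j\<in>J. (\<sigma> powr (1 - s)) ^ j * a j powr s)"
      by (simp add: sum_distrib_left)
    also have "\<dots> \<le> (1 / (1 - \<sigma>)) powr (s - 1) * (\<Sum>j\<in>J. (\<sigma> powr (1 - s)) ^ j * a j powr s)"
      using Sle S s a by (intro mult_right_mono powr_mono2 sum_nonneg) auto
    finally show ?thesis unfolding eq eq2 .
  qed
qed

text \<open>Identifies the sum of all dyadic pieces of \<open>w\<close> with \<open>w\<close>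
  itself, so that a bound for the averages that is uniform in \<open>n\<close> becomes a bound for
  \<open>w\<close>.\<close>

lemma avg_tendsto:
  fixes w :: "'a::euclidean_space \<Rightarrow> real"
  assumes w: "C1c w" shows "(\<lambda>n. avg n w x) \<longlonglongrightarrow> w x"
proof -
  obtain M where M: "M \<ge> 0" "\<And>x h. \<bar>w (x + h) - w x\<bar> \<le> M * norm h" using C1c_lipschitz[OF w] by metis
  have c: "continuous_on UNIV w" using C1cD[OF w] by simp
  then have wm[measurable]: "w \<in> borel_measurable borel" by (rule borel_measurable_continuous_onI)
  obtain R where R: "R > 0" "\<And>x. w x \<noteq> 0 \<Longrightarrow> norm x \<le> R" using C1c_support[OF w] by metis
  have iw: "integrable lborel w" using integrable_continuous_bounded_support[OF c R(2)] .
  have b: "\<bar>avg n w x - w x\<bar> \<le> M * DIM('a) * (1 / 2) ^ n" for n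
  proof -
    define V :: real where "V = 2 ^ (n * DIM('a))"
    have V: "V > 0" by (simp add: V_def)
    have i0: "integrable lborel (indicator (cell n x) :: 'a \<Rightarrow> real)"
      by (intro integrable_real_indicator) (auto simp: emeasure_cell)
    have i1: "integrable lborel (\<lambda>y. indicator (cell n x) y * w y)"
      using integrable_mult_indicator[of "cell n x" lborel w] iw by simp
    have e: "(\<lambda>y. indicator (cell n x) y * (w y - w x)) = (\<lambda>y. indicator (cell n x) y * w y - w x * indicator (cell n x) y)"
      by (auto simp: algebra_simps)
    have i2: "integrable lborel (\<lambda>y. indicator (cell n x) y * (w y - w x))" unfolding e using i0 i1 by auto
    have "avg n w x - w x = V * (\<integral>y. indicator (cell n x) y * (w y - w x) \<partial>lborel)"
      unfolding e avg_def V_def[symmetric] using i0 i1 V by (simp add: measure_cell V_def[symmetric] right_diff_distrib)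
    also have "\<bar>\<dots>\<bar> = V * \<bar>\<integral>y. indicator (cell n x) y * (w y - w x) \<partial>lborel\<bar>" using V by (simp add: abs_mult)
    also have "\<dots> \<le> V * (\<integral>y. \<bar>indicator (cell n x) y * (w y - w x)\<bar> \<partial>lborel)"
      using V integral_abs_bound[of lborel "\<lambda>y. indicator (cell n x) y * (w y - w x)"] by (intro mult_left_mono) auto
    also have "\<dots> \<le> V * (\<integral>y. (M * (DIM('a) / 2 ^ n)) * indicator (cell n x) y \<partial>lborel)"
    proof (intro mult_left_mono integral_mono integrable_abs i2 integrable_mult_right i0)
      fix y
      have "\<bar>w y - w x\<bar> \<le> M * (DIM('a) / 2 ^ n)" if "y \<in> cell n x"
      proof -
        have "\<bar>w y - w x\<bar> \<le> M * norm (y - x)" using M(2)[of x "y - x"] by simp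
        also have "\<dots> \<le> M * (DIM('a) / 2 ^ n)" using M(1) cell_dist[OF that] by (rule mult_left_mono[rotated])
        finally show ?thesis .
      qed
      then show "\<bar>indicator (cell n x) y * (w y - w x)\<bar> \<le> (M * (DIM('a) / 2 ^ n)) * indicator (cell n x) y"
        by (auto split: split_indicator)
    qed (use V in auto)
    also have "\<dots> = M * DIM('a) * (1 / 2) ^ n" using V by (simp add: measure_cell V_def[symmetric] power_one_over)
    finally show ?thesis .
  qed
  have "(\<lambda>n. M * DIM('a) * (1 / 2) ^ n) \<longlonglongrightarrow> M * DIM('a) * 0"
    by (intro tendsto_intros LIMSEQ_realpow_zero) auto
  then have z: "(\<lambda>n. M * DIM('a) * (1 / 2) ^ n) \<longlonglongrightarrow> 0" by simp
  have "(\<lambda>n. avg n w x - w x) \<longlonglongrightarrow> 0"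
    by (rule Lim_null_comparison[OF always_eventually z]) (use b in simp)
  then show ?thesis by (simp add: LIM_zero_iff)
qed

text \<open>The martingale differences of the dyadic averages, that is, the Haar pieces of
  \<open>w\<close>, with the average at level 0 as the first one.\<close>

definition dyadic_part :: "('a::euclidean_space \<Rightarrow> real) \<Rightarrow> nat \<Rightarrow> 'a \<Rightarrow> real" where
  "dyadic_part w j x = (case j of 0 \<Rightarrow> avg 0 w x | Suc i \<Rightarrow> avg (Suc i) w x - avg i w x)"

lemma sum_dyadic_part: "(\<Sum>j\<le>n. dyadic_part w j x) = avg n w x"
  by (induction n) (auto simp: dyadic_part_def)

lemma dyadic_part_cell: "y \<in> cell j x \<Longrightarrow> dyadic_part w j y = dyadic_part w j x"
proof (cases j)
  case (Suc i)
  assume y: "y \<in> cell j x"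
  then have "y \<in> cell i x" using cell_Suc_subset unfolding Suc by blast
  from avg_cell[OF this, of w] avg_cell[OF y, of w] show ?thesis by (simp add: dyadic_part_def Suc)
qed (simp add: dyadic_part_def avg_cell[of y 0 x])

lemma dyadic_part_L2:
  fixes R :: real
  assumes "R \<ge> 0"
  obtains C where "C > 0"
    "\<And>w j. C1c w \<Longrightarrow> (\<And>x::'a::euclidean_space. w x \<noteq> 0 \<Longrightarrow> norm x \<le> R) \<Longrightarrow>
       integrable lborel (\<lambda>x. (dyadic_part w j x)\<^sup>2) \<and>
       (\<integral>x. (dyadic_part w j x)\<^sup>2 \<partial>lborel) \<le> C * (1 / 4) ^ j * (\<integral>x. (norm (grad w x))\<^sup>2 \<partial>lborel)"
proof -
  define C0 where "C0 = 2 ^ DIM('a) * (real DIM('a))\<^sup>2"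
  \<comment> \<open>Level 0 has no coarser average to compare with and uses the Poincare inequality,
    whence the radius. At level \<open>Suc i\<close> the errors of the two averages contribute 2 and
    8, the latter because level \<open>i\<close> is coarser by a factor of 4.\<close>
  define C where "C = 2 * (2 * R + 1)\<^sup>2 + 10 * C0"
  have C0: "C0 > 0" unfolding C0_def by simp
  have C: "C > 0" "2 * (2 * R + 1)\<^sup>2 + 2 * C0 \<le> C" "10 * C0 \<le> C" using C0 unfolding C_def by (auto intro: add_nonneg_pos)
  have "integrable lborel (\<lambda>x. (dyadic_part w j x)\<^sup>2) \<and>
       (\<integral>x. (dyadic_part w j x)\<^sup>2 \<partial>lborel) \<le> C * (1 / 4) ^ j * (\<integral>x. (norm (grad w x))\<^sup>2 \<partial>lborel)"
    if w: "C1c w" and sup: "\<And>x::'a. w x \<noteq> 0 \<Longrightarrow> norm x \<le> R" for w j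
  proof -
    define D where "D = (\<integral>x. (norm (grad w x))\<^sup>2 \<partial>lborel)"
    have D: "D \<ge> 0" unfolding D_def by simp
    have c: "continuous_on UNIV w" using C1cD[OF w] by simp
    then have wm[measurable]: "w \<in> borel_measurable borel" by (rule borel_measurable_continuous_onI)
    have err: "integrable lborel (\<lambda>x. (w x - avg i w x)\<^sup>2)" "(\<integral>x. (w x - avg i w x)\<^sup>2 \<partial>lborel) \<le> C0 * (1 / 4) ^ i * D" for i
      using avg_L2_error[OF w, of i] unfolding C0_def D_def by auto
    have err': "integrable lborel (\<lambda>x. (avg i w x - w x)\<^sup>2)" "(\<integral>x. (avg i w x - w x)\<^sup>2 \<partial>lborel) \<le> C0 * (1 / 4) ^ i * D" for i
      using err[of i] by (simp_all add: power2_commute)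
    show ?thesis
    proof (cases j)
      case 0
      have w2: "integrable lborel (\<lambda>x. (w x - 0)\<^sup>2)" using C1c_square_integrable[OF w] by simp
      have i: "integrable lborel (\<lambda>x. (avg 0 w x - 0)\<^sup>2)"
        and le: "(\<integral>x. (avg 0 w x - 0)\<^sup>2 \<partial>lborel) \<le> 2 * (\<integral>x. (avg 0 w x - w x)\<^sup>2 \<partial>lborel) + 2 * (\<integral>x. (w x - 0)\<^sup>2 \<partial>lborel)"
        using square_triangle_integral[OF err'(1)[of 0] w2] by auto
      note le
      also have "2 * (\<integral>x. (avg 0 w x - w x)\<^sup>2 \<partial>lborel) + 2 * (\<integral>x. (w x - 0)\<^sup>2 \<partial>lborel) \<le> 2 * (C0 * D) + 2 * ((2 * R + 1)\<^sup>2 * D)"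
        using err'(2)[of 0] poincare_C1c[OF w assms sup] unfolding D_def by (intro add_mono mult_left_mono) auto
      also have "\<dots> = (2 * (2 * R + 1)\<^sup>2 + 2 * C0) * D" by (simp add: algebra_simps)
      also have "\<dots> \<le> C * D" using C D by (intro mult_right_mono) auto
      finally show ?thesis using i 0 unfolding D_def by (simp add: dyadic_part_def)
    next
      case (Suc i)
      have i: "integrable lborel (\<lambda>x. (avg (Suc i) w x - avg i w x)\<^sup>2)"
        and le: "(\<integral>x. (avg (Suc i) w x - avg i w x)\<^sup>2 \<partial>lborel) \<le>
           2 * (\<integral>x. (avg (Suc i) w x - w x)\<^sup>2 \<partial>lborel) + 2 * (\<integral>x. (w x - avg i w x)\<^sup>2 \<partial>lborel)"
        using square_triangle_integral[OF err'(1)[of "Suc i"] err(1)[of i]] by auto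
      note le
      also have "2 * (\<integral>x. (avg (Suc i) w x - w x)\<^sup>2 \<partial>lborel) + 2 * (\<integral>x. (w x - avg i w x)\<^sup>2 \<partial>lborel)
          \<le> 2 * (C0 * (1 / 4) ^ Suc i * D) + 2 * (C0 * (1 / 4) ^ i * D)"
        by (intro add_mono mult_left_mono err err') auto
      also have "\<dots> = 10 * C0 * ((1 / 4) ^ j * D)" unfolding Suc by (simp add: field_simps)
      also have "\<dots> \<le> C * ((1 / 4) ^ j * D)" using C D by (intro mult_right_mono) auto
      finally show ?thesis using i Suc unfolding D_def by (simp add: dyadic_part_def mult.assoc)
    qed
  qed
  with C(1) show ?thesis using that[of C] by blast
qed

text \<open>The pieces \<open>dyadic_part w j\<close> decay like \<open>2\<^sup>-\<^sup>j\<close> in the mean square, while their suprema grow at most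
  like \<open>2\<^sup>j\<^sup>(\<^sup>m\<^sup>/\<^sup>2\<^sup>-\<^sup>1\<^sup>)\<close>; interpolating makes their \<open>s\<close>-th powers summable below the critical exponent.\<close>

theorem sobolev_C1c:
  fixes s R :: real
  assumes s: "2 < s" "(real DIM('a::euclidean_space) - 2) * (s - 2) < 4" and R: "R \<ge> 0"
  obtains K where "K \<ge> 0"
    "\<And>w. C1c w \<Longrightarrow> (\<And>x::'a. w x \<noteq> 0 \<Longrightarrow> norm x \<le> R) \<Longrightarrow>
       (\<integral>x. \<bar>w x\<bar> powr s \<partial>lborel) \<le> K * (\<integral>x. (norm (grad w x))\<^sup>2 \<partial>lborel) powr (s / 2)"
proof -
  obtain C where C: "C > 0" and L2: "\<And>w j. C1c w \<Longrightarrow> (\<And>x::'a. w x \<noteq> 0 \<Longrightarrow> norm x \<le> R) \<Longrightarrow>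
       integrable lborel (\<lambda>x. (dyadic_part w j x)\<^sup>2) \<and>
       (\<integral>x. (dyadic_part w j x)\<^sup>2 \<partial>lborel) \<le> C * (1 / 4) ^ j * (\<integral>x. (norm (grad w x))\<^sup>2 \<partial>lborel)"
    using dyadic_part_L2[OF R] by metis
  \<comment> \<open>The ratio from one level to the next of the bounds for the integrals of
    \<open>e j x powr s\<close>: a factor 1/4 from the mean square, and the growth of the squared
    supremum raised to \<open>(s - 2) / 2\<close>. The subcriticality assumption says exactly that
    it is below 1.\<close>
  define \<rho> where "\<rho> = (2 ^ DIM('a) / 4) powr ((s - 2) / 2) / 4"
  have \<rho>0: "\<rho> > 0" unfolding \<rho>_def by simp
  have "\<rho> < 1"
  proof -
    have "(2 ^ DIM('a) / 4 :: real) = 2 powr (real DIM('a) - 2)"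
      by (simp add: powr_diff powr_realpow)
    then have "\<rho> = 2 powr ((real DIM('a) - 2) * ((s - 2) / 2)) / 4"
      unfolding \<rho>_def by (simp only: powr_powr)
    also have "\<dots> = 2 powr ((real DIM('a) - 2) * ((s - 2) / 2) - 2)" by (simp add: powr_diff)
    also have "\<dots> < 2 powr 0" using s(2) by (intro powr_less_mono) auto
    finally show ?thesis by simp
  qed
  \<comment> \<open>A weight close enough to 1 for the loss \<open>\<sigma> powr (1 - s)\<close> in
    \<open>sum_powr_le\<close> to leave a convergent series: the product \<open>\<tau>\<close> is
    \<open>\<rho>\<close> to the positive power \<open>(1 + s) / (2 * s)\<close>.\<close>
  define \<sigma> where "\<sigma> = \<rho> powr (1 / (2 * s))"
  have \<sigma>: "0 < \<sigma>" "\<sigma> < 1"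
    using \<rho>0 powr_less_mono2[of "1 / (2 * s)" \<rho> 1] \<open>\<rho> < 1\<close> s unfolding \<sigma>_def by auto
  define \<tau> where "\<tau> = \<sigma> powr (1 - s) * \<rho>"
  have \<tau>0: "\<tau> > 0" unfolding \<tau>_def using \<sigma> \<rho>0 by simp
  have "\<tau> = \<rho> powr (1 / (2 * s) * (1 - s) + 1)"
    unfolding \<tau>_def \<sigma>_def using \<rho>0 by (simp add: powr_powr powr_add)
  also have "1 / (2 * s) * (1 - s) + 1 = (1 + s) / (2 * s)" using s by (simp add: field_simps)
  also have "\<rho> powr ((1 + s) / (2 * s)) < 1 powr ((1 + s) / (2 * s))"
    using \<rho>0 \<open>\<rho> < 1\<close> s by (intro powr_less_mono2) auto
  finally have \<tau>1: "\<tau> < 1" by simp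
  define K where "K = (1 / (1 - \<sigma>)) powr (s - 1) * C powr (s / 2) * (1 / (1 - \<tau>))"
  have K: "K \<ge> 0" unfolding K_def using \<tau>1 by simp
  have "(\<integral>x. \<bar>w x\<bar> powr s \<partial>lborel) \<le> K * (\<integral>x. (norm (grad w x))\<^sup>2 \<partial>lborel) powr (s / 2)"
    if w: "C1c w" and sup: "\<And>x::'a. w x \<noteq> 0 \<Longrightarrow> norm x \<le> R" for w
  proof -
    define D where "D = (\<integral>x. (norm (grad w x))\<^sup>2 \<partial>lborel)"
    have D: "D \<ge> 0" unfolding D_def by simp
    have c: "continuous_on UNIV w" using C1cD[OF w] by simp
    then have wm[measurable]: "w \<in> borel_measurable borel" by (rule borel_measurable_continuous_onI)
    define e where "e j x = \<bar>dyadic_part w j x\<bar>" for j x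
    have em[measurable]: "e j \<in> borel_measurable borel" for j
      unfolding e_def dyadic_part_def by (cases j) simp_all
    have e2: "integrable lborel (\<lambda>x. (e j x)\<^sup>2)" "(\<integral>x. (e j x)\<^sup>2 \<partial>lborel) \<le> C * (1 / 4) ^ j * D" for j
      using L2[OF w sup, of j] unfolding e_def D_def by auto
    define \<Lambda> where "\<Lambda> j = 2 ^ (j * DIM('a)) * (C * (1 / 4) ^ j * D)" for j :: nat
    have \<Lambda>: "(e j x)\<^sup>2 \<le> \<Lambda> j" for j x
    proof -
      have "(e j x)\<^sup>2 \<le> 2 ^ (j * DIM('a)) * (\<integral>x. (e j x)\<^sup>2 \<partial>lborel)"
      proof (rule cellwise_constant_sup_bound[OF em e2(1)])
        fix y assume "y \<in> cell j x"
        from dyadic_part_cell[OF this] show "e j y = e j x" unfolding e_def by simp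
      qed
      also have "\<dots> \<le> \<Lambda> j" unfolding \<Lambda>_def by (intro mult_left_mono e2) auto
      finally show ?thesis .
    qed
    have es: "e j x powr s \<le> \<Lambda> j powr ((s - 2) / 2) * (e j x)\<^sup>2" for j x
    proof (cases "e j x = 0")
      case False
      then have p: "e j x > 0" unfolding e_def by simp
      have "s = 2 * ((s - 2) / 2) + 2" by (simp add: field_simps)
      then have "e j x powr s = e j x powr (2 * ((s - 2) / 2) + 2)"
        by (rule arg_cong[where f = "\<lambda>t. e j x powr t"])
      also have "\<dots> = e j x powr (2 * ((s - 2) / 2)) * e j x powr 2" by (rule powr_add)
      also have "e j x powr (2 * ((s - 2) / 2)) = ((e j x)\<^sup>2) powr ((s - 2) / 2)"
        unfolding powr_powr[symmetric] using p by (simp only: powr_numeral)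
      also have "\<dots> \<le> \<Lambda> j powr ((s - 2) / 2)" using \<Lambda> s by (intro powr_mono2) auto
      finally show ?thesis using p by (simp add: mult_right_mono)
    qed simp
    have eint: "integrable lborel (\<lambda>x. e j x powr s)" for j
    proof (rule Bochner_Integration.integrable_bound)
      show "integrable lborel (\<lambda>x. \<Lambda> j powr ((s - 2) / 2) * (e j x)\<^sup>2)" using e2 by simp
      show "AE x in lborel. norm (e j x powr s) \<le> norm (\<Lambda> j powr ((s - 2) / 2) * (e j x)\<^sup>2)"
        using es by (intro AE_I2) simp
    qed measurable
    have ebound: "(\<integral>x. e j x powr s \<partial>lborel) \<le> C powr (s / 2) * D powr (s / 2) * \<rho> ^ j" for j
    proof -
      have "(\<integral>x. e j x powr s \<partial>lborel) \<le> (\<integral>x. \<Lambda> j powr ((s - 2) / 2) * (e j x)\<^sup>2 \<partial>lborel)"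
        using e2 by (intro integral_mono eint es) auto
      also have "\<dots> \<le> \<Lambda> j powr ((s - 2) / 2) * (C * (1 / 4) ^ j * D)" using e2[of j] by (simp add: mult_left_mono)
      also have "\<Lambda> j = (2 ^ DIM('a) / 4) ^ j * (C * D)"
        unfolding \<Lambda>_def by (simp add: power_divide power_one_over mult.commute[of j] power_mult)
      also have "((2 ^ DIM('a) / 4) ^ j * (C * D)) powr ((s - 2) / 2) * (C * (1 / 4) ^ j * D)
          = (((2 ^ DIM('a) / 4) powr ((s - 2) / 2)) ^ j * (1 / 4) ^ j) * ((C * D) powr ((s - 2) / 2) * (C * D))"
      proof -
        have "((2 ^ DIM('a) / 4 :: real) ^ j) powr ((s - 2) / 2) = ((2 ^ DIM('a) / 4) powr ((s - 2) / 2)) ^ j"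
          by (simp add: powr_power_commute)
        then show ?thesis using C D by (simp add: powr_mult)
      qed
      also have "((2 ^ DIM('a) / 4) powr ((s - 2) / 2)) ^ j * (1 / 4) ^ j = \<rho> ^ j"
        unfolding \<rho>_def by (simp add: power_divide flip: power_mult_distrib)
      also have "(C * D) powr ((s - 2) / 2) * (C * D) = C powr (s / 2) * D powr (s / 2)"
      proof (cases "D = 0")
        case False
        then have "C * D > 0" using C D by simp
        then have "(C * D) powr ((s - 2) / 2) * (C * D) = (C * D) powr ((s - 2) / 2 + 1)" by (simp add: powr_add)
        also have "(s - 2) / 2 + 1 = s / 2" by (simp add: field_simps)
        finally show ?thesis using C D by (simp add: powr_mult)
      qed (use s in simp)
      finally show ?thesis by (simp add: mult.commute)
    qed
    have avg_int: "integrable lborel (\<lambda>x. \<bar>avg n w x\<bar> powr s) \<and>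
        (\<integral>x. \<bar>avg n w x\<bar> powr s \<partial>lborel) \<le> K * D powr (s / 2)" for n
    proof
      define T where "T = (1 / (1 - \<sigma>)) powr (s - 1)"
      have T: "T \<ge> 0" unfolding T_def by simp
      have pt: "\<bar>avg n w x\<bar> powr s \<le> T * (\<Sum>j\<le>n. (\<sigma> powr (1 - s)) ^ j * e j x powr s)" for x
      proof -
        have "\<bar>avg n w x\<bar> \<le> (\<Sum>j\<le>n. e j x)" unfolding sum_dyadic_part[symmetric] e_def by (rule sum_abs)
        then have "\<bar>avg n w x\<bar> powr s \<le> (\<Sum>j\<le>n. e j x) powr s" using s by (intro powr_mono2) auto
        also have "\<dots> \<le> T * (\<Sum>j\<le>n. (\<sigma> powr (1 - s)) ^ j * e j x powr s)"
          unfolding T_def by (rule sum_powr_le) (use \<sigma> s in \<open>auto simp: e_def\<close>)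
        finally show ?thesis .
      qed
      have i: "integrable lborel (\<lambda>x. T * (\<Sum>j\<le>n. (\<sigma> powr (1 - s)) ^ j * e j x powr s))"
        using eint by (intro integrable_mult_right Bochner_Integration.integrable_sum) auto
      show i2: "integrable lborel (\<lambda>x. \<bar>avg n w x\<bar> powr s)"
        by (rule Bochner_Integration.integrable_bound[OF i], measurable)
           (use order_trans[OF pt abs_ge_self] in \<open>simp only: real_norm_def abs_of_nonneg[OF powr_ge_zero] AE_I2\<close>)
      have "(\<integral>x. \<bar>avg n w x\<bar> powr s \<partial>lborel) \<le> (\<integral>x. T * (\<Sum>j\<le>n. (\<sigma> powr (1 - s)) ^ j * e j x powr s) \<partial>lborel)"
        by (intro integral_mono i i2 pt)
      also have "\<dots> = T * (\<Sum>j\<le>n. (\<sigma> powr (1 - s)) ^ j * (\<integral>x. e j x powr s \<partial>lborel))"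
        using eint by (simp add: Bochner_Integration.integral_sum)
      also have "\<dots> \<le> T * (\<Sum>j\<le>n. (\<sigma> powr (1 - s)) ^ j * (C powr (s / 2) * D powr (s / 2) * \<rho> ^ j))"
        using T by (intro mult_left_mono sum_mono ebound) auto
      also have "\<dots> = T * (C powr (s / 2) * D powr (s / 2) * (\<Sum>j\<le>n. \<tau> ^ j))"
        unfolding \<tau>_def by (simp add: sum_distrib_left power_mult_distrib mult_ac)
      also have "\<dots> \<le> T * (C powr (s / 2) * D powr (s / 2) * (1 / (1 - \<tau>)))"
      proof (intro mult_left_mono T)
        have "(\<Sum>j\<le>n. \<tau> ^ j) = (1 - \<tau> ^ Suc n) / (1 - \<tau>)" using \<tau>1 by (subst sum_gp0) auto
        also have "\<dots> \<le> 1 / (1 - \<tau>)" using \<tau>1 \<tau>0 by (intro divide_right_mono) auto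
        finally show "(\<Sum>j\<le>n. \<tau> ^ j) \<le> 1 / (1 - \<tau>)" .
      qed auto
      finally show "(\<integral>x. \<bar>avg n w x\<bar> powr s \<partial>lborel) \<le> K * D powr (s / 2)"
        unfolding K_def T_def by (simp add: mult_ac)
    qed
    show ?thesis unfolding D_def[symmetric]
    proof (rule fatou_bound(2)[of lborel "\<lambda>n x. \<bar>avg n w x\<bar> powr s"])
      show "AE x in lborel. (\<lambda>n. \<bar>avg n w x\<bar> powr s) \<longlonglongrightarrow> \<bar>w x\<bar> powr s"
        using s by (intro AE_I2 tendsto_intros tendsto_powr' avg_tendsto[OF w]) auto
    qed (use avg_int in auto)
  qed
  with K show ?thesis using that[of K] by blast
qed

section \<open>Compactness in the mean square\<close>

text \<open>Averages are bounded at each level and constant on cells, hence determined by their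
  values on a countable dense set; a diagonal subsequence makes them converge everywhere, at every
  level. Dominated convergence turns this into convergence in the mean square, and by
  \<open>avg_L2_error\<close> the averages at a fine level are close to the functions uniformly in
  \<open>n\<close>.\<close>

lemma cauchy_subsequence_C1c:
  fixes w :: "nat \<Rightarrow> 'a::euclidean_space \<Rightarrow> real"
  assumes w: "\<And>n. C1c (w n)" and R: "R \<ge> 0" and sup: "\<And>n x. w n x \<noteq> 0 \<Longrightarrow> norm x \<le> R"
    and bd: "\<And>n. (\<integral>x. (norm (grad (w n) x))\<^sup>2 \<partial>lborel) \<le> B"
  obtains r :: "nat \<Rightarrow> nat" where "strict_mono r"
    "\<And>e. e > 0 \<Longrightarrow> \<exists>N. \<forall>a\<ge>N. \<forall>b\<ge>N. (\<integral>x. (w (r a) x - w (r b) x)\<^sup>2 \<partial>lborel) < e"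
proof -
  define P where "P = (2 * R + 1)\<^sup>2 * B"
  have B: "B \<ge> 0" by (rule order_trans[OF _ bd[of 0]]) simp
  have P: "P \<ge> 0" unfolding P_def using B by simp
  have wm[measurable]: "w n \<in> borel_measurable borel" for n
    using C1cD(2)[OF w] by (rule borel_measurable_continuous_onI)
  have w2: "(\<integral>x. (w n x)\<^sup>2 \<partial>lborel) \<le> P" for n
  proof -
    have "(\<integral>x. (w n x)\<^sup>2 \<partial>lborel) \<le> (2 * R + 1)\<^sup>2 * (\<integral>x. (norm (grad (w n) x))\<^sup>2 \<partial>lborel)"
      by (rule poincare_C1c[OF w R]) (rule sup)
    also have "\<dots> \<le> P" unfolding P_def by (rule mult_left_mono[OF bd]) simp
    finally show ?thesis .
  qed
  have A: "\<bar>avg j (w n) x\<bar> \<le> sqrt (2 ^ (j * DIM('a))) * sqrt P" for j n x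
  proof -
    have "(avg j (w n) x)\<^sup>2 \<le> 2 ^ (j * DIM('a)) * (\<integral>x. (w n x)\<^sup>2 \<partial>lborel)"
      by (rule avg_sup_bound[OF wm C1c_square_integrable(1)[OF w]])
    also have "\<dots> \<le> 2 ^ (j * DIM('a)) * P" by (intro mult_left_mono w2) auto
    finally have "sqrt ((avg j (w n) x)\<^sup>2) \<le> sqrt (2 ^ (j * DIM('a)) * P)" by (rule real_sqrt_le_mono)
    then show ?thesis by (simp add: real_sqrt_mult)
  qed
  obtain Q :: "'a set" where Q: "countable Q" "\<And>X. open X \<Longrightarrow> X \<noteq> {} \<Longrightarrow> \<exists>d\<in>Q. d \<in> X"
    by (rule countable_dense_setE) blast
  \<comment> \<open>The bound on averages grows with the level; dividing by its growth gives the
    single bound \<open>sqrt P\<close> for all levels and points, as the diagonal argument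
    requires.\<close>
  define f where "f n p = avg (fst p) (w n) (snd p) / sqrt (2 ^ (fst p * DIM('a)))" for n and p :: "nat \<times> 'a"
  have "norm (f n p) \<le> sqrt P" for n p
    using A[of "fst p" n "snd p"] unfolding f_def by (simp add: abs_divide pos_divide_le_eq mult.commute)
  moreover have "countable (UNIV \<times> Q :: (nat \<times> 'a) set)" using Q by auto
  ultimately obtain r :: "nat \<Rightarrow> nat" where r: "strict_mono r" and rl: "\<And>p. p \<in> UNIV \<times> Q \<Longrightarrow> \<exists>l. (\<lambda>n. f (r n) p) \<longlonglongrightarrow> l"
    using function_convergent_subsequence[of "UNIV \<times> Q" f "sqrt P"] by blast
  have conv: "\<exists>l. (\<lambda>n. avg j (w (r n)) x) \<longlonglongrightarrow> l" for j x
  proof -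
    define a where "a = (\<Sum>i\<in>Basis. (\<lfloor>2 ^ j * (x \<bullet> i)\<rfloor> / 2 ^ j) *\<^sub>R i)"
    define b where "b = a + (1 / 2 ^ j) *\<^sub>R One"
    have s: "box a b \<subseteq> cell j x" using box_subset_cell[of j x] unfolding a_def b_def by auto
    have "box a b \<noteq> {}" unfolding box_ne_empty b_def by (simp add: inner_add_left)
    then obtain d where d: "d \<in> Q" "d \<in> cell j x" using Q(2)[OF open_box, of a b] s by blast
    obtain l where "(\<lambda>n. f (r n) (j, d)) \<longlonglongrightarrow> l" using rl[of "(j, d)"] d by auto
    then have "(\<lambda>n. sqrt (2 ^ (j * DIM('a))) * f (r n) (j, d)) \<longlonglongrightarrow> sqrt (2 ^ (j * DIM('a))) * l" by (intro tendsto_intros)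
    then show ?thesis using avg_cell[OF d(2)] unfolding f_def by auto
  qed
  define L where "L j x = lim (\<lambda>n. avg j (w (r n)) x)" for j x
  have L: "(\<lambda>n. avg j (w (r n)) x) \<longlonglongrightarrow> L j x" for j x
    using conv[of j x] unfolding L_def by (simp add: convergent_def flip: convergent_LIMSEQ_iff)
  have Lm[measurable]: "L j \<in> borel_measurable borel" for j unfolding L_def by measurable
  define \<rho> where "\<rho> = R + DIM('a)"
  have As: "norm x \<le> \<rho>" if "avg j (w n) x \<noteq> 0" for j n x
  proof (rule ccontr)
    assume ne: "\<not> norm x \<le> \<rho>"
    have "indicator (cell j x) y * w n y = 0" for y
    proof (rule ccontr)
      assume "indicator (cell j x) y * w n y \<noteq> 0"
      then have y: "y \<in> cell j x" "w n y \<noteq> 0" by (auto simp: indicator_def split: if_splits)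
      have "norm (y - x) \<le> DIM('a) / 2 ^ j" by (rule cell_dist[OF y(1)])
      also have "\<dots> \<le> DIM('a)" by (simp add: divide_le_eq one_le_power)
      finally have "norm x \<le> norm y + DIM('a)" using norm_triangle_sub[of x y] by (simp add: norm_minus_commute)
      then show False using sup[OF y(2)] ne unfolding \<rho>_def by simp
    qed
    then have "avg j (w n) x = 0" unfolding avg_def by (simp only: integral_zero mult_zero_right)
    with that show False by simp
  qed
  have Ls: "norm x \<le> \<rho>" if "L j x \<noteq> 0" for j x
  proof (rule ccontr)
    assume "\<not> norm x \<le> \<rho>"
    then have "avg j (w (r n)) x = 0" for n using As[of j "r n" x] by blast
    then have "L j x = 0" using L[of j x] by (simp add: LIMSEQ_const_iff)
    with that show False by simp
  qed
  have Lb: "\<bar>L j x\<bar> \<le> sqrt (2 ^ (j * DIM('a))) * sqrt P" for j x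
    by (rule LIMSEQ_le_const2[OF tendsto_rabs[OF L]]) (use A in auto)
  have dom: "(avg j (w (r n)) x - L j x)\<^sup>2 \<le> (2 * (sqrt (2 ^ (j * DIM('a))) * sqrt P))\<^sup>2 * indicator (cball 0 \<rho>) x" for j n x
  proof (cases "norm x \<le> \<rho>")
    case True
    have "\<bar>avg j (w (r n)) x - L j x\<bar> \<le> 2 * (sqrt (2 ^ (j * DIM('a))) * sqrt P)"
      using A[of j "r n" x] Lb[of j x] by linarith
    from power_mono[OF this, of 2] show ?thesis using True by (simp add: dist_norm)
  next
    case False
    then have "avg j (w (r n)) x = 0" "L j x = 0" using As[of j "r n" x] Ls[of j x] by blast+
    then show ?thesis by simp
  qed
  have di: "integrable lborel (\<lambda>x::'a. (2 * (sqrt (2 ^ (j * DIM('a))) * sqrt P))\<^sup>2 * indicator (cball 0 \<rho>) x)" for j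
    using emeasure_lborel_cball_finite[of "0::'a" \<rho>] by (intro integrable_mult_right integrable_real_indicator) auto
  have AL: "integrable lborel (\<lambda>x. (avg j (w (r n)) x - L j x)\<^sup>2)" for j n
  proof (rule Bochner_Integration.integrable_bound[OF di])
    show "AE x in lborel. norm ((avg j (w (r n)) x - L j x)\<^sup>2) \<le> norm ((2 * (sqrt (2 ^ (j * DIM('a))) * sqrt P))\<^sup>2 * indicator (cball 0 \<rho>) x)"
      using order_trans[OF dom abs_ge_self] by (intro AE_I2) (simp only: real_norm_def abs_power2)
  qed measurable
  have lim: "(\<lambda>n. \<integral>x. (avg j (w (r n)) x - L j x)\<^sup>2 \<partial>lborel) \<longlonglongrightarrow> 0" for j
  proof -
    have "(\<lambda>n. \<integral>x. (avg j (w (r n)) x - L j x)\<^sup>2 \<partial>lborel) \<longlonglongrightarrow> (\<integral>x. 0 \<partial>(lborel :: 'a measure))"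
    proof (rule integral_dominated_convergence[where f = "\<lambda>x. 0" and s = "\<lambda>n x. (avg j (w (r n)) x - L j x)\<^sup>2"
          and w = "\<lambda>x. (2 * (sqrt (2 ^ (j * DIM('a))) * sqrt P))\<^sup>2 * indicator (cball 0 \<rho>) x"])
      show "AE x in lborel. (\<lambda>n. (avg j (w (r n)) x - L j x)\<^sup>2) \<longlonglongrightarrow> 0"
      proof (rule AE_I2)
        fix x
        have "(\<lambda>n. (avg j (w (r n)) x - L j x)\<^sup>2) \<longlonglongrightarrow> (L j x - L j x)\<^sup>2"
          by (rule tendsto_power[OF tendsto_diff[OF L tendsto_const]])
        then show "(\<lambda>n. (avg j (w (r n)) x - L j x)\<^sup>2) \<longlonglongrightarrow> 0" by simp
      qed
      show "AE x in lborel. norm ((avg j (w (r n)) x - L j x)\<^sup>2) \<le> (2 * (sqrt (2 ^ (j * DIM('a))) * sqrt P))\<^sup>2 * indicator (cball 0 \<rho>) x" for n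
        using dom by (intro AE_I2) simp
    qed (measurable, rule di)
    then show ?thesis by simp
  qed
  define C0 where "C0 = 2 ^ DIM('a) * (real DIM('a))\<^sup>2 * B"
  have main: "(\<integral>x. (w (r n) x - L j x)\<^sup>2 \<partial>lborel) \<le> 2 * (C0 * (1 / 4) ^ j) + 2 * (\<integral>x. (avg j (w (r n)) x - L j x)\<^sup>2 \<partial>lborel)"
    "integrable lborel (\<lambda>x. (w (r n) x - L j x)\<^sup>2)" for j n
  proof -
    have "(\<integral>x. (w (r n) x - avg j (w (r n)) x)\<^sup>2 \<partial>lborel) \<le> 2 ^ DIM('a) * (real DIM('a))\<^sup>2 * (1 / 4) ^ j * (\<integral>x. (norm (grad (w (r n)) x))\<^sup>2 \<partial>lborel)"
      by (rule avg_L2_error(2)[OF w])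
    also have "\<dots> \<le> 2 ^ DIM('a) * (real DIM('a))\<^sup>2 * (1 / 4) ^ j * B" by (intro mult_left_mono bd) auto
    finally have "(\<integral>x. (w (r n) x - avg j (w (r n)) x)\<^sup>2 \<partial>lborel) \<le> C0 * (1 / 4) ^ j" unfolding C0_def by (simp add: mult_ac)
    then show "(\<integral>x. (w (r n) x - L j x)\<^sup>2 \<partial>lborel) \<le> 2 * (C0 * (1 / 4) ^ j) + 2 * (\<integral>x. (avg j (w (r n)) x - L j x)\<^sup>2 \<partial>lborel)"
      "integrable lborel (\<lambda>x. (w (r n) x - L j x)\<^sup>2)"
      using square_triangle_integral[OF avg_L2_error(1)[OF w[of "r n"], of j] AL[of j n] wm Lm] by auto
  qed
  have "\<exists>N. \<forall>a\<ge>N. \<forall>b\<ge>N. (\<integral>x. (w (r a) x - w (r b) x)\<^sup>2 \<partial>lborel) < e" if e: "e > 0" for e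
  proof -
    \<comment> \<open>The level \<open>j\<close> is fixed before \<open>N\<close>. Both
      contributions to \<open>main\<close> are then below \<open>e / 8\<close>, so each function is
      within \<open>e / 4\<close> of \<open>L j\<close> in the mean square, and the doubling in the
      triangle inequality ends at \<open>e\<close>.\<close>
    have "(\<lambda>j. 2 * (C0 * (1 / 4) ^ j)) \<longlonglongrightarrow> 2 * (C0 * 0)"
      by (intro tendsto_intros LIMSEQ_realpow_zero) auto
    then have "\<forall>\<^sub>F j in sequentially. 2 * (C0 * (1 / 4) ^ j) < e / 8" by (rule order_tendstoD) (use e in simp)
    then obtain j where j: "2 * (C0 * (1 / 4) ^ j) < e / 8" by (auto simp: eventually_sequentially)
    have "\<forall>\<^sub>F n in sequentially. (\<integral>x. (avg j (w (r n)) x - L j x)\<^sup>2 \<partial>lborel) < e / 16"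
      by (rule order_tendstoD[OF lim]) (use e in simp)
    then obtain N where N: "\<And>n. n \<ge> N \<Longrightarrow> (\<integral>x. (avg j (w (r n)) x - L j x)\<^sup>2 \<partial>lborel) < e / 16"
      by (auto simp: eventually_sequentially)
    have sm: "(\<integral>x. (w (r n) x - L j x)\<^sup>2 \<partial>lborel) < e / 4" if "n \<ge> N" for n
      using main(1)[of n j] N[OF that] j by linarith
    have "(\<integral>x. (w (r a) x - w (r b) x)\<^sup>2 \<partial>lborel) < e" if "a \<ge> N" "b \<ge> N" for a b
    proof -
      have e: "(\<lambda>x. (L j x - w (r b) x)\<^sup>2) = (\<lambda>x. (w (r b) x - L j x)\<^sup>2)"
        by (rule ext) (rule power2_commute)
      have "integrable lborel (\<lambda>x. (L j x - w (r b) x)\<^sup>2)" unfolding e by (rule main(2))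
      from square_triangle_integral(2)[OF main(2)[of a j] this wm wm]
      show ?thesis unfolding e using sm[OF that(1)] sm[OF that(2)] by argo
    qed
    then show ?thesis by blast
  qed
  with r show ?thesis using that[of r] by blast
qed

section \<open>The space \<open>H10\<close>\<close>

context semi_hilbert
begin

lemma sum_tendsto:
  assumes "\<And>n::nat. x n \<in> X" "l \<in> X" "\<And>n. y n \<in> X" "k \<in> X"
    "(\<lambda>n. ip (x n - l) (x n - l)) \<longlonglongrightarrow> 0" "(\<lambda>n. ip (y n - k) (y n - k)) \<longlonglongrightarrow> 0"
  shows "(\<lambda>n. ip ((x n + y n) - (l + k)) ((x n + y n) - (l + k))) \<longlonglongrightarrow> 0"
proof (rule ip_tendsto_trans[where y = "\<lambda>n. l + y n"])
  have e: "x n + y n - (l + y n) = x n - l" "l + y n - (l + k) = y n - k" for n by simp_all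
  show "(\<lambda>n. ip (x n + y n - (l + y n)) (x n + y n - (l + y n))) \<longlonglongrightarrow> 0"
    "(\<lambda>n. ip (l + y n - (l + k)) (l + y n - (l + k))) \<longlonglongrightarrow> 0" unfolding e by (rule assms)+
qed (use assms in auto)

end

locale bounded_open =
  fixes \<Omega> :: "'a::euclidean_space set"
  assumes open_\<Omega>: "open \<Omega>" and bounded_\<Omega>: "bounded \<Omega>"
begin

lemma \<Omega>_sets: "\<Omega> \<in> sets lebesgue" "\<Omega> \<inter> space lebesgue \<in> sets lebesgue"
  using open_\<Omega> by auto

lemma finite_measure_\<Omega>: "finite_measure (lebesgue_on \<Omega>)"
  by (intro finite_measure_lebesgue_on bounded_set_imp_lmeasurable bounded_\<Omega> \<Omega>_sets)

lemma \<Omega>_radius: obtains R where "R \<ge> 0" "\<And>x. x \<in> \<Omega> \<Longrightarrow> norm x \<le> R"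
  using bounded_\<Omega> unfolding bounded_pos by (meson less_imp_le)

lemma continuous_measurable:
  fixes f :: "'a \<Rightarrow> 'b::euclidean_space"
  assumes "continuous_on UNIV f" shows "f \<in> borel_measurable (lebesgue_on \<Omega>)"
  by (rule continuous_imp_measurable_on_sets_lebesgue[OF continuous_on_subset[OF assms subset_UNIV] \<Omega>_sets(1)])

text \<open>The bridge between \<open>lebesgue_on \<Omega>\<close>, over which the function spaces
  are defined, and \<open>lborel\<close> on the whole space, over which translations act. Test
  functions and their gradients vanish off \<Omega>, so their integrals may be moved.\<close>

lemma integral_lborel_eq:
  fixes f :: "'a \<Rightarrow> 'b::euclidean_space"
  assumes f: "f \<in> borel_measurable borel" and z: "\<And>x. f x \<noteq> 0 \<Longrightarrow> x \<in> \<Omega>"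
  shows "integrable (lebesgue_on \<Omega>) f \<longleftrightarrow> integrable lborel f" "(\<integral>x. f x \<partial>lebesgue_on \<Omega>) = (\<integral>x. f x \<partial>lborel)"
proof -
  have e: "(\<lambda>x. indicator \<Omega> x *\<^sub>R f x) = f" using z by (auto simp: fun_eq_iff indicator_def)
  show "integrable (lebesgue_on \<Omega>) f \<longleftrightarrow> integrable lborel f"
    using integrable_restrict_space[OF \<Omega>_sets(2), of f] integrable_completion[of f lborel] f unfolding e by simp
  show "(\<integral>x. f x \<partial>lebesgue_on \<Omega>) = (\<integral>x. f x \<partial>lborel)"
    using integral_restrict_space[OF \<Omega>_sets(2), of f] integral_completion[of f lborel] f unfolding e by simp
qed

lemma L2_measurable: "u \<in> L2 \<Omega> \<Longrightarrow> u \<in> borel_measurable (lebesgue_on \<Omega>)"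
  by (simp add: L2_def)

lemma L2_integrable: assumes "u \<in> L2 \<Omega>" shows "integrable (lebesgue_on \<Omega>) u"
proof (rule Bochner_Integration.integrable_bound)
  interpret finite_measure "lebesgue_on \<Omega>" by (rule finite_measure_\<Omega>)
  show "integrable (lebesgue_on \<Omega>) (\<lambda>x. (norm (u x))\<^sup>2 + 1)" using assms by (auto simp: L2_def)
  have "t \<le> t\<^sup>2 + 1" for t :: real
  proof -
    have "2 * t \<le> t\<^sup>2 + 1" "0 \<le> t\<^sup>2" using sum_squares_bound[of t 1] by simp_all
    then show ?thesis by linarith
  qed
  then show "AE x in lebesgue_on \<Omega>. norm (u x) \<le> norm ((norm (u x))\<^sup>2 + 1)" by (intro AE_I2) simp
qed (use assms in \<open>simp add: L2_def\<close>)

lemma ipL_self: "ipL \<Omega> u u = (\<integral>x. (norm (u x))\<^sup>2 \<partial>lebesgue_on \<Omega>)"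
  by (simp add: ipL_def dot_square_norm)

lemma ipL_cong_AE:
  assumes "AE x in lebesgue_on \<Omega>. u x = u' x" "AE x in lebesgue_on \<Omega>. v x = v' x"
    "u \<in> L2 \<Omega>" "u' \<in> L2 \<Omega>" "v \<in> L2 \<Omega>" "v' \<in> L2 \<Omega>"
  shows "ipL \<Omega> u v = ipL \<Omega> u' v'"
  unfolding ipL_def
proof (rule integral_cong_AE)
  show "AE x in lebesgue_on \<Omega>. u x \<bullet> v x = u' x \<bullet> v' x"
    using assms(1,2) by eventually_elim simp
qed (rule borel_measurable_inner[OF L2_measurable L2_measurable]; fact)+

subsection \<open>Test functions\<close>

lemma test_C1c: assumes "\<phi> \<in> test_functions \<Omega>" shows "C1c \<phi>"
proof -
  have C: "C_on (Suc 0) UNIV \<phi>" and c: "compact (closure {x. \<phi> x \<noteq> 0})"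
    using assms by (auto simp: test_functions_def smooth_on_def)
  obtain R where R: "\<And>x. x \<in> closure {x. \<phi> x \<noteq> 0} \<Longrightarrow> norm x \<le> R"
    using compact_imp_bounded[OF c] unfolding bounded_iff by blast
  have "norm x \<le> R" if "\<phi> x \<noteq> 0" for x using R[of x] closure_subset[of "{x. \<phi> x \<noteq> 0}"] that by auto
  moreover have "continuous_on UNIV (grad \<phi>)"
    unfolding grad_def[abs_def] using C by (intro continuous_intros) auto
  ultimately show ?thesis using C unfolding C1c_def by auto
qed

lemma test_support:
  assumes "\<phi> \<in> test_functions \<Omega>" shows "\<phi> x \<noteq> 0 \<Longrightarrow> x \<in> \<Omega>" "grad \<phi> x \<noteq> 0 \<Longrightarrow> x \<in> \<Omega>"
proof -
  have s: "closure {x. \<phi> x \<noteq> 0} \<subseteq> \<Omega>" using assms by (auto simp: test_functions_def)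
  then show "\<phi> x \<noteq> 0 \<Longrightarrow> x \<in> \<Omega>" using closure_subset[of "{x. \<phi> x \<noteq> 0}"] by auto
  have "grad \<phi> x = 0" if "x \<notin> \<Omega>"
  proof (rule grad_eqI)
    have o: "open (- closure {x. \<phi> x \<noteq> 0})" by (simp add: open_closed)
    have x: "x \<in> - closure {x. \<phi> x \<noteq> 0}" using that s by auto
    have z: "0 = \<phi> y" if "y \<in> - closure {x. \<phi> x \<noteq> 0}" for y
      using that closure_subset[of "{x. \<phi> x \<noteq> 0}"] by auto
    have "((\<lambda>x. 0) has_derivative (\<lambda>z. 0 \<bullet> z)) (at x)" by simp
    then show "(\<phi> has_derivative (\<lambda>z. 0 \<bullet> z)) (at x)"
      using has_derivative_transform_within_open[of "\<lambda>x. 0" "\<lambda>z. 0 \<bullet> z" x UNIV "- closure {x. \<phi> x \<noteq> 0}" \<phi>] o x z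
      by blast
  qed
  then show "grad \<phi> x \<noteq> 0 \<Longrightarrow> x \<in> \<Omega>" by blast
qed

lemma test_measurable:
  assumes "\<phi> \<in> test_functions \<Omega>" shows "\<phi> \<in> borel_measurable borel" "grad \<phi> \<in> borel_measurable borel"
  using C1cD(2,3)[OF test_C1c[OF assms]] by (auto intro: borel_measurable_continuous_onI)

lemma test_L2: assumes "\<phi> \<in> test_functions \<Omega>" shows "\<phi> \<in> L2 \<Omega>" "grad \<phi> \<in> L2 \<Omega>"
proof -
  note [measurable] = test_measurable[OF assms]
  note c = C1cD(2,3)[OF test_C1c[OF assms]] and i = C1c_square_integrable[OF test_C1c[OF assms]]
  have "integrable (lebesgue_on \<Omega>) (\<lambda>x. (norm (\<phi> x))\<^sup>2)"
    by (subst integral_lborel_eq(1)) (use i test_support[OF assms] in auto)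
  then show "\<phi> \<in> L2 \<Omega>" using continuous_measurable[OF c(1)] by (simp add: L2_def)
  have "integrable (lebesgue_on \<Omega>) (\<lambda>x. (norm (grad \<phi> x))\<^sup>2)"
    by (subst integral_lborel_eq(1)) (use i test_support[OF assms] in auto)
  then show "grad \<phi> \<in> L2 \<Omega>" using continuous_measurable[OF c(2)] by (simp add: L2_def)
qed

lemma test_ipL:
  assumes "\<phi> \<in> test_functions \<Omega>"
  shows "ipL \<Omega> \<phi> \<phi> = (\<integral>x. (\<phi> x)\<^sup>2 \<partial>lborel)" "ipL \<Omega> (grad \<phi>) (grad \<phi>) = (\<integral>x. (norm (grad \<phi> x))\<^sup>2 \<partial>lborel)"
proof -
  note [measurable] = test_measurable[OF assms]
  show "ipL \<Omega> \<phi> \<phi> = (\<integral>x. (\<phi> x)\<^sup>2 \<partial>lborel)"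
    unfolding ipL_self by (subst integral_lborel_eq(2)) (use test_support[OF assms] in auto)
  show "ipL \<Omega> (grad \<phi>) (grad \<phi>) = (\<integral>x. (norm (grad \<phi> x))\<^sup>2 \<partial>lborel)"
    unfolding ipL_self by (subst integral_lborel_eq(2)) (use test_support[OF assms] in auto)
qed

lemma test_functionI:
  assumes "smooth_on UNIV \<psi>" "\<phi>1 \<in> test_functions \<Omega>" "\<phi>2 \<in> test_functions \<Omega>"
    "\<And>x. \<psi> x \<noteq> 0 \<Longrightarrow> \<phi>1 x \<noteq> 0 \<or> \<phi>2 x \<noteq> 0"
  shows "\<psi> \<in> test_functions \<Omega>"
proof -
  have "closure {x. \<psi> x \<noteq> 0} \<subseteq> closure {x. \<phi>1 x \<noteq> 0} \<union> closure {x. \<phi>2 x \<noteq> 0}"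
    unfolding closure_Un[symmetric] by (intro closure_mono) (use assms(4) in auto)
  moreover have "compact (closure {x. \<phi>1 x \<noteq> 0} \<union> closure {x. \<phi>2 x \<noteq> 0})"
    using assms(2,3) by (auto simp: test_functions_def)
  ultimately have "compact (closure {x. \<psi> x \<noteq> 0})"
    using compact_Int_closed[of "closure {x. \<phi>1 x \<noteq> 0} \<union> closure {x. \<phi>2 x \<noteq> 0}" "closure {x. \<psi> x \<noteq> 0}"]
    by (simp add: Int_absorb1 inf.absorb_iff2)
  then show ?thesis
    using \<open>closure {x. \<psi> x \<noteq> 0} \<subseteq> _\<close> assms(1-3) by (auto simp: test_functions_def)
qed

lemma test_add: assumes "\<phi> \<in> test_functions \<Omega>" "\<psi> \<in> test_functions \<Omega>" shows "\<phi> + \<psi> \<in> test_functions \<Omega>"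
  by (rule test_functionI[OF _ assms])
     (use assms in \<open>auto simp: test_functions_def smooth_on_def plus_fun_def intro: C_on_add\<close>)

lemma test_mult: assumes "\<phi> \<in> test_functions \<Omega>" "\<psi> \<in> test_functions \<Omega>" shows "(\<lambda>x. \<phi> x * \<psi> x) \<in> test_functions \<Omega>"
  by (rule test_functionI[OF _ assms])
     (use assms in \<open>auto simp: test_functions_def smooth_on_def intro: C_on_mult\<close>)

lemma test_scale: assumes "\<phi> \<in> test_functions \<Omega>" shows "c *\<^sub>R \<phi> \<in> test_functions \<Omega>"
  by (rule test_functionI[OF _ assms assms])
     (use assms in \<open>auto simp: test_functions_def smooth_on_def scaleR_fun_def intro!: C_on_mult C_on_const\<close>)

lemma test_zero: "0 \<in> test_functions \<Omega>"
  by (auto simp: test_functions_def smooth_on_def zero_fun_def C_on_const)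

lemma test_partial: assumes "\<phi> \<in> test_functions \<Omega>" shows "frechet_derivative \<phi> (at x) i = grad \<phi> x \<bullet> i"
  using frechet_derivative_at[OF C1cD(1)[OF test_C1c[OF assms]]] by metis

lemma grad_add: assumes "\<phi> \<in> test_functions \<Omega>" "\<psi> \<in> test_functions \<Omega>" shows "grad (\<phi> + \<psi>) = grad \<phi> + grad \<psi>"
proof
  fix x
  show "grad (\<phi> + \<psi>) x = (grad \<phi> + grad \<psi>) x"
    using has_derivative_add[OF C1cD(1)[OF test_C1c[OF assms(1)]] C1cD(1)[OF test_C1c[OF assms(2)]], of x]
    by (intro grad_eqI) (simp add: plus_fun_def inner_add_left)
qed

lemma grad_scale: assumes "\<phi> \<in> test_functions \<Omega>" shows "grad (c *\<^sub>R \<phi>) = c *\<^sub>R grad \<phi>"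
proof
  fix x
  show "grad (c *\<^sub>R \<phi>) x = (c *\<^sub>R grad \<phi>) x"
    using has_derivative_scaleR_right[OF C1cD(1)[OF test_C1c[OF assms(1)]], of c x]
    by (intro grad_eqI) (simp add: scaleR_fun_def)
qed

subsection \<open>Weak gradients\<close>

lemma partial_L2: "\<phi> \<in> test_functions \<Omega> \<Longrightarrow> i \<in> Basis \<Longrightarrow> (\<lambda>x. grad \<phi> x \<bullet> i) \<in> L2 \<Omega>"
proof -
  assume \<phi>: "\<phi> \<in> test_functions \<Omega>" and i: "i \<in> Basis"
  have m: "(\<lambda>x. grad \<phi> x \<bullet> i) \<in> borel_measurable (lebesgue_on \<Omega>)"
    using L2_measurable[OF test_L2(2)[OF \<phi>]] by simp
  have "integrable (lebesgue_on \<Omega>) (\<lambda>x. (norm (grad \<phi> x \<bullet> i))\<^sup>2)"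
  proof (rule Bochner_Integration.integrable_bound)
    show "integrable (lebesgue_on \<Omega>) (\<lambda>x. (norm (grad \<phi> x))\<^sup>2)" using test_L2(2)[OF \<phi>] by (simp add: L2_def)
    have "(norm (grad \<phi> x \<bullet> i))\<^sup>2 \<le> (norm (grad \<phi> x))\<^sup>2" for x
      using Basis_le_norm[OF i, of "grad \<phi> x"] by (intro power_mono) auto
    then show "AE x in lebesgue_on \<Omega>. norm ((norm (grad \<phi> x \<bullet> i))\<^sup>2) \<le> norm ((norm (grad \<phi> x))\<^sup>2)"
      by (intro AE_I2) simp
  qed (use m in measurable)
  with m show ?thesis by (simp add: L2_def)
qed

lemma scaled_basis_L2: assumes "\<phi> \<in> test_functions \<Omega>" "i \<in> Basis" shows "(\<lambda>x. \<phi> x *\<^sub>R i) \<in> L2 \<Omega>"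
proof -
  have m: "\<phi> \<in> borel_measurable (lebesgue_on \<Omega>)" by (rule L2_measurable[OF test_L2(1)[OF assms(1)]])
  have "(\<lambda>x. \<phi> x *\<^sub>R i) \<in> borel_measurable (lebesgue_on \<Omega>)" by (rule borel_measurable_scaleR[OF m]) simp
  then show ?thesis using test_L2(1)[OF assms(1)] assms(2) by (simp add: L2_def)
qed

text \<open>Both sides are written as \<open>L2\<close> pairings with fixed elements. Linearity and
  stability of the relation under limits then follow from the corresponding facts about the inner
  product.\<close>

lemma weak_gradient_iff:
  "is_weak_gradient \<Omega> u g \<longleftrightarrow> (\<forall>\<phi>\<in>test_functions \<Omega>. \<forall>i\<in>Basis.
     ipL \<Omega> u (\<lambda>x. grad \<phi> x \<bullet> i) = - ipL \<Omega> g (\<lambda>x. \<phi> x *\<^sub>R i))"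
  unfolding is_weak_gradient_def ipL_def by (simp add: test_partial mult.commute)

lemma is_weak_gradient_add:
  assumes "u \<in> L2 \<Omega>" "v \<in> L2 \<Omega>" "g \<in> L2 \<Omega>" "h \<in> L2 \<Omega>" "is_weak_gradient \<Omega> u g" "is_weak_gradient \<Omega> v h"
  shows "is_weak_gradient \<Omega> (u + v) (g + h)"
  using assms by (simp add: weak_gradient_iff L2.ip_add_left partial_L2 scaled_basis_L2)

lemma is_weak_gradient_scale:
  assumes "u \<in> L2 \<Omega>" "g \<in> L2 \<Omega>" "is_weak_gradient \<Omega> u g"
  shows "is_weak_gradient \<Omega> (c *\<^sub>R u) (c *\<^sub>R g)"
  using assms by (simp add: weak_gradient_iff L2.ip_scale_left partial_L2 scaled_basis_L2)

lemma is_weak_gradient_diff: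
  assumes "u \<in> L2 \<Omega>" "v \<in> L2 \<Omega>" "g \<in> L2 \<Omega>" "h \<in> L2 \<Omega>" "is_weak_gradient \<Omega> u g" "is_weak_gradient \<Omega> v h"
  shows "is_weak_gradient \<Omega> (u - v) (g - h)"
  using assms by (simp add: weak_gradient_iff L2.ip_diff_left partial_L2 scaled_basis_L2)

lemma is_weak_gradient_limit:
  assumes "\<And>n::nat. u n \<in> L2 \<Omega>" "\<And>n. g n \<in> L2 \<Omega>" "v \<in> L2 \<Omega>" "h \<in> L2 \<Omega>"
    and "\<And>n. is_weak_gradient \<Omega> (u n) (g n)"
    and "(\<lambda>n. ipL \<Omega> (u n - v) (u n - v)) \<longlonglongrightarrow> 0" "(\<lambda>n. ipL \<Omega> (g n - h) (g n - h)) \<longlonglongrightarrow> 0"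
  shows "is_weak_gradient \<Omega> v h"
  unfolding weak_gradient_iff
proof (intro ballI)
  fix \<phi> and i :: 'a assume \<phi>: "\<phi> \<in> test_functions \<Omega>" and i: "i \<in> Basis"
  have "(\<lambda>n. ipL \<Omega> (u n) (\<lambda>x. grad \<phi> x \<bullet> i)) \<longlonglongrightarrow> ipL \<Omega> v (\<lambda>x. grad \<phi> x \<bullet> i)"
    by (rule L2.ip_tendsto[OF assms(1,3) partial_L2[OF \<phi> i] assms(6)])
  moreover have "(\<lambda>n. - ipL \<Omega> (g n) (\<lambda>x. \<phi> x *\<^sub>R i)) \<longlonglongrightarrow> - ipL \<Omega> h (\<lambda>x. \<phi> x *\<^sub>R i)"
    by (rule tendsto_minus[OF L2.ip_tendsto[OF assms(2,4) scaled_basis_L2[OF \<phi> i] assms(7)]])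
  moreover have "ipL \<Omega> (u n) (\<lambda>x. grad \<phi> x \<bullet> i) = - ipL \<Omega> (g n) (\<lambda>x. \<phi> x *\<^sub>R i)" for n
    using assms(5)[of n] \<phi> i by (simp add: weak_gradient_iff)
  ultimately show "ipL \<Omega> v (\<lambda>x. grad \<phi> x \<bullet> i) = - ipL \<Omega> h (\<lambda>x. \<phi> x *\<^sub>R i)"
    using LIMSEQ_unique by auto
qed

text \<open>Integration by parts: the product of two test functions is a test function, and the
  integral of its partial derivatives is zero by \<open>integral_grad_zero\<close>.\<close>

lemma is_weak_gradient_test: assumes \<phi>: "\<phi> \<in> test_functions \<Omega>" shows "is_weak_gradient \<Omega> \<phi> (grad \<phi>)"
  unfolding weak_gradient_iff
proof (intro ballI)
  fix \<psi> and i :: 'a assume \<psi>: "\<psi> \<in> test_functions \<Omega>" and i: "i \<in> Basis"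
  have g: "grad (\<lambda>x. \<phi> x * \<psi> x) x = \<phi> x *\<^sub>R grad \<psi> x + \<psi> x *\<^sub>R grad \<phi> x" for x
    using has_derivative_mult[OF C1cD(1)[OF test_C1c[OF \<phi>]] C1cD(1)[OF test_C1c[OF \<psi>]], of x]
    by (intro grad_eqI) (simp add: inner_add_left algebra_simps)
  have i1: "integrable (lebesgue_on \<Omega>) (\<lambda>x. \<phi> x * (grad \<psi> x \<bullet> i))"
    using L2_inner_integrable[OF test_L2(1)[OF \<phi>] partial_L2[OF \<psi> i]] by simp
  have i2: "integrable (lebesgue_on \<Omega>) (\<lambda>x. grad \<phi> x \<bullet> (\<psi> x *\<^sub>R i))"
    by (rule L2_inner_integrable[OF test_L2(2)[OF \<phi>] scaled_basis_L2[OF \<psi> i]])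
  note [measurable] = test_measurable[OF \<phi>] test_measurable[OF \<psi>]
  have "0 = (\<integral>x. grad (\<lambda>x. \<phi> x * \<psi> x) x \<bullet> i \<partial>lborel)"
    using integral_grad_zero[OF test_C1c[OF test_mult[OF \<phi> \<psi>]]] by simp
  also have "\<dots> = (\<integral>x. grad (\<lambda>x. \<phi> x * \<psi> x) x \<bullet> i \<partial>lebesgue_on \<Omega>)"
    by (rule integral_lborel_eq(2)[symmetric]) (use test_measurable[OF test_mult[OF \<phi> \<psi>]] test_support(2)[OF test_mult[OF \<phi> \<psi>]] in force)+
  also have "\<dots> = (\<integral>x. \<phi> x * (grad \<psi> x \<bullet> i) + grad \<phi> x \<bullet> (\<psi> x *\<^sub>R i) \<partial>lebesgue_on \<Omega>)"
    unfolding g by (simp add: inner_add_left)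
  also have "\<dots> = (\<integral>x. \<phi> x * (grad \<psi> x \<bullet> i) \<partial>lebesgue_on \<Omega>) + (\<integral>x. grad \<phi> x \<bullet> (\<psi> x *\<^sub>R i) \<partial>lebesgue_on \<Omega>)"
    by (rule Bochner_Integration.integral_add[OF i1 i2])
  finally show "ipL \<Omega> \<phi> (\<lambda>x. grad \<psi> x \<bullet> i) = - ipL \<Omega> (grad \<phi>) (\<lambda>x. \<psi> x *\<^sub>R i)"
    unfolding ipL_def inner_real_def by linarith
qed

text \<open>The fundamental lemma, applied to each component of the difference. This is what makes
  the choice in \<open>weak_gradient\<close> harmless under integrals.\<close>

lemma weak_gradient_unique:
  assumes "g \<in> L2 \<Omega>" "h \<in> L2 \<Omega>" "is_weak_gradient \<Omega> u g" "is_weak_gradient \<Omega> u h"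
  shows "AE x in lebesgue_on \<Omega>. g x = h x"
proof -
  have d: "g - h \<in> L2 \<Omega>" using assms by auto
  have "AE x in lebesgue_on \<Omega>. (g - h) x \<bullet> i = 0" if i: "i \<in> Basis" for i
  proof (rule fundamental_lemma[OF open_\<Omega>])
    show "integrable (lebesgue_on \<Omega>) (\<lambda>x. (g - h) x \<bullet> i)" using L2_integrable[OF d] by (rule integrable_inner_left)
    fix \<phi> assume \<phi>: "\<phi> \<in> test_functions \<Omega>"
    have "ipL \<Omega> g (\<lambda>x. \<phi> x *\<^sub>R i) = ipL \<Omega> h (\<lambda>x. \<phi> x *\<^sub>R i)"
      using assms \<phi> i by (metis weak_gradient_iff neg_equal_iff_equal)
    then have "ipL \<Omega> (g - h) (\<lambda>x. \<phi> x *\<^sub>R i) = 0"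
      using assms scaled_basis_L2[OF \<phi> i] by (simp add: L2.ip_diff_left)
    then show "(\<integral>x. (g - h) x \<bullet> i * \<phi> x \<partial>lebesgue_on \<Omega>) = 0" by (simp add: ipL_def mult.commute)
  qed
  then have "AE x in lebesgue_on \<Omega>. \<forall>i\<in>Basis. (g - h) x \<bullet> i = 0" by (intro AE_finite_allI) auto
  then show ?thesis by eventually_elim (auto simp: inner_diff_left intro: euclidean_eqI)
qed

lemma H1D:
  assumes "u \<in> H1 \<Omega>"
  shows "u \<in> L2 \<Omega>" "weak_gradient \<Omega> u \<in> L2 \<Omega>" "is_weak_gradient \<Omega> u (weak_gradient \<Omega> u)"
proof -
  show "u \<in> L2 \<Omega>" using assms by (simp add: H1_def)
  have "\<exists>g. g \<in> L2 \<Omega> \<and> is_weak_gradient \<Omega> u g" using assms by (auto simp: H1_def)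
  from someI_ex[OF this] show "weak_gradient \<Omega> u \<in> L2 \<Omega>" "is_weak_gradient \<Omega> u (weak_gradient \<Omega> u)"
    unfolding weak_gradient_def by auto
qed

lemma H1_I: "u \<in> L2 \<Omega> \<Longrightarrow> g \<in> L2 \<Omega> \<Longrightarrow> is_weak_gradient \<Omega> u g \<Longrightarrow> u \<in> H1 \<Omega>"
  by (auto simp: H1_def)

lemma weak_gradient_AE:
  assumes "u \<in> L2 \<Omega>" "g \<in> L2 \<Omega>" "is_weak_gradient \<Omega> u g"
  shows "AE x in lebesgue_on \<Omega>. weak_gradient \<Omega> u x = g x"
  using weak_gradient_unique[OF H1D(2)[OF H1_I[OF assms]] assms(2) H1D(3)[OF H1_I[OF assms]] assms(3)] .

text \<open>The Dirichlet form alone, without the \<open>L2\<close> part of the \<open>H1\<close>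
  norm. On \<open>H10\<close> the Poincare inequality makes it control the \<open>L2\<close> norm,
  and its quadratic form is the quantity that occurs in the equation.\<close>

definition ipH :: "('a \<Rightarrow> real) \<Rightarrow> ('a \<Rightarrow> real) \<Rightarrow> real" where
  "ipH u v = ipL \<Omega> (weak_gradient \<Omega> u) (weak_gradient \<Omega> v)"

lemma dirichlet_ipH: "dirichlet_integral \<Omega> u = ipH u u"
  by (simp add: dirichlet_integral_def ipH_def ipL_self)

lemma ipH_eq:
  assumes "u \<in> L2 \<Omega>" "g \<in> L2 \<Omega>" "is_weak_gradient \<Omega> u g" "v \<in> L2 \<Omega>" "h \<in> L2 \<Omega>" "is_weak_gradient \<Omega> v h"
  shows "ipH u v = ipL \<Omega> g h"
  unfolding ipH_def
  by (rule ipL_cong_AE) (use assms H1_I weak_gradient_AE H1D in blast)+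

text \<open>\<open>H1_norm\<close> conceals the weak gradient chosen for the difference of the test
  function and \<open>u\<close>. Here it is replaced by two separate \<open>L2\<close> limits in
  which \<open>g\<close> may be any weak gradient of \<open>u\<close>, a form suited to exhibiting
  members of \<open>H10\<close>.\<close>

lemma H10_iff:
  "u \<in> H10 \<Omega> \<longleftrightarrow> u \<in> L2 \<Omega> \<and> (\<exists>g\<in>L2 \<Omega>. \<exists>\<phi>. (\<forall>n::nat. \<phi> n \<in> test_functions \<Omega>) \<and>
     (\<lambda>n. ipL \<Omega> (\<phi> n - u) (\<phi> n - u)) \<longlonglongrightarrow> 0 \<and> (\<lambda>n. ipL \<Omega> (grad (\<phi> n) - g) (grad (\<phi> n) - g)) \<longlonglongrightarrow> 0 \<and>
     is_weak_gradient \<Omega> u g)"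
proof -
  have nrm: "H1_norm \<Omega> (\<lambda>x. \<phi> x - u x) = sqrt (ipL \<Omega> (\<phi> - u) (\<phi> - u) + ipL \<Omega> (grad \<phi> - g) (grad \<phi> - g))"
    if u: "u \<in> L2 \<Omega>" "g \<in> L2 \<Omega>" "is_weak_gradient \<Omega> u g" and \<phi>: "\<phi> \<in> test_functions \<Omega>" for \<phi> u g
  proof -
    have d: "\<phi> - u \<in> L2 \<Omega>" "grad \<phi> - g \<in> L2 \<Omega>" "is_weak_gradient \<Omega> (\<phi> - u) (grad \<phi> - g)"
      using u test_L2[OF \<phi>] is_weak_gradient_diff[OF test_L2(1)[OF \<phi>] u(1) test_L2(2)[OF \<phi>] u(2) is_weak_gradient_test[OF \<phi>] u(3)] by auto
    have e: "(\<lambda>x. \<phi> x - u x) = \<phi> - u" by (simp add: fun_diff_def)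
    show ?thesis unfolding H1_norm_def e dirichlet_ipH ipH_eq[OF d d] by (simp add: ipL_self)
  qed
  show ?thesis
  proof
    assume u: "u \<in> H10 \<Omega>"
    then have u1: "u \<in> H1 \<Omega>" by (simp add: H10_def)
    note uu = H1D[OF u1]
    obtain \<phi> where \<phi>: "\<And>n::nat. \<phi> n \<in> test_functions \<Omega>" and lim: "(\<lambda>n. H1_norm \<Omega> (\<lambda>x. \<phi> n x - u x)) \<longlonglongrightarrow> 0"
      using u by (auto simp: H10_def)
    define A B where "A n = ipL \<Omega> (\<phi> n - u) (\<phi> n - u)"
      and "B n = ipL \<Omega> (grad (\<phi> n) - weak_gradient \<Omega> u) (grad (\<phi> n) - weak_gradient \<Omega> u)" for n
    have pos: "A n \<ge> 0" "B n \<ge> 0" for n unfolding A_def B_def by (auto simp: ipL_self)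
    have "(\<lambda>n. (sqrt (A n + B n))\<^sup>2) \<longlonglongrightarrow> 0\<^sup>2"
      using tendsto_power[OF lim, of 2] unfolding nrm[OF uu \<phi>] A_def B_def .
    then have z: "(\<lambda>n. A n + B n) \<longlonglongrightarrow> 0" using pos by simp
    have "A \<longlonglongrightarrow> 0" "B \<longlonglongrightarrow> 0"
      by (rule Lim_null_comparison[OF always_eventually z], use pos in simp)+
    then show "u \<in> L2 \<Omega> \<and> (\<exists>g\<in>L2 \<Omega>. \<exists>\<phi>. (\<forall>n::nat. \<phi> n \<in> test_functions \<Omega>) \<and>
     (\<lambda>n. ipL \<Omega> (\<phi> n - u) (\<phi> n - u)) \<longlonglongrightarrow> 0 \<and> (\<lambda>n. ipL \<Omega> (grad (\<phi> n) - g) (grad (\<phi> n) - g)) \<longlonglongrightarrow> 0 \<and>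
     is_weak_gradient \<Omega> u g)"
      using uu \<phi> unfolding A_def B_def by blast
  next
    assume "u \<in> L2 \<Omega> \<and> (\<exists>g\<in>L2 \<Omega>. \<exists>\<phi>. (\<forall>n::nat. \<phi> n \<in> test_functions \<Omega>) \<and>
     (\<lambda>n. ipL \<Omega> (\<phi> n - u) (\<phi> n - u)) \<longlonglongrightarrow> 0 \<and> (\<lambda>n. ipL \<Omega> (grad (\<phi> n) - g) (grad (\<phi> n) - g)) \<longlonglongrightarrow> 0 \<and>
     is_weak_gradient \<Omega> u g)"
    then obtain g \<phi> where u: "u \<in> L2 \<Omega>" "g \<in> L2 \<Omega>" "is_weak_gradient \<Omega> u g" and \<phi>: "\<And>n::nat. \<phi> n \<in> test_functions \<Omega>"
      and lim: "(\<lambda>n. ipL \<Omega> (\<phi> n - u) (\<phi> n - u)) \<longlonglongrightarrow> 0" "(\<lambda>n. ipL \<Omega> (grad (\<phi> n) - g) (grad (\<phi> n) - g)) \<longlonglongrightarrow> 0"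
      by auto
    have "(\<lambda>n. H1_norm \<Omega> (\<lambda>x. \<phi> n x - u x)) \<longlonglongrightarrow> sqrt (0 + 0)"
      unfolding nrm[OF u \<phi>] by (intro tendsto_intros lim)
    then show "u \<in> H10 \<Omega>" using \<phi> H1_I[OF u] by (auto simp: H10_def)
  qed
qed

lemma H10D:
  assumes "u \<in> H10 \<Omega>"
  shows "u \<in> L2 \<Omega>" "weak_gradient \<Omega> u \<in> L2 \<Omega>" "is_weak_gradient \<Omega> u (weak_gradient \<Omega> u)"
  using assms H1D by (auto simp: H10_def)

lemma H10_approx:
  assumes u: "u \<in> H10 \<Omega>"
  obtains \<phi> where "\<And>n::nat. \<phi> n \<in> test_functions \<Omega>" "(\<lambda>n. ipL \<Omega> (\<phi> n - u) (\<phi> n - u)) \<longlonglongrightarrow> 0"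
    "(\<lambda>n. ipL \<Omega> (grad (\<phi> n) - weak_gradient \<Omega> u) (grad (\<phi> n) - weak_gradient \<Omega> u)) \<longlonglongrightarrow> 0"
proof -
  obtain g \<phi> where g: "g \<in> L2 \<Omega>" "is_weak_gradient \<Omega> u g" and \<phi>: "\<And>n::nat. \<phi> n \<in> test_functions \<Omega>"
      and lim: "(\<lambda>n. ipL \<Omega> (\<phi> n - u) (\<phi> n - u)) \<longlonglongrightarrow> 0" "(\<lambda>n. ipL \<Omega> (grad (\<phi> n) - g) (grad (\<phi> n) - g)) \<longlonglongrightarrow> 0"
    using u unfolding H10_iff by blast
  have ae: "AE x in lebesgue_on \<Omega>. weak_gradient \<Omega> u x = g x"
    by (rule weak_gradient_AE[OF H10D(1)[OF u] g])
  have "ipL \<Omega> (grad (\<phi> n) - weak_gradient \<Omega> u) (grad (\<phi> n) - weak_gradient \<Omega> u) = ipL \<Omega> (grad (\<phi> n) - g) (grad (\<phi> n) - g)" for n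
  proof -
    have "AE x in lebesgue_on \<Omega>. (grad (\<phi> n) - weak_gradient \<Omega> u) x = (grad (\<phi> n) - g) x"
      using ae by eventually_elim simp
    then show ?thesis using H10D(2)[OF u] g(1) test_L2(2)[OF \<phi>] by (intro ipL_cong_AE) auto
  qed
  then show ?thesis using that[of \<phi>, OF \<phi> lim(1)] lim(2) by simp
qed

lemma subspace_H10: "subspace (H10 \<Omega>)"
proof (rule subspaceI)
  have "ipL \<Omega> 0 0 = 0" "grad 0 = (0 :: 'a \<Rightarrow> 'a)" using grad_scale[OF test_zero, of 0] by simp_all
  then show "0 \<in> H10 \<Omega>"
    unfolding H10_iff using test_zero is_weak_gradient_test[OF test_zero] by (auto intro!: bexI[of _ 0] exI[of _ "\<lambda>n. 0"])
next
  fix u v assume u: "u \<in> H10 \<Omega>" and v: "v \<in> H10 \<Omega>"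
  obtain \<phi> where \<phi>: "\<And>n::nat. \<phi> n \<in> test_functions \<Omega>" "(\<lambda>n. ipL \<Omega> (\<phi> n - u) (\<phi> n - u)) \<longlonglongrightarrow> 0"
    "(\<lambda>n. ipL \<Omega> (grad (\<phi> n) - weak_gradient \<Omega> u) (grad (\<phi> n) - weak_gradient \<Omega> u)) \<longlonglongrightarrow> 0"
    using H10_approx[OF u] by blast
  obtain \<psi> where \<psi>: "\<And>n::nat. \<psi> n \<in> test_functions \<Omega>" "(\<lambda>n. ipL \<Omega> (\<psi> n - v) (\<psi> n - v)) \<longlonglongrightarrow> 0"
    "(\<lambda>n. ipL \<Omega> (grad (\<psi> n) - weak_gradient \<Omega> v) (grad (\<psi> n) - weak_gradient \<Omega> v)) \<longlonglongrightarrow> 0"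
    using H10_approx[OF v] by blast
  note uv = H10D[OF u] H10D[OF v]
  have "(\<lambda>n. ipL \<Omega> ((\<phi> n + \<psi> n) - (u + v)) ((\<phi> n + \<psi> n) - (u + v))) \<longlonglongrightarrow> 0"
    using L2.sum_tendsto[of \<phi> \<Omega> u \<psi> v] \<phi> \<psi> uv test_L2 by blast
  moreover have "(\<lambda>n. ipL \<Omega> (grad (\<phi> n + \<psi> n) - (weak_gradient \<Omega> u + weak_gradient \<Omega> v)) (grad (\<phi> n + \<psi> n) - (weak_gradient \<Omega> u + weak_gradient \<Omega> v))) \<longlonglongrightarrow> 0"
    unfolding grad_add[OF \<phi>(1) \<psi>(1)]
    using L2.sum_tendsto[of "\<lambda>n. grad (\<phi> n)" \<Omega> "weak_gradient \<Omega> u" "\<lambda>n. grad (\<psi> n)" "weak_gradient \<Omega> v"] \<phi> \<psi> uv test_L2 by blast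
  ultimately show "u + v \<in> H10 \<Omega>"
    unfolding H10_iff using uv is_weak_gradient_add[OF uv(1,4,2,5,3,6)] test_add[OF \<phi>(1) \<psi>(1)]
    by (intro conjI bexI[of _ "weak_gradient \<Omega> u + weak_gradient \<Omega> v"] exI[of _ "\<lambda>n. \<phi> n + \<psi> n"]) auto
next
  fix c u assume u: "u \<in> H10 \<Omega>"
  obtain \<phi> where \<phi>: "\<And>n::nat. \<phi> n \<in> test_functions \<Omega>" "(\<lambda>n. ipL \<Omega> (\<phi> n - u) (\<phi> n - u)) \<longlonglongrightarrow> 0"
    "(\<lambda>n. ipL \<Omega> (grad (\<phi> n) - weak_gradient \<Omega> u) (grad (\<phi> n) - weak_gradient \<Omega> u)) \<longlonglongrightarrow> 0"
    using H10_approx[OF u] by blast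
  note uu = H10D[OF u]
  have e: "ipL \<Omega> (c *\<^sub>R a - c *\<^sub>R b) (c *\<^sub>R a - c *\<^sub>R b) = c\<^sup>2 * ipL \<Omega> (a - b) (a - b)"
    if "a \<in> L2 \<Omega>" "b \<in> L2 \<Omega>" for a b :: "'a \<Rightarrow> 'c::euclidean_space"
    using that by (simp add: L2.ip_scale_left L2.ip_scale_right power2_eq_square flip: scaleR_diff_right)
  have "(\<lambda>n. ipL \<Omega> (c *\<^sub>R \<phi> n - c *\<^sub>R u) (c *\<^sub>R \<phi> n - c *\<^sub>R u)) \<longlonglongrightarrow> 0"
    using tendsto_mult_right_zero[OF \<phi>(2), of "c\<^sup>2"] by (simp add: e test_L2[OF \<phi>(1)] uu)
  moreover have "(\<lambda>n. ipL \<Omega> (grad (c *\<^sub>R \<phi> n) - c *\<^sub>R weak_gradient \<Omega> u) (grad (c *\<^sub>R \<phi> n) - c *\<^sub>R weak_gradient \<Omega> u)) \<longlonglongrightarrow> 0"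
    using tendsto_mult_right_zero[OF \<phi>(3), of "c\<^sup>2"] by (simp add: grad_scale[OF \<phi>(1)] e test_L2[OF \<phi>(1)] uu)
  ultimately show "c *\<^sub>R u \<in> H10 \<Omega>"
    unfolding H10_iff using uu is_weak_gradient_scale[OF uu] test_scale[OF \<phi>(1)]
    by (intro conjI bexI[of _ "c *\<^sub>R weak_gradient \<Omega> u"] exI[of _ "\<lambda>n. c *\<^sub>R \<phi> n"]) auto
qed

lemma test_H10: assumes "\<phi> \<in> test_functions \<Omega>" shows "\<phi> \<in> H10 \<Omega>"
proof -
  have "ipL \<Omega> (\<phi> - \<phi>) (\<phi> - \<phi>) = 0" "ipL \<Omega> (grad \<phi> - grad \<phi>) (grad \<phi> - grad \<phi>) = 0" by (simp_all add: ipL_def)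
  then show ?thesis
    unfolding H10_iff using test_L2[OF assms] is_weak_gradient_test[OF assms] assms
    by (intro conjI bexI[of _ "grad \<phi>"] exI[of _ "\<lambda>n. \<phi>"]) auto
qed

lemma ipH_diff_eq:
  assumes "u \<in> H10 \<Omega>" "v \<in> L2 \<Omega>" "h \<in> L2 \<Omega>" "is_weak_gradient \<Omega> v h"
  shows "ipH (u - v) (u - v) = ipL \<Omega> (weak_gradient \<Omega> u - h) (weak_gradient \<Omega> u - h)"
proof -
  note u = H10D[OF assms(1)]
  show ?thesis
    by (rule ipH_eq) (use u assms is_weak_gradient_diff[OF u(1) assms(2) u(2) assms(3) u(3) assms(4)] in auto)
qed

lemma poincare:
  obtains C where "C \<ge> 1" "\<And>u. u \<in> H10 \<Omega> \<Longrightarrow> ipL \<Omega> u u \<le> C * ipH u u"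
proof -
  obtain R where R: "R \<ge> 0" "\<And>x. x \<in> \<Omega> \<Longrightarrow> norm x \<le> R"
    using \<Omega>_radius by blast
  have "ipL \<Omega> u u \<le> (2 * R + 1)\<^sup>2 * ipH u u" if u: "u \<in> H10 \<Omega>" for u
  proof -
    obtain \<phi> where \<phi>: "\<And>n::nat. \<phi> n \<in> test_functions \<Omega>" "(\<lambda>n. ipL \<Omega> (\<phi> n - u) (\<phi> n - u)) \<longlonglongrightarrow> 0"
      "(\<lambda>n. ipL \<Omega> (grad (\<phi> n) - weak_gradient \<Omega> u) (grad (\<phi> n) - weak_gradient \<Omega> u)) \<longlonglongrightarrow> 0"
    using H10_approx[OF u] by blast
    note uu = H10D[OF u]
    have "(\<lambda>n. (L2.nm \<Omega> (\<phi> n))\<^sup>2) \<longlonglongrightarrow> (L2.nm \<Omega> u)\<^sup>2"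
      by (intro tendsto_power L2.nm_tendsto \<phi> uu test_L2)
    then have l1: "(\<lambda>n. ipL \<Omega> (\<phi> n) (\<phi> n)) \<longlonglongrightarrow> ipL \<Omega> u u" using uu test_L2[OF \<phi>(1)] by (simp add: L2.nm_sq)
    have "(\<lambda>n. (L2.nm \<Omega> (grad (\<phi> n)))\<^sup>2) \<longlonglongrightarrow> (L2.nm \<Omega> (weak_gradient \<Omega> u))\<^sup>2"
      by (intro tendsto_power L2.nm_tendsto \<phi> uu test_L2)
    then have l2: "(\<lambda>n. ipL \<Omega> (grad (\<phi> n)) (grad (\<phi> n))) \<longlonglongrightarrow> ipH u u"
      using uu test_L2[OF \<phi>(1)] by (simp add: L2.nm_sq ipH_def)
    have "ipL \<Omega> (\<phi> n) (\<phi> n) \<le> (2 * R + 1)\<^sup>2 * ipL \<Omega> (grad (\<phi> n)) (grad (\<phi> n))" for n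
      unfolding test_ipL[OF \<phi>(1)]
      by (rule poincare_C1c[OF test_C1c[OF \<phi>(1)] R(1)]) (use test_support(1)[OF \<phi>(1)] R(2) in blast)
    then show ?thesis by (intro LIMSEQ_le[OF l1 tendsto_mult_left[OF l2]]) auto
  qed
  moreover have "(2 * R + 1)\<^sup>2 \<ge> 1" using R(1) by (simp add: one_le_power)
  ultimately show ?thesis using that by blast
qed

text \<open>Completeness is the substantial part. A Cauchy sequence has \<open>L2\<close> limits for
  its gradients and, by the Poincare inequality, for its functions; the weak gradient relation
  survives. Replacing each \<open>x n\<close> by a test function at distance below
  \<open>1 / Suc n\<close> shows that the limit is again approximable, hence in
  \<open>H10\<close>.\<close>

sublocale H: semi_hilbert "H10 \<Omega>" ipH
proof
  show "subspace (H10 \<Omega>)" by (rule subspace_H10)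
next
  fix u v w assume u: "u \<in> H10 \<Omega>" and v: "v \<in> H10 \<Omega>" and w: "w \<in> H10 \<Omega>"
  note d = H10D[OF u] H10D[OF v] H10D[OF w]
  have "ipH (u + v) w = ipL \<Omega> (weak_gradient \<Omega> u + weak_gradient \<Omega> v) (weak_gradient \<Omega> w)"
    by (rule ipH_eq) (use d is_weak_gradient_add[OF d(1,4,2,5,3,6)] in auto)
  then show "ipH (u + v) w = ipH u w + ipH v w" using d by (simp add: ipH_def L2.ip_add_left)
next
  fix c u v assume u: "u \<in> H10 \<Omega>" and v: "v \<in> H10 \<Omega>"
  note d = H10D[OF u] H10D[OF v]
  have "ipH (c *\<^sub>R u) v = ipL \<Omega> (c *\<^sub>R weak_gradient \<Omega> u) (weak_gradient \<Omega> v)"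
    by (rule ipH_eq) (use d is_weak_gradient_scale[OF d(1-3)] in auto)
  then show "ipH (c *\<^sub>R u) v = c * ipH u v" using d by (simp add: ipH_def L2.ip_scale_left)
next
  fix u v assume "u \<in> H10 \<Omega>" "v \<in> H10 \<Omega>"
  then show "ipH u v = ipH v u" unfolding ipH_def by (intro L2.ip_commute H10D)
next
  fix u assume "u \<in> H10 \<Omega>"
  then show "0 \<le> ipH u u" by (simp add: ipH_def ipL_self)
next
  fix x :: "nat \<Rightarrow> 'a \<Rightarrow> real"
  assume x: "\<And>n. x n \<in> H10 \<Omega>"
    and cauchy: "\<And>e. 0 < e \<Longrightarrow> \<exists>N. \<forall>m\<ge>N. \<forall>n\<ge>N. ipH (x m - x n) (x m - x n) < e"
  define g where "g n = weak_gradient \<Omega> (x n)" for n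
  have xd: "x m - x n \<in> H10 \<Omega>" for m n using subspace_diff[OF subspace_H10 x x] .
  note d = H10D[OF x, folded g_def]
  have e: "ipH (x m - x n) (x m - x n) = ipL \<Omega> (g m - g n) (g m - g n)" for m n
    unfolding g_def by (rule ipH_diff_eq[OF x H10D[OF x]])
  obtain C where C: "C \<ge> 1" "\<And>u. u \<in> H10 \<Omega> \<Longrightarrow> ipL \<Omega> u u \<le> C * ipH u u"
    using poincare by blast
  have "\<exists>l\<in>L2 \<Omega>. (\<lambda>n. ipL \<Omega> (g n - l) (g n - l)) \<longlonglongrightarrow> 0"
    by (rule L2.ip_complete) (use d cauchy in \<open>auto simp: e\<close>)
  then obtain G where G: "G \<in> L2 \<Omega>" "(\<lambda>n. ipL \<Omega> (g n - G) (g n - G)) \<longlonglongrightarrow> 0" by blast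
  have "\<exists>l\<in>L2 \<Omega>. (\<lambda>n. ipL \<Omega> (x n - l) (x n - l)) \<longlonglongrightarrow> 0"
  proof (rule L2.ip_complete)
    fix \<epsilon> :: real assume "\<epsilon> > 0"
    then have "\<epsilon> / C > 0" using C by simp
    from cauchy[OF this] obtain N where N: "\<And>m n. m \<ge> N \<Longrightarrow> n \<ge> N \<Longrightarrow> ipH (x m - x n) (x m - x n) < \<epsilon> / C" by blast
    have "ipL \<Omega> (x m - x n) (x m - x n) < \<epsilon>" if "m \<ge> N" "n \<ge> N" for m n
    proof -
      have "C * ipH (x m - x n) (x m - x n) < C * (\<epsilon> / C)" using N[OF that] C by (intro mult_strict_left_mono) auto
      then show ?thesis using C(2)[OF xd, of m n] C(1) by simp
    qed
    then show "\<exists>N. \<forall>m\<ge>N. \<forall>n\<ge>N. ipL \<Omega> (x m - x n) (x m - x n) < \<epsilon>" by blast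
  qed (rule d)
  then obtain v where v: "v \<in> L2 \<Omega>" "(\<lambda>n. ipL \<Omega> (x n - v) (x n - v)) \<longlonglongrightarrow> 0" by blast
  have wg: "is_weak_gradient \<Omega> v G" by (rule is_weak_gradient_limit[OF d(1,2) v(1) G(1) d(3) v(2) G(2)])
  have "\<exists>\<phi>\<in>test_functions \<Omega>. ipL \<Omega> (\<phi> - x n) (\<phi> - x n) < 1 / Suc n \<and> ipL \<Omega> (grad \<phi> - g n) (grad \<phi> - g n) < 1 / Suc n" for n
  proof -
    obtain \<phi> where \<phi>: "\<And>k::nat. \<phi> k \<in> test_functions \<Omega>" "(\<lambda>k. ipL \<Omega> (\<phi> k - x n) (\<phi> k - x n)) \<longlonglongrightarrow> 0"
      "(\<lambda>k. ipL \<Omega> (grad (\<phi> k) - g n) (grad (\<phi> k) - g n)) \<longlonglongrightarrow> 0" unfolding g_def using H10_approx[OF x] by blast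
    have "\<forall>\<^sub>F k in sequentially. ipL \<Omega> (\<phi> k - x n) (\<phi> k - x n) < 1 / Suc n \<and> ipL \<Omega> (grad (\<phi> k) - g n) (grad (\<phi> k) - g n) < 1 / Suc n"
      by (intro eventually_conj order_tendstoD(2)[OF \<phi>(2)] order_tendstoD(2)[OF \<phi>(3)]) auto
    then show ?thesis using \<phi>(1) unfolding eventually_sequentially by blast
  qed
  then obtain \<phi> where \<phi>: "\<And>n. \<phi> n \<in> test_functions \<Omega>" "\<And>n. ipL \<Omega> (\<phi> n - x n) (\<phi> n - x n) < 1 / Suc n"
    "\<And>n. ipL \<Omega> (grad (\<phi> n) - g n) (grad (\<phi> n) - g n) < 1 / Suc n" by metis
  have z: "(\<lambda>m. 1 / Suc m) \<longlonglongrightarrow> (0::real)"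
    using LIMSEQ_inverse_real_of_nat by (simp add: field_simps)
  have "(\<lambda>n. ipL \<Omega> (\<phi> n - x n) (\<phi> n - x n)) \<longlonglongrightarrow> 0"
    by (rule Lim_null_comparison[OF always_eventually z], rule allI)
       (simp only: real_norm_def abs_of_nonneg[OF L2.ip_nonneg] L2.X_closed test_L2[OF \<phi>(1)] d less_imp_le[OF \<phi>(2)])
  then have l1: "(\<lambda>n. ipL \<Omega> (\<phi> n - v) (\<phi> n - v)) \<longlonglongrightarrow> 0"
    by (rule L2.ip_tendsto_trans[OF test_L2(1)[OF \<phi>(1)] d(1) v(1) _ v(2)])
  have "(\<lambda>n. ipL \<Omega> (grad (\<phi> n) - g n) (grad (\<phi> n) - g n)) \<longlonglongrightarrow> 0"
    by (rule Lim_null_comparison[OF always_eventually z], rule allI)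
       (simp only: real_norm_def abs_of_nonneg[OF L2.ip_nonneg] L2.X_closed test_L2[OF \<phi>(1)] d less_imp_le[OF \<phi>(3)])
  then have l2: "(\<lambda>n. ipL \<Omega> (grad (\<phi> n) - G) (grad (\<phi> n) - G)) \<longlonglongrightarrow> 0"
    by (rule L2.ip_tendsto_trans[OF test_L2(2)[OF \<phi>(1)] d(2) G(1) _ G(2)])
  have "v \<in> H10 \<Omega>" unfolding H10_iff using v G wg \<phi>(1) l1 l2 by blast
  moreover have "ipH (x n - v) (x n - v) = ipL \<Omega> (g n - G) (g n - G)" for n
    unfolding g_def by (rule ipH_diff_eq[OF x v(1) G(1) wg])
  ultimately show "\<exists>l\<in>H10 \<Omega>. (\<lambda>n. ipH (x n - l) (x n - l)) \<longlonglongrightarrow> 0" using G(2) by (intro bexI[of _ v]) simp_all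
qed

end

section \<open>Convergence of integrals\<close>

text \<open>For the case in which the bounds on the integrals converge, as the norms of
  approximating gradients do: the bound \<open>B + e\<close> holds from some index on, and
  \<open>e\<close> is arbitrary.\<close>

lemma fatou_tendsto:
  fixes f :: "nat \<Rightarrow> 'a \<Rightarrow> real"
  assumes int: "\<And>n. integrable M (f n)" and nonneg: "\<And>n x. 0 \<le> f n x"
    and g: "g \<in> borel_measurable M" and lim: "AE x in M. (\<lambda>n. f n x) \<longlonglongrightarrow> g x"
    and le: "\<And>n. (\<integral>x. f n x \<partial>M) \<le> b n" and b: "b \<longlonglongrightarrow> B"
  shows "integrable M g" "(\<integral>x. g x \<partial>M) \<le> B"
proof -
  have main: "integrable M g \<and> (\<integral>x. g x \<partial>M) \<le> B + e" if "e > 0" for e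
  proof -
    have "\<forall>\<^sub>F n in sequentially. b n < B + e" by (rule order_tendstoD[OF b]) (use that in simp)
    then obtain N where N: "\<And>n. n \<ge> N \<Longrightarrow> b n < B + e" by (auto simp: eventually_sequentially)
    have l: "AE x in M. (\<lambda>n. f (n + N) x) \<longlonglongrightarrow> g x"
      using lim by eventually_elim (rule LIMSEQ_ignore_initial_segment)
    have "(\<integral>x. f (n + N) x \<partial>M) \<le> B + e" for n
      using le[of "n + N"] N[of "n + N"] by linarith
    from fatou_bound[OF int nonneg g l this] show ?thesis by blast
  qed
  show "integrable M g" using main[of 1] by simp
  show "(\<integral>x. g x \<partial>M) \<le> B" by (rule field_le_epsilon) (use main in blast)
qed

text \<open>Fatou's lemma for the nonnegative function
  \<open>\<epsilon> * norm y powr s + c + g y\<close>. The constant \<open>c\<close> cancels on a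
  finite measure space, and the power term costs at most \<open>\<epsilon> * B\<close>, less than
  \<open>e\<close>. Used for \<open>g\<close> and \<open>- g\<close> it yields convergence of the
  integrals, in the role of Vitali's theorem.\<close>

lemma integral_lsc_subcritical:
  fixes u :: "nat \<Rightarrow> 'a \<Rightarrow> 'b::euclidean_space" and g :: "'b \<Rightarrow> real"
  assumes M: "finite_measure M" and g: "continuous_on UNIV g"
    and growth: "\<And>e. e > 0 \<Longrightarrow> \<exists>c. \<forall>y. \<bar>g y\<bar> \<le> e * norm y powr s + c"
    and um: "\<And>n. u n \<in> borel_measurable M" "v \<in> borel_measurable M"
    and lim: "AE x in M. (\<lambda>n. u n x) \<longlonglongrightarrow> v x"
    and int: "\<And>n. integrable M (\<lambda>x. norm (u n x) powr s)" and B: "\<And>n. (\<integral>x. norm (u n x) powr s \<partial>M) \<le> B"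
    and s: "s > 0" and e: "e > 0"
  shows "integrable M (\<lambda>x. g (v x))" "\<And>n. integrable M (\<lambda>x. g (u n x))"
    "\<forall>\<^sub>F n in sequentially. (\<integral>x. g (v x) \<partial>M) - e < (\<integral>x. g (u n x) \<partial>M)"
proof -
  interpret finite_measure M by fact
  note um [measurable]
  have gm [measurable]: "g \<in> borel_measurable borel" by (rule borel_measurable_continuous_onI[OF g])
  have plim: "AE x in M. (\<lambda>n. norm (u n x) powr s) \<longlonglongrightarrow> norm (v x) powr s"
    using lim by eventually_elim (use s in \<open>auto intro!: tendsto_powr' tendsto_norm\<close>)
  have vint: "integrable M (\<lambda>x. norm (v x) powr s)"
    by (rule fatou_bound(1)[OF int _ _ plim B]) (simp, measurable)
  have gint: "integrable M (\<lambda>x. g (w x))" if "w \<in> borel_measurable M" "integrable M (\<lambda>x. norm (w x) powr s)" for w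
  proof -
    obtain c where c: "\<And>y. \<bar>g y\<bar> \<le> 1 * norm y powr s + c" using growth[of 1] by auto
    have "integrable M (\<lambda>x. 1 * norm (w x) powr s + c)" using that by simp
    then show ?thesis
    proof (rule Bochner_Integration.integrable_bound)
      show "(\<lambda>x. g (w x)) \<in> borel_measurable M" using that by measurable
      show "AE x in M. norm (g (w x)) \<le> norm (1 * norm (w x) powr s + c)"
        using order_trans[OF c abs_ge_self] by (intro AE_I2) (simp only: real_norm_def)
    qed
  qed
  show gv: "integrable M (\<lambda>x. g (v x))" by (rule gint[OF um(2) vint])
  show gu: "integrable M (\<lambda>x. g (u n x))" for n by (rule gint[OF um(1) int])
  have B0: "B \<ge> 0" by (rule order_trans[OF _ B[of 0]]) simp
  \<comment> \<open>The increment of \<open>B\<close> keeps the divisor positive when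
    \<open>B = 0\<close>; the factor 2 makes \<open>\<epsilon> * B < e\<close> strict.\<close>
  define \<epsilon> where "\<epsilon> = e / (2 * (B + 1))"
  have \<epsilon>: "\<epsilon> > 0" using e B0 unfolding \<epsilon>_def by simp
  have "\<epsilon> * B < \<epsilon> * (2 * (B + 1))" using \<epsilon> B0 by (intro mult_strict_left_mono) auto
  also have "\<dots> = e" using B0 unfolding \<epsilon>_def by simp
  finally have \<epsilon>B: "\<epsilon> * B < e" .
  obtain c where c: "\<And>y. \<bar>g y\<bar> \<le> \<epsilon> * norm y powr s + c" using growth[OF \<epsilon>] by auto
  show "\<forall>\<^sub>F n in sequentially. (\<integral>x. g (v x) \<partial>M) - e < (\<integral>x. g (u n x) \<partial>M)"
  proof (rule ccontr)
    assume "\<not> ?thesis"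
    then have "\<forall>N. \<exists>n\<ge>N. (\<integral>x. g (u n x) \<partial>M) \<le> (\<integral>x. g (v x) \<partial>M) - e"
      unfolding eventually_sequentially by (meson not_le)
    \<comment> \<open>A failure of the eventual inequality supplies arbitrarily late indices. They
      need not increase strictly: \<open>r N \<ge> N\<close> suffices to keep the pointwise
      limit.\<close>
    from choice[OF this] obtain r where r: "\<And>N. r N \<ge> N" "\<And>N. (\<integral>x. g (u (r N) x) \<partial>M) \<le> (\<integral>x. g (v x) \<partial>M) - e" by blast
    have rf: "filterlim r sequentially sequentially"
      by (rule filterlim_at_top_mono[OF filterlim_ident]) (use r(1) in auto)
    define \<psi> where "\<psi> y = \<epsilon> * norm y powr s + c + g y" for y
    have \<psi>0: "\<psi> y \<ge> 0" for y unfolding \<psi>_def using c[of y] by linarith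
    have \<psi>lim: "AE x in M. (\<lambda>n. \<psi> (u (r n) x)) \<longlonglongrightarrow> \<psi> (v x)"
      using lim
    proof eventually_elim
      case (elim x)
      have 1: "(\<lambda>n. u (r n) x) \<longlonglongrightarrow> v x" by (rule filterlim_compose[OF elim rf])
      have "isCont g (v x)" using g by (simp add: continuous_on_eq_continuous_at)
      then have "(\<lambda>n. g (u (r n) x)) \<longlonglongrightarrow> g (v x)" using 1 by (rule isCont_tendsto_compose)
      moreover have "(\<lambda>n. norm (u (r n) x) powr s) \<longlonglongrightarrow> norm (v x) powr s"
        using 1 s by (auto intro!: tendsto_powr' tendsto_norm)
      ultimately show ?case unfolding \<psi>_def by (intro tendsto_add tendsto_mult tendsto_const)
    qed
    have \<psi>eq: "(\<integral>x. \<psi> (w x) \<partial>M) = \<epsilon> * (\<integral>x. norm (w x) powr s \<partial>M) + c * measure M (space M) + (\<integral>x. g (w x) \<partial>M)"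
      and \<psi>int: "integrable M (\<lambda>x. \<psi> (w x))"
      if "w \<in> borel_measurable M" "integrable M (\<lambda>x. norm (w x) powr s)" for w
      unfolding \<psi>_def using that gint[OF that] by (simp_all add: mult.commute)
    have "(\<integral>x. \<psi> (u (r n) x) \<partial>M) \<le> \<epsilon> * B + c * measure M (space M) + ((\<integral>x. g (v x) \<partial>M) - e)" for n
    proof -
      have "\<epsilon> * (\<integral>x. norm (u (r n) x) powr s \<partial>M) \<le> \<epsilon> * B" using \<epsilon> B by (intro mult_left_mono) auto
      then show ?thesis unfolding \<psi>eq[OF um(1) int] using r(2)[of n] by linarith
    qed
    then have "(\<integral>x. \<psi> (v x) \<partial>M) \<le> \<epsilon> * B + c * measure M (space M) + ((\<integral>x. g (v x) \<partial>M) - e)"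
      by (intro fatou_bound(2)[OF \<psi>int[OF um(1) int] \<psi>0 _ \<psi>lim]) (use \<psi>int[OF um(2) vint] in auto)
    moreover have "0 \<le> \<epsilon> * (\<integral>x. norm (v x) powr s \<partial>M)" using \<epsilon> by simp
    ultimately show False unfolding \<psi>eq[OF um(2) vint] using \<epsilon>B by linarith
  qed
qed

lemma integral_tendsto_subcritical:
  fixes u :: "nat \<Rightarrow> 'a \<Rightarrow> 'b::euclidean_space" and g :: "'b \<Rightarrow> real"
  assumes M: "finite_measure M" and g: "continuous_on UNIV g"
    and growth: "\<And>e. e > 0 \<Longrightarrow> \<exists>c. \<forall>y. \<bar>g y\<bar> \<le> e * norm y powr s + c"
    and um: "\<And>n. u n \<in> borel_measurable M" "v \<in> borel_measurable M"
    and lim: "AE x in M. (\<lambda>n. u n x) \<longlonglongrightarrow> v x"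
    and int: "\<And>n. integrable M (\<lambda>x. norm (u n x) powr s)" and B: "\<And>n. (\<integral>x. norm (u n x) powr s \<partial>M) \<le> B"
    and s: "s > 0"
  shows "(\<lambda>n. \<integral>x. g (u n x) \<partial>M) \<longlonglongrightarrow> (\<integral>x. g (v x) \<partial>M)"
proof (rule tendstoI)
  fix e :: real assume e: "e > 0"
  have g': "continuous_on UNIV (\<lambda>y. - g y)" using g by (intro continuous_intros)
  have growth': "\<exists>c. \<forall>y. \<bar>- g y\<bar> \<le> e * norm y powr s + c" if "e > 0" for e using growth[OF that] by simp
  have "\<forall>\<^sub>F n in sequentially. (\<integral>x. g (v x) \<partial>M) - e < (\<integral>x. g (u n x) \<partial>M)"
    by (rule integral_lsc_subcritical(3)[OF M g growth um lim int B s e])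
  moreover have "\<forall>\<^sub>F n in sequentially. (\<integral>x. - g (v x) \<partial>M) - e < (\<integral>x. - g (u n x) \<partial>M)"
    by (rule integral_lsc_subcritical(3)[OF M g' growth' um lim int B s e])
  ultimately show "\<forall>\<^sub>F n in sequentially. dist (\<integral>x. g (u n x) \<partial>M) (\<integral>x. g (v x) \<partial>M) < e"
  proof eventually_elim
    case (elim n)
    then show ?case by (simp add: dist_real_def abs_less_iff)
  qed
qed

section \<open>Compact embedding of \<open>H10\<close>\<close>

context bounded_open
begin

lemma L2_AE_subseq:
  fixes u :: "nat \<Rightarrow> 'a \<Rightarrow> 'b::euclidean_space"
  assumes "\<And>n. u n \<in> L2 \<Omega>" "v \<in> L2 \<Omega>" "(\<lambda>n. ipL \<Omega> (u n - v) (u n - v)) \<longlonglongrightarrow> 0"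
  obtains r :: "nat \<Rightarrow> nat" where "strict_mono r" "AE x in lebesgue_on \<Omega>. (\<lambda>n. u (r n) x) \<longlonglongrightarrow> v x"
proof -
  have d: "u n - v \<in> L2 \<Omega>" for n using assms by auto
  have "\<exists>r. strict_mono r \<and> (AE x in lebesgue_on \<Omega>. (\<lambda>n. (norm (u (r n) x - v x))\<^sup>2) \<longlonglongrightarrow> 0)"
  proof (rule tendsto_L1_AE_subseq)
    show "integrable (lebesgue_on \<Omega>) (\<lambda>x. (norm (u n x - v x))\<^sup>2)" for n
      using d[of n] by (simp add: L2_def)
    show "(\<lambda>n. \<integral>x. norm ((norm (u n x - v x))\<^sup>2) \<partial>lebesgue_on \<Omega>) \<longlonglongrightarrow> 0"
      using assms(3) by (simp add: ipL_self)
  qed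
  then obtain r where r: "strict_mono r" "AE x in lebesgue_on \<Omega>. (\<lambda>n. (norm (u (r n) x - v x))\<^sup>2) \<longlonglongrightarrow> 0" by blast
  have "AE x in lebesgue_on \<Omega>. (\<lambda>n. u (r n) x) \<longlonglongrightarrow> v x"
    using r(2)
  proof eventually_elim
    case (elim x)
    have "(\<lambda>n. norm (u (r n) x - v x)) \<longlonglongrightarrow> 0" using tendsto_real_sqrt[OF elim] by simp
    then show ?case by (simp add: tendsto_norm_zero_iff LIM_zero_iff)
  qed
  with r(1) show ?thesis using that by blast
qed

text \<open>Density and Fatou: approximating test functions converge almost everywhere along a
  subsequence, and their gradient norms converge to that of \<open>u\<close>, so the constant from
  \<open>sobolev_C1c\<close> is kept.\<close>

lemma H10_sobolev:
  assumes s: "2 < s" "(real DIM('a) - 2) * (s - 2) < 4"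
  obtains K where "K \<ge> 0" "\<And>u. u \<in> H10 \<Omega> \<Longrightarrow> integrable (lebesgue_on \<Omega>) (\<lambda>x. \<bar>u x\<bar> powr s)"
    "\<And>u. u \<in> H10 \<Omega> \<Longrightarrow> (\<integral>x. \<bar>u x\<bar> powr s \<partial>lebesgue_on \<Omega>) \<le> K * ipH u u powr (s / 2)"
proof -
  obtain R where R: "R \<ge> 0" "\<And>x. x \<in> \<Omega> \<Longrightarrow> norm x \<le> R" using \<Omega>_radius by blast
  obtain K where K: "K \<ge> 0" and sob: "\<And>w. C1c w \<Longrightarrow> (\<And>x::'a. w x \<noteq> 0 \<Longrightarrow> norm x \<le> R) \<Longrightarrow>
       (\<integral>x. \<bar>w x\<bar> powr s \<partial>lborel) \<le> K * (\<integral>x. (norm (grad w x))\<^sup>2 \<partial>lborel) powr (s / 2)"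
    using sobolev_C1c[OF s R(1)] by blast
  have "integrable (lebesgue_on \<Omega>) (\<lambda>x. \<bar>u x\<bar> powr s) \<and> (\<integral>x. \<bar>u x\<bar> powr s \<partial>lebesgue_on \<Omega>) \<le> K * ipH u u powr (s / 2)"
    if u: "u \<in> H10 \<Omega>" for u
  proof -
    note uu = H10D[OF u]
    obtain \<phi> where \<phi>: "\<And>n::nat. \<phi> n \<in> test_functions \<Omega>" "(\<lambda>n. ipL \<Omega> (\<phi> n - u) (\<phi> n - u)) \<longlonglongrightarrow> 0"
      "(\<lambda>n. ipL \<Omega> (grad (\<phi> n) - weak_gradient \<Omega> u) (grad (\<phi> n) - weak_gradient \<Omega> u)) \<longlonglongrightarrow> 0"
      using H10_approx[OF u] by blast
    obtain r :: "nat \<Rightarrow> nat" where r: "strict_mono r" and ae: "AE x in lebesgue_on \<Omega>. (\<lambda>n. \<phi> (r n) x) \<longlonglongrightarrow> u x"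
      using L2_AE_subseq[OF test_L2(1)[OF \<phi>(1)] uu(1) \<phi>(2)] by blast
    have "(\<lambda>n. (L2.nm \<Omega> (grad (\<phi> n)))\<^sup>2) \<longlonglongrightarrow> (L2.nm \<Omega> (weak_gradient \<Omega> u))\<^sup>2"
      by (intro tendsto_power L2.nm_tendsto \<phi> uu test_L2)
    then have "(\<lambda>n. ipL \<Omega> (grad (\<phi> n)) (grad (\<phi> n))) \<longlonglongrightarrow> ipH u u"
      using uu test_L2[OF \<phi>(1)] by (simp add: L2.nm_sq ipH_def)
    from LIMSEQ_subseq_LIMSEQ[OF this r]
    have "(\<lambda>n. ipL \<Omega> (grad (\<phi> (r n))) (grad (\<phi> (r n)))) \<longlonglongrightarrow> ipH u u" by (simp add: o_def)
    then have b: "(\<lambda>n. K * ipL \<Omega> (grad (\<phi> (r n))) (grad (\<phi> (r n))) powr (s / 2)) \<longlonglongrightarrow> K * ipH u u powr (s / 2)"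
      using s by (intro tendsto_mult tendsto_const tendsto_powr') (auto simp: ipL_self)
    have m: "\<phi> n \<in> borel_measurable borel" "C1c (\<phi> n)" for n using test_measurable[OF \<phi>(1)] test_C1c[OF \<phi>(1)] by auto
    note [measurable] = m(1)
    have supp: "norm x \<le> R" if "\<phi> n x \<noteq> 0" for n x using test_support(1)[OF \<phi>(1) that] R(2) by blast
    have z: "x \<in> \<Omega>" if "\<bar>\<phi> n x\<bar> powr s \<noteq> 0" for n x using that test_support(1)[OF \<phi>(1), of n x] by auto
    have mm: "(\<lambda>x. \<bar>\<phi> n x\<bar> powr s) \<in> borel_measurable borel" for n by measurable
    have int: "integrable (lebesgue_on \<Omega>) (\<lambda>x. \<bar>\<phi> n x\<bar> powr s)" for n
    proof (subst integral_lborel_eq(1)[OF mm], erule z, rule integrable_continuous_bounded_support)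
      show "continuous_on UNIV (\<lambda>x. \<bar>\<phi> n x\<bar> powr s)"
        by (intro continuous_on_powr' continuous_intros C1cD(2)[OF m(2)]) (use s in auto)
      show "\<bar>\<phi> n x\<bar> powr s \<noteq> 0 \<Longrightarrow> norm x \<le> R" for x using supp[of n x] by auto
    qed
    have le: "(\<integral>x. \<bar>\<phi> n x\<bar> powr s \<partial>lebesgue_on \<Omega>) \<le> K * ipL \<Omega> (grad (\<phi> n)) (grad (\<phi> n)) powr (s / 2)" for n
      unfolding test_ipL(2)[OF \<phi>(1)] by (subst integral_lborel_eq(2)[OF mm], erule z, rule sob[OF m(2)], erule supp)
    have um: "(\<lambda>x. \<bar>u x\<bar> powr s) \<in> borel_measurable (lebesgue_on \<Omega>)"
      using L2_measurable[OF uu(1)] by measurable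
    have "AE x in lebesgue_on \<Omega>. (\<lambda>n. \<bar>\<phi> (r n) x\<bar> powr s) \<longlonglongrightarrow> \<bar>u x\<bar> powr s"
      using ae by eventually_elim (use s in \<open>auto intro!: tendsto_powr' tendsto_rabs\<close>)
    from fatou_tendsto[OF int _ um this le b] show ?thesis by simp
  qed
  with K show ?thesis using that[of K] by blast
qed

text \<open>Keeps the convex combinations from \<open>mazur\<close> close to an \<open>L2\<close>
  limit: if a tail of the sequence lies in such a ball, so does its convex hull.\<close>

lemma convex_L2_ball:
  assumes "v \<in> L2 \<Omega>" shows "convex {z \<in> L2 \<Omega>. L2.nm \<Omega> (z - v) \<le> e}"
proof (rule convexI)
  fix x y :: "'a \<Rightarrow> 'b" and a b :: real
  assume xy: "x \<in> {z \<in> L2 \<Omega>. L2.nm \<Omega> (z - v) \<le> e}" "y \<in> {z \<in> L2 \<Omega>. L2.nm \<Omega> (z - v) \<le> e}" and ab: "0 \<le> a" "0 \<le> b" "a + b = 1"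
  have eq: "a *\<^sub>R x + b *\<^sub>R y - v = a *\<^sub>R (x - v) + b *\<^sub>R (y - v)"
    using ab(3) by (simp add: algebra_simps flip: scaleR_add_left)
  have "L2.nm \<Omega> (a *\<^sub>R x + b *\<^sub>R y - v) \<le> L2.nm \<Omega> (a *\<^sub>R (x - v)) + L2.nm \<Omega> (b *\<^sub>R (y - v))"
    unfolding eq by (rule L2.nm_triangle) (use xy assms in auto)
  also have "\<dots> = a * L2.nm \<Omega> (x - v) + b * L2.nm \<Omega> (y - v)"
    using xy assms ab by (simp add: L2.nm_scale)
  also have "\<dots> \<le> a * e + b * e" using xy ab by (intro add_mono mult_left_mono) auto
  also have "\<dots> = e" using ab(3) by (simp flip: distrib_right)
  finally show "a *\<^sub>R x + b *\<^sub>R y \<in> {z \<in> L2 \<Omega>. L2.nm \<Omega> (z - v) \<le> e}" using xy by auto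
qed

text \<open>Test functions close to the \<open>x n\<close> make
  \<open>cauchy_subsequence_C1c\<close> applicable and give a strong \<open>L2\<close> limit
  \<open>v\<close>, which need not be known to lie in \<open>H10\<close>. The convex combinations
  from \<open>mazur\<close> converge to some \<open>l\<close> in \<open>H10\<close> whose Dirichlet
  integral is at most the limit \<open>d\<close>. The same combinations converge to \<open>v\<close>
  in \<open>L2\<close>, so \<open>l\<close> and \<open>v\<close> agree almost everywhere.\<close>

theorem rellich:
  assumes x: "\<And>n::nat. x n \<in> H10 \<Omega>" and B: "\<And>n. ipH (x n) (x n) \<le> B"
  obtains r :: "nat \<Rightarrow> nat" and l d where "strict_mono r" "l \<in> H10 \<Omega>" "(\<lambda>n. ipH (x (r n)) (x (r n))) \<longlonglongrightarrow> d"
    "ipH l l \<le> d" "AE t in lebesgue_on \<Omega>. (\<lambda>n. x (r n) t) \<longlonglongrightarrow> l t"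
proof -
  define g where "g n = weak_gradient \<Omega> (x n)" for n
  note d = H10D[OF x, folded g_def]
  have "\<exists>\<phi>\<in>test_functions \<Omega>. ipL \<Omega> (\<phi> - x n) (\<phi> - x n) < 1 / Suc n \<and> ipL \<Omega> (grad \<phi> - g n) (grad \<phi> - g n) < 1" for n
  proof -
    obtain \<phi> where \<phi>: "\<And>k::nat. \<phi> k \<in> test_functions \<Omega>" "(\<lambda>k. ipL \<Omega> (\<phi> k - x n) (\<phi> k - x n)) \<longlonglongrightarrow> 0"
      "(\<lambda>k. ipL \<Omega> (grad (\<phi> k) - g n) (grad (\<phi> k) - g n)) \<longlonglongrightarrow> 0" unfolding g_def using H10_approx[OF x] by blast
    have "\<forall>\<^sub>F k in sequentially. ipL \<Omega> (\<phi> k - x n) (\<phi> k - x n) < 1 / Suc n \<and> ipL \<Omega> (grad (\<phi> k) - g n) (grad (\<phi> k) - g n) < 1"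
      by (intro eventually_conj order_tendstoD(2)[OF \<phi>(2)] order_tendstoD(2)[OF \<phi>(3)]) auto
    then show ?thesis using \<phi>(1) unfolding eventually_sequentially by blast
  qed
  then obtain \<phi> where \<phi>: "\<And>n. \<phi> n \<in> test_functions \<Omega>" "\<And>n. ipL \<Omega> (\<phi> n - x n) (\<phi> n - x n) < 1 / Suc n"
    "\<And>n. ipL \<Omega> (grad (\<phi> n) - g n) (grad (\<phi> n) - g n) < 1" by metis
  note \<phi>L = test_L2[OF \<phi>(1)]
  have gB: "ipL \<Omega> (g n) (g n) \<le> B" for n using B[of n] by (simp add: ipH_def g_def)
  \<comment> \<open>Distance below 1 between the gradients is enough, since the gradients of the
    test functions only have to stay bounded; the functions themselves are approximated with
    vanishing error.\<close>
  have D: "(\<integral>t. (norm (grad (\<phi> n) t))\<^sup>2 \<partial>lborel) \<le> 2 + 2 * B" for n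
  proof -
    have "(L2.nm \<Omega> (grad (\<phi> n)))\<^sup>2 \<le> (L2.nm \<Omega> (grad (\<phi> n) - g n) + L2.nm \<Omega> (g n))\<^sup>2"
      using L2.nm_triangle[of "grad (\<phi> n) - g n" \<Omega> "g n"] \<phi>L d by (intro power_mono) auto
    also have "\<dots> \<le> 2 * (L2.nm \<Omega> (grad (\<phi> n) - g n))\<^sup>2 + 2 * (L2.nm \<Omega> (g n))\<^sup>2"
      using sum_squares_bound[of "L2.nm \<Omega> (grad (\<phi> n) - g n)" "L2.nm \<Omega> (g n)"] by (simp add: power2_sum)
    finally show ?thesis using \<phi>L[of n] d(2)[of n] \<phi>(3)[of n] gB[of n] by (simp add: L2.nm_sq test_ipL(2)[OF \<phi>(1), symmetric])
  qed
  obtain R where R: "R \<ge> 0" "\<And>x. x \<in> \<Omega> \<Longrightarrow> norm x \<le> R" using \<Omega>_radius by blast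
  have supp: "norm t \<le> R" if "\<phi> n t \<noteq> 0" for n t using test_support(1)[OF \<phi>(1) that] R(2) by blast
  obtain r0 :: "nat \<Rightarrow> nat" where r0: "strict_mono r0"
    "\<And>e. e > 0 \<Longrightarrow> \<exists>N. \<forall>a\<ge>N. \<forall>b\<ge>N. (\<integral>t. (\<phi> (r0 a) t - \<phi> (r0 b) t)\<^sup>2 \<partial>lborel) < e"
    using cauchy_subsequence_C1c[of \<phi> R "2 + 2 * B"] test_C1c[OF \<phi>(1)] R(1) supp D by blast
  have eq: "ipL \<Omega> (\<phi> m - \<phi> n) (\<phi> m - \<phi> n) = (\<integral>t. (\<phi> m t - \<phi> n t)\<^sup>2 \<partial>lborel)" for m n
    using test_ipL(1)[OF test_add[OF \<phi>(1) test_scale[OF \<phi>(1), of "-1"]], of m n] by simp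
  have "\<exists>l\<in>L2 \<Omega>. (\<lambda>n. ipL \<Omega> (\<phi> (r0 n) - l) (\<phi> (r0 n) - l)) \<longlonglongrightarrow> 0"
    by (rule L2.ip_complete) (use \<phi>L r0(2) in \<open>auto simp: eq\<close>)
  then obtain v where v: "v \<in> L2 \<Omega>" "(\<lambda>n. ipL \<Omega> (\<phi> (r0 n) - v) (\<phi> (r0 n) - v)) \<longlonglongrightarrow> 0" by blast
  have z: "(\<lambda>m. 1 / Suc m) \<longlonglongrightarrow> (0::real)"
    using LIMSEQ_inverse_real_of_nat by (simp add: field_simps)
  have zr: "(\<lambda>m. 1 / Suc (r0 m)) \<longlonglongrightarrow> (0::real)"
    using LIMSEQ_subseq_LIMSEQ[OF z r0(1)] by (simp add: o_def)
  have "(\<lambda>n. ipL \<Omega> (x (r0 n) - \<phi> (r0 n)) (x (r0 n) - \<phi> (r0 n))) \<longlonglongrightarrow> 0"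
  proof (rule Lim_null_comparison[OF always_eventually zr], rule allI)
    fix n
    have "ipL \<Omega> (x (r0 n) - \<phi> (r0 n)) (x (r0 n) - \<phi> (r0 n)) = ipL \<Omega> (\<phi> (r0 n) - x (r0 n)) (\<phi> (r0 n) - x (r0 n))"
      using L2.nm_minus_commute[OF d(1)[of "r0 n"] \<phi>L(1)[of "r0 n"]] by (simp add: L2.nm_def)
    then show "norm (ipL \<Omega> (x (r0 n) - \<phi> (r0 n)) (x (r0 n) - \<phi> (r0 n))) \<le> 1 / Suc (r0 n)"
      using \<phi>(2)[of "r0 n"] L2.ip_nonneg[of "\<phi> (r0 n) - x (r0 n)" \<Omega>] d \<phi>L by (simp del: of_nat_Suc)
  qed
  then have xv: "(\<lambda>n. ipL \<Omega> (x (r0 n) - v) (x (r0 n) - v)) \<longlonglongrightarrow> 0"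
    by (rule L2.ip_tendsto_trans[OF d(1) \<phi>L(1) v(1) _ v(2)])
  have "bounded (range (\<lambda>n. ipH (x (r0 n)) (x (r0 n))))"
    unfolding bounded_iff using B H.ip_nonneg[OF x] by (intro exI[of _ B]) auto
  then obtain e1 r1 where r1: "strict_mono (r1 :: nat \<Rightarrow> nat)" "((\<lambda>n. ipH (x (r0 n)) (x (r0 n))) \<circ> r1) \<longlonglongrightarrow> e1"
    using bounded_imp_convergent_subsequence by blast
  have xv1: "(\<lambda>n. ipL \<Omega> (x (r0 (r1 n)) - v) (x (r0 (r1 n)) - v)) \<longlonglongrightarrow> 0"
    using LIMSEQ_subseq_LIMSEQ[OF xv r1(1)] by (simp add: o_def)
  obtain r2 :: "nat \<Rightarrow> nat" where r2: "strict_mono r2" "AE t in lebesgue_on \<Omega>. (\<lambda>n. x (r0 (r1 (r2 n))) t) \<longlonglongrightarrow> v t"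
    using L2_AE_subseq[of "\<lambda>n. x (r0 (r1 n))", OF d(1) v(1) xv1] by blast
  define r where "r n = r0 (r1 (r2 n))" for n
  have r: "strict_mono r" unfolding r_def using r0(1) r1(1) r2(1) by (simp add: strict_mono_def)
  have dlim: "(\<lambda>n. ipH (x (r n)) (x (r n))) \<longlonglongrightarrow> e1"
    using LIMSEQ_subseq_LIMSEQ[OF r1(2) r2(1)] unfolding r_def by (simp add: o_def)
  have vlim: "(\<lambda>n. ipL \<Omega> (x (r n) - v) (x (r n) - v)) \<longlonglongrightarrow> 0"
    using LIMSEQ_subseq_LIMSEQ[OF xv1 r2(1)] unfolding r_def by (simp add: o_def)
  obtain w l where w: "\<And>n. w n \<in> convex hull ((\<lambda>n. x (r n)) ` {n..})" and l: "l \<in> H10 \<Omega>"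
    "(\<lambda>n. ipH (w n - l) (w n - l)) \<longlonglongrightarrow> 0" "ipH l l \<le> e1"
    using H.mazur[of "\<lambda>n. x (r n)", OF x dlim] by blast
  have wX: "w n \<in> H10 \<Omega>" for n
  proof -
    have "convex hull ((\<lambda>n. x (r n)) ` {n..}) \<subseteq> H10 \<Omega>"
      by (rule hull_minimal[where S = convex]) (use x subspace_imp_convex[OF subspace_H10] in auto)
    then show ?thesis using w by blast
  qed
  obtain C where C: "C \<ge> 1" "\<And>u. u \<in> H10 \<Omega> \<Longrightarrow> ipL \<Omega> u u \<le> C * ipH u u" using poincare by blast
  have wl: "(\<lambda>n. ipL \<Omega> (w n - l) (w n - l)) \<longlonglongrightarrow> 0"
  proof (rule Lim_null_comparison[OF always_eventually tendsto_mult_right_zero[OF l(2)]], rule allI)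
    fix n
    show "norm (ipL \<Omega> (w n - l) (w n - l)) \<le> C * ipH (w n - l) (w n - l)"
      using C(2)[of "w n - l"] wX l by (simp add: ipL_self)
  qed
  \<comment> \<open>From index \<open>N\<close> on the sequence lies in the ball of radius
    \<open>e / 2\<close> around \<open>v\<close>, and \<open>w n\<close> is in the convex hull of
    the tail from \<open>n\<close>.\<close>
  have wv: "(\<lambda>n. L2.nm \<Omega> (w n - v)) \<longlonglongrightarrow> 0"
  proof (rule LIMSEQ_I)
    fix e :: real assume e: "e > 0"
    have "\<forall>\<^sub>F n in sequentially. L2.nm \<Omega> (x (r n) - v) < e / 2"
      by (rule order_tendstoD(2)[OF L2.nm_tendsto_0[OF vlim]]) (use e in simp)
    then obtain N where N: "\<And>n. n \<ge> N \<Longrightarrow> L2.nm \<Omega> (x (r n) - v) < e / 2" by (auto simp: eventually_sequentially)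
    have "norm (L2.nm \<Omega> (w n - v) - 0) < e" if n: "n \<ge> N" for n
    proof -
      have "convex hull ((\<lambda>n. x (r n)) ` {n..}) \<subseteq> {z \<in> L2 \<Omega>. L2.nm \<Omega> (z - v) \<le> e / 2}"
        by (rule hull_minimal[where S = convex, OF _ convex_L2_ball[OF v(1)]]) (use d(1) N n in \<open>auto intro: less_imp_le\<close>)
      then have "L2.nm \<Omega> (w n - v) \<le> e / 2" using w by blast
      moreover have "0 \<le> L2.nm \<Omega> (w n - v)" using H10D(1)[OF wX] v(1) by auto
      ultimately show ?thesis using e by simp
    qed
    then show "\<exists>N. \<forall>n\<ge>N. norm (L2.nm \<Omega> (w n - v) - 0) < e" by blast
  qed
  note lL = H10D(1)[OF l(1)] and wL = H10D(1)[OF wX]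
  have "(\<lambda>n. L2.nm \<Omega> (w n - l) + L2.nm \<Omega> (w n - v)) \<longlonglongrightarrow> 0 + 0"
    by (intro tendsto_add wv L2.nm_tendsto_0[OF wl])
  then have "L2.nm \<Omega> (l - v) \<le> 0 + 0"
    by (rule LIMSEQ_le_const)
       (use L2.nm_diff_triangle[OF lL wL v(1)] L2.nm_minus_commute[OF lL wL] in auto)
  moreover have "0 \<le> L2.nm \<Omega> (l - v)" using lL v(1) by auto
  ultimately have "L2.nm \<Omega> (l - v) = 0" by simp
  then have "ipL \<Omega> (l - v) (l - v) = 0" using lL v(1) by (simp add: L2.nm_def)
  then have i0: "(\<integral>t. (norm ((l - v) t))\<^sup>2 \<partial>lebesgue_on \<Omega>) = 0" by (simp only: ipL_self)
  have "l - v \<in> L2 \<Omega>" using lL v(1) by auto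
  then have "AE t in lebesgue_on \<Omega>. (norm ((l - v) t))\<^sup>2 = 0"
    using i0 by (subst (asm) integral_nonneg_eq_0_iff_AE) (auto simp: L2_def)
  then have "AE t in lebesgue_on \<Omega>. (\<lambda>n. x (r n) t) \<longlonglongrightarrow> l t"
    using r2(2) by eventually_elim (auto simp: r_def)
  with r l dlim show ?thesis using that by blast
qed

end

section \<open>The energy functional\<close>

lemma primitive_has_derivative:
  assumes "continuous_on UNIV f"
  shows "(primitive f has_real_derivative f x) (at x)"
proof -
  \<comment> \<open>The interval contains 0 and has \<open>x\<close> in its interior, which turns
    the one-sided derivative within the interval into a two-sided one.\<close>
  define a b where "a = min x 0 - 1" and "b = max x 0 + 1"
  have "((\<lambda>u. LBINT y=0..u. f y) has_vector_derivative f x) (at x within {a..b})"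
    using interval_integral_FTC2[of a 0 b f x] continuous_on_subset[OF assms subset_UNIV]
    unfolding a_def b_def by (simp add: zero_ereal_def)
  then have "(primitive f has_vector_derivative f x) (at x within {a..b})"
    unfolding primitive_def[abs_def] .
  moreover have "x \<in> interior {a..b}" unfolding a_def b_def by (auto simp: interior_atLeastAtMost_real)
  ultimately have "(primitive f has_vector_derivative f x) (at x)"
    by (simp only: at_within_interior)
  then show ?thesis by (simp only: has_real_derivative_iff_has_vector_derivative)
qed

lemma primitive_0 [simp]: "primitive f 0 = 0"
  by (simp add: primitive_def zero_ereal_def)

text \<open>Lets a function known only on the nonnegative half-line be replaced by an extension to
  the whole line without changing its primitive there.\<close>

lemma primitive_cong_nonneg:
  assumes "\<And>s. 0 \<le> s \<Longrightarrow> f s = g s" "0 \<le> t"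
  shows "primitive f t = primitive g t"
  unfolding primitive_def
proof (rule interval_integral_cong)
  fix x assume "x \<in> einterval (min 0 (ereal t)) (max 0 (ereal t))"
  moreover have "min 0 (ereal t) = 0" using assms(2) by (simp add: min_def)
  ultimately have "0 < ereal x" by (simp only: einterval_iff)
  then show "f x = g x" using assms(1) by simp
qed

lemma primitive_bound:
  assumes "continuous_on UNIV f" "\<And>z. \<bar>z\<bar> \<le> \<bar>\<xi>\<bar> \<Longrightarrow> \<bar>f z\<bar> \<le> B"
  shows "\<bar>primitive f \<xi>\<bar> \<le> B * \<bar>\<xi>\<bar>"
proof -
  have "norm (primitive f \<xi> - primitive f 0) \<le> B * norm (\<xi> - 0)"
  proof (rule field_differentiable_bound[of "{min 0 \<xi>..max 0 \<xi>}" "primitive f" f])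
    show "(primitive f has_field_derivative f z) (at z within {min 0 \<xi>..max 0 \<xi>})" for z
      by (rule has_field_derivative_at_within[OF primitive_has_derivative[OF assms(1)]])
    show "norm (f z) \<le> B" if "z \<in> {min 0 \<xi>..max 0 \<xi>}" for z
      using that assms(2)[of z] by auto
  qed auto
  then show ?thesis by simp
qed

lemma powr_le_eps_powr:
  fixes p s e :: real
  assumes "0 < p" "p < s" "e > 0" shows "\<exists>c\<ge>0. \<forall>y\<ge>0. y powr p \<le> e * y powr s + c"
proof -
  \<comment> \<open>The point at which \<open>e * R powr (s - p) = 1\<close>: beyond it the higher
    power alone dominates, before it the constant \<open>R powr p\<close> does.\<close>
  define R where "R = (1 / e) powr (1 / (s - p))"
  have R: "R > 0" using assms unfolding R_def by simp
  have "y powr p \<le> e * y powr s + R powr p" if y: "y \<ge> 0" for y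
  proof (cases "y \<le> R")
    case True
    then have "y powr p \<le> R powr p" using y assms by (intro powr_mono2) auto
    then show ?thesis using assms by (simp add: add_increasing)
  next
    case False
    then have "R powr (s - p) \<le> y powr (s - p)" using R assms by (intro powr_mono2) auto
    also have "R powr (s - p) = 1 / e" using assms unfolding R_def by (simp add: powr_powr)
    finally have "1 \<le> e * y powr (s - p)" using assms by (simp add: field_simps)
    then have "y powr p * 1 \<le> y powr p * (e * y powr (s - p))" by (intro mult_left_mono) auto
    also have "\<dots> = e * y powr s" using False R by (simp flip: powr_add)
    finally show ?thesis by (simp add: add_increasing2)
  qed
  then show ?thesis by (intro exI[of _ "R powr p"]) auto
qed

text \<open>The condition \<open>q_sub\<close> is \<open>q < (m + 2) / (m - 2)\<close> multiplied
  out, with \<open>m\<close> the dimension. It is the condition of the Sobolev inequality for the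
  exponent \<open>q + 1\<close>.\<close>

locale subcritical = bounded_open \<Omega> for \<Omega> :: "'a::euclidean_space set" +
  fixes f :: "real \<Rightarrow> real" and q A :: real
  assumes f_cont: "continuous_on UNIV f" and A: "A > 0" and q: "q > 1"
    and f_growth: "\<And>\<xi>. \<bar>f \<xi>\<bar> \<le> A * (1 + \<bar>\<xi>\<bar> powr q)"
    and q_sub: "(real DIM('a) - 2) * (q - 1) < 4"
begin

definition J :: "('a \<Rightarrow> real) \<Rightarrow> real" where
  "J u = (\<integral>x. primitive f (u x) \<partial>lebesgue_on \<Omega>)"

definition pairing :: "('a \<Rightarrow> real) \<Rightarrow> ('a \<Rightarrow> real) \<Rightarrow> real" where
  "pairing u v = (\<integral>x. f (u x) * v x \<partial>lebesgue_on \<Omega>)"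

lemma F_deriv: "(primitive f has_real_derivative f x) (at x)"
  by (rule primitive_has_derivative[OF f_cont])

lemma F_cont: "continuous_on UNIV (primitive f)"
  by (auto intro!: DERIV_isCont[OF F_deriv] simp: continuous_on_eq_continuous_at)

text \<open>A crude form of Young's inequality, by comparing \<open>a\<close> with \<open>b\<close>.
  Pairings are thereby bounded by integrals of the single power \<open>q + 1\<close>.\<close>

lemma growth_product: assumes "0 \<le> a" "0 \<le> b" shows "(1 + a powr q) * b \<le> 1 + a powr (q + 1) + 2 * b powr (q + 1)"
proof -
  have 1: "b \<le> 1 + b powr (q + 1)"
  proof (cases "b \<le> 1")
    case False
    then have "b powr 1 \<le> b powr (q + 1)" using q by (intro powr_mono) auto
    then show ?thesis using False by simp
  qed (simp add: add_increasing2)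
  have "a powr q * b \<le> a powr (q + 1) + b powr (q + 1)"
  proof (cases "a \<le> b")
    case True
    have "a powr q * b \<le> b powr q * b" using True assms q by (intro mult_right_mono powr_mono2) auto
    also have "\<dots> = b powr (q + 1)" using assms by (cases "b = 0") (auto simp: powr_add)
    finally show ?thesis by (simp add: add_increasing)
  next
    case False
    have "a powr q * b \<le> a powr q * a" using False assms by (intro mult_left_mono) auto
    also have "\<dots> = a powr (q + 1)" using False assms by (simp add: powr_add)
    finally show ?thesis by (simp add: add_increasing2)
  qed
  with 1 show ?thesis by (simp add: distrib_right)
qed

lemma F_growth: "\<bar>primitive f \<xi>\<bar> \<le> 3 * A * (1 + \<bar>\<xi>\<bar> powr (q + 1))"
proof -
  have "\<bar>primitive f \<xi>\<bar> \<le> A * (1 + \<bar>\<xi>\<bar> powr q) * \<bar>\<xi>\<bar>"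
  proof (rule primitive_bound[OF f_cont])
    fix z assume z: "\<bar>z\<bar> \<le> \<bar>\<xi>\<bar>"
    then have "\<bar>z\<bar> powr q \<le> \<bar>\<xi>\<bar> powr q" using q by (intro powr_mono2) auto
    then have "A * (1 + \<bar>z\<bar> powr q) \<le> A * (1 + \<bar>\<xi>\<bar> powr q)" using A by simp
    then show "\<bar>f z\<bar> \<le> A * (1 + \<bar>\<xi>\<bar> powr q)" using f_growth[of z] by simp
  qed
  also have "\<dots> = A * ((1 + \<bar>\<xi>\<bar> powr q) * \<bar>\<xi>\<bar>)" by simp
  also have "\<dots> \<le> A * (1 + \<bar>\<xi>\<bar> powr (q + 1) + 2 * \<bar>\<xi>\<bar> powr (q + 1))"
    using A by (intro mult_left_mono growth_product) auto
  also have "\<dots> \<le> A * (3 * (1 + \<bar>\<xi>\<bar> powr (q + 1)))" using A by (intro mult_left_mono) auto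
  finally show ?thesis by (simp only: mult.assoc mult.left_commute[of A 3])
qed

lemma f_measurable [measurable]: "f \<in> borel_measurable borel" "primitive f \<in> borel_measurable borel"
  using f_cont F_cont by (auto intro: borel_measurable_continuous_onI)

lemma H10_measurable: "u \<in> H10 \<Omega> \<Longrightarrow> u \<in> borel_measurable (lebesgue_on \<Omega>)"
  using H10D(1) L2_measurable by blast

lemma ipH_nonneg: "0 \<le> ipH u u"
  by (simp add: ipH_def ipL_self)

lemma ipH_powr: "u \<in> H10 \<Omega> \<Longrightarrow> ipH u u powr (s / 2) = H.nm u powr s" for s
  by (simp add: H.nm_def powr_half_sqrt[symmetric] powr_powr ipH_nonneg)

lemma power_integrals:
  obtains S where "S > 0" "\<And>u. u \<in> H10 \<Omega> \<Longrightarrow> integrable (lebesgue_on \<Omega>) (\<lambda>x. \<bar>u x\<bar> powr (q + 1))"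
    "\<And>u. u \<in> H10 \<Omega> \<Longrightarrow> (\<integral>x. \<bar>u x\<bar> powr (q + 1) \<partial>lebesgue_on \<Omega>) \<le> S * H.nm u powr (q + 1)"
proof -
  obtain K where K: "K \<ge> 0" "\<And>u. u \<in> H10 \<Omega> \<Longrightarrow> integrable (lebesgue_on \<Omega>) (\<lambda>x. \<bar>u x\<bar> powr (q + 1))"
    "\<And>u. u \<in> H10 \<Omega> \<Longrightarrow> (\<integral>x. \<bar>u x\<bar> powr (q + 1) \<partial>lebesgue_on \<Omega>) \<le> K * ipH u u powr ((q + 1) / 2)"
    using H10_sobolev[of "q + 1"] q q_sub by auto
  have "K * H.nm u powr (q + 1) \<le> (K + 1) * H.nm u powr (q + 1)" for u by (intro mult_right_mono) auto
  then show ?thesis using that[of "K + 1"] K ipH_powr by (auto intro: order_trans)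
qed

text \<open>An exponent strictly between \<open>q + 1\<close> and the critical one; bounds for it give uniform
  integrability of everything that grows like \<open>\<bar>\<xi>\<bar>\<^sup>q\<^sup>+\<^sup>1\<close>.\<close>

lemma higher_power_integrals:
  obtains s where "s > q + 1" "\<And>u. u \<in> H10 \<Omega> \<Longrightarrow> integrable (lebesgue_on \<Omega>) (\<lambda>x. \<bar>u x\<bar> powr s)"
    "\<And>B. \<exists>C. \<forall>u\<in>H10 \<Omega>. H.nm u \<le> B \<longrightarrow> (\<integral>x. \<bar>u x\<bar> powr s \<partial>lebesgue_on \<Omega>) \<le> C"
proof -
  have "\<exists>s. s > q + 1 \<and> (real DIM('a) - 2) * (s - 2) < 4"
  proof (cases "real DIM('a) - 2 > 0")
    case False
    then have "(real DIM('a) - 2) * (q + 2 - 2) \<le> 0" using q by (intro mult_nonpos_nonneg) auto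
    then show ?thesis by (intro exI[of _ "q + 2"]) auto
  next
    case True
    define m where "m = real DIM('a) - 2"
    have m: "m > 0" "m * (q - 1) < 4" using True q_sub unfolding m_def by auto
    \<comment> \<open>The midpoint between \<open>q - 1\<close> and the critical value
      \<open>4 / m\<close>; the exponent is \<open>s = t + 2\<close>.\<close>
    define t where "t = (q - 1 + 4 / m) / 2"
    have "q - 1 < 4 / m" using m by (simp add: pos_less_divide_eq mult.commute)
    then have t: "q - 1 < t" "t < 4 / m" unfolding t_def by auto
    then have "m * t < 4" using m by (simp add: pos_less_divide_eq mult.commute)
    then show ?thesis using t unfolding m_def[symmetric] by (intro exI[of _ "t + 2"]) auto
  qed
  then obtain s where s: "s > q + 1" "(real DIM('a) - 2) * (s - 2) < 4" by blast
  obtain K where K: "K \<ge> 0" "\<And>u. u \<in> H10 \<Omega> \<Longrightarrow> integrable (lebesgue_on \<Omega>) (\<lambda>x. \<bar>u x\<bar> powr s)"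
    "\<And>u. u \<in> H10 \<Omega> \<Longrightarrow> (\<integral>x. \<bar>u x\<bar> powr s \<partial>lebesgue_on \<Omega>) \<le> K * ipH u u powr (s / 2)"
    using H10_sobolev[of s] q s by auto
  have "(\<integral>x. \<bar>u x\<bar> powr s \<partial>lebesgue_on \<Omega>) \<le> K * \<bar>B\<bar> powr s" if "u \<in> H10 \<Omega>" "H.nm u \<le> B" for u B
  proof -
    have "H.nm u powr s \<le> \<bar>B\<bar> powr s" using that s q by (intro powr_mono2) auto
    then have "K * ipH u u powr (s / 2) \<le> K * \<bar>B\<bar> powr s"
      unfolding ipH_powr[OF that(1)] using K(1) by (rule mult_left_mono)
    then show ?thesis using K(3)[OF that(1)] by linarith
  qed
  then show ?thesis using that[OF s(1) K(2)] by blast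
qed

lemma pairing_integrable:
  assumes u: "u \<in> H10 \<Omega>" and v: "v \<in> H10 \<Omega>"
  shows "integrable (lebesgue_on \<Omega>) (\<lambda>x. f (u x) * v x)"
proof -
  interpret finite_measure "lebesgue_on \<Omega>" by (rule finite_measure_\<Omega>)
  note [measurable] = H10_measurable[OF u] H10_measurable[OF v]
  obtain S where S: "\<And>u. u \<in> H10 \<Omega> \<Longrightarrow> integrable (lebesgue_on \<Omega>) (\<lambda>x. \<bar>u x\<bar> powr (q + 1))"
    using power_integrals by blast
  show ?thesis
  proof (rule Bochner_Integration.integrable_bound)
    show "integrable (lebesgue_on \<Omega>) (\<lambda>x. A * (1 + \<bar>u x\<bar> powr (q + 1) + 2 * \<bar>v x\<bar> powr (q + 1)))"
      using S[OF u] S[OF v] by simp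
    have pt: "\<bar>f (u x) * v x\<bar> \<le> A * (1 + \<bar>u x\<bar> powr (q + 1) + 2 * \<bar>v x\<bar> powr (q + 1))" for x
    proof -
      have "\<bar>f (u x)\<bar> * \<bar>v x\<bar> \<le> A * (1 + \<bar>u x\<bar> powr q) * \<bar>v x\<bar>" by (intro mult_right_mono f_growth) auto
      also have "\<dots> \<le> A * (1 + \<bar>u x\<bar> powr (q + 1) + 2 * \<bar>v x\<bar> powr (q + 1))"
        unfolding mult.assoc using A by (intro mult_left_mono growth_product) auto
      finally show ?thesis by (simp add: abs_mult)
    qed
    show "AE x in lebesgue_on \<Omega>. norm (f (u x) * v x) \<le> norm (A * (1 + \<bar>u x\<bar> powr (q + 1) + 2 * \<bar>v x\<bar> powr (q + 1)))"
      unfolding real_norm_def by (intro AE_I2 order_trans[OF pt abs_ge_self])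
  qed measurable
qed

text \<open>The growth estimate is not homogeneous in \<open>v\<close>, so it is used on the unit
  ball and extended by scaling. This replaces the Hoelder inequality.\<close>

lemma pairing_bound:
  obtains C where "C \<ge> 0" "\<And>u v. u \<in> H10 \<Omega> \<Longrightarrow> v \<in> H10 \<Omega> \<Longrightarrow> \<bar>pairing u v\<bar> \<le> C * (1 + H.nm u powr (q + 1)) * H.nm v"
proof -
  interpret finite_measure "lebesgue_on \<Omega>" by (rule finite_measure_\<Omega>)
  obtain S where S: "S > 0" "\<And>u. u \<in> H10 \<Omega> \<Longrightarrow> integrable (lebesgue_on \<Omega>) (\<lambda>x. \<bar>u x\<bar> powr (q + 1))"
    "\<And>u. u \<in> H10 \<Omega> \<Longrightarrow> (\<integral>x. \<bar>u x\<bar> powr (q + 1) \<partial>lebesgue_on \<Omega>) \<le> S * H.nm u powr (q + 1)"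
    using power_integrals by blast
  define \<mu> where "\<mu> = measure (lebesgue_on \<Omega>) (space (lebesgue_on \<Omega>))"
  define C where "C = A * (\<mu> + 2 * S)"
  have C: "C \<ge> 0" unfolding C_def \<mu>_def using A S by simp
  have one: "\<bar>pairing u v\<bar> \<le> C * (1 + H.nm u powr (q + 1))"
    if u: "u \<in> H10 \<Omega>" and v: "v \<in> H10 \<Omega>" and le: "H.nm v \<le> 1" for u v
  proof -
    have "\<bar>pairing u v\<bar> \<le> (\<integral>x. \<bar>f (u x) * v x\<bar> \<partial>lebesgue_on \<Omega>)" unfolding pairing_def by (rule integral_abs_bound)
    also have "\<dots> \<le> (\<integral>x. A * (1 + \<bar>u x\<bar> powr (q + 1) + 2 * \<bar>v x\<bar> powr (q + 1)) \<partial>lebesgue_on \<Omega>)"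
    proof (intro integral_mono integrable_abs pairing_integrable u v)
      show "integrable (lebesgue_on \<Omega>) (\<lambda>x. A * (1 + \<bar>u x\<bar> powr (q + 1) + 2 * \<bar>v x\<bar> powr (q + 1)))"
        using S(2)[OF u] S(2)[OF v] by simp
      fix x
      have "\<bar>f (u x)\<bar> * \<bar>v x\<bar> \<le> A * (1 + \<bar>u x\<bar> powr q) * \<bar>v x\<bar>" by (intro mult_right_mono f_growth) auto
      also have "\<dots> \<le> A * (1 + \<bar>u x\<bar> powr (q + 1) + 2 * \<bar>v x\<bar> powr (q + 1))"
        unfolding mult.assoc using A by (intro mult_left_mono growth_product) auto
      finally show "\<bar>f (u x) * v x\<bar> \<le> A * (1 + \<bar>u x\<bar> powr (q + 1) + 2 * \<bar>v x\<bar> powr (q + 1))" by (simp add: abs_mult)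
    qed
    also have "\<dots> = A * (\<mu> + (\<integral>x. \<bar>u x\<bar> powr (q + 1) \<partial>lebesgue_on \<Omega>) + 2 * (\<integral>x. \<bar>v x\<bar> powr (q + 1) \<partial>lebesgue_on \<Omega>))"
      using S(2)[OF u] S(2)[OF v] unfolding \<mu>_def by simp
    also have "\<dots> \<le> A * (\<mu> + S * H.nm u powr (q + 1) + 2 * S)"
    proof (intro mult_left_mono add_mono)
      have "H.nm v powr (q + 1) \<le> 1 powr (q + 1)" using le v q by (intro powr_mono2) auto
      then have "S * H.nm v powr (q + 1) \<le> S" using S(1) by simp
      then show "(\<integral>x. \<bar>v x\<bar> powr (q + 1) \<partial>lebesgue_on \<Omega>) \<le> S" using S(3)[OF v] by linarith
    qed (use S(3)[OF u] A in auto)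
    also have "\<dots> \<le> C * (1 + H.nm u powr (q + 1))"
    proof -
      have "\<mu> + S * t + 2 * S \<le> (\<mu> + 2 * S) * (1 + t)" if "t \<ge> 0" for t
        using that S(1) mult_nonneg_nonneg[of \<mu> t] mult_nonneg_nonneg[of S t] unfolding \<mu>_def by (simp add: algebra_simps)
      then show ?thesis unfolding C_def mult.assoc using A by (intro mult_left_mono) auto
    qed
    finally show ?thesis .
  qed
  have scale: "pairing u (c *\<^sub>R v) = c * pairing u v" for u v c
    unfolding pairing_def by (simp add: mult.left_commute[of _ c])
  have "\<bar>pairing u v\<bar> \<le> C * (1 + H.nm u powr (q + 1)) * H.nm v" if u: "u \<in> H10 \<Omega>" and v: "v \<in> H10 \<Omega>" for u v
  proof (cases "H.nm v = 0")
    case True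
    have "pairing u v = 0"
    proof (rule ccontr)
      assume ne: "pairing u v \<noteq> 0"
      \<comment> \<open>A \<open>v\<close> of seminorm zero remains in the unit ball under every
        scaling; this factor would lift the pairing just above the bound valid there.\<close>
      define t where "t = (C * (1 + H.nm u powr (q + 1)) + 1) / pairing u v"
      have "\<bar>pairing u (t *\<^sub>R v)\<bar> \<le> C * (1 + H.nm u powr (q + 1))"
        by (rule one[OF u]) (use v True in \<open>auto simp: H.nm_scale\<close>)
      moreover have "pairing u (t *\<^sub>R v) = C * (1 + H.nm u powr (q + 1)) + 1"
        unfolding scale t_def using ne by simp
      ultimately show False by linarith
    qed
    then show ?thesis using True by simp
  next
    case False
    then have p: "H.nm v > 0" using v H.nm_nonneg[OF v] by linarith
    have "\<bar>pairing u ((1 / H.nm v) *\<^sub>R v)\<bar> \<le> C * (1 + H.nm u powr (q + 1))"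
      by (rule one[OF u]) (use v p in \<open>auto simp: H.nm_scale\<close>)
    then show ?thesis unfolding scale using p by (simp add: abs_mult field_simps)
  qed
  with C show ?thesis using that by blast
qed

text \<open>The gradient of \<open>J\<close> for the Dirichlet form, that is, the Riesz
  representative of \<open>pairing u\<close>. It is fixed up to seminorm zero only, hence the
  choice.\<close>

definition G :: "('a \<Rightarrow> real) \<Rightarrow> 'a \<Rightarrow> real" where
  "G u = (SOME g. g \<in> H10 \<Omega> \<and> (\<forall>v\<in>H10 \<Omega>. ipH g v = pairing u v))"

lemma G: assumes u: "u \<in> H10 \<Omega>" shows "G u \<in> H10 \<Omega>" "\<And>v. v \<in> H10 \<Omega> \<Longrightarrow> ipH (G u) v = pairing u v"
proof -
  obtain C where "C \<ge> 0" and C: "\<And>u v. u \<in> H10 \<Omega> \<Longrightarrow> v \<in> H10 \<Omega> \<Longrightarrow> \<bar>pairing u v\<bar> \<le> C * (1 + H.nm u powr (q + 1)) * H.nm v"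
    using pairing_bound by blast
  have "\<exists>g. g \<in> H10 \<Omega> \<and> (\<forall>v\<in>H10 \<Omega>. ipH g v = pairing u v)"
  proof (rule H.riesz[of "pairing u" "C * (1 + H.nm u powr (q + 1))"])
    show "pairing u (v + w) = pairing u v + pairing u w" if "v \<in> H10 \<Omega>" "w \<in> H10 \<Omega>" for v w
      unfolding pairing_def using pairing_integrable[OF u that(1)] pairing_integrable[OF u that(2)]
      by (simp add: distrib_left)
    show "pairing u (c *\<^sub>R v) = c * pairing u v" for c v
      unfolding pairing_def by (simp add: mult.left_commute[of _ c])
    show "\<bar>pairing u v\<bar> \<le> C * (1 + H.nm u powr (q + 1)) * H.nm v" if "v \<in> H10 \<Omega>" for v by (rule C[OF u that])
  qed blast
  from someI_ex[OF this] show "G u \<in> H10 \<Omega>" "\<And>v. v \<in> H10 \<Omega> \<Longrightarrow> ipH (G u) v = pairing u v"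
    unfolding G_def by blast+
qed

lemma G_bound: obtains C where "C \<ge> 0" "\<And>u. u \<in> H10 \<Omega> \<Longrightarrow> H.nm (G u) \<le> C * (1 + H.nm u powr (q + 1))"
proof -
  obtain C where C: "C \<ge> 0" "\<And>u v. u \<in> H10 \<Omega> \<Longrightarrow> v \<in> H10 \<Omega> \<Longrightarrow> \<bar>pairing u v\<bar> \<le> C * (1 + H.nm u powr (q + 1)) * H.nm v"
    using pairing_bound by blast
  have "H.nm (G u) \<le> C * (1 + H.nm u powr (q + 1))" if u: "u \<in> H10 \<Omega>" for u
  proof (cases "H.nm (G u) = 0")
    case True
    then show ?thesis using C(1) by simp
  next
    case False
    then have p: "H.nm (G u) > 0" using H.nm_nonneg[OF G(1)[OF u]] by linarith
    have "H.nm (G u) * H.nm (G u) = \<bar>pairing u (G u)\<bar>"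
      using G[OF u] H.nm_sq[OF G(1)[OF u]] by (simp add: power2_eq_square ipH_nonneg flip: G(2)[OF u])
    also have "\<dots> \<le> C * (1 + H.nm u powr (q + 1)) * H.nm (G u)" by (rule C(2)[OF u G(1)[OF u]])
    finally show ?thesis using p by simp
  qed
  with C(1) show ?thesis using that by blast
qed

lemma J_integrable: assumes u: "u \<in> H10 \<Omega>" shows "integrable (lebesgue_on \<Omega>) (\<lambda>x. primitive f (u x))"
proof -
  interpret finite_measure "lebesgue_on \<Omega>" by (rule finite_measure_\<Omega>)
  note [measurable] = H10_measurable[OF u]
  obtain S where S: "\<And>u. u \<in> H10 \<Omega> \<Longrightarrow> integrable (lebesgue_on \<Omega>) (\<lambda>x. \<bar>u x\<bar> powr (q + 1))"
    using power_integrals by blast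
  show ?thesis
  proof (rule Bochner_Integration.integrable_bound)
    show "integrable (lebesgue_on \<Omega>) (\<lambda>x. 3 * A * (1 + \<bar>u x\<bar> powr (q + 1)))" using S[OF u] by simp
    show "AE x in lebesgue_on \<Omega>. norm (primitive f (u x)) \<le> norm (3 * A * (1 + \<bar>u x\<bar> powr (q + 1)))"
      unfolding real_norm_def by (intro AE_I2 order_trans[OF F_growth abs_ge_self])
  qed measurable
qed

lemma J_bound: obtains C where "C > 0" "\<And>u. u \<in> H10 \<Omega> \<Longrightarrow> \<bar>J u\<bar> \<le> C * (1 + H.nm u powr (q + 1))"
proof -
  interpret finite_measure "lebesgue_on \<Omega>" by (rule finite_measure_\<Omega>)
  obtain S where S: "S > 0" "\<And>u. u \<in> H10 \<Omega> \<Longrightarrow> integrable (lebesgue_on \<Omega>) (\<lambda>x. \<bar>u x\<bar> powr (q + 1))"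
    "\<And>u. u \<in> H10 \<Omega> \<Longrightarrow> (\<integral>x. \<bar>u x\<bar> powr (q + 1) \<partial>lebesgue_on \<Omega>) \<le> S * H.nm u powr (q + 1)"
    using power_integrals by blast
  define \<mu> where "\<mu> = measure (lebesgue_on \<Omega>) (space (lebesgue_on \<Omega>))"
  define C where "C = 3 * A * (\<mu> + S)"
  have \<mu>: "\<mu> \<ge> 0" unfolding \<mu>_def by simp
  have C: "C > 0" unfolding C_def using A S \<mu> by (simp add: add_nonneg_pos)
  have "\<bar>J u\<bar> \<le> C * (1 + H.nm u powr (q + 1))" if u: "u \<in> H10 \<Omega>" for u
  proof -
    have "\<bar>J u\<bar> \<le> (\<integral>x. \<bar>primitive f (u x)\<bar> \<partial>lebesgue_on \<Omega>)" unfolding J_def by (rule integral_abs_bound)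
    also have "\<dots> \<le> (\<integral>x. 3 * A * (1 + \<bar>u x\<bar> powr (q + 1)) \<partial>lebesgue_on \<Omega>)"
      by (intro integral_mono integrable_abs J_integrable[OF u] F_growth) (use S(2)[OF u] in simp)
    also have "\<dots> = 3 * A * (\<mu> + (\<integral>x. \<bar>u x\<bar> powr (q + 1) \<partial>lebesgue_on \<Omega>))"
      using S(2)[OF u] unfolding \<mu>_def by simp
    also have "\<dots> \<le> 3 * A * (\<mu> + S * H.nm u powr (q + 1))" using S(3)[OF u] A by simp
    also have "\<dots> \<le> 3 * A * ((\<mu> + S) * (1 + H.nm u powr (q + 1)))"
      using A S(1) \<mu> mult_nonneg_nonneg[OF \<mu> powr_ge_zero, of "H.nm u" "q + 1"]
      by (intro mult_left_mono) (auto simp: algebra_simps)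
    finally show ?thesis unfolding C_def by (simp add: mult.assoc)
  qed
  with C show ?thesis using that by blast
qed

text \<open>Since \<open>s > q + 1\<close>, the primitive is dominated by an arbitrarily small
  multiple of the power \<open>s\<close> plus a constant. Bounded seminorms bound the integrals of
  that power, and almost everywhere convergence suffices.\<close>

lemma J_tendsto:
  assumes x: "\<And>n::nat. x n \<in> H10 \<Omega>" and B: "\<And>n. H.nm (x n) \<le> B" and l: "l \<in> H10 \<Omega>"
    and lim: "AE t in lebesgue_on \<Omega>. (\<lambda>n. x n t) \<longlonglongrightarrow> l t"
  shows "(\<lambda>n. J (x n)) \<longlonglongrightarrow> J l"
proof -
  obtain s where s: "s > q + 1" "\<And>u. u \<in> H10 \<Omega> \<Longrightarrow> integrable (lebesgue_on \<Omega>) (\<lambda>x. \<bar>u x\<bar> powr s)"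
    "\<And>B. \<exists>C. \<forall>u\<in>H10 \<Omega>. H.nm u \<le> B \<longrightarrow> (\<integral>x. \<bar>u x\<bar> powr s \<partial>lebesgue_on \<Omega>) \<le> C"
    using higher_power_integrals by blast
  obtain C where C: "\<And>u. u \<in> H10 \<Omega> \<Longrightarrow> H.nm u \<le> B \<Longrightarrow> (\<integral>x. \<bar>u x\<bar> powr s \<partial>lebesgue_on \<Omega>) \<le> C"
    using s(3) by blast
  have growth: "\<exists>c. \<forall>y. \<bar>primitive f y\<bar> \<le> e * norm y powr s + c" if e: "e > 0" for e
  proof -
    obtain c where c: "\<And>y. y \<ge> 0 \<Longrightarrow> y powr (q + 1) \<le> e / (3 * A) * y powr s + c"
      using powr_le_eps_powr[of "q + 1" s "e / (3 * A)"] q s(1) e A by auto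
    have "\<bar>primitive f y\<bar> \<le> e * norm y powr s + 3 * A * (1 + c)" for y
    proof -
      have "3 * A * (1 + \<bar>y\<bar> powr (q + 1)) \<le> 3 * A * (1 + (e / (3 * A) * \<bar>y\<bar> powr s + c))"
        using A c[of "\<bar>y\<bar>"] by (intro mult_left_mono) auto
      also have "\<dots> = e * \<bar>y\<bar> powr s + 3 * A * (1 + c)" using A by (simp add: field_simps)
      finally show ?thesis using F_growth[of y] by simp
    qed
    then show ?thesis by blast
  qed
  show ?thesis unfolding J_def
    by (rule integral_tendsto_subcritical[OF finite_measure_\<Omega> F_cont growth H10_measurable[OF x] H10_measurable[OF l] lim])
       (use s x C[OF x B] q in auto)
qed

end

section \<open>Compactness and uniform continuity of the gradient of \<open>J\<close>\<close>

context subcritical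
begin

lemma nm_le_iff_ipH: "u \<in> H10 \<Omega> \<Longrightarrow> 0 \<le> R \<Longrightarrow> H.nm u \<le> R \<longleftrightarrow> ipH u u \<le> R\<^sup>2"
  using real_sqrt_le_iff[of "ipH u u" "R\<^sup>2"] by (simp add: H.nm_def)

text \<open>Prepares \<open>G_compact\<close>, whose integrand depends on three functions at once:
  all three are bounded by the norm \<open>N\<close> of the triple, so the integrand has order
  \<open>q + 1 < s\<close>.\<close>

lemma triple_growth:
  assumes s: "s > q + 1" and e: "e > 0"
  shows "\<exists>c. \<forall>y::real \<times> real \<times> real. \<bar>(f (fst y) - f (fst (snd y))) * snd (snd y)\<bar> \<le> e * norm y powr s + c"
proof -
  define e' where "e' = e / (6 * A)"
  have e': "e' > 0" using e A unfolding e'_def by simp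
  obtain c where c: "\<And>y. y \<ge> 0 \<Longrightarrow> y powr (q + 1) \<le> e' * y powr s + c"
    using powr_le_eps_powr[of "q + 1" s e'] q s e' by auto
  have "\<bar>(f x - f y) * z\<bar> \<le> e * norm (x, y, z) powr s + A * (2 + 6 * c)" for x y z :: real
  proof -
    define N where "N = norm (x, y, z)"
    have N: "\<bar>x\<bar> \<le> N" "\<bar>y\<bar> \<le> N" "\<bar>z\<bar> \<le> N" "0 \<le> N"
    proof -
      have "\<bar>x\<bar> \<le> N" "norm (y, z) \<le> N" "\<bar>y\<bar> \<le> norm (y, z)" "\<bar>z\<bar> \<le> norm (y, z)" "0 \<le> N"
        using norm_fst_le[of x "(y, z)"] norm_snd_le[of "(y, z)" x] norm_fst_le[of y z] norm_snd_le[of z y]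
        unfolding N_def by simp_all
      then show "\<bar>x\<bar> \<le> N" "\<bar>y\<bar> \<le> N" "\<bar>z\<bar> \<le> N" "0 \<le> N" by linarith+
    qed
    have f1: "\<bar>f w\<bar> \<le> A * (1 + N powr q)" if "\<bar>w\<bar> \<le> N" for w
    proof -
      have "\<bar>w\<bar> powr q \<le> N powr q" using that q by (intro powr_mono2) auto
      then have "A * (1 + \<bar>w\<bar> powr q) \<le> A * (1 + N powr q)" using A by simp
      then show ?thesis using f_growth[of w] by linarith
    qed
    have "\<bar>f x - f y\<bar> \<le> 2 * (A * (1 + N powr q))" using f1[OF N(1)] f1[OF N(2)] by linarith
    then have "\<bar>(f x - f y) * z\<bar> \<le> 2 * (A * (1 + N powr q)) * N"
      unfolding abs_mult using N A by (intro mult_mono) auto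
    also have "\<dots> = 2 * A * ((1 + N powr q) * N)" by simp
    also have "\<dots> \<le> 2 * A * (1 + N powr (q + 1) + 2 * N powr (q + 1))"
      using A N by (intro mult_left_mono growth_product) auto
    also have "\<dots> \<le> 2 * A * (1 + 3 * (e' * N powr s + c))"
      using A c[OF N(4)] by (intro mult_left_mono) auto
    also have "\<dots> = (6 * A * e') * N powr s + A * (2 + 6 * c)" by (simp add: algebra_simps)
    also have "6 * A * e' = e" using A unfolding e'_def by simp
    finally show ?thesis unfolding N_def .
  qed
  then show ?thesis by (intro exI[of _ "A * (2 + 6 * c)"]) auto
qed

lemma norm_triple_powr:
  fixes x y z :: real
  assumes "s > 0"
  shows "norm (x, y, z) powr s \<le> 3 powr s * (\<bar>x\<bar> powr s + \<bar>y\<bar> powr s + \<bar>z\<bar> powr s)"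
proof -
  define M where "M = max \<bar>x\<bar> (max \<bar>y\<bar> \<bar>z\<bar>)"
  have "norm (x, y, z) \<le> norm x + norm (y, z)" by (rule norm_Pair_le)
  also have "\<dots> \<le> norm x + (norm y + norm z)" by (intro add_left_mono norm_Pair_le)
  also have "\<dots> \<le> 3 * M"
  proof -
    have "\<bar>x\<bar> \<le> M" "\<bar>y\<bar> \<le> M" "\<bar>z\<bar> \<le> M" unfolding M_def by auto
    then show ?thesis by simp
  qed
  finally have "norm (x, y, z) powr s \<le> (3 * M) powr s" using assms by (intro powr_mono2) auto
  also have "\<dots> = 3 powr s * M powr s" by (rule powr_mult)
  also have "M powr s \<le> \<bar>x\<bar> powr s + \<bar>y\<bar> powr s + \<bar>z\<bar> powr s"
    unfolding M_def max_def by auto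
  finally show ?thesis by simp
qed

text \<open>With \<open>z = G x - G y\<close>, the squared seminorm of \<open>z\<close> is the
  integral of \<open>(f x - f y) * z\<close>. The functions \<open>z n\<close> are bounded in
  \<open>H10\<close>, so a subsequence of them also converges almost everywhere. The integrand then
  tends pointwise to 0, because both sequences have the limit \<open>l\<close>, and the growth bound
  passes this on to the integrals.\<close>

lemma G_compact:
  assumes x: "\<And>n::nat. x n \<in> H10 \<Omega>" "\<And>n. H.nm (x n) \<le> B" and y: "\<And>n. y n \<in> H10 \<Omega>" "\<And>n. H.nm (y n) \<le> B"
    and l: "l \<in> H10 \<Omega>" and xl: "AE t in lebesgue_on \<Omega>. (\<lambda>n. x n t) \<longlonglongrightarrow> l t"
    and yl: "AE t in lebesgue_on \<Omega>. (\<lambda>n. y n t) \<longlonglongrightarrow> l t"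
  obtains r :: "nat \<Rightarrow> nat" where "strict_mono r" "(\<lambda>n. H.nm (G (x (r n)) - G (y (r n)))) \<longlonglongrightarrow> 0"
proof -
  define z where "z n = G (x n) - G (y n)" for n
  have zX: "z n \<in> H10 \<Omega>" for n unfolding z_def using G(1) x y by auto
  obtain C where C: "C \<ge> 0" "\<And>u. u \<in> H10 \<Omega> \<Longrightarrow> H.nm (G u) \<le> C * (1 + H.nm u powr (q + 1))" using G_bound by blast
  define B' where "B' = 2 * (C * (1 + B powr (q + 1)))"
  have gb: "H.nm (G u) \<le> C * (1 + B powr (q + 1))" if "u \<in> H10 \<Omega>" "H.nm u \<le> B" for u
  proof -
    have "H.nm u powr (q + 1) \<le> B powr (q + 1)" using that q by (intro powr_mono2) auto
    then have "C * (1 + H.nm u powr (q + 1)) \<le> C * (1 + B powr (q + 1))" using C by (intro mult_left_mono) auto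
    then show ?thesis using C(2)[OF that(1)] by linarith
  qed
  have zB: "H.nm (z n) \<le> B'" for n
  proof -
    have "H.nm (z n) \<le> H.nm (G (x n)) + H.nm (G (y n))"
      unfolding z_def using H.nm_triangle[of "G (x n)" "- G (y n)"] H.nm_minus[of "G (y n)"] G(1) x(1) y(1) by simp
    then show ?thesis using gb[OF x(1) x(2), of n] gb[OF y(1) y(2), of n] unfolding B'_def by linarith
  qed
  have "0 \<le> B'" using zB[of 0] H.nm_nonneg[OF zX[of 0]] by linarith
  then have "ipH (z n) (z n) \<le> B'\<^sup>2" for n using zB[of n] nm_le_iff_ipH[OF zX] by blast
  from rellich[of z, OF zX this] obtain r :: "nat \<Rightarrow> nat" and \<zeta> d where r: "strict_mono r" and \<zeta>: "\<zeta> \<in> H10 \<Omega>"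
    and \<zeta>l: "AE t in lebesgue_on \<Omega>. (\<lambda>n. z (r n) t) \<longlonglongrightarrow> \<zeta> t" by metis
  obtain s where s: "s > q + 1" "\<And>u. u \<in> H10 \<Omega> \<Longrightarrow> integrable (lebesgue_on \<Omega>) (\<lambda>x. \<bar>u x\<bar> powr s)"
    "\<And>B. \<exists>C. \<forall>u\<in>H10 \<Omega>. H.nm u \<le> B \<longrightarrow> (\<integral>x. \<bar>u x\<bar> powr s \<partial>lebesgue_on \<Omega>) \<le> C"
    using higher_power_integrals by blast
  obtain C1 where C1: "\<And>u. u \<in> H10 \<Omega> \<Longrightarrow> H.nm u \<le> B \<Longrightarrow> (\<integral>x. \<bar>u x\<bar> powr s \<partial>lebesgue_on \<Omega>) \<le> C1"
    using s(3)[of B] by blast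
  obtain C2 where C2: "\<And>u. u \<in> H10 \<Omega> \<Longrightarrow> H.nm u \<le> B' \<Longrightarrow> (\<integral>x. \<bar>u x\<bar> powr s \<partial>lebesgue_on \<Omega>) \<le> C2"
    using s(3)[of B'] by blast
  have s0: "s > 0" using s(1) q by simp
  define g :: "real \<times> real \<times> real \<Rightarrow> real" where "g = (\<lambda>y. (f (fst y) - f (fst (snd y))) * snd (snd y))"
  define U where "U n = (\<lambda>t. (x (r n) t, y (r n) t, z (r n) t))" for n
  have Um: "U n \<in> borel_measurable (lebesgue_on \<Omega>)" for n
    unfolding U_def using H10_measurable[OF x(1)] H10_measurable[OF y(1)] H10_measurable[OF zX] by (intro borel_measurable_Pair)
  have dom: "integrable (lebesgue_on \<Omega>) (\<lambda>t. 3 powr s * (\<bar>x n t\<bar> powr s + \<bar>y n t\<bar> powr s + \<bar>z n t\<bar> powr s))" for n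
    using s(2)[OF x(1)] s(2)[OF y(1)] s(2)[OF zX] by simp
  have Uint: "integrable (lebesgue_on \<Omega>) (\<lambda>t. norm (U n t) powr s)" for n
  proof (rule Bochner_Integration.integrable_bound[OF dom])
    show "(\<lambda>t. norm (U n t) powr s) \<in> borel_measurable (lebesgue_on \<Omega>)" using Um[of n] by measurable
    show "AE t in lebesgue_on \<Omega>. norm (norm (U n t) powr s) \<le> norm (3 powr s * (\<bar>x (r n) t\<bar> powr s + \<bar>y (r n) t\<bar> powr s + \<bar>z (r n) t\<bar> powr s))"
      unfolding U_def using norm_triple_powr[OF s0] by (intro AE_I2) simp
  qed
  have UB: "(\<integral>t. norm (U n t) powr s \<partial>lebesgue_on \<Omega>) \<le> 3 powr s * (C1 + C1 + C2)" for n
  proof -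
    have "(\<integral>t. norm (U n t) powr s \<partial>lebesgue_on \<Omega>) \<le> (\<integral>t. 3 powr s * (\<bar>x (r n) t\<bar> powr s + \<bar>y (r n) t\<bar> powr s + \<bar>z (r n) t\<bar> powr s) \<partial>lebesgue_on \<Omega>)"
      by (intro integral_mono Uint dom) (simp only: U_def norm_triple_powr[OF s0])
    also have "\<dots> = 3 powr s * ((\<integral>t. \<bar>x (r n) t\<bar> powr s \<partial>lebesgue_on \<Omega>) + (\<integral>t. \<bar>y (r n) t\<bar> powr s \<partial>lebesgue_on \<Omega>) + (\<integral>t. \<bar>z (r n) t\<bar> powr s \<partial>lebesgue_on \<Omega>))"
      using s(2)[OF x(1)] s(2)[OF y(1)] s(2)[OF zX] by simp
    also have "\<dots> \<le> 3 powr s * (C1 + C1 + C2)"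
      using C1[OF x(1) x(2)] C1[OF y(1) y(2)] C2[OF zX zB] by (intro mult_left_mono add_mono) auto
    finally show ?thesis .
  qed
  have xl': "AE t in lebesgue_on \<Omega>. (\<lambda>n. x (r n) t) \<longlonglongrightarrow> l t"
    using xl by eventually_elim (use LIMSEQ_subseq_LIMSEQ[OF _ r] in \<open>auto simp: o_def\<close>)
  have yl': "AE t in lebesgue_on \<Omega>. (\<lambda>n. y (r n) t) \<longlonglongrightarrow> l t"
    using yl by eventually_elim (use LIMSEQ_subseq_LIMSEQ[OF _ r] in \<open>auto simp: o_def\<close>)
  have Ul: "AE t in lebesgue_on \<Omega>. (\<lambda>n. U n t) \<longlonglongrightarrow> (l t, l t, \<zeta> t)"
    using xl' yl' \<zeta>l unfolding U_def by eventually_elim (intro tendsto_Pair)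
  have lm: "(\<lambda>t. (l t, l t, \<zeta> t)) \<in> borel_measurable (lebesgue_on \<Omega>)"
    using H10_measurable[OF l] H10_measurable[OF \<zeta>] by (intro borel_measurable_Pair)
  have gc: "continuous_on UNIV g"
    unfolding g_def by (intro continuous_intros continuous_on_compose2[OF f_cont]) auto
  have "(\<lambda>n. \<integral>t. g (U n t) \<partial>lebesgue_on \<Omega>) \<longlonglongrightarrow> (\<integral>t. g (l t, l t, \<zeta> t) \<partial>lebesgue_on \<Omega>)"
    by (rule integral_tendsto_subcritical[OF finite_measure_\<Omega> gc _ Um lm Ul Uint UB s0])
       (unfold g_def, rule triple_growth[OF s(1)])
  moreover have "(\<integral>t. g (U n t) \<partial>lebesgue_on \<Omega>) = ipH (z (r n)) (z (r n))" for n
  proof -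
    have "ipH (z (r n)) (z (r n)) = pairing (x (r n)) (z (r n)) - pairing (y (r n)) (z (r n))"
      using G x y zX by (subst (1) z_def) (simp add: H.ip_diff_left)
    also have "\<dots> = (\<integral>t. f (x (r n) t) * z (r n) t - f (y (r n) t) * z (r n) t \<partial>lebesgue_on \<Omega>)"
      unfolding pairing_def
      by (rule Bochner_Integration.integral_diff[symmetric]; rule pairing_integrable) (use x y zX in auto)
    finally show ?thesis by (simp add: g_def U_def left_diff_distrib)
  qed
  ultimately have "(\<lambda>n. ipH (z (r n)) (z (r n))) \<longlonglongrightarrow> 0" by (simp add: g_def)
  then have "(\<lambda>n. H.nm (z (r n))) \<longlonglongrightarrow> 0" using tendsto_real_sqrt unfolding H.nm_def by fastforce
  with r show ?thesis using that unfolding z_def by blast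
qed

lemma H10_AE_subseq:
  assumes "\<And>n::nat. x n \<in> H10 \<Omega>" "(\<lambda>n. H.nm (x n)) \<longlonglongrightarrow> 0"
  obtains r :: "nat \<Rightarrow> nat" where "strict_mono r" "AE t in lebesgue_on \<Omega>. (\<lambda>n. x (r n) t) \<longlonglongrightarrow> 0"
proof -
  obtain C where C: "C \<ge> 1" "\<And>u. u \<in> H10 \<Omega> \<Longrightarrow> ipL \<Omega> u u \<le> C * ipH u u" using poincare by blast
  have "(\<lambda>n. (H.nm (x n))\<^sup>2) \<longlonglongrightarrow> 0\<^sup>2" by (rule tendsto_power[OF assms(2)])
  then have z: "(\<lambda>n. C * ipH (x n) (x n)) \<longlonglongrightarrow> 0"
    using assms(1) by (intro tendsto_mult_right_zero) (simp add: H.nm_sq)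
  have "(\<lambda>n. ipL \<Omega> (x n - 0) (x n - 0)) \<longlonglongrightarrow> 0"
    by (rule Lim_null_comparison[OF always_eventually z]) (use C(2)[OF assms(1)] in \<open>simp add: ipL_self\<close>)
  then show ?thesis
    using L2_AE_subseq[of x 0] H10D(1)[OF assms(1)] that by fastforce
qed

text \<open>By contradiction: pairs whose distance tends to 0 have, after passing to subsequences, a
  common limit almost everywhere, and \<open>G_compact\<close> brings their gradients
  together.\<close>

lemma G_uniformly_continuous:
  assumes e: "e > 0"
  shows "\<exists>d>0. \<forall>u\<in>H10 \<Omega>. \<forall>v\<in>H10 \<Omega>. H.nm u \<le> R \<longrightarrow> H.nm v \<le> R \<longrightarrow> H.nm (u - v) < d \<longrightarrow> H.nm (G u - G v) < e"
proof (rule ccontr)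
  assume neg: "\<not> ?thesis"
  have "\<exists>u v. u \<in> H10 \<Omega> \<and> v \<in> H10 \<Omega> \<and> H.nm u \<le> R \<and> H.nm v \<le> R \<and> H.nm (u - v) < 1 / Suc n \<and> \<not> H.nm (G u - G v) < e" for n :: nat
  proof (rule ccontr)
    assume "\<not> ?thesis"
    moreover have "(1::real) / Suc n > 0" by simp
    ultimately show False using neg by blast
  qed
  then obtain u v where u: "\<And>n::nat. u n \<in> H10 \<Omega>" "\<And>n. H.nm (u n) \<le> R" and v: "\<And>n. v n \<in> H10 \<Omega>" "\<And>n. H.nm (v n) \<le> R"
    and uv: "\<And>n. H.nm (u n - v n) < 1 / Suc n" and G_e: "\<And>n. \<not> H.nm (G (u n) - G (v n)) < e" by metis
  have R: "0 \<le> R" using u(2)[of 0] H.nm_nonneg[OF u(1)[of 0]] by linarith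
  have "ipH (u n) (u n) \<le> R\<^sup>2" for n using nm_le_iff_ipH[OF u(1) R] u(2) by blast
  from rellich[of u, OF u(1) this] obtain r :: "nat \<Rightarrow> nat" and l d where r: "strict_mono r" and l: "l \<in> H10 \<Omega>"
    and ul: "AE t in lebesgue_on \<Omega>. (\<lambda>n. u (r n) t) \<longlonglongrightarrow> l t" by metis
  have z: "(\<lambda>m. 1 / Suc m) \<longlonglongrightarrow> (0::real)"
    using LIMSEQ_inverse_real_of_nat by (simp add: field_simps)
  have "(\<lambda>n. H.nm (u n - v n)) \<longlonglongrightarrow> 0"
    by (rule Lim_null_comparison[OF always_eventually z])
       (use less_imp_le[OF uv] H.nm_nonneg[OF H.X_closed(3)[OF u(1) v(1)]] in \<open>simp del: of_nat_Suc\<close>)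
  from LIMSEQ_subseq_LIMSEQ[OF this r]
  have "(\<lambda>n. H.nm (u (r n) - v (r n))) \<longlonglongrightarrow> 0" by (simp add: o_def)
  then obtain r' :: "nat \<Rightarrow> nat" where r': "strict_mono r'"
    and d0: "AE t in lebesgue_on \<Omega>. (\<lambda>n. (u (r (r' n)) - v (r (r' n))) t) \<longlonglongrightarrow> 0"
    using H10_AE_subseq[of "\<lambda>n. u (r n) - v (r n)"] u(1) v(1) by blast
  have ul': "AE t in lebesgue_on \<Omega>. (\<lambda>n. u (r (r' n)) t) \<longlonglongrightarrow> l t"
    using ul by eventually_elim (use LIMSEQ_subseq_LIMSEQ[OF _ r'] in \<open>auto simp: o_def\<close>)
  have vl': "AE t in lebesgue_on \<Omega>. (\<lambda>n. v (r (r' n)) t) \<longlonglongrightarrow> l t"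
    using ul' d0
  proof eventually_elim
    case (elim t)
    from tendsto_diff[OF elim] show ?case by simp
  qed
  obtain r'' :: "nat \<Rightarrow> nat" where "(\<lambda>n. H.nm (G (u (r (r' (r'' n)))) - G (v (r (r' (r'' n)))))) \<longlonglongrightarrow> 0"
    using G_compact[of "\<lambda>n. u (r (r' n))" R "\<lambda>n. v (r (r' n))" l, OF u(1) u(2) v(1) v(2) l ul' vl'] by blast
  from order_tendstoD(2)[OF this e] show False using G_e by (auto simp: eventually_sequentially)
qed

text \<open>Dominated convergence for difference quotients along sequences. Steps of modulus at most
  1 keep the arguments of \<open>f\<close> within \<open>\<bar>U x\<bar> + \<bar>w x\<bar>\<close>,
  so the mean value bound gives a majorant of order \<open>q + 1\<close>.\<close>

lemma J_has_derivative:
  assumes u: "u \<in> H10 \<Omega>" and w: "w \<in> H10 \<Omega>"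
  shows "((\<lambda>t. J (u + t *\<^sub>R w)) has_real_derivative pairing (u + s *\<^sub>R w) w) (at s)"
proof -
  interpret finite_measure "lebesgue_on \<Omega>" by (rule finite_measure_\<Omega>)
  define U where "U = u + s *\<^sub>R w"
  have U: "U \<in> H10 \<Omega>" unfolding U_def using u w by auto
  note [measurable] = H10_measurable[OF U] H10_measurable[OF w]
  obtain S where S: "\<And>u. u \<in> H10 \<Omega> \<Longrightarrow> integrable (lebesgue_on \<Omega>) (\<lambda>x. \<bar>u x\<bar> powr (q + 1))"
    using power_integrals by blast
  have "(\<lambda>n. (J (u + (s + h n) *\<^sub>R w) - J (u + s *\<^sub>R w)) / h n) \<longlonglongrightarrow> pairing U w"
    if h: "\<And>n. h n \<noteq> 0" "h \<longlonglongrightarrow> 0" "\<And>n. \<bar>h n\<bar> \<le> 1" for h :: "nat \<Rightarrow> real"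
  proof -
    define D where "D n x = (primitive f (U x + h n * w x) - primitive f (U x)) / h n" for n x
    have Dm[measurable]: "D n \<in> borel_measurable (lebesgue_on \<Omega>)" for n unfolding D_def by measurable
    have eq: "(J (u + (s + h n) *\<^sub>R w) - J (u + s *\<^sub>R w)) / h n = (\<integral>x. D n x \<partial>lebesgue_on \<Omega>)" for n
    proof -
      have "u + (s + h n) *\<^sub>R w = U + h n *\<^sub>R w" unfolding U_def by (simp add: scaleR_left_distrib)
      moreover have "U + h n *\<^sub>R w \<in> H10 \<Omega>" using U w by auto
      from J_integrable[OF this] have "integrable (lebesgue_on \<Omega>) (\<lambda>x. primitive f (U x + h n * w x))" by simp
      ultimately show ?thesis
        unfolding D_def J_def U_def[symmetric] using J_integrable[OF U] by simp
    qed
    have "(\<lambda>n. \<integral>x. D n x \<partial>lebesgue_on \<Omega>) \<longlonglongrightarrow> (\<integral>x. f (U x) * w x \<partial>lebesgue_on \<Omega>)"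
    proof (rule integral_dominated_convergence[where w = "\<lambda>x. A * (1 + (3 powr (q + 1) * (\<bar>U x\<bar> powr (q + 1) + \<bar>w x\<bar> powr (q + 1) + \<bar>w x\<bar> powr (q + 1))) + 2 * \<bar>w x\<bar> powr (q + 1))"])
      show "integrable (lebesgue_on \<Omega>) (\<lambda>x. A * (1 + (3 powr (q + 1) * (\<bar>U x\<bar> powr (q + 1) + \<bar>w x\<bar> powr (q + 1) + \<bar>w x\<bar> powr (q + 1))) + 2 * \<bar>w x\<bar> powr (q + 1)))"
        using S[OF U] S[OF w] by simp
      show "AE x in lebesgue_on \<Omega>. (\<lambda>n. D n x) \<longlonglongrightarrow> f (U x) * w x"
      proof (rule AE_I2)
        fix x
        have "((\<lambda>t. primitive f (U x + t * w x)) has_real_derivative f (U x + 0 * w x) * w x) (at 0)"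
          by (rule DERIV_chain2[OF F_deriv]) (auto intro!: derivative_eq_intros)
        then have "((\<lambda>t. (primitive f (U x + t * w x) - primitive f (U x)) / t) \<longlongrightarrow> f (U x) * w x) (at 0)"
          by (simp add: has_field_derivative_iff)
        moreover have "filterlim h (at 0) sequentially" unfolding filterlim_at using h by auto
        ultimately show "(\<lambda>n. D n x) \<longlonglongrightarrow> f (U x) * w x" unfolding D_def by (rule filterlim_compose)
      qed
      show "AE x in lebesgue_on \<Omega>. norm (D n x) \<le> A * (1 + (3 powr (q + 1) * (\<bar>U x\<bar> powr (q + 1) + \<bar>w x\<bar> powr (q + 1) + \<bar>w x\<bar> powr (q + 1))) + 2 * \<bar>w x\<bar> powr (q + 1))" for n
      proof (rule AE_I2)
        fix x
        define r where "r = \<bar>U x\<bar> + \<bar>w x\<bar>"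
        have r: "r \<ge> 0" unfolding r_def by simp
        have hb: "\<bar>h n * w x\<bar> \<le> \<bar>w x\<bar>" using h(3)[of n] by (simp add: abs_mult mult_left_le_one_le)
        have "norm (primitive f (U x + h n * w x) - primitive f (U x)) \<le> A * (1 + r powr q) * norm (U x + h n * w x - U x)"
        proof (rule field_differentiable_bound[of "{- r..r}" "primitive f" f])
          show "(primitive f has_field_derivative f z) (at z within {- r..r})" for z
            by (rule has_field_derivative_at_within[OF F_deriv])
          show "norm (f z) \<le> A * (1 + r powr q)" if "z \<in> {- r..r}" for z
          proof -
            have "\<bar>z\<bar> powr q \<le> r powr q" using that q by (intro powr_mono2) auto
            then have "A * (1 + \<bar>z\<bar> powr q) \<le> A * (1 + r powr q)" using A by simp
            then show ?thesis using f_growth[of z] by simp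
          qed
          show "U x + h n * w x \<in> {- r..r}" "U x \<in> {- r..r}" using hb unfolding r_def by auto
        qed simp
        also have "\<dots> = \<bar>h n\<bar> * (A * (1 + r powr q) * \<bar>w x\<bar>)" by (simp add: abs_mult)
        finally have "\<bar>D n x\<bar> \<le> A * (1 + r powr q) * \<bar>w x\<bar>"
          unfolding D_def using h(1)[of n] by (simp add: abs_divide pos_divide_le_eq mult.commute)
        also have "\<dots> \<le> A * (1 + r powr (q + 1) + 2 * \<bar>w x\<bar> powr (q + 1))"
          unfolding mult.assoc using A r by (intro mult_left_mono growth_product) auto
        also have "r powr (q + 1) \<le> 3 powr (q + 1) * (\<bar>U x\<bar> powr (q + 1) + \<bar>w x\<bar> powr (q + 1) + \<bar>w x\<bar> powr (q + 1))"
        proof -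
          define M where "M = max \<bar>U x\<bar> \<bar>w x\<bar>"
          have "r \<le> 3 * M" unfolding r_def M_def by simp
          then have "r powr (q + 1) \<le> (3 * M) powr (q + 1)" using r q by (intro powr_mono2) auto
          also have "\<dots> = 3 powr (q + 1) * M powr (q + 1)" by (rule powr_mult)
          also have "M powr (q + 1) \<le> \<bar>U x\<bar> powr (q + 1) + \<bar>w x\<bar> powr (q + 1) + \<bar>w x\<bar> powr (q + 1)"
            unfolding M_def max_def by auto
          finally show ?thesis by simp
        qed
        finally show "norm (D n x) \<le> A * (1 + (3 powr (q + 1) * (\<bar>U x\<bar> powr (q + 1) + \<bar>w x\<bar> powr (q + 1) + \<bar>w x\<bar> powr (q + 1))) + 2 * \<bar>w x\<bar> powr (q + 1))"
          using A by simp
      qed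
    qed measurable
    then show ?thesis unfolding eq pairing_def .
  qed note seq = this
  have "((\<lambda>t. (J (u + (s + t) *\<^sub>R w) - J (u + s *\<^sub>R w)) / t) \<longlongrightarrow> pairing U w) (at 0)"
    unfolding tendsto_at_iff_sequentially comp_def
  proof (intro allI impI)
    fix h :: "nat \<Rightarrow> real" assume h: "\<forall>i. h i \<in> UNIV - {0}" "h \<longlonglongrightarrow> 0"
    have "\<forall>\<^sub>F n in sequentially. \<bar>h n\<bar> < 1"
      using order_tendstoD(2)[OF tendsto_rabs_zero[OF h(2)], of 1] by simp
    \<comment> \<open>An arbitrary null sequence has modulus at most 1 only from some index on; the
      initial segment is cut off.\<close>
    then obtain N where N: "\<And>n. n \<ge> N \<Longrightarrow> \<bar>h n\<bar> < 1" by (auto simp: eventually_sequentially)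
    have "(\<lambda>n. (J (u + (s + h (n + N)) *\<^sub>R w) - J (u + s *\<^sub>R w)) / h (n + N)) \<longlonglongrightarrow> pairing U w"
      by (rule seq) (use h N LIMSEQ_ignore_initial_segment[OF h(2), of N] in \<open>auto intro: less_imp_le\<close>)
    then show "(\<lambda>n. (J (u + (s + h n) *\<^sub>R w) - J (u + s *\<^sub>R w)) / h n) \<longlonglongrightarrow> pairing U w"
      by (rule LIMSEQ_offset)
  qed
  then show ?thesis unfolding U_def by (simp add: DERIV_def)
qed

end

section \<open>Critical points of the Kirchhoff functional\<close>

text \<open>Here \<open>k\<close> is continuous on the whole line, so that \<open>K\<close> has a
  two-sided derivative at 0 as well, a point that Dirichlet integrals attain. The original function
  is extended constantly to the left before this locale is used.\<close>

locale kirchhoff = subcritical \<Omega> f q A for \<Omega> :: "'a::euclidean_space set" and f q A +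
  fixes k :: "real \<Rightarrow> real"
  assumes k_cont: "continuous_on UNIV k" and k_nonneg: "\<And>t. 0 \<le> t \<Longrightarrow> 0 \<le> k t"
    and k_pos: "\<And>t. 0 < t \<Longrightarrow> 0 < k t"
    and K_growth: "filterlim (\<lambda>t. primitive k t / t powr ((q + 1) / 2)) at_top at_top"
begin

abbreviation K :: "real \<Rightarrow> real" where "K \<equiv> primitive k"

definition \<Phi> :: "real \<Rightarrow> real \<Rightarrow> ('a \<Rightarrow> real) \<Rightarrow> real" where
  "\<Phi> a b u = a / 2 * ipH u u + b / 2 * K (ipH u u) - J u"

definition \<Phi>_grad :: "real \<Rightarrow> real \<Rightarrow> ('a \<Rightarrow> real) \<Rightarrow> 'a \<Rightarrow> real" where
  "\<Phi>_grad a b u = (a + b * k (ipH u u)) *\<^sub>R u - G u"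

lemma K_deriv: "(K has_real_derivative k t) (at t)"
  by (rule primitive_has_derivative[OF k_cont])

lemma K_isCont: "isCont K t"
  by (rule DERIV_isCont[OF K_deriv])

lemma k_isCont: "isCont k t"
  using k_cont by (simp add: continuous_on_eq_continuous_at)

lemma K_mono: "0 \<le> s \<Longrightarrow> s \<le> t \<Longrightarrow> K s \<le> K t"
  by (rule DERIV_nonneg_imp_nondecreasing) (use K_deriv k_nonneg in force)+

lemma K_nonneg: "0 \<le> t \<Longrightarrow> 0 \<le> K t"
  using K_mono[of 0 t] by simp

lemma K_pos: assumes "0 < t" shows "0 < K t"
proof -
  obtain z where "0 < z" "K t - K 0 = (t - 0) * k z" using MVT2[of 0 t K k] K_deriv assms by blast
  then show ?thesis using k_pos[of z] assms by simp
qed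

lemma \<Phi>_grad_closed: "u \<in> H10 \<Omega> \<Longrightarrow> \<Phi>_grad a b u \<in> H10 \<Omega>"
  unfolding \<Phi>_grad_def using G(1) by auto

lemma nm_powr: "u \<in> H10 \<Omega> \<Longrightarrow> H.nm u powr (q + 1) = ipH u u powr ((q + 1) / 2)"
  by (rule ipH_powr[symmetric])

lemma K_dominates: "\<exists>T\<ge>1. \<forall>t\<ge>T. c * t powr ((q + 1) / 2) \<le> K t"
proof -
  have "\<forall>\<^sub>F t in at_top. c \<le> K t / t powr ((q + 1) / 2)"
    using K_growth unfolding filterlim_at_top by blast
  then obtain T where T: "\<And>t. t \<ge> T \<Longrightarrow> c \<le> K t / t powr ((q + 1) / 2)" unfolding eventually_at_top_linorder by blast
  have "c * t powr ((q + 1) / 2) \<le> K t" if "t \<ge> max T 1" for t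
    using T[of t] that by (simp add: pos_le_divide_eq)
  then show ?thesis by (intro exI[of _ "max T 1"]) auto
qed

text \<open>The radius serves all \<open>b \<ge> b0\<close> at once, as limits with varying
  \<open>b\<close> demand. Where the Dirichlet integral is at least \<open>T\<close>, the constant
  \<open>2 * C / b0\<close> lets the term with \<open>K\<close> absorb the growth of
  \<open>J\<close>, and what is left bounds \<open>a / 2 * ipH u u\<close>.\<close>

lemma coercive:
  assumes a: "a > 0" and b0: "b0 > 0"
  obtains R where "R \<ge> 0" "\<And>b u. b \<ge> b0 \<Longrightarrow> u \<in> H10 \<Omega> \<Longrightarrow> \<Phi> a b u \<le> M \<Longrightarrow> H.nm u \<le> R"
proof -
  obtain C where C: "C > 0" "\<And>u. u \<in> H10 \<Omega> \<Longrightarrow> \<bar>J u\<bar> \<le> C * (1 + H.nm u powr (q + 1))" using J_bound by blast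
  obtain T where T: "T \<ge> 1" "\<And>t. t \<ge> T \<Longrightarrow> 2 * C / b0 * t powr ((q + 1) / 2) \<le> K t"
    using K_dominates[of "2 * C / b0"] by blast
  define S where "S = max T (2 * (\<bar>M\<bar> + C) / a)"
  have S: "S \<ge> 1" unfolding S_def using T(1) by simp
  have "H.nm u \<le> sqrt S" if b: "b \<ge> b0" and u: "u \<in> H10 \<Omega>" and le: "\<Phi> a b u \<le> M" for b u
  proof (cases "ipH u u \<ge> T")
    case True
    have "C * ipH u u powr ((q + 1) / 2) = b0 / 2 * (2 * C / b0 * ipH u u powr ((q + 1) / 2))" using b0 by simp
    also have "\<dots> \<le> b0 / 2 * K (ipH u u)" using T(2)[OF True] b0 by (intro mult_left_mono) auto
    also have "\<dots> \<le> b / 2 * K (ipH u u)" using b K_nonneg[OF ipH_nonneg] by (intro mult_right_mono) auto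
    finally have "C * H.nm u powr (q + 1) \<le> b / 2 * K (ipH u u)" unfolding nm_powr[OF u] .
    moreover have "J u \<le> C + C * H.nm u powr (q + 1)" using C(2)[OF u] by (simp add: distrib_left)
    ultimately have "a / 2 * ipH u u \<le> M + C" using le unfolding \<Phi>_def by linarith
    then have "a / 2 * ipH u u \<le> \<bar>M\<bar> + C" by linarith
    then have "ipH u u \<le> 2 * (\<bar>M\<bar> + C) / a" using a by (simp add: field_simps)
    then show ?thesis unfolding S_def H.nm_def by simp
  next
    case False
    then show ?thesis unfolding S_def H.nm_def by simp
  qed
  then show ?thesis using that[of "sqrt S"] S by auto
qed

lemma rellich_nm:
  assumes x: "\<And>n::nat. x n \<in> H10 \<Omega>" "\<And>n. H.nm (x n) \<le> R"
  obtains r :: "nat \<Rightarrow> nat" and l d where "strict_mono r" "l \<in> H10 \<Omega>" "(\<lambda>n. ipH (x (r n)) (x (r n))) \<longlonglongrightarrow> d"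
    "ipH l l \<le> d" "AE t in lebesgue_on \<Omega>. (\<lambda>n. x (r n) t) \<longlonglongrightarrow> l t" "(\<lambda>n. J (x (r n))) \<longlonglongrightarrow> J l"
proof -
  have R: "0 \<le> R" using x(2)[of 0] H.nm_nonneg[OF x(1)[of 0]] by linarith
  have "ipH (x n) (x n) \<le> R\<^sup>2" for n using nm_le_iff_ipH[OF x(1) R] x(2) by blast
  from rellich[of x, OF x(1) this] obtain r :: "nat \<Rightarrow> nat" and l d where r: "strict_mono r" "l \<in> H10 \<Omega>" "(\<lambda>n. ipH (x (r n)) (x (r n))) \<longlonglongrightarrow> d"
    "ipH l l \<le> d" "AE t in lebesgue_on \<Omega>. (\<lambda>n. x (r n) t) \<longlonglongrightarrow> l t" by blast
  have "(\<lambda>n. J (x (r n))) \<longlonglongrightarrow> J l"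
    by (rule J_tendsto[OF x(1) x(2) r(2) r(5)])
  with r show ?thesis using that by blast
qed

text \<open>Minimality forces the Dirichlet integrals to converge to that of the limit, not only to be
  bounded below by it.\<close>

lemma minimizer_limit:
  assumes a: "a > 0" and b0: "b0 > 0" and \<beta>: "\<And>n. \<beta> n \<ge> b0" "\<beta> \<longlonglongrightarrow> b" and u: "\<And>n::nat. u n \<in> H10 \<Omega>"
    and min: "\<And>n v. v \<in> H10 \<Omega> \<Longrightarrow> \<Phi> a (\<beta> n) (u n) \<le> \<Phi> a (\<beta> n) v + \<epsilon> n" and \<epsilon>: "\<epsilon> \<longlonglongrightarrow> 0"
  obtains r :: "nat \<Rightarrow> nat" and l where "strict_mono r" "l \<in> H10 \<Omega>" "\<And>v. v \<in> H10 \<Omega> \<Longrightarrow> \<Phi> a b l \<le> \<Phi> a b v"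
    "(\<lambda>n. ipH (u (r n)) (u (r n))) \<longlonglongrightarrow> ipH l l"
proof -
  have z: "\<Phi> a (\<beta> n) 0 = - J 0" for n by (simp add: \<Phi>_def)
  obtain E where E: "\<And>n. \<bar>\<epsilon> n\<bar> \<le> E" using convergent_imp_Bseq[of \<epsilon>] \<epsilon> unfolding convergent_def Bseq_def by auto
  obtain R where R: "\<And>b u. b \<ge> b0 \<Longrightarrow> u \<in> H10 \<Omega> \<Longrightarrow> \<Phi> a b u \<le> - J 0 + E \<Longrightarrow> H.nm u \<le> R"
    using coercive[OF a b0] by metis
  have uR: "H.nm (u n) \<le> R" for n
  proof (rule R[OF \<beta>(1) u])
    show "\<Phi> a (\<beta> n) (u n) \<le> - J 0 + E" using min[of 0 n] z[of n] E[of n] by (auto simp: abs_le_iff)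
  qed
  obtain r :: "nat \<Rightarrow> nat" and l d where r: "strict_mono r" "l \<in> H10 \<Omega>" "(\<lambda>n. ipH (u (r n)) (u (r n))) \<longlonglongrightarrow> d"
    "ipH l l \<le> d" and J: "(\<lambda>n. J (u (r n))) \<longlonglongrightarrow> J l" using rellich_nm[of u R, OF u uR] by blast
  have d: "d \<ge> 0" using r(4) ipH_nonneg[of l] by linarith
  have \<beta>r: "(\<lambda>n. \<beta> (r n)) \<longlonglongrightarrow> b" "(\<lambda>n. \<epsilon> (r n)) \<longlonglongrightarrow> 0"
    using LIMSEQ_subseq_LIMSEQ[OF \<beta>(2) r(1)] LIMSEQ_subseq_LIMSEQ[OF \<epsilon> r(1)] by (auto simp: o_def)
  have b: "b \<ge> b0" by (rule LIMSEQ_le_const[OF \<beta>(2)]) (use \<beta>(1) in auto)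
  have lim: "(\<lambda>n. \<Phi> a (\<beta> (r n)) (u (r n))) \<longlonglongrightarrow> a / 2 * d + b / 2 * K d - J l"
    unfolding \<Phi>_def by (intro tendsto_diff tendsto_add tendsto_mult tendsto_divide tendsto_const \<beta>r r(3) J
      isCont_tendsto_compose[OF K_isCont]) auto
  have le: "a / 2 * d + b / 2 * K d - J l \<le> \<Phi> a b v" if v: "v \<in> H10 \<Omega>" for v
  proof (rule LIMSEQ_le[OF lim])
    have "(\<lambda>n. \<Phi> a (\<beta> (r n)) v + \<epsilon> (r n)) \<longlonglongrightarrow> \<Phi> a b v + 0"
      unfolding \<Phi>_def by (intro tendsto_diff tendsto_add tendsto_mult tendsto_divide tendsto_const \<beta>r) auto
    then show "(\<lambda>n. \<Phi> a (\<beta> (r n)) v + \<epsilon> (r n)) \<longlonglongrightarrow> \<Phi> a b v" by simp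
  qed (use min[OF v] in auto)
  \<comment> \<open>The limit value is compared with the energy of \<open>l\<close> itself.
    Monotonicity of \<open>K\<close> removes the middle terms, and \<open>a > 0\<close> gives
    \<open>d \<le> ipH l l\<close>, the missing half.\<close>
  have "b / 2 * K (ipH l l) \<le> b / 2 * K d"
    using b b0 K_mono[OF ipH_nonneg r(4)] by (intro mult_left_mono) auto
  then have "a / 2 * d \<le> a / 2 * ipH l l" using le[OF r(2)] unfolding \<Phi>_def by linarith
  then have "d \<le> ipH l l" using a by simp
  then have dl: "d = ipH l l" using r(4) by simp
  show ?thesis
  proof (rule that[OF r(1,2)])
    show "\<Phi> a b l \<le> \<Phi> a b v" if "v \<in> H10 \<Omega>" for v using le[OF that] unfolding dl \<Phi>_def[of a b l] .
    show "(\<lambda>n. ipH (u (r n)) (u (r n))) \<longlonglongrightarrow> ipH l l" using r(3) unfolding dl .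
  qed
qed

text \<open>An instance of \<open>minimizer_limit\<close> with constant \<open>b\<close> and a
  minimising sequence, whose excess over the infimum is below \<open>1 / Suc n\<close>. Coercivity
  bounds the energy below: where it is positive nothing has to be shown, elsewhere the seminorm is
  at most \<open>R\<close>.\<close>

lemma minimizer_exists:
  assumes a: "a > 0" and b: "b > 0"
  obtains u where "u \<in> H10 \<Omega>" "\<And>v. v \<in> H10 \<Omega> \<Longrightarrow> \<Phi> a b u \<le> \<Phi> a b v"
proof -
  obtain C where C: "C > 0" "\<And>u. u \<in> H10 \<Omega> \<Longrightarrow> \<bar>J u\<bar> \<le> C * (1 + H.nm u powr (q + 1))" using J_bound by blast
  obtain R where R: "R \<ge> 0" "\<And>b' u. b' \<ge> b \<Longrightarrow> u \<in> H10 \<Omega> \<Longrightarrow> \<Phi> a b' u \<le> 0 \<Longrightarrow> H.nm u \<le> R"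
    using coercive[OF a b, of 0] by metis
  have low: "- (C * (1 + R powr (q + 1))) \<le> \<Phi> a b u" if u: "u \<in> H10 \<Omega>" for u
  proof (cases "\<Phi> a b u \<le> 0")
    case True
    then have "H.nm u \<le> R" using R(2)[OF order_refl u] by simp
    then have "H.nm u powr (q + 1) \<le> R powr (q + 1)" using u q by (intro powr_mono2) auto
    then have "C * (1 + H.nm u powr (q + 1)) \<le> C * (1 + R powr (q + 1))" using C(1) by simp
    then have "J u \<le> C * (1 + R powr (q + 1))" using C(2)[OF u] by linarith
    moreover have "0 \<le> a / 2 * ipH u u" "0 \<le> b / 2 * K (ipH u u)"
      using a b ipH_nonneg[of u] K_nonneg[OF ipH_nonneg[of u]] by simp_all
    ultimately show ?thesis unfolding \<Phi>_def by linarith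
  next
    case False
    moreover have "0 \<le> C * (1 + R powr (q + 1))" using C(1) by (intro mult_nonneg_nonneg add_nonneg_nonneg) auto
    ultimately show ?thesis by linarith
  qed
  define I where "I = Inf (\<Phi> a b ` H10 \<Omega>)"
  have bb: "bdd_below (\<Phi> a b ` H10 \<Omega>)" using low by (auto intro!: bdd_belowI)
  have I: "I \<le> \<Phi> a b v" if "v \<in> H10 \<Omega>" for v unfolding I_def using bb that by (auto intro: cInf_lower)
  have "\<exists>u\<in>H10 \<Omega>. \<Phi> a b u < I + 1 / Suc n" for n :: nat
  proof -
    have "Inf (\<Phi> a b ` H10 \<Omega>) < I + 1 / Suc n" unfolding I_def by simp
    moreover have "\<Phi> a b ` H10 \<Omega> \<noteq> {}" using H.X_closed(1) by blast
    ultimately obtain z where "z \<in> \<Phi> a b ` H10 \<Omega>" "z < I + 1 / Suc n" using cInf_lessD[of "\<Phi> a b ` H10 \<Omega>"] by auto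
    then show ?thesis by blast
  qed
  then obtain u where u: "\<And>n. u n \<in> H10 \<Omega>" "\<And>n. \<Phi> a b (u n) < I + 1 / Suc n" by metis
  have z: "(\<lambda>m. 1 / Suc m) \<longlonglongrightarrow> (0::real)"
    using LIMSEQ_inverse_real_of_nat by (simp add: field_simps)
  have m: "\<Phi> a b (u n) \<le> \<Phi> a b v + 1 / Suc n" if "v \<in> H10 \<Omega>" for n v
    using add_right_mono[OF I[OF that], of "1 / Suc n"] u(2)[of n] by (rule order_trans[OF less_imp_le, rotated])
  obtain l where "l \<in> H10 \<Omega>" "\<And>v. v \<in> H10 \<Omega> \<Longrightarrow> \<Phi> a b l \<le> \<Phi> a b v"
    using minimizer_limit[of a b "\<lambda>n. b" b u "\<lambda>n. 1 / Suc n", OF a b order_refl tendsto_const u(1) m z] by metis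
  then show ?thesis using that by blast
qed

lemma \<Phi>_has_derivative:
  assumes u: "u \<in> H10 \<Omega>" and w: "w \<in> H10 \<Omega>"
  shows "((\<lambda>s. \<Phi> a b (u + s *\<^sub>R w)) has_real_derivative ipH (\<Phi>_grad a b (u + s *\<^sub>R w)) w) (at s)"
proof -
  define D where "D t = ipH u u + 2 * t * ipH u w + t\<^sup>2 * ipH w w" for t
  have D: "ipH (u + t *\<^sub>R w) (u + t *\<^sub>R w) = D t" for t
    using u w H.ip_commute[OF w u] unfolding D_def by (simp add: H.ip_simps power2_eq_square algebra_simps)
  define U where "U = u + s *\<^sub>R w"
  have U: "U \<in> H10 \<Omega>" unfolding U_def using u w by auto
  have D': "(D has_real_derivative 2 * ipH U w) (at s)"
    unfolding D_def U_def using u w by (auto intro!: derivative_eq_intros simp: H.ip_simps)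
  have K': "((\<lambda>t. K (D t)) has_real_derivative k (D s) * (2 * ipH U w)) (at s)"
    by (rule DERIV_chain2[OF K_deriv D'])
  have "((\<lambda>t. a / 2 * D t + b / 2 * K (D t) - J (u + t *\<^sub>R w)) has_real_derivative
      a / 2 * (2 * ipH U w) + b / 2 * (k (D s) * (2 * ipH U w)) - pairing U w) (at s)"
    unfolding U_def by (intro DERIV_diff DERIV_add DERIV_cmult J_has_derivative[OF u w] D'[unfolded U_def] K'[unfolded U_def])
  moreover have "ipH (\<Phi>_grad a b U) w = a / 2 * (2 * ipH U w) + b / 2 * (k (D s) * (2 * ipH U w)) - pairing U w"
    unfolding \<Phi>_grad_def using U w G[OF U] D[of s, folded U_def] by (simp add: H.ip_simps algebra_simps)
  ultimately show ?thesis unfolding \<Phi>_def D U_def[symmetric] by simp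
qed

lemma critical_point:
  assumes u: "u \<in> H10 \<Omega>" and z: "H.nm (\<Phi>_grad a b u) = 0" and v: "v \<in> H10 \<Omega>"
  shows "(a + b * k (ipH u u)) * ipH u v = pairing u v"
proof -
  have "ipH (\<Phi>_grad a b u) v = 0"
    using H.cauchy_schwarz[OF \<Phi>_grad_closed[OF u] v, of a b] z by simp
  then show ?thesis unfolding \<Phi>_grad_def using u v G[OF u] by (simp add: H.ip_simps)
qed

text \<open>The variation is taken in the direction of the gradient itself, which makes its seminorm
  vanish at once.\<close>

lemma minimizer_critical:
  assumes u: "u \<in> H10 \<Omega>" and min: "\<And>v. v \<in> H10 \<Omega> \<Longrightarrow> \<Phi> a b u \<le> \<Phi> a b v"
  shows "H.nm (\<Phi>_grad a b u) = 0"
proof -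
  define w where "w = \<Phi>_grad a b u"
  have w: "w \<in> H10 \<Omega>" unfolding w_def by (rule \<Phi>_grad_closed[OF u])
  have "ipH (\<Phi>_grad a b (u + 0 *\<^sub>R w)) w = 0"
  proof (rule DERIV_local_min[OF \<Phi>_has_derivative[OF u w, of a b 0], of 1])
    show "\<forall>y. \<bar>0 - y\<bar> < 1 \<longrightarrow> \<Phi> a b (u + 0 *\<^sub>R w) \<le> \<Phi> a b (u + y *\<^sub>R w)" using min u w by auto
  qed simp
  then show ?thesis unfolding w_def by (simp add: H.nm_def)
qed

section \<open>The hypotheses of the mountain pass theorem for the energy\<close>

lemma \<Phi>_grad_bounded:
  assumes a: "a > 0" and b: "b > 0"
  shows "\<exists>M. \<forall>u\<in>H10 \<Omega>. H.nm u \<le> R \<longrightarrow> H.nm (\<Phi>_grad a b u) \<le> M"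
proof -
  obtain C where C: "C \<ge> 0" "\<And>u. u \<in> H10 \<Omega> \<Longrightarrow> H.nm (G u) \<le> C * (1 + H.nm u powr (q + 1))" using G_bound by blast
  have "bounded (k ` {0..R\<^sup>2})"
    by (intro compact_imp_bounded compact_continuous_image continuous_on_subset[OF k_cont]) auto
  then obtain B where B: "B > 0" "\<And>t. t \<in> {0..R\<^sup>2} \<Longrightarrow> \<bar>k t\<bar> \<le> B" by (auto simp: bounded_pos)
  have "H.nm (\<Phi>_grad a b u) \<le> (a + b * B) * R + C * (1 + R powr (q + 1))" if u: "u \<in> H10 \<Omega>" and le: "H.nm u \<le> R" for u
  proof -
    have R: "0 \<le> R" using le H.nm_nonneg[OF u] by linarith
    have "ipH u u \<in> {0..R\<^sup>2}" using nm_le_iff_ipH[OF u R] le ipH_nonneg by auto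
    then have kB: "\<bar>k (ipH u u)\<bar> \<le> B" by (rule B(2))
    have h: "\<bar>a + b * k (ipH u u)\<bar> \<le> a + b * B"
    proof -
      have "b * \<bar>k (ipH u u)\<bar> \<le> b * B" using kB b by (intro mult_left_mono) auto
      then have "\<bar>b * k (ipH u u)\<bar> \<le> b * B" using b by (simp add: abs_mult)
      then show ?thesis using a by linarith
    qed
    have "H.nm (\<Phi>_grad a b u) \<le> H.nm ((a + b * k (ipH u u)) *\<^sub>R u) + H.nm (G u)"
      unfolding \<Phi>_grad_def using H.nm_triangle[of "(a + b * k (ipH u u)) *\<^sub>R u" "- G u"] u G(1)[OF u] by (simp add: H.nm_minus)
    also have "H.nm ((a + b * k (ipH u u)) *\<^sub>R u) \<le> (a + b * B) * R"
      unfolding H.nm_scale[OF u] using h le u by (intro mult_mono) auto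
    also have "H.nm (G u) \<le> C * (1 + R powr (q + 1))"
    proof -
      have "H.nm u powr (q + 1) \<le> R powr (q + 1)" using u le q by (intro powr_mono2) auto
      then have "C * (1 + H.nm u powr (q + 1)) \<le> C * (1 + R powr (q + 1))" using C(1) by (intro mult_left_mono) auto
      then show ?thesis using C(2)[OF u] by linarith
    qed
    finally show ?thesis by simp
  qed
  then show ?thesis by blast
qed

lemma \<Phi>_grad_uniformly_continuous:
  assumes a: "a > 0" and b: "b > 0" and e: "e > 0"
  shows "\<exists>d>0. \<forall>u\<in>H10 \<Omega>. \<forall>v\<in>H10 \<Omega>. H.nm u \<le> R \<longrightarrow> H.nm v \<le> R \<longrightarrow> H.nm (u - v) < d \<longrightarrow>
    H.nm (\<Phi>_grad a b u - \<Phi>_grad a b v) < e"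
proof -
  define R' where "R' = \<bar>R\<bar> + 1"
  have R': "R' > 0" unfolding R'_def by simp
  have "bounded (k ` {0..R'\<^sup>2})"
    by (intro compact_imp_bounded compact_continuous_image continuous_on_subset[OF k_cont]) auto
  then obtain B where B: "B > 0" "\<And>t. t \<in> {0..R'\<^sup>2} \<Longrightarrow> \<bar>k t\<bar> \<le> B" by (auto simp: bounded_pos)
  define H where "H = a + b * B"
  have H: "H > 0" unfolding H_def using a b B by (simp add: add_pos_pos)
  have "uniformly_continuous_on {0..R'\<^sup>2} k"
    by (intro compact_uniformly_continuous continuous_on_subset[OF k_cont]) auto
  moreover have "e / (3 * b * R') > 0" using e b R' by simp
  ultimately obtain d1 where d1: "d1 > 0" "\<And>s t. s \<in> {0..R'\<^sup>2} \<Longrightarrow> t \<in> {0..R'\<^sup>2} \<Longrightarrow> dist s t < d1 \<Longrightarrow> dist (k s) (k t) < e / (3 * b * R')"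
    unfolding uniformly_continuous_on_def by meson
  have e3: "e / 3 > 0" using e by simp
  obtain d2 where d2: "d2 > 0" "\<And>u v. u \<in> H10 \<Omega> \<Longrightarrow> v \<in> H10 \<Omega> \<Longrightarrow> H.nm u \<le> R' \<Longrightarrow> H.nm v \<le> R' \<Longrightarrow> H.nm (u - v) < d2 \<Longrightarrow> H.nm (G u - G v) < e / 3"
    using G_uniformly_continuous[OF e3, of R'] by blast
  \<comment> \<open>One entry for each third of \<open>e\<close>: \<open>H\<close> bounds the
    coefficient of \<open>u - v\<close>, \<open>d1 / (2 * R')\<close> makes the Dirichlet integrals
    differ by less than \<open>d1\<close>, and \<open>d2\<close> controls the part with
    \<open>G\<close>.\<close>
  define d where "d = min (e / (3 * H)) (min (d1 / (2 * R')) d2)"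
  have d: "d > 0" unfolding d_def using e H d1 d2 R' by simp
  have "H.nm (\<Phi>_grad a b u - \<Phi>_grad a b v) < e"
    if u: "u \<in> H10 \<Omega>" and v: "v \<in> H10 \<Omega>" and le: "H.nm u \<le> R" "H.nm v \<le> R" and uv: "H.nm (u - v) < d" for u v
  proof -
    have le': "H.nm u \<le> R'" "H.nm v \<le> R'" using le unfolding R'_def by auto
    have n0: "0 \<le> H.nm u" "0 \<le> H.nm v" "0 \<le> H.nm (u - v)" using u v by auto
    have mem: "ipH u u \<in> {0..R'\<^sup>2}" "ipH v v \<in> {0..R'\<^sup>2}"
      using nm_le_iff_ipH[OF u, of R'] nm_le_iff_ipH[OF v, of R'] R' le' ipH_nonneg by auto
    have "\<bar>ipH u u - ipH v v\<bar> = \<bar>H.nm u - H.nm v\<bar> * (H.nm u + H.nm v)"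
    proof -
      have "ipH u u - ipH v v = (H.nm u - H.nm v) * (H.nm u + H.nm v)"
        using H.nm_sq[OF u] H.nm_sq[OF v] by (simp add: power2_eq_square algebra_simps)
      then show ?thesis using n0 by (simp add: abs_mult)
    qed
    also have "\<dots> \<le> H.nm (u - v) * (2 * R')" using H.nm_diff_ineq[OF u v] le' n0 by (intro mult_mono) auto
    also have "\<dots> < d1"
    proof -
      have "H.nm (u - v) < d1 / (2 * R')" using uv unfolding d_def by simp
      then show ?thesis using R' by (simp add: pos_less_divide_eq)
    qed
    finally have kd: "\<bar>k (ipH u u) - k (ipH v v)\<bar> < e / (3 * b * R')"
      using d1(2)[OF mem] by (simp add: dist_real_def)
    define hu hv where "hu = a + b * k (ipH u u)" and "hv = a + b * k (ipH v v)"
    have hu: "\<bar>hu\<bar> \<le> H"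
    proof -
      have "b * \<bar>k (ipH u u)\<bar> \<le> b * B" using B(2)[OF mem(1)] b by (intro mult_left_mono) auto
      then have "\<bar>b * k (ipH u u)\<bar> \<le> b * B" using b by (simp add: abs_mult)
      then show ?thesis using a unfolding hu_def H_def by linarith
    qed
    \<comment> \<open>Splits the difference into the change of the vector, of the scalar
      coefficient, and of \<open>G\<close>.\<close>
    have eq: "\<Phi>_grad a b u - \<Phi>_grad a b v = hu *\<^sub>R (u - v) + ((hu - hv) *\<^sub>R v + - (G u - G v))"
      unfolding \<Phi>_grad_def hu_def[symmetric] hv_def[symmetric] by (simp add: scaleR_diff_right scaleR_diff_left)
    have "H.nm (\<Phi>_grad a b u - \<Phi>_grad a b v) \<le> H.nm (hu *\<^sub>R (u - v)) + (H.nm ((hu - hv) *\<^sub>R v) + H.nm (- (G u - G v)))"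
      unfolding eq using u v G(1) by (intro order_trans[OF H.nm_triangle] add_left_mono H.nm_triangle) auto
    also have "\<dots> = \<bar>hu\<bar> * H.nm (u - v) + (\<bar>hu - hv\<bar> * H.nm v + H.nm (G u - G v))"
      using H.nm_scale[of "u - v" hu] H.nm_scale[OF v] H.nm_minus[of "G u - G v"] u v G(1) by simp
    also have "\<dots> < e / 3 + (e / 3 + e / 3)"
    proof -
      have "\<bar>hu\<bar> * H.nm (u - v) \<le> H * H.nm (u - v)" using hu n0 by (intro mult_right_mono) auto
      also have "\<dots> < H * (e / (3 * H))" using uv H unfolding d_def by (intro mult_strict_left_mono) auto
      finally have 1: "\<bar>hu\<bar> * H.nm (u - v) < e / 3" using H by simp
      have "\<bar>hu - hv\<bar> = b * \<bar>k (ipH u u) - k (ipH v v)\<bar>"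
        unfolding hu_def hv_def using b by (simp add: abs_mult flip: right_diff_distrib)
      also have "\<dots> \<le> b * (e / (3 * b * R'))" using kd b by (intro mult_left_mono) auto
      finally have "\<bar>hu - hv\<bar> * H.nm v \<le> b * (e / (3 * b * R')) * R'" using le' n0 e b R' by (intro mult_mono) auto
      then have 2: "\<bar>hu - hv\<bar> * H.nm v \<le> e / 3" using b R' by simp
      have 3: "H.nm (G u - G v) < e / 3" using d2(2)[OF u v le'] uv unfolding d_def by simp
      show ?thesis by (intro add_strict_mono 1 add_le_less_mono 2 3)
    qed
    finally show ?thesis by simp
  qed
  with d show ?thesis by blast
qed

text \<open>From the definition of the gradient,
  \<open>h n *\<^sub>R y n = \<Phi>_grad a b (y n) + G (y n)\<close>. The first summand tends to 0,
  the second converges by \<open>G_compact\<close>, and the coefficients \<open>h n\<close> tend to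
  \<open>\<eta> > 0\<close> because \<open>a > 0\<close>. So \<open>y n\<close> converges
  strongly.\<close>

lemma palais_smale:
  assumes a: "a > 0" and b: "b > 0" and x: "\<And>n::nat. x n \<in> H10 \<Omega>"
    and grad: "(\<lambda>n. H.nm (\<Phi>_grad a b (x n))) \<longlonglongrightarrow> 0" and lev: "(\<lambda>n. \<Phi> a b (x n)) \<longlonglongrightarrow> c"
  shows "\<exists>u\<in>H10 \<Omega>. \<Phi> a b u = c \<and> H.nm (\<Phi>_grad a b u) = 0"
proof -
  obtain E where E: "\<And>n. \<bar>\<Phi> a b (x n)\<bar> \<le> E"
    using convergent_imp_Bseq[of "\<lambda>n. \<Phi> a b (x n)"] lev unfolding convergent_def Bseq_def by auto
  obtain R where R: "R \<ge> 0" "\<And>b' u. b' \<ge> b \<Longrightarrow> u \<in> H10 \<Omega> \<Longrightarrow> \<Phi> a b' u \<le> E \<Longrightarrow> H.nm u \<le> R"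
    using coercive[OF a b, of E] by metis
  have xR: "H.nm (x n) \<le> R" for n using R(2)[OF order_refl x] E[of n] by (auto simp: abs_le_iff)
  obtain r :: "nat \<Rightarrow> nat" and l d where r: "strict_mono r" "l \<in> H10 \<Omega>" "(\<lambda>n. ipH (x (r n)) (x (r n))) \<longlonglongrightarrow> d"
    "ipH l l \<le> d" "AE t in lebesgue_on \<Omega>. (\<lambda>n. x (r n) t) \<longlonglongrightarrow> l t"
    using rellich_nm[of x R, OF x xR] by blast
  have d0: "d \<ge> 0" using r(4) ipH_nonneg[of l] by linarith
  define B where "B = max R (H.nm l)"
  have lB: "\<And>n. H.nm (x (r n)) \<le> B" "H.nm l \<le> B" using xR unfolding B_def by (auto intro: max.coboundedI1)
  have "AE t in lebesgue_on \<Omega>. (\<lambda>n. l t) \<longlonglongrightarrow> l t" by simp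
  then obtain r' :: "nat \<Rightarrow> nat" where r': "strict_mono r'" and Gl: "(\<lambda>n. H.nm (G (x (r (r' n))) - G l)) \<longlonglongrightarrow> 0"
    using G_compact[of "\<lambda>n. x (r n)" B "\<lambda>n. l" l, OF x lB(1) r(2) lB(2) r(2) r(5)] by blast
  define y where "y n = x (r (r' n))" for n
  have yX: "y n \<in> H10 \<Omega>" and yR: "H.nm (y n) \<le> R" for n unfolding y_def using x xR by auto
  have rr: "strict_mono (\<lambda>n. r (r' n))" using r(1) r' by (simp add: strict_mono_def)
  have yd: "(\<lambda>n. ipH (y n) (y n)) \<longlonglongrightarrow> d" using LIMSEQ_subseq_LIMSEQ[OF r(3) r'] unfolding y_def by (simp add: o_def)
  have ygrad: "(\<lambda>n. H.nm (\<Phi>_grad a b (y n))) \<longlonglongrightarrow> 0" using LIMSEQ_subseq_LIMSEQ[OF grad rr] unfolding y_def by (simp add: o_def)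
  have ylev: "(\<lambda>n. \<Phi> a b (y n)) \<longlonglongrightarrow> c" using LIMSEQ_subseq_LIMSEQ[OF lev rr] unfolding y_def by (simp add: o_def)
  define \<eta> where "\<eta> = a + b * k d"
  have \<eta>: "\<eta> > 0" unfolding \<eta>_def using a b k_nonneg[OF d0] by (simp add: add_pos_nonneg)
  define h where "h n = a + b * k (ipH (y n) (y n))" for n
  have h: "h \<longlonglongrightarrow> \<eta>"
    unfolding h_def \<eta>_def by (intro tendsto_add tendsto_mult tendsto_const isCont_tendsto_compose[OF k_isCont yd])
  \<comment> \<open>The strong limit read off from that identity. Once \<open>y n\<close> tends to
    \<open>u\<close>, continuity of the energy and of its gradient gives the level and
    criticality.\<close>
  define u where "u = (1 / \<eta>) *\<^sub>R G l"
  have Gl': "G l \<in> H10 \<Omega>" by (rule G(1)[OF r(2)])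
  have uX: "u \<in> H10 \<Omega>" unfolding u_def using Gl' by auto
  have "(\<lambda>n. (1 / \<eta>) * (\<bar>\<eta> - h n\<bar> * R + (H.nm (\<Phi>_grad a b (y n)) + H.nm (G (y n) - G l)))) \<longlonglongrightarrow> (1 / \<eta>) * (\<bar>\<eta> - \<eta>\<bar> * R + (0 + 0))"
    by (intro tendsto_add tendsto_mult tendsto_const tendsto_rabs tendsto_diff h ygrad Gl[folded y_def])
  then have z: "(\<lambda>n. (1 / \<eta>) * (\<bar>\<eta> - h n\<bar> * R + (H.nm (\<Phi>_grad a b (y n)) + H.nm (G (y n) - G l)))) \<longlonglongrightarrow> 0" by simp
  have yu: "(\<lambda>n. H.nm (y n - u)) \<longlonglongrightarrow> 0"
  proof (rule Lim_null_comparison[OF always_eventually z], rule allI)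
    fix n
    have eq: "y n - u = (1 / \<eta>) *\<^sub>R ((\<eta> - h n) *\<^sub>R y n + (\<Phi>_grad a b (y n) + (G (y n) - G l)))"
    proof -
      have "\<Phi>_grad a b (y n) = h n *\<^sub>R y n - G (y n)" unfolding \<Phi>_grad_def h_def ..
      then have e: "(\<eta> - h n) *\<^sub>R y n + (\<Phi>_grad a b (y n) + (G (y n) - G l)) = \<eta> *\<^sub>R y n - G l"
        by (simp add: scaleR_diff_left)
      show ?thesis unfolding e u_def using \<eta> by (simp add: scaleR_diff_right)
    qed
    have mem: "(\<eta> - h n) *\<^sub>R y n \<in> H10 \<Omega>" "\<Phi>_grad a b (y n) \<in> H10 \<Omega>" "G (y n) - G l \<in> H10 \<Omega>"
      using yX[of n] \<Phi>_grad_closed[OF yX] G(1)[OF yX] Gl' by auto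
    have "H.nm ((\<eta> - h n) *\<^sub>R y n + (\<Phi>_grad a b (y n) + (G (y n) - G l))) \<le> H.nm ((\<eta> - h n) *\<^sub>R y n) + (H.nm (\<Phi>_grad a b (y n)) + H.nm (G (y n) - G l))"
      using mem by (intro order_trans[OF H.nm_triangle] add_left_mono H.nm_triangle) auto
    also have "H.nm ((\<eta> - h n) *\<^sub>R y n) \<le> \<bar>\<eta> - h n\<bar> * R"
      unfolding H.nm_scale[OF yX] using yR by (intro mult_left_mono) auto
    finally have main: "H.nm ((\<eta> - h n) *\<^sub>R y n + (\<Phi>_grad a b (y n) + (G (y n) - G l))) \<le> \<bar>\<eta> - h n\<bar> * R + (H.nm (\<Phi>_grad a b (y n)) + H.nm (G (y n) - G l))"
      by - (simp only: add_right_mono)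
    have memS: "(\<eta> - h n) *\<^sub>R y n + (\<Phi>_grad a b (y n) + (G (y n) - G l)) \<in> H10 \<Omega>"
      by (intro H.X_closed(2) mem)
    have "H.nm (y n - u) \<le> (1 / \<eta>) * (\<bar>\<eta> - h n\<bar> * R + (H.nm (\<Phi>_grad a b (y n)) + H.nm (G (y n) - G l)))"
      unfolding eq H.nm_scale[OF memS] using \<eta> main by (simp only: abs_of_pos divide_pos_pos zero_less_one) (intro mult_left_mono, auto)
    moreover have "0 \<le> H.nm (y n - u)" using yX uX by auto
    ultimately show "norm (H.nm (y n - u)) \<le> (1 / \<eta>) * (\<bar>\<eta> - h n\<bar> * R + (H.nm (\<Phi>_grad a b (y n)) + H.nm (G (y n) - G l)))"
      by simp
  qed
  obtain r'' :: "nat \<Rightarrow> nat" where r'': "strict_mono r''" and ae: "AE t in lebesgue_on \<Omega>. (\<lambda>n. (y (r'' n) - u) t) \<longlonglongrightarrow> 0"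
    using H10_AE_subseq[of "\<lambda>n. y n - u"] yX uX yu by blast
  have "AE t in lebesgue_on \<Omega>. (\<lambda>n. y (r'' n) t) \<longlonglongrightarrow> u t"
    using ae by eventually_elim (simp add: LIM_zero_iff)
  from J_tendsto[OF yX yR uX this] have Ju: "(\<lambda>n. J (y (r'' n))) \<longlonglongrightarrow> J u" .
  have "(\<lambda>n. ipH (y n - u) (y n - u)) \<longlonglongrightarrow> 0"
    using tendsto_power[OF yu, of 2] yX uX by (simp add: H.nm_sq)
  from H.nm_tendsto[OF yX uX this] have ynu: "(\<lambda>n. H.nm (y n)) \<longlonglongrightarrow> H.nm u" .
  have du: "d = ipH u u"
    using LIMSEQ_unique[OF yd] tendsto_power[OF ynu, of 2] yX uX by (simp add: H.nm_sq)
  have uR: "H.nm u \<le> R" by (rule LIMSEQ_le_const2[OF ynu]) (use yR in auto)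
  have "(\<lambda>n. \<Phi> a b (y (r'' n))) \<longlonglongrightarrow> \<Phi> a b u"
  proof -
    have yd'': "(\<lambda>n. ipH (y (r'' n)) (y (r'' n))) \<longlonglongrightarrow> ipH u u" using LIMSEQ_subseq_LIMSEQ[OF yd r''] unfolding du by (simp add: o_def)
    show ?thesis unfolding \<Phi>_def
      by (intro tendsto_diff tendsto_add tendsto_mult tendsto_const Ju yd'' isCont_tendsto_compose[OF K_isCont yd''])
  qed
  moreover have "(\<lambda>n. \<Phi> a b (y (r'' n))) \<longlonglongrightarrow> c" using LIMSEQ_subseq_LIMSEQ[OF ylev r''] by (simp add: o_def)
  ultimately have 1: "\<Phi> a b u = c" by (rule LIMSEQ_unique)
  have "H.nm (\<Phi>_grad a b u) < e + e" if e: "e > 0" for e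
  proof -
    obtain \<delta> where \<delta>: "\<delta> > 0" "\<And>u v. u \<in> H10 \<Omega> \<Longrightarrow> v \<in> H10 \<Omega> \<Longrightarrow> H.nm u \<le> R \<Longrightarrow> H.nm v \<le> R \<Longrightarrow> H.nm (u - v) < \<delta> \<Longrightarrow>
        H.nm (\<Phi>_grad a b u - \<Phi>_grad a b v) < e" using \<Phi>_grad_uniformly_continuous[OF a b e, of R] by blast
    have "\<forall>\<^sub>F n in sequentially. H.nm (y n - u) < \<delta> \<and> H.nm (\<Phi>_grad a b (y n)) < e"
      by (intro eventually_conj order_tendstoD(2)[OF yu \<delta>(1)] order_tendstoD(2)[OF ygrad e])
    then obtain n where n: "H.nm (y n - u) < \<delta>" "H.nm (\<Phi>_grad a b (y n)) < e" by (auto simp: eventually_sequentially)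
    have "H.nm (\<Phi>_grad a b u - \<Phi>_grad a b (y n)) < e"
      using \<delta>(2)[OF uX yX uR yR] n(1) H.nm_minus_commute[OF uX yX] by simp
    then show ?thesis
      using n(2) H.nm_triangle[of "\<Phi>_grad a b u - \<Phi>_grad a b (y n)" "\<Phi>_grad a b (y n)"] \<Phi>_grad_closed[OF uX] \<Phi>_grad_closed[OF yX] by simp
  qed
  then have "H.nm (\<Phi>_grad a b u) \<le> 0 + e" if "e > 0" for e
    using that by (metis add_0 field_sum_of_halves half_gt_zero less_imp_le)
  then have "H.nm (\<Phi>_grad a b u) \<le> 0" by (rule field_le_epsilon)
  then have "H.nm (\<Phi>_grad a b u) = 0" using H.nm_nonneg[OF \<Phi>_grad_closed[OF uX]] by (meson antisym)
  with 1 uX show ?thesis by blast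
qed

text \<open>For \<open>a\<close> large no global minimum lies on the unit sphere, for any \<open>b\<close>. Minimisers are outside
  the unit ball for small \<open>b\<close> and inside for large \<open>b\<close>; at the threshold both kinds coexist.\<close>

theorem three_critical_points:
  assumes C: "C > 0" "\<And>u. u \<in> H10 \<Omega> \<Longrightarrow> \<bar>J u\<bar> \<le> C * (1 + H.nm u powr (q + 1))"
    and a: "a > 4 * C" and unbounded: "\<And>c. \<exists>w\<in>H10 \<Omega>. a / 2 * ipH w w - J w < c"
  obtains b u1 u2 u3 where "b > 0" "u1 \<in> H10 \<Omega>" "u2 \<in> H10 \<Omega>" "u3 \<in> H10 \<Omega>"
    "\<And>v. v \<in> H10 \<Omega> \<Longrightarrow> \<Phi> a b u1 \<le> \<Phi> a b v" "\<And>v. v \<in> H10 \<Omega> \<Longrightarrow> \<Phi> a b u2 \<le> \<Phi> a b v"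
    "ipH u2 u2 < 1" "1 < ipH u1 u1" "\<Phi> a b u1 < \<Phi> a b u3" "H.nm (\<Phi>_grad a b u3) = 0"
proof -
  have a0: "a > 0" using a C(1) by linarith
  have \<Phi>0: "\<Phi> a b 0 = 0" for b
    unfolding \<Phi>_def J_def by simp
  have J1: "J u \<le> 2 * C" if "u \<in> H10 \<Omega>" "ipH u u \<le> 1" for u
  proof -
    have "H.nm u \<le> 1" using nm_le_iff_ipH[OF that(1), of 1] that(2) by simp
    then have "H.nm u powr (q + 1) \<le> 1 powr (q + 1)" using that q by (intro powr_mono2) auto
    then have "C * (1 + H.nm u powr (q + 1)) \<le> C * 2" using C(1) by (intro mult_left_mono) auto
    then show ?thesis using C(2)[OF that(1)] by linarith
  qed
  \<comment> \<open>The quadratic part on the sphere minus the largest value that \<open>J\<close>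
    can have in the closed unit ball.\<close>
  define \<alpha> where "\<alpha> = a / 2 - 2 * C"
  have \<alpha>: "\<alpha> > 0" unfolding \<alpha>_def using a by simp
  have sphere: "\<alpha> \<le> \<Phi> a b u" if "b > 0" "u \<in> H10 \<Omega>" "ipH u u = 1" for b u
  proof -
    have "0 \<le> b / 2 * K 1" using that(1) K_nonneg[of 1] by simp
    then show ?thesis using J1[OF that(2)] that(3) unfolding \<Phi>_def \<alpha>_def by simp
  qed
  define is_min where "is_min b u \<longleftrightarrow> u \<in> H10 \<Omega> \<and> (\<forall>v\<in>H10 \<Omega>. \<Phi> a b u \<le> \<Phi> a b v)" for b u
  have ne1: "ipH u u \<noteq> 1" if "b > 0" "is_min b u" for b u
  proof
    assume "ipH u u = 1"
    then have "\<alpha> \<le> \<Phi> a b u" using sphere that unfolding is_min_def by blast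
    moreover have "\<Phi> a b u \<le> \<Phi> a b 0" using that H.X_closed(1) unfolding is_min_def by blast
    ultimately show False using \<alpha> \<Phi>0 by simp
  qed
  \<comment> \<open>The supremum of this set is the threshold: beyond it all minimisers lie inside
    the unit ball, and parameters arbitrarily close to it from below, or equal to it, have one
    outside.\<close>
  define S where "S = {b. b > 0 \<and> (\<exists>u. is_min b u \<and> ipH u u \<ge> 1)}"
  have "S \<noteq> {}"
  proof -
    obtain w where w: "w \<in> H10 \<Omega>" "a / 2 * ipH w w - J w < - 2 * C - 1" using unbounded by blast
    \<comment> \<open>So small that the term with \<open>K\<close> adds at most 1 at
      \<open>w\<close>, whose energy stays below \<open>- 2 * C\<close>. In the open unit ball the
      energy is never below \<open>- 2 * C\<close>, so the minimiser cannot be there.\<close>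
    define b where "b = 1 / (K (ipH w w) + 1)"
    have Kw: "K (ipH w w) \<ge> 0" using K_nonneg[OF ipH_nonneg] .
    then have b: "b > 0" unfolding b_def by simp
    have "b / 2 * K (ipH w w) \<le> 1" using Kw unfolding b_def by (simp add: field_simps)
    then have lt: "\<Phi> a b w < - 2 * C" using w(2) unfolding \<Phi>_def by linarith
    obtain u where u: "u \<in> H10 \<Omega>" "\<And>v. v \<in> H10 \<Omega> \<Longrightarrow> \<Phi> a b u \<le> \<Phi> a b v" using minimizer_exists[OF a0 b] by blast
    have "ipH u u \<ge> 1"
    proof (rule ccontr)
      assume "\<not> ipH u u \<ge> 1"
      then have "J u \<le> 2 * C" using J1[OF u(1)] by simp
      moreover have "0 \<le> a / 2 * ipH u u" "0 \<le> b / 2 * K (ipH u u)"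
        using a0 b ipH_nonneg[of u] K_nonneg[OF ipH_nonneg[of u]] by simp_all
      ultimately show False using u(2)[OF w(1)] lt unfolding \<Phi>_def[of a b u] by linarith
    qed
    then have "b \<in> S" using b u unfolding S_def is_min_def by blast
    then show ?thesis by blast
  qed
  obtain b1 where b1: "b1 \<in> S" using \<open>S \<noteq> {}\<close> by blast
  obtain T where T: "T \<ge> 1" "\<And>t. t \<ge> T \<Longrightarrow> 1 * t powr ((q + 1) / 2) \<le> K t" using K_dominates[of 1] by blast
  \<comment> \<open>Chosen so that \<open>K t \<ge> \<kappa> * (1 + t powr ((q + 1) / 2))\<close>
    for all \<open>t \<ge> 1\<close>: from \<open>T\<close> on by the growth of \<open>K\<close>, on
    the interval from 1 to \<open>T\<close> by monotonicity and \<open>K 1 > 0\<close>. Both sides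
    of the energy inequality then carry the same factor, which leaves a bound on
    \<open>b\<close>.\<close>
  define \<kappa> where "\<kappa> = min (1 / 2) (K 1 / (1 + T powr ((q + 1) / 2)))"
  have \<kappa>: "\<kappa> > 0" unfolding \<kappa>_def using K_pos[of 1] by (simp add: add_pos_nonneg)
  have \<kappa>_le: "\<kappa> \<le> 1 / 2" "\<kappa> \<le> K 1 / (1 + T powr ((q + 1) / 2))" unfolding \<kappa>_def by (rule min.cobounded1, rule min.cobounded2)
  have Klow: "\<kappa> * (1 + t powr ((q + 1) / 2)) \<le> K t" if "t \<ge> 1" for t
  proof (cases "t \<ge> T")
    case True
    have "t powr ((q + 1) / 2) \<ge> 1" using that q by (intro ge_one_powr_ge_zero) auto
    then have "\<kappa> * (1 + t powr ((q + 1) / 2)) \<le> 1 / 2 * (2 * t powr ((q + 1) / 2))"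
      by (intro mult_mono \<kappa>_le) auto
    then show ?thesis using T(2)[OF True] by simp
  next
    case False
    have p: "1 + T powr ((q + 1) / 2) > 0" by (simp add: add_pos_nonneg)
    have "t powr ((q + 1) / 2) \<le> T powr ((q + 1) / 2)" using False that q by (intro powr_mono2) auto
    then have "\<kappa> * (1 + t powr ((q + 1) / 2)) \<le> K 1 / (1 + T powr ((q + 1) / 2)) * (1 + T powr ((q + 1) / 2))"
      using K_nonneg[of 1] by (intro mult_mono \<kappa>_le) auto
    also have "\<dots> = K 1" using p by simp
    also have "\<dots> \<le> K t" using that by (intro K_mono) auto
    finally show ?thesis .
  qed
  have bound: "b \<le> 2 * C / \<kappa>" if bS: "b \<in> S" for b
  proof -
    obtain u where b: "b > 0" and u: "u \<in> H10 \<Omega>" "\<And>v. v \<in> H10 \<Omega> \<Longrightarrow> \<Phi> a b u \<le> \<Phi> a b v" "ipH u u \<ge> 1"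
      using bS unfolding S_def is_min_def by blast
    define P where "P = 1 + ipH u u powr ((q + 1) / 2)"
    have P: "P > 0" unfolding P_def by (simp add: add_pos_nonneg)
    have "\<Phi> a b u \<le> 0" using u(2)[OF H.X_closed(1)] \<Phi>0 by simp
    moreover have "0 \<le> a / 2 * ipH u u" using a0 ipH_nonneg[of u] by simp
    moreover have "J u \<le> C * P" using C(2)[OF u(1)] unfolding P_def nm_powr[OF u(1)] by linarith
    ultimately have "b / 2 * K (ipH u u) \<le> C * P" unfolding \<Phi>_def by linarith
    moreover have "b / 2 * (\<kappa> * P) \<le> b / 2 * K (ipH u u)" unfolding P_def using b Klow[OF u(3)] by (intro mult_left_mono) auto
    ultimately have "(b / 2 * \<kappa>) * P \<le> C * P" by simp
    then have "b / 2 * \<kappa> \<le> C" using P by simp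
    then show ?thesis using \<kappa> by (simp add: field_simps)
  qed
  have bddS: "bdd_above S" using bound by (auto intro!: bdd_aboveI)
  define b where "b = Sup S"
  have bb1: "b1 \<le> b" unfolding b_def using b1 bddS by (intro cSup_upper)
  have b1pos: "b1 > 0" using b1 unfolding S_def by blast
  have b: "b > 0" using bb1 b1pos by linarith
  have z: "(\<lambda>m. 1 / Suc m) \<longlonglongrightarrow> (0::real)"
    using LIMSEQ_inverse_real_of_nat by (simp add: field_simps)
  have "\<exists>u1. is_min b u1 \<and> ipH u1 u1 \<ge> 1"
  proof -
    \<comment> \<open>Approach to the supremum from below, scaled so that all parameters stay at
      least \<open>b / 2\<close>; this is the uniform positivity required by
      \<open>minimizer_limit\<close>. The condition on the Dirichlet integral is closed and passes
      to the limit.\<close>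
    have "\<exists>c\<in>S. b - b / 2 * (1 / Suc n) < c" for n :: nat
    proof -
      have "b - b / 2 * (1 / Suc n) < Sup S" using b unfolding b_def[symmetric] by simp
      then show ?thesis using less_cSupE[OF _ \<open>S \<noteq> {}\<close>] by metis
    qed
    then obtain \<beta> where \<beta>: "\<And>n. \<beta> n \<in> S" "\<And>n. b - b / 2 * (1 / Suc n) < \<beta> n" by metis
    have le: "\<beta> n \<le> b" for n unfolding b_def using \<beta>(1) bddS by (intro cSup_upper)
    have low: "b / 2 \<le> \<beta> n" for n
    proof -
      have "b / 2 * (1 / Suc n) \<le> b / 2 * 1" using b by (intro mult_left_mono) auto
      then show ?thesis using \<beta>(2)[of n] by linarith
    qed
    have "(\<lambda>n. b - b / 2 * (1 / Suc n)) \<longlonglongrightarrow> b - b / 2 * 0" by (intro tendsto_diff tendsto_mult tendsto_const z)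
    then have "(\<lambda>n. b - b / 2 * (1 / Suc n)) \<longlonglongrightarrow> b" by simp
    then have lim: "\<beta> \<longlonglongrightarrow> b"
      by (rule tendsto_sandwich[rotated 2, OF _ tendsto_const]) (use \<beta>(2) le in \<open>auto intro!: always_eventually less_imp_le simp del: of_nat_Suc\<close>)
    have "\<forall>n. \<exists>u. is_min (\<beta> n) u \<and> ipH u u \<ge> 1" using \<beta>(1) unfolding S_def by blast
    then obtain u where u: "\<And>n. u n \<in> H10 \<Omega>" "\<And>n v. v \<in> H10 \<Omega> \<Longrightarrow> \<Phi> a (\<beta> n) (u n) \<le> \<Phi> a (\<beta> n) v + 0" "\<And>n. ipH (u n) (u n) \<ge> 1"
      unfolding is_min_def by (metis add.right_neutral)
    have b2: "b / 2 > 0" using b by simp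
    obtain r l where rl: "strict_mono (r :: nat \<Rightarrow> nat)" "l \<in> H10 \<Omega>" "\<And>v. v \<in> H10 \<Omega> \<Longrightarrow> \<Phi> a b l \<le> \<Phi> a b v"
      "(\<lambda>n. ipH (u (r n)) (u (r n))) \<longlonglongrightarrow> ipH l l"
      using minimizer_limit[of a "b / 2" \<beta> b u "\<lambda>n. 0", OF a0 b2 low lim u(1) u(2) tendsto_const] by blast
    have "ipH l l \<ge> 1" by (rule LIMSEQ_le_const[OF rl(4)]) (use u(3) in auto)
    with rl show ?thesis unfolding is_min_def by blast
  qed
  then obtain u1 where u1: "is_min b u1" "ipH u1 u1 \<ge> 1" by blast
  have "\<exists>u2. is_min b u2 \<and> ipH u2 u2 \<le> 1"
  proof -
    \<comment> \<open>Parameters above the supremum do not belong to \<open>S\<close>, so every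
      minimiser for them has Dirichlet integral below 1; their limit has at most 1, and equality is
      excluded afterwards by \<open>ne1\<close>.\<close>
    define \<beta> where "\<beta> n = b + 1 / Suc n" for n
    have \<beta>: "\<beta> n > b" for n unfolding \<beta>_def by simp
    have nS: "\<beta> n \<notin> S" for n using cSup_upper[OF _ bddS, of "\<beta> n"] \<beta>[of n] unfolding b_def[symmetric] by (meson not_le)
    have pos: "\<beta> n > 0" for n using \<beta>[of n] b by linarith
    have "\<exists>u. u \<in> H10 \<Omega> \<and> (\<forall>v\<in>H10 \<Omega>. \<Phi> a (\<beta> n) u \<le> \<Phi> a (\<beta> n) v)" for n
      using minimizer_exists[OF a0 pos[of n]] by metis
    then obtain u where u: "\<And>n. u n \<in> H10 \<Omega>" "\<And>n v. v \<in> H10 \<Omega> \<Longrightarrow> \<Phi> a (\<beta> n) (u n) \<le> \<Phi> a (\<beta> n) v + 0" by (metis add.right_neutral)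
    have lt: "ipH (u n) (u n) < 1" for n
    proof (rule ccontr)
      assume "\<not> ipH (u n) (u n) < 1"
      then have "\<beta> n \<in> S" unfolding S_def is_min_def using pos[of n] u(1)[of n] u(2)[of _ n] by auto
      then show False using nS by blast
    qed
    have "(\<lambda>n. b + 1 / Suc n) \<longlonglongrightarrow> b + 0" by (intro tendsto_add tendsto_const z)
    then have lim: "\<beta> \<longlonglongrightarrow> b" unfolding \<beta>_def by simp
    obtain r l where rl: "strict_mono (r :: nat \<Rightarrow> nat)" "l \<in> H10 \<Omega>" "\<And>v. v \<in> H10 \<Omega> \<Longrightarrow> \<Phi> a b l \<le> \<Phi> a b v"
      "(\<lambda>n. ipH (u (r n)) (u (r n))) \<longlonglongrightarrow> ipH l l"
      using minimizer_limit[of a b \<beta> b u "\<lambda>n. 0", OF a0 b less_imp_le[OF \<beta>] lim u(1) u(2) tendsto_const] by blast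
    have "ipH l l \<le> 1" by (rule LIMSEQ_le_const2[OF rl(4)]) (use lt in \<open>auto intro: less_imp_le\<close>)
    with rl show ?thesis unfolding is_min_def by blast
  qed
  then obtain u2 where u2: "is_min b u2" "ipH u2 u2 \<le> 1" by blast
  have u12: "ipH u2 u2 < 1" "1 < ipH u1 u1" using ne1[OF b u1(1)] ne1[OF b u2(1)] u1(2) u2(2) by auto
  have m1: "u1 \<in> H10 \<Omega>" "\<And>v. v \<in> H10 \<Omega> \<Longrightarrow> \<Phi> a b u1 \<le> \<Phi> a b v" using u1(1) unfolding is_min_def by auto
  have m2: "u2 \<in> H10 \<Omega>" "\<And>v. v \<in> H10 \<Omega> \<Longrightarrow> \<Phi> a b u2 \<le> \<Phi> a b v" using u2(1) unfolding is_min_def by auto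
  have low: "\<Phi> a b u1 < \<alpha>" "\<Phi> a b u2 < \<alpha>" using m1(2)[OF H.X_closed(1)] m2(2)[OF H.X_closed(1)] \<Phi>0 \<alpha> by auto
  \<comment> \<open>The minimisers have energy at most that of 0, hence below
    \<open>\<alpha>\<close>, and lie on different sides of the unit sphere. The critical point found
    has energy at least \<open>\<alpha>\<close>, so it is no minimiser.\<close>
  have "\<exists>u\<in>H10 \<Omega>. \<alpha> \<le> \<Phi> a b u \<and> H.nm (\<Phi>_grad a b u) = 0"
  proof (rule H.mountain_pass[where r = 1 and ?u0.0 = u2 and ?u1.0 = u1])
    show "\<exists>R. \<forall>u\<in>H10 \<Omega>. \<Phi> a b u \<le> M \<longrightarrow> H.nm u \<le> R" for M
    proof -
      obtain R where "\<And>b' u. b' \<ge> b \<Longrightarrow> u \<in> H10 \<Omega> \<Longrightarrow> \<Phi> a b' u \<le> M \<Longrightarrow> H.nm u \<le> R" using coercive[OF a0 b, of M] by blast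
      then show ?thesis by blast
    qed
    show "\<alpha> \<le> \<Phi> a b u" if "u \<in> H10 \<Omega>" "H.nm u = 1" for u
      using sphere[OF b that(1)] H.nm_sq[OF that(1)] that(2) by simp
    show "H.nm u2 \<le> 1" "1 \<le> H.nm u1" using u12 unfolding H.nm_def by auto
  qed (fact m1(1) m2(1) low \<Phi>_grad_closed \<Phi>_has_derivative \<Phi>_grad_bounded[OF a0 b] \<Phi>_grad_uniformly_continuous[OF a0 b] palais_smale[OF a0 b])+
  then obtain u3 where "u3 \<in> H10 \<Omega>" "\<alpha> \<le> \<Phi> a b u3" "H.nm (\<Phi>_grad a b u3) = 0" by blast
  then show ?thesis using that[OF b m1(1) m2(1) _ m1(2) m2(2) u12] low(1) by simp
qed

end

section \<open>The class of nonlinearities\<close>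

lemma class_A_growth:
  assumes "f \<in> class_A q" "q > 0"
  obtains A where "A > 0" "\<And>\<xi>. \<bar>f \<xi>\<bar> \<le> A * (1 + \<bar>\<xi>\<bar> powr q)"
proof -
  have cont: "continuous_on UNIV f" and "Limsup at_infinity (\<lambda>\<xi>. ereal (\<bar>f \<xi>\<bar> / \<bar>\<xi>\<bar> powr q)) < \<infinity>"
    using assms(1) by (auto simp: class_A_def)
  then obtain c where "Limsup at_infinity (\<lambda>\<xi>. ereal (\<bar>f \<xi>\<bar> / \<bar>\<xi>\<bar> powr q)) < ereal c"
    using ereal_dense2 by blast
  from Limsup_lessD[OF this] obtain b where b: "\<And>\<xi>. b \<le> \<bar>\<xi>\<bar> \<Longrightarrow> \<bar>f \<xi>\<bar> / \<bar>\<xi>\<bar> powr q < c"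
    by (auto simp: eventually_at_infinity)
  have "bounded (f ` {- max b 1..max b 1})"
    by (intro compact_imp_bounded compact_continuous_image continuous_on_subset[OF cont]) auto
  then obtain M where M: "M > 0" "\<And>\<xi>. \<xi> \<in> {- max b 1..max b 1} \<Longrightarrow> \<bar>f \<xi>\<bar> \<le> M"
    by (auto simp: bounded_pos)
  define A where "A = M + \<bar>c\<bar>"
  have A: "A > 0" "M \<le> A" "c \<le> A" using M(1) by (auto simp: A_def)
  have "\<bar>f \<xi>\<bar> \<le> A * (1 + \<bar>\<xi>\<bar> powr q)" for \<xi>
  proof (cases "\<bar>\<xi>\<bar> \<le> max b 1")
    case True
    then have "\<bar>f \<xi>\<bar> \<le> M" by (intro M(2)) auto
    then have "\<bar>f \<xi>\<bar> \<le> A * 1" using A by simp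
    also have "\<dots> \<le> A * (1 + \<bar>\<xi>\<bar> powr q)" using A by (intro mult_left_mono) auto
    finally show ?thesis .
  next
    case False
    then have "\<bar>f \<xi>\<bar> < c * \<bar>\<xi>\<bar> powr q" using b[of \<xi>] by (simp add: pos_divide_less_eq)
    also have "\<dots> \<le> A * (1 + \<bar>\<xi>\<bar> powr q)" using A by (intro mult_mono) auto
    finally show ?thesis by simp
  qed
  with A(1) show ?thesis using that by blast
qed

text \<open>Limits the loss where a scaled test function lies between 0 and its plateau value.
  Writing \<open>1 + \<xi>\<^sup>2\<close> merges the bound at infinity with the one on a compact
  interval.\<close>

lemma class_A_lower:
  assumes "f \<in> class_A q"
  obtains c where "c \<ge> 0" "\<And>\<xi>. - c * (1 + \<xi>\<^sup>2) \<le> primitive f \<xi>"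
proof -
  have cont: "continuous_on UNIV f" and "- \<infinity> < Liminf at_infinity (\<lambda>\<xi>. ereal (primitive f \<xi> / \<xi>\<^sup>2))"
    using assms by (auto simp: class_A_def)
  then obtain d where "ereal d < Liminf at_infinity (\<lambda>\<xi>. ereal (primitive f \<xi> / \<xi>\<^sup>2))"
    using ereal_dense2 by blast
  from less_LiminfD[OF this] obtain b where b: "\<And>\<xi>. b \<le> \<bar>\<xi>\<bar> \<Longrightarrow> d < primitive f \<xi> / \<xi>\<^sup>2"
    by (auto simp: eventually_at_infinity)
  have "continuous_on UNIV (primitive f)"
    by (auto intro!: DERIV_isCont[OF primitive_has_derivative[OF cont]] simp: continuous_on_eq_continuous_at)
  then have "bounded (primitive f ` {- max b 1..max b 1})"
    by (intro compact_imp_bounded compact_continuous_image) (auto intro: continuous_on_subset)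
  then obtain M where M: "M > 0" "\<And>\<xi>. \<xi> \<in> {- max b 1..max b 1} \<Longrightarrow> \<bar>primitive f \<xi>\<bar> \<le> M"
    by (auto simp: bounded_pos)
  define c where "c = M + \<bar>d\<bar>"
  have c: "c \<ge> 0" "M \<le> c" "- d \<le> c" using M(1) by (auto simp: c_def)
  have "- primitive f \<xi> \<le> c * (1 + \<xi>\<^sup>2)" for \<xi>
  proof (cases "\<bar>\<xi>\<bar> \<le> max b 1")
    case True
    then have "\<bar>primitive f \<xi>\<bar> \<le> M" by (intro M(2)) auto
    then have "- primitive f \<xi> \<le> c * 1" using c by simp
    also have "\<dots> \<le> c * (1 + \<xi>\<^sup>2)" using c by (intro mult_left_mono) auto
    finally show ?thesis .
  next
    case False
    then have "d * \<xi>\<^sup>2 < primitive f \<xi>" using b[of \<xi>] by (simp add: pos_less_divide_eq)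
    then have "- primitive f \<xi> \<le> - d * \<xi>\<^sup>2" by simp
    also have "\<dots> \<le> c * (1 + \<xi>\<^sup>2)" using c by (intro mult_mono) auto
    finally show ?thesis .
  qed
  then have "- c * (1 + \<xi>\<^sup>2) \<le> primitive f \<xi>" for \<xi> by (simp add: minus_le_iff)
  with c(1) show ?thesis using that by blast
qed

text \<open>The infinite upper limit in a form free of division by \<open>\<xi>\<close>: a bound by
  \<open>N * (1 + \<xi>\<^sup>2)\<close> for every \<xi> would make the quotient bounded at
  infinity.\<close>

lemma class_A_superquadratic:
  assumes "f \<in> class_A q"
  obtains \<xi> where "N * (1 + \<xi>\<^sup>2) < primitive f \<xi>"
proof (rule ccontr)
  assume "\<not> thesis"
  then have le: "primitive f \<xi> \<le> N * (1 + \<xi>\<^sup>2)" for \<xi> using that not_le by blast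
  have "primitive f \<xi> / \<xi>\<^sup>2 \<le> 2 * \<bar>N\<bar>" if "1 \<le> \<bar>\<xi>\<bar>" for \<xi>
  proof -
    have "1 \<le> \<xi>\<^sup>2" using that by (metis one_le_power power2_abs)
    then have "N * (1 + \<xi>\<^sup>2) \<le> \<bar>N\<bar> * (2 * \<xi>\<^sup>2)" by (intro mult_mono) auto
    with le[of \<xi>] have "primitive f \<xi> \<le> 2 * \<bar>N\<bar> * \<xi>\<^sup>2" by simp
    then show ?thesis using \<open>1 \<le> \<xi>\<^sup>2\<close> by (subst pos_divide_le_eq) auto
  qed
  then have "\<forall>\<^sub>F \<xi> in at_infinity. ereal (primitive f \<xi> / \<xi>\<^sup>2) \<le> ereal (2 * \<bar>N\<bar>)"
    by (auto simp: eventually_at_infinity)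
  from Limsup_bounded[OF this] have "Limsup at_infinity (\<lambda>\<xi>. ereal (primitive f \<xi> / \<xi>\<^sup>2)) \<le> ereal (2 * \<bar>N\<bar>)" .
  then show False using assms by (auto simp: class_A_def)
qed

text \<open>For \<open>q \<le> 1\<close> the function would grow at most linearly and its primitive
  at most quadratically, against the infinite upper limit.\<close>

lemma class_A_exponent:
  assumes f: "f \<in> class_A q" and q: "q > 0" shows "q > 1"
proof (rule ccontr)
  assume n: "\<not> q > 1"
  obtain A where A: "A > 0" "\<And>\<xi>. \<bar>f \<xi>\<bar> \<le> A * (1 + \<bar>\<xi>\<bar> powr q)" using class_A_growth[OF f q] by blast
  have cont: "continuous_on UNIV f" using f by (simp add: class_A_def)
  have "primitive f \<xi> \<le> 3 * A * (1 + \<xi>\<^sup>2)" for \<xi>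
  proof -
    have "\<bar>f z\<bar> \<le> A * (2 + \<bar>\<xi>\<bar>)" if z: "\<bar>z\<bar> \<le> \<bar>\<xi>\<bar>" for z
    proof -
      have "\<bar>z\<bar> powr q \<le> 1 + \<bar>z\<bar>"
      proof (cases "\<bar>z\<bar> \<le> 1")
        case True
        then have "\<bar>z\<bar> powr q \<le> 1 powr q" using q by (intro powr_mono2) auto
        then show ?thesis by simp
      next
        case False
        then have "\<bar>z\<bar> powr q \<le> \<bar>z\<bar> powr 1" using n by (intro powr_mono) auto
        then show ?thesis using False by simp
      qed
      then have "A * (1 + \<bar>z\<bar> powr q) \<le> A * (2 + \<bar>\<xi>\<bar>)" using z A(1) by (intro mult_left_mono) auto
      then show ?thesis using A(2)[of z] by linarith
    qed
    from primitive_bound[OF cont this] have "\<bar>primitive f \<xi>\<bar> \<le> A * ((2 + \<bar>\<xi>\<bar>) * \<bar>\<xi>\<bar>)" by (simp add: mult.assoc)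
    also have "\<dots> \<le> A * (3 * (1 + \<xi>\<^sup>2))"
    proof -
      have "0 \<le> (\<bar>\<xi>\<bar> - 1)\<^sup>2 + (\<xi>\<^sup>2 + 2)" by (intro add_nonneg_nonneg) auto
      then have "(2 + \<bar>\<xi>\<bar>) * \<bar>\<xi>\<bar> \<le> 3 * (1 + \<xi>\<^sup>2)" by (simp add: power2_eq_square algebra_simps)
      then show ?thesis using A(1) by (intro mult_left_mono) auto
    qed
    finally show ?thesis by (simp only: mult.assoc mult.left_commute[of A 3] abs_le_iff)
  qed
  moreover obtain \<xi> where "3 * A * (1 + \<xi>\<^sup>2) < primitive f \<xi>" using class_A_superquadratic[OF f] by blast
  ultimately show False using not_le by blast
qed

text \<open>Multiples \<open>\<xi> *\<^sub>R \<phi>\<close> of a test function equal to 1 on an open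
  set \<open>E\<close>. On \<open>E\<close> the primitive takes the value at \<xi> itself, which can
  exceed every multiple of \<open>1 + \<xi>\<^sup>2\<close>; the remaining terms, including the
  possible loss off \<open>E\<close>, are at most quadratic in \<xi>.\<close>

lemma (in subcritical) J_unbounded:
  assumes \<Omega>: "\<Omega> \<noteq> {}" and a: "a \<ge> 0" and f: "f \<in> class_A p"
  shows "\<exists>w\<in>H10 \<Omega>. a / 2 * ipH w w - J w < l"
proof -
  interpret finite_measure "lebesgue_on \<Omega>" by (rule finite_measure_\<Omega>)
  obtain x where x: "x \<in> \<Omega>" using \<Omega> by blast
  obtain c d where cd: "cbox c d \<subseteq> \<Omega>" "x \<in> box c d"
    by (rule open_contains_cbox[OF open_\<Omega> x])
  \<comment> \<open>The argument of \<open>plateau\<close> is 2 at \<open>x\<close>, hence above 1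
    in a neighbourhood, where the test function is identically 1.\<close>
  define j where "j = 2 / box_bump c d x"
  have j: "j > 0" "j * box_bump c d x = 2" using box_bump_pos[of c d x] cd(2) by (simp_all add: j_def)
  define E where "E = {x. 1 < j * box_bump c d x}"
  define \<phi> where "\<phi> = box_test j c d"
  have \<phi>: "\<phi> \<in> H10 \<Omega>" unfolding \<phi>_def by (intro test_H10 box_test_test_function cd(1))
  have \<phi>01: "0 \<le> \<phi> x" "\<phi> x \<le> 1" for x using box_test_bounds[of j c d x] j(1) by (simp_all add: \<phi>_def)
  have \<phi>E: "\<phi> x = 1" if "x \<in> E" for x using that by (simp add: E_def \<phi>_def box_test_def plateau_props(2))
  have cont: "continuous_on UNIV (\<lambda>x. j * box_bump c d x)"
    using smooth_box_bump[of c d] unfolding smooth_on_def by (intro continuous_intros) (metis C_on.simps(1))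
  have Eo: "open E" unfolding E_def by (intro open_Collect_less cont continuous_on_const)
  have "x \<in> E" using j(2) by (simp add: E_def)
  then have Ene: "E \<noteq> {}" by blast
  have E\<Omega>: "E \<subseteq> \<Omega>"
  proof
    fix y assume "y \<in> E"
    then have "0 < j * box_bump c d y" by (simp add: E_def)
    then have "y \<in> box c d" using j(1) by (simp add: zero_less_mult_iff box_bump_pos)
    then show "y \<in> \<Omega>" using cd(1) box_subset_cbox[of c d] by blast
  qed
  define m where "m = measure (lebesgue_on \<Omega>) E"
  have m: "m > 0"
  proof -
    have "m = measure lebesgue E" unfolding m_def using \<Omega>_sets E\<Omega> by (simp add: measure_restrict_space)
    moreover have "E \<in> lmeasurable" using Eo bounded_subset[OF bounded_\<Omega> E\<Omega>] by (intro bounded_set_imp_lmeasurable) auto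
    then have "measure lebesgue E \<noteq> 0" using open_not_negligible[OF Eo Ene] by (simp add: negligible_iff_measure0)
    ultimately show ?thesis by (simp add: zero_less_measure_iff)
  qed
  have Em: "E \<in> sets (lebesgue_on \<Omega>)" using Eo E\<Omega> \<Omega>_sets by (simp add: sets_restrict_space_iff)
  obtain s where s: "s \<ge> 0" "\<And>\<xi>. - s * (1 + \<xi>\<^sup>2) \<le> primitive f \<xi>" using class_A_lower[OF f] by blast
  define \<mu> where "\<mu> = measure (lebesgue_on \<Omega>) (space (lebesgue_on \<Omega>))"
  \<comment> \<open>Collects the coefficients of \<open>1 + \<xi>\<^sup>2\<close> in all terms that
    have to be beaten, with the target level \<open>l\<close> among them; division by the measure of
    \<open>E\<close> follows in the choice of \<xi>.\<close>
  define B where "B = a / 2 * ipH \<phi> \<phi> + s * \<mu> + \<bar>l\<bar>"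
  obtain \<xi> where \<xi>: "B / m * (1 + \<xi>\<^sup>2) < primitive f \<xi>" using class_A_superquadratic[OF f] by blast
  define w where "w = \<xi> *\<^sub>R \<phi>"
  have w: "w \<in> H10 \<Omega>" unfolding w_def using \<phi> by auto
  have low: "indicator E x * primitive f \<xi> - s * (1 + \<xi>\<^sup>2) \<le> primitive f (w x)" for x
  proof (cases "x \<in> E")
    case True
    have "0 \<le> s * (1 + \<xi>\<^sup>2)" using s(1) by simp
    then show ?thesis using True \<phi>E[OF True] by (simp add: w_def scaleR_fun_def)
  next
    case False
    have "(\<xi> * \<phi> x)\<^sup>2 \<le> \<xi>\<^sup>2" using \<phi>01[of x] by (simp add: power_mult_distrib power_le_one mult_left_le)
    then have "s * (1 + (\<xi> * \<phi> x)\<^sup>2) \<le> s * (1 + \<xi>\<^sup>2)" using s(1) by (intro mult_left_mono) auto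
    then show ?thesis using False s(2)[of "\<xi> * \<phi> x"] by (simp add: w_def scaleR_fun_def)
  qed
  have iE: "integrable (lebesgue_on \<Omega>) (\<lambda>x. indicator E x * primitive f \<xi>)"
    using Em by (intro integrable_mult_left integrable_real_indicator) (auto simp: emeasure_eq_measure)
  have "(\<integral>x. indicator E x * primitive f \<xi> - s * (1 + \<xi>\<^sup>2) \<partial>lebesgue_on \<Omega>) \<le> J w"
    unfolding J_def using low iE by (intro integral_mono J_integrable[OF w] Bochner_Integration.integrable_diff) auto
  also have "(\<integral>x. indicator E x * primitive f \<xi> - s * (1 + \<xi>\<^sup>2) \<partial>lebesgue_on \<Omega>) = m * primitive f \<xi> - \<mu> * (s * (1 + \<xi>\<^sup>2))"
  proof -
    have "(\<integral>x. indicator E x * primitive f \<xi> \<partial>lebesgue_on \<Omega>) = m * primitive f \<xi>"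
      using Em sets.sets_into_space[OF Em] by (simp add: m_def Int_absorb2)
    then show ?thesis using iE by (simp add: Bochner_Integration.integral_diff \<mu>_def)
  qed
  finally have J: "m * primitive f \<xi> - \<mu> * (s * (1 + \<xi>\<^sup>2)) \<le> J w" .
  have "B * (1 + \<xi>\<^sup>2) < m * primitive f \<xi>" using \<xi> m by (simp add: pos_divide_less_eq mult.commute)
  moreover have "ipH w w = \<xi>\<^sup>2 * ipH \<phi> \<phi>" unfolding w_def using \<phi> by (simp add: H.ip_simps power2_eq_square)
  then have "a / 2 * ipH w w \<le> a / 2 * ipH \<phi> \<phi> * (1 + \<xi>\<^sup>2)"
    using a ipH_nonneg[of \<phi>] by (simp add: algebra_simps)
  moreover have "\<bar>l\<bar> * 1 \<le> \<bar>l\<bar> * (1 + \<xi>\<^sup>2)" by (intro mult_left_mono) auto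
  moreover have "B * (1 + \<xi>\<^sup>2) = a / 2 * ipH \<phi> \<phi> * (1 + \<xi>\<^sup>2) + \<mu> * (s * (1 + \<xi>\<^sup>2)) + \<bar>l\<bar> * (1 + \<xi>\<^sup>2)"
    unfolding B_def by (simp add: algebra_simps)
  ultimately have "a / 2 * ipH w w - J w < l" using J by argo
  with w show ?thesis by blast
qed

text \<open>The choice in \<open>weak_gradient\<close> may differ for two representatives of one
  class, so invariance needs an argument: a weak gradient of \<open>v\<close> is also one of
  \<open>u\<close>.\<close>

lemma (in bounded_open) ipH_ae_equal:
  assumes u: "u \<in> H10 \<Omega>" and v: "v \<in> H10 \<Omega>" and uv: "ae_equal \<Omega> u v"
  shows "ipH u u = ipH v v"
proof -
  have ae: "AE x in lebesgue_on \<Omega>. u x = v x" using uv by (simp add: ae_equal_def)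
  have "ipL \<Omega> u (\<lambda>x. grad \<phi> x \<bullet> i) = ipL \<Omega> v (\<lambda>x. grad \<phi> x \<bullet> i)"
    if "\<phi> \<in> test_functions \<Omega>" "i \<in> Basis" for \<phi> i
    using ae u v that by (intro ipL_cong_AE partial_L2 H10D(1)) auto
  then have "is_weak_gradient \<Omega> u (weak_gradient \<Omega> v)"
    using H10D(3)[OF v] by (simp add: weak_gradient_iff)
  then show ?thesis
    using ipH_eq[OF H10D(1)[OF u] H10D(2)[OF v] _ H10D(1)[OF u] H10D(2)[OF v]] by (simp add: ipH_def)
qed

lemma (in kirchhoff) \<Phi>_ae_equal:
  assumes u: "u \<in> H10 \<Omega>" and v: "v \<in> H10 \<Omega>" and uv: "ae_equal \<Omega> u v"
  shows "\<Phi> a b u = \<Phi> a b v"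
proof -
  note [measurable] = H10_measurable[OF u] H10_measurable[OF v]
  have "J u = J v" unfolding J_def
    by (rule integral_cong_AE) (use uv in \<open>auto simp: ae_equal_def\<close>)
  then show ?thesis by (simp add: \<Phi>_def ipH_ae_equal[OF assms])
qed

theorem theorem1:
  fixes \<Omega> :: "(real ^ 'm) set" and q :: real and f :: "real \<Rightarrow> real"
  assumes "CARD('m) \<ge> 3"
    and "smooth_bounded_domain \<Omega>"
    and "0 < q" and "q < (real CARD('m) + 2) / (real CARD('m) - 2)"
    and "f \<in> class_A q"
  shows "\<exists>a :: nat \<Rightarrow> real. (\<forall>n. a n > 0) \<and> filterlim a at_top sequentially \<and>
    (\<forall>n. \<forall>k :: real \<Rightarrow> real.
       continuous_on {0..} k \<longrightarrow> mono_on {0..} k \<longrightarrow> (\<forall>t\<ge>0. k t \<ge> 0) \<longrightarrow>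
       filterlim (\<lambda>t. primitive k t / t powr ((q + 1) / 2)) at_top at_top \<longrightarrow>
       interior {t. 0 \<le> t \<and> k t = 0} = {} \<longrightarrow>
       (\<exists>b>0. \<exists>u\<^sub>1 u\<^sub>2 u\<^sub>3.
          \<not> ae_equal \<Omega> u\<^sub>1 u\<^sub>2 \<and> \<not> ae_equal \<Omega> u\<^sub>1 u\<^sub>3 \<and> \<not> ae_equal \<Omega> u\<^sub>2 u\<^sub>3 \<and>
          (\<forall>u\<in>{u\<^sub>1, u\<^sub>2, u\<^sub>3}. weak_solution \<Omega> (\<lambda>t. a n + b * k t) f u) \<and>
          (\<forall>u\<in>{u\<^sub>1, u\<^sub>2}. global_min_on (H10 \<Omega>) (energy \<Omega> (a n) b k f) u)))"
proof -
  have open\<Omega>: "open \<Omega>" "bounded \<Omega>" and \<Omega>: "\<Omega> \<noteq> {}" using assms(2) by (auto simp: smooth_bounded_domain_def)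
  have q1: "q > 1" by (rule class_A_exponent[OF assms(5,3)])
  obtain A where A: "A > 0" "\<And>\<xi>. \<bar>f \<xi>\<bar> \<le> A * (1 + \<bar>\<xi>\<bar> powr q)" using class_A_growth[OF assms(5,3)] by blast
  have cont: "continuous_on UNIV f" using assms(5) by (simp add: class_A_def)
  have "q * (real CARD('m) - 2) < real CARD('m) + 2" using assms(1,4) by (simp add: pos_less_divide_eq)
  then have q_sub: "(real DIM(real ^ 'm) - 2) * (q - 1) < 4" by (simp add: algebra_simps)
  interpret subcritical \<Omega> f q A
    by unfold_locales (fact open\<Omega> cont A q1 q_sub)+
  obtain C where C: "C > 0" "\<And>u. u \<in> H10 \<Omega> \<Longrightarrow> \<bar>J u\<bar> \<le> C * (1 + H.nm u powr (q + 1))" using J_bound by blast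
  \<comment> \<open>Fixed by the constant of \<open>J_bound\<close> alone, ahead of any choice of
    \<open>k\<close>.\<close>
  define a where "a n = 4 * C + 1 + real n" for n
  have a: "a n > 4 * C" "a n > 0" for n using C(1) by (simp_all add: a_def)
  have lim: "filterlim a at_top sequentially"
    unfolding a_def by (rule filterlim_tendsto_add_at_top[OF tendsto_const filterlim_real_sequentially])
  have main: "\<exists>b>0. \<exists>u\<^sub>1 u\<^sub>2 u\<^sub>3.
      \<not> ae_equal \<Omega> u\<^sub>1 u\<^sub>2 \<and> \<not> ae_equal \<Omega> u\<^sub>1 u\<^sub>3 \<and> \<not> ae_equal \<Omega> u\<^sub>2 u\<^sub>3 \<and>
      (\<forall>u\<in>{u\<^sub>1, u\<^sub>2, u\<^sub>3}. weak_solution \<Omega> (\<lambda>t. a n + b * k t) f u) \<and>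
      (\<forall>u\<in>{u\<^sub>1, u\<^sub>2}. global_min_on (H10 \<Omega>) (energy \<Omega> (a n) b k f) u)"
    if k: "continuous_on {0..} k" "mono_on {0..} k" "\<forall>t\<ge>0. k t \<ge> 0"
      and K: "filterlim (\<lambda>t. primitive k t / t powr ((q + 1) / 2)) at_top at_top"
      and int: "interior {t. 0 \<le> t \<and> k t = 0} = {}" for n and k :: "real \<Rightarrow> real"
  proof -
    \<comment> \<open>The constant extension to the left. It agrees with \<open>k\<close> at all
      Dirichlet integrals, as these are nonnegative.\<close>
    define k' where "k' t = k (max 0 t)" for t
    have k': "k' t = k t" if "t \<ge> 0" for t using that by (simp add: k'_def)
    have K': "primitive k' t = primitive k t" if "t \<ge> 0" for t
      using primitive_cong_nonneg[of k' k t] k' that by blast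
    \<comment> \<open>A zero at \<open>t > 0\<close> would, by monotonicity and nonnegativity,
      spread over the open interval from 0 to \<open>t\<close>.\<close>
    have pos: "0 < k t" if t: "0 < t" for t
    proof (rule ccontr)
      assume "\<not> 0 < k t"
      then have "k t = 0" using k(3) t by (simp add: order_antisym)
      then have "k s = 0" if "s \<in> {0<..<t}" for s
        using mono_onD[OF k(2), of s t] k(3) that t by (simp add: order_antisym)
      then have "{0<..<t} \<subseteq> interior {t. 0 \<le> t \<and> k t = 0}" by (intro interior_maximal) auto
      then show False using int t by auto
    qed
    interpret kirchhoff \<Omega> f q A k'
    proof unfold_locales
      show "continuous_on UNIV k'" unfolding k'_def
        by (rule continuous_on_compose2[OF k(1)]) (auto intro: continuous_intros)
      have "\<forall>\<^sub>F t in at_top. primitive k' t / t powr ((q + 1) / 2) = primitive k t / t powr ((q + 1) / 2)"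
        using eventually_ge_at_top[of 0] by eventually_elim (simp add: K')
      then show "filterlim (\<lambda>t. primitive k' t / t powr ((q + 1) / 2)) at_top at_top"
        using K by (subst filterlim_cong[OF refl refl])
    qed (use k' k(3) pos in auto)
    obtain b u1 u2 u3 where b: "b > 0" and u: "u1 \<in> H10 \<Omega>" "u2 \<in> H10 \<Omega>" "u3 \<in> H10 \<Omega>"
      and min: "\<And>v. v \<in> H10 \<Omega> \<Longrightarrow> \<Phi> (a n) b u1 \<le> \<Phi> (a n) b v" "\<And>v. v \<in> H10 \<Omega> \<Longrightarrow> \<Phi> (a n) b u2 \<le> \<Phi> (a n) b v"
      and D: "ipH u2 u2 < 1" "1 < ipH u1 u1" and lev: "\<Phi> (a n) b u1 < \<Phi> (a n) b u3"
      and crit: "H.nm (\<Phi>_grad (a n) b u3) = 0"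
      using three_critical_points[OF C a(1)[of n] J_unbounded[OF \<Omega> less_imp_le[OF a(2)[of n]] assms(5)]] by blast
    have E: "energy \<Omega> (a n) b k f v = \<Phi> (a n) b v" for v
      by (simp add: energy_def \<Phi>_def J_def dirichlet_ipH K' ipH_nonneg)
    have sol: "weak_solution \<Omega> (\<lambda>t. a n + b * k t) f v" if v: "v \<in> H10 \<Omega>" "H.nm (\<Phi>_grad (a n) b v) = 0" for v
      unfolding weak_solution_def dirichlet_ipH
      using v(1) pairing_integrable[OF v(1)] critical_point[OF v]
      by (auto simp: ipH_def ipL_def pairing_def k'[OF ipH_nonneg, unfolded ipH_def ipL_def])
    have "weak_solution \<Omega> (\<lambda>t. a n + b * k t) f v" if "v \<in> {u1, u2, u3}" for v
      using that sol[OF u(3) crit] sol[OF u(1) minimizer_critical[OF u(1) min(1)]]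
        sol[OF u(2) minimizer_critical[OF u(2) min(2)]] by blast
    moreover have "global_min_on (H10 \<Omega>) (energy \<Omega> (a n) b k f) v" if "v \<in> {u1, u2}" for v
      using that u min unfolding global_min_on_def E by blast
    \<comment> \<open>The Dirichlet integral and the energy depend only on the class modulo null
      sets. The first separates the two minimisers, the second separates both from
      \<open>u3\<close>.\<close>
    moreover have "\<not> ae_equal \<Omega> u1 u2" using ipH_ae_equal[OF u(1,2)] D by force
    moreover have "\<not> ae_equal \<Omega> u1 u3" using \<Phi>_ae_equal[OF u(1,3), of "a n" b] lev by force
    moreover have "\<not> ae_equal \<Omega> u2 u3" using \<Phi>_ae_equal[OF u(2,3), of "a n" b] min(2)[OF u(1)] lev by force
    ultimately show ?thesis using b by blast
  qed
  show ?thesis using a(2) lim main by (intro exI[of _ a] conjI allI impI)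
qed

end
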